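(* Let $\varepsilon$ satisfy $0\le \varepsilon<\tfrac14 u_{\min}$. Then the functional $$J(u)=\tfrac12\|y(\Phi_\varepsilon(u))-z\|_{L^2(\Omega)}^2+\alpha\,G(u)+\beta\,\mathrm{TV}(u)$$ has a global minimizer $\bar u\in BV(\Omega)$ over $BV(\Omega)$; that is, there exists $\bar u\in BV(\Omega)$ with $J(\bar u)\le J(u)$ for all $u\in BV(\Omega)$.
   Context: Setting. $d\in\mathbb N$, and $\Omega\subset\mathbb R^d$ is a bounded strongly Lipschitz domain (locally, after a rigid change of coordinates, $\partial\Omega$ is the graph of a Lipschitz function with $\Omega$ lying on one side). $\alpha,\beta>0$, $f,z\in L^2(\Omega)$, $0<u_{\min}<u_{\max}<\infty$, and $0=u_1<u_2<\dots<u_m=u_{\max}-u_{\min}$ are given. Total variation: $BV(\Omega)$ is the space of $v\in L^1(\Omega)$ whose distributional derivative $Dv$ is a finite $\mathbb R^d$-valued Radon measure, and $\mathrm{TV}(v)=|Dv|(\Omega)$ is its (isotropic, w.r.t. the Euclidean norm) total variation; $\|v\|_{BV}=\|v\|_{L^1}+\mathrm{TV}(v)$. Multi-bang penalty: $G(u)=\int_\Omega g(u(x))\,dx$ with $g:\mathbb R\to\mathbb R$, $g(t)=-u_mt$ for $t\le u_1$; $g(t)=\frac12\big((u_i+u_{i+1})t-u_iu_{i+1}\big)$ for $t\in[u_i,u_{i+1}]$, $1\le i<m$; $g(t)=u_mt-\frac12u_m^2$ for $t\ge u_m$. Superposition operator: $[\Phi_\varepsilon(v)](x)=\varphi_\varepsilon(v(x))$,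 where for $\varepsilon=0$, $\varphi_0(t)=u_{\min}+\min\{\max\{t,0\},u_m\}$, and for $\varepsilon>0$ $\varphi_\varepsilon(t)=u_{\min}+\rho(t)$ with $\rho(t)=-\varepsilon$ for $t\le-\varepsilon$; $\rho(t)=-\frac{1}{\varepsilon^2}t^3-\frac1\varepsilon t^2+t$ for $t\in[-\varepsilon,0]$; $\rho(t)=t$ for $t\in[0,u_m]$; $\rho(t)=-\frac1{\varepsilon^2}t^3+\frac{3u_m+\varepsilon}{\varepsilon^2}t^2+\frac{\varepsilon^2-2u_m\varepsilon-3u_m^2}{\varepsilon^2}t+\frac{u_m^3+u_m^2\varepsilon}{\varepsilon^2}$ for $t\in[u_m,u_m+\varepsilon]$; $\rho(t)=u_m+\varepsilon$ for $t\ge u_m+\varepsilon$. (So $\varphi_\varepsilon$ takes values in $[u_{\min}-\varepsilon,u_{\max}+\varepsilon]$.) State: for $w\in L^\infty(\Omega)$ bounded below by a positive constant a.e., $y(w)\in H^1_0(\Omega)$ denotes the unique weak solution of $-\operatorname{div}(w\nabla y)=f$ in $\Omega$, $y=0$ on $\partial\Omega$. *)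

theory Defs
  imports "HOL-Analysis.Analysis"
begin

text \<open>
  Functions on \<open>\<Omega>\<close> are represented by total functions on the ambient space of which only the
  values on \<open>\<Omega>\<close> matter; elements of function spaces are represented by their representatives,
  that is, functions equal almost everywhere are not identified.
\<close>


section \<open>Strongly Lipschitz domains\<close>

text \<open>
  A rigid change of coordinates enters only through the unit vector \<open>e\<close> that becomes the vertical
  axis: \<open>x \<bullet> e\<close> is the vertical coordinate of \<open>x\<close>, and \<open>x - (x \<bullet> e) *\<^sub>R e\<close>, a point of the
  hyperplane orthogonal to \<open>e\<close>, collects the remaining ones.  The open set \<open>U\<close> is the neighbourhood
  of the boundary point in which the graph representation holds.
\<close>

definition lipschitz_graph_near :: "'a::euclidean_space set \<Rightarrow> 'a \<Rightarrow> bool" where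
  "lipschitz_graph_near \<Omega> p \<longleftrightarrow>
     (\<exists>U e \<gamma> L. open U \<and> p \<in> U \<and> norm e = 1 \<and> L-lipschitz_on {y. y \<bullet> e = 0} \<gamma> \<and>
        frontier \<Omega> \<inter> U = {x \<in> U. x \<bullet> e = (\<gamma> (x - (x \<bullet> e) *\<^sub>R e) :: real)} \<and>
        \<Omega> \<inter> U = {x \<in> U. x \<bullet> e > \<gamma> (x - (x \<bullet> e) *\<^sub>R e)})"

definition bounded_strongly_lipschitz_domain :: "'a::euclidean_space set \<Rightarrow> bool" where
  "bounded_strongly_lipschitz_domain \<Omega> \<longleftrightarrow>
     \<Omega> \<noteq> {} \<and> open \<Omega> \<and> connected \<Omega> \<and> bounded \<Omega> \<and>
     (\<forall>p\<in>frontier \<Omega>. lipschitz_graph_near \<Omega> p)"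


section \<open>Test functions\<close>

abbreviation partial_deriv ::
    "'a::euclidean_space \<Rightarrow> ('a \<Rightarrow> 'b::real_normed_vector) \<Rightarrow> 'a \<Rightarrow> 'b" where
  "partial_deriv b f x \<equiv> frechet_derivative f (at x) b"

primrec cont_diff :: "nat \<Rightarrow> ('a::euclidean_space \<Rightarrow> 'b::real_normed_vector) \<Rightarrow> bool" where
  "cont_diff 0 f \<longleftrightarrow> continuous_on UNIV f"
| "cont_diff (Suc k) f \<longleftrightarrow>
     f differentiable_on UNIV \<and> (\<forall>b\<in>Basis. cont_diff k (partial_deriv b f))"

text \<open>\<open>C\<^sub>c\<^sup>\<infinity>(\<Omega>)\<close>; its elements are extended by zero to the whole space.\<close>

definition test_functions :: "'a::euclidean_space set \<Rightarrow> ('a \<Rightarrow> real) set" where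
  "test_functions \<Omega> =
     {\<phi>. (\<forall>k. cont_diff k \<phi>) \<and> compact (closure {x. \<phi> x \<noteq> 0}) \<and> closure {x. \<phi> x \<noteq> 0} \<subseteq> \<Omega>}"


section \<open>Functions of bounded variation\<close>

text \<open>
  A finite vector-valued Radon measure on \<open>\<Omega>\<close> is a countably additive set function on the Borel
  subsets of \<open>\<Omega>\<close>.  Its values are vectors, so finiteness is built in; on open subsets of
  Euclidean space, finite Borel measures are automatically Radon.  The values of \<open>\<mu>\<close> on all other
  sets are irrelevant.
\<close>

definition vector_measure :: "'a::euclidean_space set \<Rightarrow> ('a set \<Rightarrow> 'b::euclidean_space) \<Rightarrow> bool" where
  "vector_measure \<Omega> \<mu> \<longleftrightarrow>
     (\<forall>A :: nat \<Rightarrow> 'a set. range A \<subseteq> sets (restrict_space borel \<Omega>) \<longrightarrow> disjoint_family A \<longrightarrow>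
        (\<lambda>n. \<mu> (A n)) sums \<mu> (\<Union>n. A n))"

text \<open>The total variation \<open>|\<mu>|(\<Omega>)\<close>: the supremum over all countable Borel partitions of \<open>\<Omega>\<close>.\<close>

definition variation :: "'a::euclidean_space set \<Rightarrow> ('a set \<Rightarrow> 'b::euclidean_space) \<Rightarrow> ennreal" where
  "variation \<Omega> \<mu> =
     (SUP A \<in> {A :: nat \<Rightarrow> 'a set. range A \<subseteq> sets (restrict_space borel \<Omega>) \<and>
                 disjoint_family A \<and> (\<Union>n. A n) = \<Omega>}.
        \<Sum>n. ennreal (norm (\<mu> (A n))))"

text \<open>
  The integral of \<open>\<phi>\<close> against a finite signed measure \<open>m\<close>, by writing \<open>m\<close> as a difference of two
  finite positive measures, for instance its Jordan decomposition; the value does not depend on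
  the choice of \<open>P\<close> and \<open>N\<close>.
\<close>

definition has_signed_integral ::
    "'a::euclidean_space set \<Rightarrow> ('a set \<Rightarrow> real) \<Rightarrow> ('a \<Rightarrow> real) \<Rightarrow> real \<Rightarrow> bool" where
  "has_signed_integral \<Omega> m \<phi> I \<longleftrightarrow>
     (\<exists>P N. finite_measure P \<and> sets P = sets (restrict_space borel \<Omega>) \<and>
            finite_measure N \<and> sets N = sets (restrict_space borel \<Omega>) \<and>
            (\<forall>A\<in>sets (restrict_space borel \<Omega>). m A = measure P A - measure N A) \<and>
            integrable P \<phi> \<and> integrable N \<phi> \<and>
            I = (LINT x|P. \<phi> x) - (LINT x|N. \<phi> x))"

definition has_measure_derivative ::
    "'a::euclidean_space set \<Rightarrow> ('a \<Rightarrow> real) \<Rightarrow> ('a set \<Rightarrow> 'a) \<Rightarrow> bool" where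
  "has_measure_derivative \<Omega> v \<mu> \<longleftrightarrow>
     vector_measure \<Omega> \<mu> \<and>
     (\<forall>\<phi>\<in>test_functions \<Omega>. \<forall>b\<in>Basis.
        has_signed_integral \<Omega> (\<lambda>A. \<mu> A \<bullet> b) \<phi>
          (- (LINT x|lebesgue_on \<Omega>. v x * partial_deriv b \<phi> x)))"

definition BV :: "'a::euclidean_space set \<Rightarrow> ('a \<Rightarrow> real) set" where
  "BV \<Omega> = {v. integrable (lebesgue_on \<Omega>) v \<and> (\<exists>\<mu>. has_measure_derivative \<Omega> v \<mu>)}"

text \<open>
  For \<open>v\<close> in \<open>BV \<Omega>\<close> the measure \<open>Dv\<close> is unique on the Borel subsets of \<open>\<Omega>\<close>, and its total
  variation is finite, like that of every vector measure with values in a Euclidean space.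
\<close>

definition TV :: "'a::euclidean_space set \<Rightarrow> ('a \<Rightarrow> real) \<Rightarrow> real" where
  "TV \<Omega> v = enn2real (variation \<Omega> (SOME \<mu>. has_measure_derivative \<Omega> v \<mu>))"


section \<open>Sobolev spaces and the state equation\<close>

definition L2 :: "'a::euclidean_space set \<Rightarrow> ('a \<Rightarrow> 'b::euclidean_space) set" where
  "L2 \<Omega> = {v \<in> borel_measurable (lebesgue_on \<Omega>). integrable (lebesgue_on \<Omega>) (\<lambda>x. (norm (v x))\<^sup>2)}"

definition L2_norm :: "'a::euclidean_space set \<Rightarrow> ('a \<Rightarrow> 'b::euclidean_space) \<Rightarrow> real" where
  "L2_norm \<Omega> v = sqrt (LINT x|lebesgue_on \<Omega>. (norm (v x))\<^sup>2)"

definition has_weak_gradient ::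
    "'a::euclidean_space set \<Rightarrow> ('a \<Rightarrow> real) \<Rightarrow> ('a \<Rightarrow> 'a) \<Rightarrow> bool" where
  "has_weak_gradient \<Omega> v V \<longleftrightarrow>
     (\<forall>\<phi>\<in>test_functions \<Omega>. \<forall>b\<in>Basis.
        (LINT x|lebesgue_on \<Omega>. v x * partial_deriv b \<phi> x) =
        - (LINT x|lebesgue_on \<Omega>. (V x \<bullet> b) * \<phi> x))"

definition H1 :: "'a::euclidean_space set \<Rightarrow> ('a \<Rightarrow> real) set" where
  "H1 \<Omega> = {v \<in> L2 \<Omega>. \<exists>V\<in>L2 \<Omega>. has_weak_gradient \<Omega> v V}"

text \<open>Unique only up to null sets.\<close>

definition weak_gradient :: "'a::euclidean_space set \<Rightarrow> ('a \<Rightarrow> real) \<Rightarrow> 'a \<Rightarrow> 'a" where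
  "weak_gradient \<Omega> v = (SOME V. V \<in> L2 \<Omega> \<and> has_weak_gradient \<Omega> v V)"

definition H1_norm :: "'a::euclidean_space set \<Rightarrow> ('a \<Rightarrow> real) \<Rightarrow> real" where
  "H1_norm \<Omega> v = sqrt ((L2_norm \<Omega> v)\<^sup>2 + (L2_norm \<Omega> (weak_gradient \<Omega> v))\<^sup>2)"

text \<open>The closure of \<open>C\<^sub>c\<^sup>\<infinity>(\<Omega>)\<close> in \<open>H\<^sup>1(\<Omega>)\<close>.\<close>

definition H10 :: "'a::euclidean_space set \<Rightarrow> ('a \<Rightarrow> real) set" where
  "H10 \<Omega> = {v \<in> H1 \<Omega>. \<forall>\<delta>>0. \<exists>\<phi>\<in>test_functions \<Omega>. H1_norm \<Omega> (\<lambda>x. v x - \<phi> x) < \<delta>}"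

definition weak_solution ::
    "'a::euclidean_space set \<Rightarrow> ('a \<Rightarrow> real) \<Rightarrow> ('a \<Rightarrow> real) \<Rightarrow> ('a \<Rightarrow> real) \<Rightarrow> bool" where
  "weak_solution \<Omega> f w y \<longleftrightarrow>
     y \<in> H10 \<Omega> \<and>
     (\<forall>\<eta>\<in>H10 \<Omega>.
        (LINT x|lebesgue_on \<Omega>. w x * (weak_gradient \<Omega> y x \<bullet> weak_gradient \<Omega> \<eta> x)) =
        (LINT x|lebesgue_on \<Omega>. f x * \<eta> x))"

text \<open>
  The weak solution exists and is unique up to null sets when \<open>f\<close> is in \<open>L\<^sup>2(\<Omega>)\<close> and \<open>w\<close> is
  essentially bounded and bounded below by a positive constant almost everywhere.
\<close>

definition state :: "'a::euclidean_space set \<Rightarrow> ('a \<Rightarrow> real) \<Rightarrow> ('a \<Rightarrow> real) \<Rightarrow> 'a \<Rightarrow> real" where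
  "state \<Omega> f w = (SOME y. weak_solution \<Omega> f w y)"


section \<open>The multi-bang penalty and the superposition operator\<close>

text \<open>
  The values \<open>u\<^sub>1 < \<dots> < u\<^sub>m\<close> are \<open>us 1, \<dots>, us m\<close>.  The affine pieces agree at the breakpoints, so
  the half-open intervals below, which make the index unique, lose nothing.
\<close>

definition multibang :: "nat \<Rightarrow> (nat \<Rightarrow> real) \<Rightarrow> real \<Rightarrow> real" where
  "multibang m us t =
     (if t \<le> us 1 then - us m * t
      else if us m \<le> t then us m * t - (us m)\<^sup>2 / 2
      else (let i = (THE i. i \<in> {1..<m} \<and> us i \<le> t \<and> t < us (Suc i))
            in ((us i + us (Suc i)) * t - us i * us (Suc i)) / 2))"

definition multibang_penalty ::
    "'a::euclidean_space set \<Rightarrow> nat \<Rightarrow> (nat \<Rightarrow> real) \<Rightarrow> ('a \<Rightarrow> real) \<Rightarrow> real" where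
  "multibang_penalty \<Omega> m us u = (LINT x|lebesgue_on \<Omega>. multibang m us (u x))"

definition smooth_trunc :: "real \<Rightarrow> real \<Rightarrow> real \<Rightarrow> real" where
  "smooth_trunc \<epsilon> um t =
     (if t \<le> - \<epsilon> then - \<epsilon>
      else if t \<le> 0 then - (1 / \<epsilon>\<^sup>2) * t ^ 3 - (1 / \<epsilon>) * t\<^sup>2 + t
      else if t \<le> um then t
      else if t \<le> um + \<epsilon> then
        - (1 / \<epsilon>\<^sup>2) * t ^ 3 + ((3 * um + \<epsilon>) / \<epsilon>\<^sup>2) * t\<^sup>2
        + ((\<epsilon>\<^sup>2 - 2 * um * \<epsilon> - 3 * um\<^sup>2) / \<epsilon>\<^sup>2) * t + (um ^ 3 + um\<^sup>2 * \<epsilon>) / \<epsilon>\<^sup>2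
      else um + \<epsilon>)"

definition superposition :: "real \<Rightarrow> real \<Rightarrow> real \<Rightarrow> ('a \<Rightarrow> real) \<Rightarrow> 'a \<Rightarrow> real" where
  "superposition \<epsilon> umin um v x =
     umin + (if \<epsilon> = 0 then min (max (v x) 0) um else smooth_trunc \<epsilon> um (v x))"


section \<open>The reduced functional\<close>

definition objective ::
    "'a::euclidean_space set \<Rightarrow> ('a \<Rightarrow> real) \<Rightarrow> ('a \<Rightarrow> real) \<Rightarrow> real \<Rightarrow> real \<Rightarrow> real \<Rightarrow>
     nat \<Rightarrow> (nat \<Rightarrow> real) \<Rightarrow> real \<Rightarrow> ('a \<Rightarrow> real) \<Rightarrow> real" where
  "objective \<Omega> f z \<alpha> \<beta> umin m us \<epsilon> u =
     1 / 2 * (L2_norm \<Omega> (\<lambda>x. state \<Omega> f (superposition \<epsilon> umin (us m) u) x - z x))\<^sup>2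
     + \<alpha> * multibang_penalty \<Omega> m us u
     + \<beta> * TV \<Omega> u"

end

theory Submission
  imports Defs "HOL-Probability.Probability"
begin

text \<open>
  The proof is the direct method. The penalty grows linearly, so a minimizing sequence is bounded
  in \<open>L\<^sup>1\<close> and in total variation. On compact subsets of \<open>\<Omega>\<close> such a sequence is precompact in \<open>L\<^sup>1\<close>:
  products with test functions have a translation estimate on the whole space, so mollification
  changes them uniformly little, while the mollified functions converge along a weakly convergent
  subsequence. Convergence almost everywhere on \<open>\<Omega>\<close> is all that is needed afterwards. The penalty is
  lower semicontinuous by Fatou's lemma and the total variation because weak limits of the measures
  \<open>|Du\<^sub>n|\<close> bound it. The coefficients \<open>w\<^sub>n\<close> of the state equation converge boundedly almost everywhere
  to \<open>w\<close>, and testing the two equations with \<open>y(w\<^sub>n) - y(w)\<close> bounds \<open>\<nabla>(y(w\<^sub>n) - y(w))\<close> in \<open>L\<^sup>2\<close> by a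
  multiple of \<open>(w - w\<^sub>n) \<nabla>y(w)\<close>, which tends to zero by dominated convergence.
\<close>

section \<open>Smooth functions\<close>

text \<open>Compactness up to the boundary would call for an extension of BV functions across it.
  The three terms of the functional ask for less: they see only almost everywhere convergence and
  pairings of Du_n with compactly supported test functions, and mass that escapes to the boundary
  can only lower the penalty and the total variation. The second obstacle is that the total
  variation is a supremum over partitions of a vector measure and not a supremum of linear
  functionals. Radon-Nikodym writes Dv as h \<sigma> with a finite positive \<sigma>, and the total
  variation becomes the integral of norm h. With the direction sgn h as a second coordinate, Dv
  turns into one positive measure on pairs, whose weak limit both produces a vector measure for the
  limit function and bounds its variation. The tracking term is continuous because \<epsilon> < umin
  keeps all coefficients above umin - \<epsilon> > 0. No liminf of total variations is taken: once
  the penalty converges along a subsequence, near-minimality bounds them by a convergent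
  sequence.\<close>

lemma partial_deriv_eq: "(f has_derivative D) (at x) \<Longrightarrow> partial_deriv b f x = D b"
  by (metis frechet_derivative_at)

lemma has_derivative_frechet:
  "f differentiable at x \<Longrightarrow> (f has_derivative frechet_derivative f (at x)) (at x)"
  by (simp add: frechet_derivative_works)

definition smooth :: "('a::euclidean_space \<Rightarrow> 'b::real_normed_vector) \<Rightarrow> bool" where
  "smooth f \<longleftrightarrow> (\<forall>k. cont_diff k f)"

lemma cont_diff_imp_continuous: "cont_diff k f \<Longrightarrow> continuous_on UNIV f"
  by (cases k) (auto intro: differentiable_imp_continuous_on)

text \<open>\<open>cont_diff (Suc k)\<close> speaks of order k only through the partial derivatives,
  so lowering the order takes an induction. The product rule needs it, since it leaves one factor
  undifferentiated.\<close>

lemma cont_diff_Suc_imp: "cont_diff (Suc k) f \<Longrightarrow> cont_diff k f"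
proof (induction k arbitrary: f)
  case 0
  then show ?case by (auto intro: differentiable_imp_continuous_on)
next
  case (Suc k)
  from Suc.prems have "f differentiable_on UNIV"
    and b: "\<And>b. b \<in> Basis \<Longrightarrow> cont_diff (Suc k) (partial_deriv b f)"
    using cont_diff.simps(2)[of "Suc k" f] by auto
  then show ?case using Suc.IH[OF b] by simp
qed

lemma cont_diff_const: "cont_diff k (\<lambda>x::'a::euclidean_space. c)"
  by (induction k arbitrary: c) simp_all

lemma cont_diff_add:
  fixes f g :: "'a::euclidean_space \<Rightarrow> 'b::real_normed_vector"
  shows "cont_diff k f \<Longrightarrow> cont_diff k g \<Longrightarrow> cont_diff k (\<lambda>x. f x + g x)"
proof (induction k arbitrary: f g)
  case 0
  then show ?case by (auto intro: continuous_on_add)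
next
  case (Suc k)
  have "partial_deriv b (\<lambda>x. f x + g x) x = partial_deriv b f x + partial_deriv b g x" for b x
  proof -
    have "f differentiable at x" "g differentiable at x"
      using Suc.prems by (auto simp: differentiable_on_def)
    then show ?thesis
      by (intro partial_deriv_eq[OF has_derivative_add] has_derivative_frechet)
  qed
  then have "partial_deriv b (\<lambda>x. f x + g x) = (\<lambda>x. partial_deriv b f x + partial_deriv b g x)" for b
    by auto
  moreover have "cont_diff k (\<lambda>x. partial_deriv b f x + partial_deriv b g x)" if "b \<in> Basis" for b
    using Suc.prems that by (intro Suc.IH) auto
  moreover have "(\<lambda>x. f x + g x) differentiable_on UNIV"
    using Suc.prems by (auto intro: differentiable_on_add)
  ultimately show ?case by simp
qed

lemma cont_diff_mult:
  fixes f g :: "'a::euclidean_space \<Rightarrow> real"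
  shows "cont_diff k f \<Longrightarrow> cont_diff k g \<Longrightarrow> cont_diff k (\<lambda>x. f x * g x)"
proof (induction k arbitrary: f g)
  case 0
  then show ?case by (auto intro: continuous_on_mult)
next
  case (Suc k)
  have "partial_deriv b (\<lambda>x. f x * g x) x = f x * partial_deriv b g x + partial_deriv b f x * g x"
    for b x
  proof -
    have "f differentiable at x" "g differentiable at x"
      using Suc.prems by (auto simp: differentiable_on_def)
    then show ?thesis
      by (intro partial_deriv_eq[OF has_derivative_mult] has_derivative_frechet)
  qed
  then have "partial_deriv b (\<lambda>x. f x * g x)
      = (\<lambda>x. f x * partial_deriv b g x + partial_deriv b f x * g x)" for b
    by auto
  moreover have "cont_diff k f" "cont_diff k g"
    using Suc.prems cont_diff_Suc_imp by blast+
  then have "cont_diff k (\<lambda>x. f x * partial_deriv b g x + partial_deriv b f x * g x)"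
    if "b \<in> Basis" for b
    using Suc.prems that by (intro cont_diff_add Suc.IH) auto
  moreover have "(\<lambda>x. f x * g x) differentiable_on UNIV"
    using Suc.prems by (auto intro: differentiable_on_mult)
  ultimately show ?case by simp
qed

lemma cont_diff_translate:
  fixes f :: "'a::euclidean_space \<Rightarrow> real"
  shows "cont_diff k f \<Longrightarrow> cont_diff k (\<lambda>x. f (x + a))"
proof (induction k arbitrary: f)
  case 0
  then show ?case by (auto intro!: continuous_on_compose2[of UNIV f] continuous_intros)
next
  case (Suc k)
  have der: "((\<lambda>x. f (x + a)) has_derivative frechet_derivative f (at (x + a))) (at x)" for x
  proof -
    have "(f has_derivative frechet_derivative f (at (x + a))) (at (x + a))"
      using Suc.prems by (auto intro: has_derivative_frechet simp: differentiable_on_def)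
    moreover have "((\<lambda>x. x + a) has_derivative (\<lambda>h. h)) (at x)"
      by (auto intro!: derivative_eq_intros)
    ultimately show ?thesis
      using has_derivative_compose[of "\<lambda>x. x + a" "\<lambda>h. h" x UNIV f] by simp
  qed
  have "partial_deriv b (\<lambda>x. f (x + a)) x = partial_deriv b f (x + a)" for b x
    by (rule partial_deriv_eq[OF der])
  then have "partial_deriv b (\<lambda>x. f (x + a)) = (\<lambda>x. partial_deriv b f (x + a))" for b by auto
  moreover have "cont_diff k (\<lambda>x. partial_deriv b f (x + a))" if "b \<in> Basis" for b
    using Suc.prems that by (intro Suc.IH) auto
  moreover have "(\<lambda>x. f (x + a)) differentiable_on UNIV"
    using der by (auto simp: differentiable_on_def intro: differentiableI)
  ultimately show ?case by simp
qed

lemma smooth_const: "smooth (\<lambda>x::'a::euclidean_space. c)"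
  by (simp add: smooth_def cont_diff_const)

lemma smooth_add: "smooth f \<Longrightarrow> smooth g \<Longrightarrow> smooth (\<lambda>x. f x + g x)"
  by (simp add: smooth_def cont_diff_add)

lemma smooth_mult: "smooth f \<Longrightarrow> smooth g \<Longrightarrow> smooth (\<lambda>x. f x * g x :: real)"
  by (simp add: smooth_def cont_diff_mult)

lemma smooth_cmult: "smooth g \<Longrightarrow> smooth (\<lambda>x. c * g x :: real)"
  using smooth_mult[OF smooth_const] .

lemma smooth_minus: "smooth g \<Longrightarrow> smooth (\<lambda>x. - g x :: real)"
  using smooth_cmult[of g "-1"] by simp

lemma smooth_diff: "smooth f \<Longrightarrow> smooth g \<Longrightarrow> smooth (\<lambda>x. f x - g x :: real)"
  using smooth_add[OF _ smooth_minus] by simp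

lemma smooth_translate: "smooth f \<Longrightarrow> smooth (\<lambda>x. f (x + a) :: real)"
  by (simp add: smooth_def cont_diff_translate)

lemma smooth_differentiable: "smooth f \<Longrightarrow> f differentiable (at x)"
  unfolding smooth_def using cont_diff.simps(2)[of 0 f] by (auto simp: differentiable_on_def)

lemma smooth_partial_deriv: "smooth f \<Longrightarrow> b \<in> Basis \<Longrightarrow> smooth (partial_deriv b f)"
  unfolding smooth_def using cont_diff.simps(2) by blast

lemma smooth_continuous: "smooth f \<Longrightarrow> continuous_on S f"
  unfolding smooth_def using cont_diff_imp_continuous continuous_on_subset by blast

lemma smoothI:
  assumes "\<And>x. f differentiable (at x)" "\<And>b. b \<in> Basis \<Longrightarrow> smooth (partial_deriv b f)"
  shows "smooth f"
  unfolding smooth_def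
proof
  fix k show "cont_diff k f"
  proof (cases k)
    case 0
    then show ?thesis
      using assms(1) by (auto simp: differentiable_on_def intro: differentiable_imp_continuous_on)
  next
    case (Suc j)
    then show ?thesis using assms by (auto simp: differentiable_on_def smooth_def)
  qed
qed

lemma smooth_inner: "smooth (\<lambda>x::'a::euclidean_space. x \<bullet> c)"
proof (rule smoothI)
  have der: "((\<lambda>x. x \<bullet> c) has_derivative (\<lambda>h. h \<bullet> c)) (at x)" for x
    by (auto intro!: derivative_eq_intros)
  show "(\<lambda>x. x \<bullet> c) differentiable (at x)" for x using der differentiableI by blast
  show "smooth (partial_deriv b (\<lambda>x. x \<bullet> c))" for b
    using partial_deriv_eq[OF der] by (simp add: smooth_const)
qed

lemma smooth_norm_sq: "smooth (\<lambda>x::'a::euclidean_space. (norm (x - a))\<^sup>2)"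
proof (rule smoothI)
  have der: "((\<lambda>x. (norm (x - a))\<^sup>2) has_derivative (\<lambda>h. 2 * (h \<bullet> (x - a)))) (at x)" for x
    unfolding power2_norm_eq_inner
    by (auto intro!: derivative_eq_intros simp: inner_commute)
  show "(\<lambda>x. (norm (x - a))\<^sup>2) differentiable (at x)" for x using der differentiableI by blast
  have "partial_deriv b (\<lambda>x. (norm (x - a))\<^sup>2) = (\<lambda>x. 2 * (x \<bullet> b + - (a \<bullet> b)))" for b
    using partial_deriv_eq[OF der] by (auto simp: inner_commute inner_diff_right)
  then show "smooth (partial_deriv b (\<lambda>x. (norm (x - a))\<^sup>2))" for b
    by (simp only: smooth_cmult smooth_add smooth_inner smooth_const)
qed

text \<open>The family is closed under differentiation up to linear combinations, which makes the
  induction over all orders of derivatives go through.\<close>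

definition flat_exp :: "nat \<Rightarrow> real \<Rightarrow> real" where
  "flat_exp j t = (if t > 0 then exp (- 1 / t) / t ^ j else 0)"

text \<open>Bounding exp (1/t) from below by (1 + x/n)^n with x = 1/t and n = j + 1 beats the power
  t^j by one order; the spare factor t is what makes all derivatives vanish at 0.\<close>

lemma flat_exp_le:
  assumes "t > 0"
  shows "exp (- 1 / t) / t ^ j \<le> (real (Suc j)) ^ Suc j * t"
proof -
  have "(1 / t / real (Suc j)) ^ Suc j \<le> (1 + 1 / t / real (Suc j)) ^ Suc j"
    using assms by (intro power_mono) auto
  also have "\<dots> \<le> exp (1 / t)"
    using assms by (intro exp_ge_one_plus_x_over_n_power_n) (auto intro: order_trans[of _ 0])
  finally have "1 / (t ^ Suc j * real (Suc j) ^ Suc j) \<le> exp (1 / t)"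
    by (simp only: power_divide power_one divide_divide_eq_left power_mult_distrib)
  then have "exp (- (1 / t)) \<le> t ^ Suc j * real (Suc j) ^ Suc j"
    using assms by (simp add: exp_minus divide_simps mult_ac del: power_Suc)
  then have "exp (- 1 / t) \<le> (real (Suc j) ^ Suc j * t) * t ^ j"
    by (simp add: mult_ac)
  then show ?thesis using assms by (simp add: divide_le_eq)
qed

lemma has_real_derivative_flat_exp:
  "(flat_exp j has_real_derivative flat_exp (j + 2) t - real j * flat_exp (j + 1) t) (at t)"
proof (cases t "0::real" rule: linorder_cases)
  case less
  have "((\<lambda>_. 0) has_real_derivative 0) (at t)" by simp
  then have "(flat_exp j has_real_derivative 0) (at t)"
    by (rule has_field_derivative_transform_within_open[of _ _ _ "{..<0}"])
      (use less in \<open>auto simp: flat_exp_def\<close>)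
  then show ?thesis using less by (simp add: flat_exp_def)
next
  case greater
  have "((\<lambda>t. exp (- 1 / t) / t ^ j) has_real_derivative
      exp (- 1 / t) / t ^ (j + 2) - real j * (exp (- 1 / t) / t ^ (j + 1))) (at t)"
  proof (cases j)
    case 0
    then show ?thesis
      using greater by (auto intro!: derivative_eq_intros simp: field_simps power2_eq_square)
  next
    case (Suc n)
    have "((\<lambda>t. exp (- 1 / t) / t ^ Suc n) has_real_derivative
        (exp (- 1 / t) * (1 / (t * t)) * t ^ Suc n - exp (- 1 / t) * (real (Suc n) * t ^ n))
          / (t ^ Suc n * t ^ Suc n)) (at t)"
      using greater by (auto intro!: derivative_eq_intros simp del: power_Suc)
    moreover have "(exp (- 1 / t) * (1 / (t * t)) * t ^ Suc n - exp (- 1 / t) * (real (Suc n) * t ^ n))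
          / (t ^ Suc n * t ^ Suc n)
        = exp (- 1 / t) / t ^ (Suc n + 2) - real (Suc n) * (exp (- 1 / t) / t ^ (Suc n + 1))"
      using greater by (simp add: field_simps)
    ultimately show ?thesis using Suc by simp
  qed
  then have "(flat_exp j has_real_derivative
      exp (- 1 / t) / t ^ (j + 2) - real j * (exp (- 1 / t) / t ^ (j + 1))) (at t)"
    by (rule has_field_derivative_transform_within_open[of _ _ _ "{0<..}"])
      (use greater in \<open>auto simp: flat_exp_def\<close>)
  then show ?thesis using greater by (simp add: flat_exp_def)
next
  case equal
  \<comment> \<open>At 0 the difference quotient is \<open>flat_exp (j + 1)\<close>, which the
    linear bound squeezes to 0.\<close>
  have "((\<lambda>y. (flat_exp j y - flat_exp j 0) / (y - 0)) \<longlongrightarrow> 0) (at 0)"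
  proof (rule Lim_null_comparison)
    show "\<forall>\<^sub>F y in at 0. norm ((flat_exp j y - flat_exp j 0) / (y - 0))
        \<le> real (Suc (j + 1)) ^ Suc (j + 1) * \<bar>y\<bar>"
    proof (intro always_eventually allI)
      fix y :: real
      have "0 \<le> real (Suc (j + 1)) ^ Suc (j + 1) * \<bar>y\<bar>"
        by (intro mult_nonneg_nonneg zero_le_power) auto
      then show "norm ((flat_exp j y - flat_exp j 0) / (y - 0)) \<le> real (Suc (j + 1)) ^ Suc (j + 1) * \<bar>y\<bar>"
      proof (cases "y > 0")
        case True
        then show ?thesis using flat_exp_le[of y "j + 1"] by (simp add: flat_exp_def mult_ac)
      next
        case False
        then have "(flat_exp j y - flat_exp j 0) / (y - 0) = 0" by (simp add: flat_exp_def)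
        then show ?thesis
          using \<open>0 \<le> real (Suc (j + 1)) ^ Suc (j + 1) * \<bar>y\<bar>\<close> by (simp only: norm_zero)
      qed
    qed
    show "((\<lambda>y. real (Suc (j + 1)) ^ Suc (j + 1) * \<bar>y\<bar>) \<longlongrightarrow> 0) (at 0)"
      by (auto intro!: tendsto_eq_intros)
  qed
  then show ?thesis using equal by (simp add: has_field_derivative_iff flat_exp_def)
qed

lemma cont_diff_flat_exp_comp:
  fixes q :: "'a::euclidean_space \<Rightarrow> real"
  shows "cont_diff k q \<Longrightarrow> cont_diff k (\<lambda>x. flat_exp j (q x))"
proof (induction k arbitrary: j)
  case 0
  have "continuous_on UNIV (flat_exp j)"
    by (meson has_real_derivative_flat_exp DERIV_isCont continuous_at_imp_continuous_on)
  then show ?case using 0 by (auto intro!: continuous_on_compose2[of UNIV "flat_exp j"])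
next
  case (Suc k)
  let ?d = "\<lambda>x. flat_exp (j + 2) (q x) + (- real j) * flat_exp (j + 1) (q x)"
  have der: "((\<lambda>x. flat_exp j (q x)) has_derivative (\<lambda>h. frechet_derivative q (at x) h * ?d x)) (at x)" for x
  proof -
    have "(q has_derivative frechet_derivative q (at x)) (at x)"
      using Suc.prems by (auto intro: has_derivative_frechet simp: differentiable_on_def)
    from has_derivative_compose[OF this,
        OF has_real_derivative_flat_exp[of j "q x", unfolded has_field_derivative_def]]
    show ?thesis by (simp add: mult.commute algebra_simps)
  qed
  have "cont_diff k q" using Suc.prems by (rule cont_diff_Suc_imp)
  then have "cont_diff k ?d" using Suc.IH by (intro cont_diff_add cont_diff_mult cont_diff_const)
  moreover have "partial_deriv b (\<lambda>x. flat_exp j (q x)) = (\<lambda>x. partial_deriv b q x * ?d x)" for b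
    using partial_deriv_eq[OF der] by auto
  ultimately show ?case
    using Suc.prems der
    by (auto simp: differentiable_on_def differentiable_def simp del: add_uminus_conv_diff
        intro!: cont_diff_mult)
qed


section \<open>Test functions\<close>

lemma test_functionsI:
  assumes "smooth \<phi>" "compact K" "K \<subseteq> \<Omega>" "\<And>x. x \<notin> K \<Longrightarrow> \<phi> x = 0"
  shows "\<phi> \<in> test_functions \<Omega>"
proof -
  have "closure {x. \<phi> x \<noteq> 0} \<subseteq> K"
    using assms by (intro closure_minimal) (auto intro: compact_imp_closed)
  then show ?thesis
    using assms compact_Int_closed[of K "closure {x. \<phi> x \<noteq> 0}"]
    unfolding test_functions_def smooth_def by (auto simp: Int_absorb1)
qed

lemma test_functionsE:
  assumes "\<phi> \<in> test_functions \<Omega>"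
  obtains K where "smooth \<phi>" "compact K" "K \<subseteq> \<Omega>"
    "\<forall>x. x \<notin> K \<longrightarrow> \<phi> x = 0"
proof
  show "smooth \<phi>" "compact (closure {x. \<phi> x \<noteq> 0})" "closure {x. \<phi> x \<noteq> 0} \<subseteq> \<Omega>"
    using assms by (auto simp: test_functions_def smooth_def)
  show "\<forall>x. x \<notin> closure {x. \<phi> x \<noteq> 0} \<longrightarrow> \<phi> x = 0"
    using closure_subset[of "{x. \<phi> x \<noteq> 0}"] by auto
qed

lemma test_functions_smooth: "\<phi> \<in> test_functions \<Omega> \<Longrightarrow> smooth \<phi>"
  by (elim test_functionsE)

lemma test_functions_outside: "\<phi> \<in> test_functions \<Omega> \<Longrightarrow> x \<notin> \<Omega> \<Longrightarrow> \<phi> x = 0"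
  by (elim test_functionsE) auto

lemma test_functions_mono: "\<phi> \<in> test_functions S \<Longrightarrow> S \<subseteq> T \<Longrightarrow> \<phi> \<in> test_functions T"
  unfolding test_functions_def by auto

lemma test_functions_zero: "(\<lambda>x. 0) \<in> test_functions \<Omega>"
  by (rule test_functionsI[of _ "{}"]) (auto simp: smooth_const)

lemma test_functions_add:
  assumes "\<phi> \<in> test_functions \<Omega>" "\<psi> \<in> test_functions \<Omega>"
  shows "(\<lambda>x. \<phi> x + \<psi> x) \<in> test_functions \<Omega>"
proof -
  from assms(1) obtain K where K: "smooth \<phi>" "compact K" "K \<subseteq> \<Omega>"
    "\<forall>x. x \<notin> K \<longrightarrow> \<phi> x = 0"
    by (rule test_functionsE)
  from assms(2) obtain L where L: "smooth \<psi>" "compact L" "L \<subseteq> \<Omega>"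
    "\<forall>x. x \<notin> L \<longrightarrow> \<psi> x = 0"
    by (rule test_functionsE)
  show ?thesis
  proof (rule test_functionsI)
    show "smooth (\<lambda>x. \<phi> x + \<psi> x)" using K(1) L(1) by (rule smooth_add)
    show "compact (K \<union> L)" using K(2) L(2) by (rule compact_Un)
  qed (use K L in auto)
qed

lemma test_functions_smooth_mult:
  assumes "smooth f" "\<phi> \<in> test_functions \<Omega>"
  shows "(\<lambda>x. f x * \<phi> x) \<in> test_functions \<Omega>"
proof -
  from assms(2) obtain K where K: "smooth \<phi>" "compact K" "K \<subseteq> \<Omega>"
    "\<forall>x. x \<notin> K \<longrightarrow> \<phi> x = 0"
    by (rule test_functionsE)
  show ?thesis
    by (rule test_functionsI[OF smooth_mult[OF assms(1) K(1)] K(2,3)]) (use K(4) in auto)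
qed

lemma test_functions_mult_smooth:
  assumes "smooth f" "\<phi> \<in> test_functions \<Omega>"
  shows "(\<lambda>x. \<phi> x * f x) \<in> test_functions \<Omega>"
  using test_functions_smooth_mult[OF assms] by (simp add: mult.commute)

lemma test_functions_cmult: "\<phi> \<in> test_functions \<Omega> \<Longrightarrow> (\<lambda>x. c * \<phi> x) \<in> test_functions \<Omega>"
  by (rule test_functions_smooth_mult[OF smooth_const])

lemma test_functions_diff:
  "\<phi> \<in> test_functions \<Omega> \<Longrightarrow> \<psi> \<in> test_functions \<Omega> \<Longrightarrow> (\<lambda>x. \<phi> x - \<psi> x) \<in> test_functions \<Omega>"
  using test_functions_add[of \<phi> \<Omega> "\<lambda>x. -1 * \<psi> x"] test_functions_cmult[of \<psi> \<Omega> "-1"] by simp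

lemma test_functions_translate:
  assumes "\<phi> \<in> test_functions UNIV"
  shows "(\<lambda>x. \<phi> (x + a)) \<in> test_functions UNIV"
proof -
  from assms obtain K where K: "smooth \<phi>" "compact K" "K \<subseteq> UNIV"
    "\<forall>x. x \<notin> K \<longrightarrow> \<phi> x = 0"
    by (rule test_functionsE)
  show ?thesis
  proof (rule test_functionsI)
    show "smooth (\<lambda>x. \<phi> (x + a))" using K(1) by (rule smooth_translate)
    show "compact ((\<lambda>x. x - a) ` K)"
      using K(2) by (intro compact_continuous_image continuous_intros)
    fix x assume "x \<notin> (\<lambda>x. x - a) ` K"
    then have "x + a \<notin> K" by (metis add_diff_cancel image_eqI)
    then show "\<phi> (x + a) = 0" using K(4) by blast
  qed simp
qed

lemma partial_deriv_eq_0_outside: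
  assumes "closed K" "\<And>x. x \<notin> K \<Longrightarrow> f x = 0" "x \<notin> K"
  shows "partial_deriv b f x = 0"
proof -
  have "(f has_derivative (\<lambda>_. 0)) (at x)"
    by (rule has_derivative_transform_within_open[of "\<lambda>_. 0" _ _ _ "- K"]) (use assms in auto)
  then show ?thesis by (rule partial_deriv_eq)
qed

lemma test_functions_partial_deriv:
  assumes "\<phi> \<in> test_functions \<Omega>" "b \<in> Basis"
  shows "partial_deriv b \<phi> \<in> test_functions \<Omega>"
proof -
  from assms(1) obtain K where K: "smooth \<phi>" "compact K" "K \<subseteq> \<Omega>"
    "\<forall>x. x \<notin> K \<longrightarrow> \<phi> x = 0"
    by (rule test_functionsE)
  show ?thesis
    using smooth_partial_deriv[OF K(1) assms(2)] K(2,3)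
    by (rule test_functionsI)
      (rule partial_deriv_eq_0_outside[OF compact_imp_closed[OF K(2)]], use K(4) in auto)
qed

lemma test_functions_bounded:
  assumes "\<phi> \<in> test_functions \<Omega>"
  obtains B where "B > 0" "\<And>x. \<bar>\<phi> x\<bar> \<le> B"
proof -
  from assms obtain K where K: "smooth \<phi>" "compact K" "K \<subseteq> \<Omega>"
    "\<forall>x. x \<notin> K \<longrightarrow> \<phi> x = 0"
    by (rule test_functionsE)
  then have "bounded (\<phi> ` K)"
    by (intro compact_imp_bounded compact_continuous_image smooth_continuous)
  then obtain B where B: "B > 0" "\<And>x. x \<in> K \<Longrightarrow> \<bar>\<phi> x\<bar> \<le> B"
    by (auto simp: bounded_pos)
  have "\<bar>\<phi> x\<bar> \<le> B" for x using B K(4) by (cases "x \<in> K") auto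
  with B(1) show ?thesis by (rule that)
qed

lemma test_functions_borel: "\<phi> \<in> test_functions \<Omega> \<Longrightarrow> \<phi> \<in> borel_measurable borel"
  by (intro borel_measurable_continuous_onI smooth_continuous test_functions_smooth)

lemma test_functions_integrable:
  assumes "\<phi> \<in> test_functions \<Omega>"
  shows "integrable lborel \<phi>"
proof -
  from assms obtain K where K: "smooth \<phi>" "compact K" "K \<subseteq> \<Omega>"
    "\<forall>x. x \<notin> K \<longrightarrow> \<phi> x = 0"
    by (rule test_functionsE)
  have "integrable lborel (\<lambda>x. indicator K x *\<^sub>R \<phi> x)"
    using K by (intro borel_integrable_compact smooth_continuous)
  moreover have "(\<lambda>x. indicator K x *\<^sub>R \<phi> x) = \<phi>"
    using K(4) by (auto simp: indicator_def fun_eq_iff)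
  ultimately show ?thesis by simp
qed

section \<open>Smooth bumps and approximation of open sets from inside\<close>

definition ball_bump :: "'a::euclidean_space \<Rightarrow> real \<Rightarrow> real \<Rightarrow> 'a \<Rightarrow> real" where
  "ball_bump a r c x = flat_exp 0 (c * (r\<^sup>2 - (norm (x - a))\<^sup>2))"

lemma ball_bump_test_function:
  assumes "c > 0" "r > 0" "cball a r \<subseteq> \<Omega>"
  shows "ball_bump a r c \<in> test_functions \<Omega>"
proof (rule test_functionsI[of _ "cball a r"])
  have "smooth (\<lambda>x. c * (r\<^sup>2 - (norm (x - a))\<^sup>2))"
    by (intro smooth_cmult smooth_diff smooth_const smooth_norm_sq)
  then show "smooth (ball_bump a r c)"
    unfolding smooth_def ball_bump_def[abs_def] using cont_diff_flat_exp_comp by blast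
  fix x assume "x \<notin> cball a r"
  then have "r \<le> norm (x - a)" by (simp add: dist_norm norm_minus_commute)
  then have "r\<^sup>2 \<le> (norm (x - a))\<^sup>2" using assms by (intro power_mono) auto
  then have "\<not> 0 < c * (r\<^sup>2 - (norm (x - a))\<^sup>2)"
    using assms(1) by (simp add: zero_less_mult_iff not_less)
  then show "ball_bump a r c x = 0"
    by (simp add: ball_bump_def flat_exp_def)
qed (use assms in auto)

lemma ball_bump_range: "0 \<le> ball_bump a r c x" "ball_bump a r c x \<le> 1"
  by (auto simp: ball_bump_def flat_exp_def)

text \<open>The factor \<open>c\<close> exists for this limit: the bump is exp (-1 / (c s)) with s =
  r^2 - |x - a|^2 > 0, so growing c sends it to 1 on the open ball while the support stays the
  same.\<close>

lemma ball_bump_tendsto: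
  assumes "r > 0" "x \<in> ball a r"
  shows "(\<lambda>k. ball_bump a r (real (Suc k)) x) \<longlonglongrightarrow> 1"
proof -
  have "norm (x - a) < r" using assms by (simp add: dist_norm norm_minus_commute)
  then have "(norm (x - a))\<^sup>2 < r\<^sup>2"
    by (intro power_strict_mono) auto
  then have "r\<^sup>2 - (norm (x - a))\<^sup>2 > 0" by simp
  moreover define s where "s = r\<^sup>2 - (norm (x - a))\<^sup>2"
  ultimately have s: "s > 0" by simp
  have "(\<lambda>k. exp (- (inverse (real (Suc k)) * inverse s))) \<longlonglongrightarrow> exp (- (0 * inverse s))"
    by (rule tendsto_exp[OF tendsto_minus[OF tendsto_mult_right[OF LIMSEQ_inverse_real_of_nat]]])
  moreover have "ball_bump a r (real (Suc k)) x = exp (- (inverse (real (Suc k)) * inverse s))" for k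
  proof -
    have "0 < real (Suc k) * s" using s by (simp add: s_def)
    then show ?thesis
      by (simp only: ball_bump_def flat_exp_def s_def[symmetric] if_True divide_inverse
          inverse_mult_distrib power_0 inverse_1 mult_1_right mult_minus_left mult_1_left)
  qed
  ultimately show ?thesis by (simp only: mult_zero_left minus_zero exp_zero)
qed

text \<open>Lindelof leaves countably many balls whose closures lie in U. The formula 1 - (1 -
  b_1)...(1 - b_k) is a smooth union of the first k bumps: it has values in [0, 1], inherits compact
  support and dominates each single bump, while the steepness of the bumps grows with k as
  well.\<close>

lemma open_indicator_approx:
  fixes U :: "'a::euclidean_space set"
  assumes "open U"
  obtains \<phi> :: "nat \<Rightarrow> 'a \<Rightarrow> real" where
    "\<And>k. \<phi> k \<in> test_functions U" "\<And>k x. 0 \<le> \<phi> k x" "\<And>k x. \<phi> k x \<le> 1"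
    "\<And>x. (\<lambda>k. \<phi> k x) \<longlonglongrightarrow> indicator U x"
proof (cases "U = {}")
  case True
  then show ?thesis
    by (intro that[of "\<lambda>_ _. 0"]) (auto simp: test_functions_zero)
next
  case False
  define F where "F = {ball x r |x r. r > 0 \<and> cball x r \<subseteq> U}"
  have "\<And>S. S \<in> F \<Longrightarrow> open S" by (auto simp: F_def)
  then obtain F' where F': "F' \<subseteq> F" "countable F'" "\<Union>F' = \<Union>F" by (rule Lindelof)
  have UF: "\<Union>F = U"
  proof
    show "\<Union>F \<subseteq> U" by (auto simp: F_def)
    show "U \<subseteq> \<Union>F"
    proof
      fix x assume "x \<in> U"
      then obtain r where "r > 0" "cball x r \<subseteq> U" using assms open_contains_cball by blast
      then show "x \<in> \<Union>F" unfolding F_def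
        by (intro UnionI[of "ball x r"]) auto
    qed
  qed
  have "F' \<noteq> {}" using False UF F' by auto
  then have "from_nat_into F' i \<in> F" for i using F'(1) from_nat_into[of F' i] by auto
  then have "\<forall>i. \<exists>x r. from_nat_into F' i = ball x r \<and> r > 0 \<and> cball x r \<subseteq> U"
    by (auto simp: F_def)
  then obtain a r where ar: "\<And>i. from_nat_into F' i = ball (a i) (r i)" "\<And>i. r i > 0"
    "\<And>i. cball (a i) (r i) \<subseteq> U" by metis
  have cover: "\<exists>i. x \<in> ball (a i) (r i)" if "x \<in> U" for x
  proof -
    have "x \<in> \<Union>F'" using that UF F'(3) by simp
    then obtain B where "B \<in> F'" "x \<in> B" by blast
    then obtain i where "B = from_nat_into F' i"
      using F'(2) by (metis from_nat_into_surj)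
    then show ?thesis using ar \<open>x \<in> B\<close> by auto
  qed
  define \<beta> where "\<beta> i k = ball_bump (a i) (r i) (real (Suc k))" for i k
  have \<beta>: "\<beta> i k \<in> test_functions U" "0 \<le> \<beta> i k x" "\<beta> i k x \<le> 1" for i k x
    using ar by (auto simp: \<beta>_def ball_bump_test_function ball_bump_range)
  define \<phi> where "\<phi> k x = 1 - (\<Prod>i<k. 1 - \<beta> i k x)" for k x
  have "(\<lambda>x. 1 - (\<Prod>i<n. 1 - \<beta> i k x)) \<in> test_functions U" for n k
  proof (induction n)
    case 0
    then show ?case by (simp add: test_functions_zero)
  next
    case (Suc n)
    let ?P = "\<lambda>x. 1 - (\<Prod>i<n. 1 - \<beta> i k x)"
    \<comment> \<open>The constant 1 is no test function; rewriting 1 - (1 - P)(1 - b) as P + b - P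
      b stays inside the test functions.\<close>
    have "(\<lambda>x. (?P x + \<beta> n k x) - ?P x * \<beta> n k x) \<in> test_functions U"
      by (rule test_functions_diff[OF test_functions_add[OF Suc \<beta>(1)]
            test_functions_smooth_mult[OF test_functions_smooth[OF Suc] \<beta>(1)]])
    moreover have "(?P x + \<beta> n k x) - ?P x * \<beta> n k x = 1 - (\<Prod>i<Suc n. 1 - \<beta> i k x)" for x
      by (simp only: prod.lessThan_Suc) (simp only: algebra_simps)
    ultimately show ?case by (simp only:)
  qed
  then have 1: "\<phi> k \<in> test_functions U" for k by (simp add: \<phi>_def[abs_def])
  have P: "0 \<le> (\<Prod>i<k. 1 - \<beta> i k x)" "(\<Prod>i<k. 1 - \<beta> i k x) \<le> 1" for k x
    using \<beta>(2,3) by (intro prod_nonneg prod_le_1; simp)+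
  have lim: "(\<lambda>k. \<phi> k x) \<longlonglongrightarrow> indicator U x" for x
  proof (cases "x \<in> U")
    case False
    then have "\<phi> k x = 0" for k using 1 test_functions_outside by blast
    then show ?thesis using False by simp
  next
    case True
    then obtain j where j: "x \<in> ball (a j) (r j)" using cover by blast
    have "(\<lambda>k. \<phi> k x) \<longlonglongrightarrow> 1"
    proof (rule tendsto_sandwich)
      show "(\<lambda>k. \<beta> j k x) \<longlonglongrightarrow> 1"
        unfolding \<beta>_def by (rule ball_bump_tendsto[OF ar(2) j])
      show "\<forall>\<^sub>F k in sequentially. \<beta> j k x \<le> \<phi> k x"
        unfolding eventually_sequentially
      proof (intro exI[of _ "Suc j"] allI impI)
        fix k assume "Suc j \<le> k"
        then have "(\<Prod>i<k. 1 - \<beta> i k x) = (1 - \<beta> j k x) * (\<Prod>i\<in>{..<k} - {j}. 1 - \<beta> i k x)"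
          by (subst prod.remove[of _ j]) auto
        also have "\<dots> \<le> (1 - \<beta> j k x) * 1"
          using \<beta>(2,3) by (intro mult_left_mono prod_le_1) simp_all
        finally show "\<beta> j k x \<le> \<phi> k x" by (simp add: \<phi>_def)
      qed
      show "\<forall>\<^sub>F k in sequentially. \<phi> k x \<le> 1" using P(1) by (simp add: \<phi>_def)
    qed simp
    then show ?thesis using True by simp
  qed
  show ?thesis
  proof (rule that)
    show "\<phi> k \<in> test_functions U" "(\<lambda>k. \<phi> k x) \<longlonglongrightarrow> indicator U x" for k x using 1 lim by auto
    show "0 \<le> \<phi> k x" "\<phi> k x \<le> 1" for k x using P[where k=k and x=x] by (auto simp: \<phi>_def)
  qed
qed

section \<open>Integration against test functions\<close>

lemma integral_translate:
  fixes f :: "'a::euclidean_space \<Rightarrow> real"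
  assumes "f \<in> borel_measurable borel"
  shows "(LINT x|lborel. f (x + a)) = (LINT x|lborel. f x)"
proof -
  have "(LINT x|lborel. f x) = (LINT x|distr lborel borel ((+) a). f x)"
    by (simp add: lborel_distr_plus)
  also have "\<dots> = (LINT x|lborel. f (a + x))"
    using assms by (intro integral_distr) auto
  finally show ?thesis by (simp add: add.commute)
qed

lemma integrable_translate:
  fixes f :: "'a::euclidean_space \<Rightarrow> real"
  assumes "integrable lborel f"
  shows "integrable lborel (\<lambda>x. f (x + a))"
proof -
  have "integrable (distr lborel borel ((+) a)) f"
    using assms by (simp add: lborel_distr_plus)
  then have "integrable lborel (\<lambda>x. f (a + x))"
    by (subst (asm) integrable_distr_eq) (use assms in auto)
  then show ?thesis by (simp add: add.commute)
qed

lemma has_real_derivative_along: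
  fixes f :: "'a::euclidean_space \<Rightarrow> real"
  assumes "smooth f"
  shows "((\<lambda>t. f (x + t *\<^sub>R b)) has_real_derivative partial_deriv b f (x + t *\<^sub>R b)) (at t)"
proof -
  let ?D = "frechet_derivative f (at (x + t *\<^sub>R b))"
  have D: "(f has_derivative ?D) (at (x + t *\<^sub>R b))"
    by (rule has_derivative_frechet[OF smooth_differentiable[OF assms]])
  have "((\<lambda>t. x + t *\<^sub>R b) has_derivative (\<lambda>s. s *\<^sub>R b)) (at t)"
    by (auto intro!: derivative_eq_intros)
  from has_derivative_compose[OF this D]
  have "((\<lambda>t. f (x + t *\<^sub>R b)) has_derivative (\<lambda>s. ?D (s *\<^sub>R b))) (at t)" .
  moreover have "?D (s *\<^sub>R b) = ?D b * s" for s
    using linear_scale[OF has_derivative_linear[OF D]] by simp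
  ultimately show ?thesis by (simp add: has_field_derivative_def)
qed

lemma partial_deriv_mult:
  fixes f g :: "'a::euclidean_space \<Rightarrow> real"
  assumes "smooth f" "smooth g"
  shows "partial_deriv b (\<lambda>x. f x * g x) x = f x * partial_deriv b g x + partial_deriv b f x * g x"
  by (intro partial_deriv_eq[OF has_derivative_mult] has_derivative_frechet smooth_differentiable assms)

lemma partial_deriv_add:
  fixes f g :: "'a::euclidean_space \<Rightarrow> real"
  assumes "smooth f" "smooth g"
  shows "partial_deriv b (\<lambda>x. f x + g x) x = partial_deriv b f x + partial_deriv b g x"
  by (intro partial_deriv_eq[OF has_derivative_add] has_derivative_frechet smooth_differentiable assms)

lemma partial_deriv_cmult:
  fixes f :: "'a::euclidean_space \<Rightarrow> real"
  assumes "smooth f"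
  shows "partial_deriv b (\<lambda>x. c * f x) x = c * partial_deriv b f x"
  by (intro partial_deriv_eq[OF has_derivative_mult_right] has_derivative_frechet smooth_differentiable assms)

lemma partial_deriv_translate:
  fixes f :: "'a::euclidean_space \<Rightarrow> real"
  assumes "smooth f"
  shows "partial_deriv b (\<lambda>x. f (x + a)) x = partial_deriv b f (x + a)"
proof -
  have "((\<lambda>x. x + a) has_derivative (\<lambda>h. h)) (at x)"
    by (auto intro!: derivative_eq_intros)
  from has_derivative_compose[OF this has_derivative_frechet[OF smooth_differentiable[OF assms]]]
  show ?thesis by (rule partial_deriv_eq)
qed

lemma partial_deriv_inner:
  "partial_deriv b (\<lambda>x::'a::euclidean_space. x \<bullet> c) x = b \<bullet> c"
  by (rule partial_deriv_eq) (auto intro!: derivative_eq_intros)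

lemma smooth_increment_le:
  fixes f :: "'a::euclidean_space \<Rightarrow> real"
  assumes "smooth f" "\<And>x. \<bar>partial_deriv b f x\<bar> \<le> L"
  shows "\<bar>f (x + t *\<^sub>R b) - f x\<bar> \<le> L * \<bar>t\<bar>"
proof -
  have "norm (f (x + t *\<^sub>R b) - f (x + 0 *\<^sub>R b)) \<le> L * norm (t - 0)"
    by (rule field_differentiable_bound[of UNIV "\<lambda>t. f (x + t *\<^sub>R b)"
          "\<lambda>t. partial_deriv b f (x + t *\<^sub>R b)"])
      (use assms has_real_derivative_along in auto)
  then show ?thesis by simp
qed

text \<open>Difference quotients of \<psi> have integral 0 by translation invariance. Steps of size
  at most 1 keep them supported in the ball of radius R + 1, where the Lipschitz constant L is a
  majorant.\<close>

lemma integral_partial_deriv_eq_0: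
  assumes \<psi>: "\<psi> \<in> test_functions UNIV" and b: "b \<in> Basis"
  shows "(LINT x|lborel. partial_deriv b \<psi> x) = 0"
proof -
  have sm: "smooth \<psi>" by (rule test_functions_smooth[OF \<psi>])
  obtain K where K: "compact K" "\<forall>x. x \<notin> K \<longrightarrow> \<psi> x = 0"
    using \<psi> by (elim test_functionsE) blast
  then obtain R where R: "R > 0" "\<And>x. x \<in> K \<Longrightarrow> norm x \<le> R"
    by (meson bounded_pos compact_imp_bounded)
  obtain L where L: "L > 0" "\<And>x. \<bar>partial_deriv b \<psi> x\<bar> \<le> L"
    using test_functions_bounded[OF test_functions_partial_deriv[OF \<psi> b]] by blast
  define h where "h n = inverse (real (Suc n))" for n
  have h: "h n > 0" "h n \<le> 1" for n by (auto simp: h_def inverse_le_1_iff)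
  have hlim: "h \<longlonglongrightarrow> 0" unfolding h_def by (rule LIMSEQ_inverse_real_of_nat)
  define D where "D n x = (\<psi> (x + h n *\<^sub>R b) - \<psi> x) / h n" for n x
  note meas[measurable] = test_functions_borel[OF \<psi>]
  have int: "integrable lborel \<psi>" by (rule test_functions_integrable[OF \<psi>])
  have "(\<lambda>n. LINT x|lborel. D n x) \<longlonglongrightarrow> (LINT x|lborel. partial_deriv b \<psi> x)"
  proof (rule integral_dominated_convergence[where w = "\<lambda>x. L * indicator (cball 0 (R + 1)) x"])
    show "partial_deriv b \<psi> \<in> borel_measurable lborel"
      using test_functions_borel[OF test_functions_partial_deriv[OF \<psi> b]] by simp
    show "D n \<in> borel_measurable lborel" for n
      unfolding D_def[abs_def] by measurable
    show "integrable lborel (\<lambda>x. L * indicator (cball (0::'a) (R + 1)) x)"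
      using emeasure_compact_finite[OF compact_cball, of "0::'a" "R + 1"]
      by (intro integrable_mult_right integrable_real_indicator) (auto simp: top.not_eq_extremum)
    show "AE x in lborel. (\<lambda>n. D n x) \<longlonglongrightarrow> partial_deriv b \<psi> x"
    proof (rule AE_I2)
      fix x
      have "((\<lambda>t. \<psi> (x + t *\<^sub>R b)) has_real_derivative partial_deriv b \<psi> (x + 0 *\<^sub>R b)) (at 0)"
        by (rule has_real_derivative_along[OF sm])
      then have "(\<lambda>t. (\<psi> (x + t *\<^sub>R b) - \<psi> x) / t) \<midarrow>0\<rightarrow> partial_deriv b \<psi> x"
        by (simp add: DERIV_def)
      moreover have "filterlim h (at 0) sequentially"
        using h hlim by (auto simp: filterlim_at less_imp_neq[symmetric])
      ultimately show "(\<lambda>n. D n x) \<longlonglongrightarrow> partial_deriv b \<psi> x"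
        unfolding D_def by (rule filterlim_compose)
    qed
    show "AE x in lborel. norm (D n x) \<le> L * indicator (cball 0 (R + 1)) x" for n
    proof (rule AE_I2)
      fix x
      show "norm (D n x) \<le> L * indicator (cball 0 (R + 1)) x"
      proof (cases "x \<in> cball 0 (R + 1)")
        case True
        then show ?thesis
          using smooth_increment_le[OF sm L(2), of x "h n"] h(1)[of n]
          by (simp add: D_def divide_le_eq)
      next
        case False
        then have "norm x > R + 1" by simp
        then have "norm (x + h n *\<^sub>R b) > R"
          using norm_triangle_ineq2[of x "- (h n *\<^sub>R b)"] b h[of n] by simp
        then have "x + h n *\<^sub>R b \<notin> K" "x \<notin> K" using R(2) \<open>norm x > R + 1\<close> by fastforce+
        then show ?thesis using K False by (simp add: D_def)
      qed
    qed
  qed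
  moreover have "(LINT x|lborel. D n x) = 0" for n
    unfolding D_def
    using int integrable_translate[OF int, of "h n *\<^sub>R b"] integral_translate[of \<psi> "h n *\<^sub>R b"]
    by simp
  ultimately show ?thesis by (simp add: LIMSEQ_const_iff)
qed

lemma integral_by_parts:
  assumes \<phi>: "\<phi> \<in> test_functions UNIV" and g: "smooth g" and b: "b \<in> Basis"
  shows "(LINT x|lborel. \<phi> x * partial_deriv b g x) = - (LINT x|lborel. partial_deriv b \<phi> x * g x)"
proof -
  have sm: "smooth \<phi>" by (rule test_functions_smooth[OF \<phi>])
  have "(LINT x|lborel. \<phi> x * partial_deriv b g x + partial_deriv b \<phi> x * g x) = 0"
    using integral_partial_deriv_eq_0[OF test_functions_mult_smooth[OF g \<phi>] b]
    by (simp add: partial_deriv_mult[OF sm g])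
  moreover have "integrable lborel (\<lambda>x. \<phi> x * partial_deriv b g x)"
    by (intro test_functions_integrable[where \<Omega> = UNIV] test_functions_mult_smooth
        smooth_partial_deriv g b \<phi>)
  moreover have "integrable lborel (\<lambda>x. partial_deriv b \<phi> x * g x)"
    by (intro test_functions_integrable[where \<Omega> = UNIV] test_functions_mult_smooth
        test_functions_partial_deriv g b \<phi>)
  ultimately show ?thesis by simp
qed

text \<open>The inequality results from integrating the derivative of \<open>x\<^sub>b \<phi>\<^sup>2\<close>.\<close>

lemma poincare_test_function:
  assumes \<phi>: "\<phi> \<in> test_functions \<Omega>" and b: "b \<in> Basis" and R: "\<And>x. x \<in> \<Omega> \<Longrightarrow> norm x \<le> R"
  shows "(LINT x|lborel. (\<phi> x)\<^sup>2) \<le> 4 * R\<^sup>2 * (LINT x|lborel. (partial_deriv b \<phi> x)\<^sup>2)"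
proof -
  let ?d = "partial_deriv b \<phi>"
  have \<phi>': "\<phi> \<in> test_functions UNIV" using \<phi> test_functions_mono by blast
  have sm: "smooth \<phi>" by (rule test_functions_smooth[OF \<phi>])
  have d: "?d \<in> test_functions UNIV" by (rule test_functions_partial_deriv[OF \<phi>' b])
  have int: "integrable lborel (\<lambda>x. \<phi> x * \<phi> x)" "integrable lborel (\<lambda>x. ?d x * ?d x)"
    "integrable lborel (\<lambda>x. (x \<bullet> b) * (?d x * \<phi> x))"
    by (intro test_functions_integrable[where \<Omega> = UNIV] test_functions_smooth_mult smooth_inner
        test_functions_smooth[OF \<phi>'] test_functions_smooth[OF d] \<phi>' d)+
  have "(LINT x|lborel. (\<phi> x * \<phi> x) * partial_deriv b (\<lambda>x. x \<bullet> b) x)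
      = - (LINT x|lborel. partial_deriv b (\<lambda>x. \<phi> x * \<phi> x) x * (x \<bullet> b))"
    by (intro integral_by_parts test_functions_smooth_mult smooth_inner b \<phi>' sm)
  also have "(\<lambda>x. (\<phi> x * \<phi> x) * partial_deriv b (\<lambda>x. x \<bullet> b) x) = (\<lambda>x. \<phi> x * \<phi> x)"
    using b by (simp add: partial_deriv_inner)
  also have "(\<lambda>x. partial_deriv b (\<lambda>x. \<phi> x * \<phi> x) x * (x \<bullet> b)) = (\<lambda>x. 2 * ((x \<bullet> b) * (?d x * \<phi> x)))"
    using partial_deriv_mult[OF sm sm] by (auto simp: algebra_simps)
  also have "- (LINT x|lborel. 2 * ((x \<bullet> b) * (?d x * \<phi> x))) = (LINT x|lborel. - (2 * ((x \<bullet> b) * (?d x * \<phi> x))))"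
    by simp
  \<comment> \<open>Young's inequality, weighted so that half of the left-hand side can be absorbed;
    this is where the factor 4 comes from.\<close>
  also have "\<dots> \<le> (LINT x|lborel. 1 / 2 * (\<phi> x * \<phi> x) + 2 * R\<^sup>2 * (?d x * ?d x))"
  proof (rule integral_mono)
    show "integrable lborel (\<lambda>x. - (2 * ((x \<bullet> b) * (?d x * \<phi> x))))" using int by simp
    show "integrable lborel (\<lambda>x. 1 / 2 * (\<phi> x * \<phi> x) + 2 * R\<^sup>2 * (?d x * ?d x))" using int by simp
    fix x
    show "- (2 * ((x \<bullet> b) * (?d x * \<phi> x))) \<le> 1 / 2 * (\<phi> x * \<phi> x) + 2 * R\<^sup>2 * (?d x * ?d x)"
    proof (cases "x \<in> \<Omega>")
      case True
      then have "\<bar>x \<bullet> b\<bar> \<le> R" using Basis_le_norm[OF b, of x] R[OF True] by linarith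
      then have "(x \<bullet> b)\<^sup>2 \<le> R\<^sup>2" by (metis abs_ge_zero power2_abs power_mono)
      then have "2 * (x \<bullet> b)\<^sup>2 * (?d x)\<^sup>2 \<le> 2 * R\<^sup>2 * (?d x)\<^sup>2"
        by (intro mult_right_mono) auto
      moreover have "0 \<le> 1 / 2 * (\<phi> x + 2 * (x \<bullet> b) * ?d x)\<^sup>2" by simp
      ultimately show ?thesis by (simp add: power2_eq_square algebra_simps)
    next
      case False
      then show ?thesis using test_functions_outside[OF \<phi>] by simp
    qed
  qed
  also have "\<dots> = 1 / 2 * (LINT x|lborel. \<phi> x * \<phi> x) + 2 * R\<^sup>2 * (LINT x|lborel. ?d x * ?d x)"
    using int by simp
  finally show ?thesis by (simp add: power2_eq_square)
qed


section \<open>Measures are determined by test functions\<close>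

lemma sets_restrict_borel_eq:
  assumes "open \<Omega>"
  shows "sets (restrict_space borel \<Omega>) = sigma_sets \<Omega> {U. open U \<and> U \<subseteq> \<Omega>}"
proof -
  have "sets (restrict_space borel \<Omega>) = (\<inter>) \<Omega> ` sigma_sets UNIV {U. open U}"
    by (simp add: sets_restrict_space borel_def)
  also have "\<dots> = sigma_sets \<Omega> ((\<inter>) \<Omega> ` {U. open U})"
    using assms by (intro sigma_sets_Int) auto
  also have "(\<inter>) \<Omega> ` {U. open U} = {U. open U \<and> U \<subseteq> \<Omega>}"
  proof
    show "{U. open U \<and> U \<subseteq> \<Omega>} \<subseteq> (\<inter>) \<Omega> ` {U. open U}" by (auto simp: image_iff)
    show "(\<inter>) \<Omega> ` {U. open U} \<subseteq> {U. open U \<and> U \<subseteq> \<Omega>}" using assms by auto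
  qed
  finally show ?thesis .
qed

lemma tendsto_measure_open_indicator_approx:
  assumes M: "finite_measure M" "sets M = sets (restrict_space borel \<Omega>)" and U: "open U" "U \<subseteq> \<Omega>"
    and \<phi>: "\<And>k. \<phi> k \<in> test_functions U" "\<And>k x. 0 \<le> \<phi> k x" "\<And>k x. \<phi> k x \<le> 1"
    "\<And>x. (\<lambda>k. \<phi> k x) \<longlonglongrightarrow> indicator U x"
  shows "(\<lambda>k. LINT x|M. \<phi> k x) \<longlonglongrightarrow> measure M U"
proof -
  interpret finite_measure M by fact
  have meas: "f \<in> borel_measurable M" if "f \<in> borel_measurable borel" for f :: "'a \<Rightarrow> real"
    using measurable_restrict_space1[OF that] measurable_cong_sets[OF M(2) refl] by blast
  have UM: "U \<in> sets M"
    using U unfolding M(2) sets_restrict_space by (auto simp: image_iff intro!: bexI[of _ U])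
  have [measurable]: "\<phi> k \<in> borel_measurable M" for k by (rule meas[OF test_functions_borel[OF \<phi>(1)]])
  have "(\<lambda>k. LINT x|M. \<phi> k x) \<longlonglongrightarrow> (LINT x|M. indicator U x)"
    by (rule integral_dominated_convergence[where w = "\<lambda>_. 1"])
      (use \<phi>(2-4) UM in \<open>auto simp: abs_of_nonneg\<close>)
  then show ?thesis using UM by simp
qed

text \<open>Open sets are an intersection-stable generator, and the measure of an open set is a
  limit of integrals of test functions supported in it.\<close>

lemma finite_measure_eqI_test_functions:
  assumes \<Omega>: "open \<Omega>"
    and P: "finite_measure P" "sets P = sets (restrict_space borel \<Omega>)"
    and N: "finite_measure N" "sets N = sets (restrict_space borel \<Omega>)"
    and eq: "\<And>\<phi>. \<phi> \<in> test_functions \<Omega> \<Longrightarrow> (LINT x|P. \<phi> x) = (LINT x|N. \<phi> x)"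
  shows "P = N"
proof (rule measure_eqI_generator_eq[where E = "{U. open U \<and> U \<subseteq> \<Omega>}" and A = "\<lambda>_. \<Omega>" and \<Omega> = \<Omega>])
  show "Int_stable {U. open U \<and> U \<subseteq> \<Omega>}" by (auto simp: Int_stable_def)
  show "sets P = sigma_sets \<Omega> {U. open U \<and> U \<subseteq> \<Omega>}" "sets N = sigma_sets \<Omega> {U. open U \<and> U \<subseteq> \<Omega>}"
    using P N sets_restrict_borel_eq[OF \<Omega>] by auto
  show "emeasure P \<Omega> \<noteq> \<infinity>" using P by (simp add: finite_measure.emeasure_finite)
  fix U assume "U \<in> {U. open U \<and> U \<subseteq> \<Omega>}"
  then have U: "open U" "U \<subseteq> \<Omega>" by auto
  obtain \<phi> where \<phi>: "\<And>k. \<phi> k \<in> test_functions U" "\<And>k x. 0 \<le> \<phi> k x" "\<And>k x. \<phi> k x \<le> 1"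
    "\<And>x. (\<lambda>k. \<phi> k x) \<longlonglongrightarrow> indicator U x"
    using open_indicator_approx[OF U(1)] by blast
  have "(LINT x|P. \<phi> k x) = (LINT x|N. \<phi> k x)" for k
    using test_functions_mono[OF \<phi>(1) U(2)] eq by blast
  then have "measure P U = measure N U"
    using tendsto_measure_open_indicator_approx[OF P U \<phi>]
      tendsto_measure_open_indicator_approx[OF N U \<phi>] LIMSEQ_unique by fastforce
  then show "emeasure P U = emeasure N U"
    using P N by (simp add: finite_measure.emeasure_eq_measure)
qed (use \<Omega> in auto)

text \<open>Outer regularity of \<open>|w| dx\<close> yields test functions close to the sign of \<open>w\<close>.\<close>

lemma integral_abs_le_dual:
  fixes w :: "'a::euclidean_space \<Rightarrow> real"
  assumes \<Omega>: "open \<Omega>" and w: "integrable lborel w" and supp: "\<And>x. x \<notin> \<Omega> \<Longrightarrow> w x = 0"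
    and C: "\<And>\<phi>. \<phi> \<in> test_functions \<Omega> \<Longrightarrow> (\<And>x. \<bar>\<phi> x\<bar> \<le> 1) \<Longrightarrow> (LINT x|lborel. w x * \<phi> x) \<le> C"
  shows "(LINT x|lborel. \<bar>w x\<bar>) \<le> C"
proof (rule field_le_epsilon)
  fix e :: real assume "e > 0"
  have [measurable]: "w \<in> borel_measurable borel" using w by auto
  define M where "M = density lborel (\<lambda>x. ennreal \<bar>w x\<bar>)"
  define A where "A = {x. w x > 0}"
  have A[measurable]: "A \<in> sets borel" unfolding A_def by measurable
  have fin: "emeasure M (space M) \<noteq> \<infinity>"
  proof -
    have "emeasure M (space M) = (\<integral>\<^sup>+ x. ennreal \<bar>w x\<bar> \<partial>lborel)"
      by (simp add: M_def emeasure_density)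
    also have "\<dots> < \<infinity>" using w by (simp add: integrable_iff_bounded)
    finally show ?thesis by simp
  qed
  then interpret M: finite_measure M by (rule finite_measureI)
  have "emeasure M A = (INF U\<in>{U. A \<subseteq> U \<and> open U}. emeasure M U)"
    using fin A by (intro outer_regular) (auto simp: M_def)
  moreover have "emeasure M A < emeasure M A + ennreal (e / 2)"
    using \<open>e > 0\<close> by (simp add: M.emeasure_eq_measure ennreal_less_iff flip: ennreal_plus)
  ultimately obtain U where U: "A \<subseteq> U" "open U" "emeasure M U < emeasure M A + ennreal (e / 2)"
    by (auto simp: INF_less_iff)
  have UM: "U \<in> sets M" "A \<in> sets M" "U - A \<in> sets borel"
    using U A by (auto simp: M_def)
  have "measure M U < measure M A + e / 2"
    using U(3) \<open>e > 0\<close> by (simp add: M.emeasure_eq_measure ennreal_less_iff flip: ennreal_plus)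
  then have diff: "measure M (U - A) \<le> e / 2"
    using M.finite_measure_Diff[OF UM(1,2) U(1)] by simp
  have diff': "(LINT x|lborel. \<bar>w x\<bar> * indicator (U - A) x) \<le> e / 2"
  proof -
    have "measure M (U - A) = (LINT x|M. indicator (U - A) x)"
      using UM(3) by (simp add: M_def)
    also have "\<dots> = (LINT x|lborel. \<bar>w x\<bar> *\<^sub>R indicator (U - A) x)"
      unfolding M_def using UM(3) by (intro integral_density) auto
    finally show ?thesis using diff by simp
  qed
  obtain \<phi> where \<phi>: "\<And>k. \<phi> k \<in> test_functions U" "\<And>k x. 0 \<le> \<phi> k x" "\<And>k x. \<phi> k x \<le> 1"
    "\<And>x. (\<lambda>k. \<phi> k x) \<longlonglongrightarrow> indicator U x"
    using open_indicator_approx[OF U(2)] by blast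
  obtain \<psi> where \<psi>: "\<And>k. \<psi> k \<in> test_functions \<Omega>" "\<And>k x. 0 \<le> \<psi> k x" "\<And>k x. \<psi> k x \<le> 1"
    "\<And>x. (\<lambda>k. \<psi> k x) \<longlonglongrightarrow> indicator \<Omega> x"
    using open_indicator_approx[OF \<Omega>] by blast
  \<comment> \<open>In the limit, 2 \<phi> - 1 is the sign +1 on U and -1 elsewhere; the factor
    \<psi> supplies the compact support that it lacks.\<close>
  define \<theta> where "\<theta> k x = (2 * \<phi> k x - 1) * \<psi> k x" for k x
  have \<theta>: "\<theta> k \<in> test_functions \<Omega>" for k
    unfolding \<theta>_def[abs_def] using \<phi>(1) \<psi>(1)
    by (intro test_functions_smooth_mult smooth_diff smooth_cmult smooth_const)
      (auto intro: test_functions_smooth)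
  have \<theta>_le: "\<bar>\<theta> k x\<bar> \<le> 1" for k x
  proof -
    have "\<bar>2 * \<phi> k x - 1\<bar> * \<bar>\<psi> k x\<bar> \<le> 1 * 1"
      using \<phi>(2,3)[of k x] \<psi>(2,3)[of k x] by (intro mult_mono) auto
    then show ?thesis by (simp add: \<theta>_def abs_mult)
  qed
  have [measurable]: "\<theta> k \<in> borel_measurable borel" for k by (rule test_functions_borel[OF \<theta>])
  have [measurable]: "U \<in> sets borel" "\<Omega> \<in> sets borel" using U \<Omega> by auto
  have "(\<lambda>k. LINT x|lborel. w x * \<theta> k x) \<longlonglongrightarrow> (LINT x|lborel. w x * ((2 * indicator U x - 1) * indicator \<Omega> x))"
  proof (rule integral_dominated_convergence[where w = "\<lambda>x. \<bar>w x\<bar>"])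
    show "AE x in lborel. (\<lambda>k. w x * \<theta> k x) \<longlonglongrightarrow> w x * ((2 * indicator U x - 1) * indicator \<Omega> x)"
      unfolding \<theta>_def by (intro AE_I2 tendsto_intros \<phi>(4) \<psi>(4))
    show "AE x in lborel. norm (w x * \<theta> k x) \<le> \<bar>w x\<bar>" for k
      using \<theta>_le by (intro AE_I2) (auto simp: abs_mult intro: mult_left_le)
  qed (use w in auto)
  then have le: "(LINT x|lborel. w x * ((2 * indicator U x - 1) * indicator \<Omega> x)) \<le> C"
    by (rule LIMSEQ_le_const2) (use C[OF \<theta> \<theta>_le] in auto)
  \<comment> \<open>The limit of the tests differs from |w| only on U - A, where the sign is wrong
    and the loss is 2 |w|; hence the choice of e / 2 above.\<close>
  have "w x * ((2 * indicator U x - 1) * indicator \<Omega> x) = \<bar>w x\<bar> - 2 * (\<bar>w x\<bar> * indicator (U - A) x)" for x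
    using U(1) supp by (cases "x \<in> \<Omega>"; cases "w x > 0") (auto simp: A_def indicator_def subset_iff)
  moreover have "integrable lborel (\<lambda>x. \<bar>w x\<bar> * indicator (U - A) x)"
    using w UM(3) by (intro integrable_real_mult_indicator) auto
  ultimately have "(LINT x|lborel. \<bar>w x\<bar>) - 2 * (LINT x|lborel. \<bar>w x\<bar> * indicator (U - A) x) \<le> C"
    using le w by simp
  then show "(LINT x|lborel. \<bar>w x\<bar>) \<le> C + e" using diff' by simp
qed

section \<open>Square integrable functions\<close>

definition sq_integrable :: "'a measure \<Rightarrow> ('a \<Rightarrow> 'b::euclidean_space) \<Rightarrow> bool" where
  "sq_integrable M f \<longleftrightarrow> f \<in> borel_measurable M \<and> integrable M (\<lambda>x. (norm (f x))\<^sup>2)"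

lemma sq_integrable_measurable[measurable_dest]: "sq_integrable M f \<Longrightarrow> f \<in> borel_measurable M"
  by (simp add: sq_integrable_def)

lemma sq_integrable_norm_sq: "sq_integrable M f \<Longrightarrow> integrable M (\<lambda>x. (norm (f x))\<^sup>2)"
  by (simp add: sq_integrable_def)

lemma norm_add_sq_le: "(norm (a + b))\<^sup>2 \<le> 2 * (norm a)\<^sup>2 + 2 * (norm (b::'b::real_inner))\<^sup>2"
proof -
  have "0 \<le> (norm (a - b))\<^sup>2" by simp
  then show ?thesis by (simp add: power2_norm_eq_inner inner_add inner_diff inner_commute)
qed

lemma sq_integrable_bound:
  fixes f :: "'a \<Rightarrow> 'b::euclidean_space"
  assumes "f \<in> borel_measurable M" "integrable M g" "\<And>x. (norm (f x))\<^sup>2 \<le> g x"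
  shows "sq_integrable M f"
  unfolding sq_integrable_def
proof
  show "integrable M (\<lambda>x. (norm (f x))\<^sup>2)"
  proof (rule Bochner_Integration.integrable_bound[OF assms(2)])
    show "AE x in M. norm ((norm (f x))\<^sup>2) \<le> norm (g x)"
      using assms(3) by (intro AE_I2) (smt (verit) real_norm_def zero_le_power2)
  qed (use assms(1) in measurable)
qed fact

lemma sq_integrable_add:
  assumes "sq_integrable M f" "sq_integrable M g"
  shows "sq_integrable M (\<lambda>x. f x + g x)"
  by (rule sq_integrable_bound[where g = "\<lambda>x. 2 * (norm (f x))\<^sup>2 + 2 * (norm (g x))\<^sup>2"])
    (use assms in \<open>auto simp: norm_add_sq_le sq_integrable_def\<close>)

lemma sq_integrable_bounded_scaleR:
  fixes w :: "'a \<Rightarrow> real"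
  assumes "sq_integrable M f" "w \<in> borel_measurable M" "\<And>x. \<bar>w x\<bar> \<le> C"
  shows "sq_integrable M (\<lambda>x. w x *\<^sub>R f x)"
proof (rule sq_integrable_bound[where g = "\<lambda>x. C\<^sup>2 * (norm (f x))\<^sup>2"])
  have "(w x)\<^sup>2 \<le> C\<^sup>2" for x using power_mono[OF assms(3)[of x] abs_ge_zero, of 2] by simp
  then show "(norm (w x *\<^sub>R f x))\<^sup>2 \<le> C\<^sup>2 * (norm (f x))\<^sup>2" for x
    by (simp add: power_mult_distrib mult_right_mono)
qed (use assms in \<open>auto simp: sq_integrable_def\<close>)

lemma sq_integrable_scaleR: "sq_integrable M f \<Longrightarrow> sq_integrable M (\<lambda>x. c *\<^sub>R f x)"
  by (rule sq_integrable_bounded_scaleR[where C = "\<bar>c\<bar>"]) auto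

lemma sq_integrable_diff:
  assumes "sq_integrable M f" "sq_integrable M g"
  shows "sq_integrable M (\<lambda>x. f x - g x)"
  using sq_integrable_add[OF assms(1) sq_integrable_scaleR[OF assms(2), of "-1"]] by simp

lemma sq_integrable_inner:
  assumes "sq_integrable M f" "sq_integrable M g"
  shows "integrable M (\<lambda>x. f x \<bullet> g x)"
proof (rule Bochner_Integration.integrable_bound)
  show "integrable M (\<lambda>x. (norm (f x))\<^sup>2 + (norm (g x))\<^sup>2)"
    using assms by (auto simp: sq_integrable_def)
  show "(\<lambda>x. f x \<bullet> g x) \<in> borel_measurable M"
    using assms by (auto simp: sq_integrable_def)
  have "\<bar>f x \<bullet> g x\<bar> \<le> (norm (f x))\<^sup>2 + (norm (g x))\<^sup>2" for x
  proof -
    have "0 \<le> (norm (f x) - norm (g x))\<^sup>2 + (norm (f x))\<^sup>2 + (norm (g x))\<^sup>2" by simp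
    then have "norm (f x) * norm (g x) \<le> (norm (f x))\<^sup>2 + (norm (g x))\<^sup>2"
      by (simp add: power2_diff)
    then show ?thesis using Cauchy_Schwarz_ineq2[of "f x" "g x"] by linarith
  qed
  then show "AE x in M. norm (f x \<bullet> g x) \<le> norm ((norm (f x))\<^sup>2 + (norm (g x))\<^sup>2)"
    by (intro AE_I2) simp
qed

text \<open>The discriminant criterion without a sign assumption on c. It gives the Cauchy-Schwarz
  inequality, and with a = 0 it forces b = 0, which is how the Euler-Lagrange equation is obtained
  below.\<close>

lemma quadratic_nonneg_imp:
  fixes a b c :: real
  assumes "\<And>s. 0 \<le> a + 2 * s * b + s\<^sup>2 * c"
  shows "b\<^sup>2 \<le> a * c"
proof (cases "c = 0")
  case True
  have "b = 0"
  proof (rule ccontr)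
    assume "b \<noteq> 0"
    then have "2 * (- (\<bar>a\<bar> + 1) / (2 * b)) * b = - (\<bar>a\<bar> + 1)" by simp
    then show False
      using assms[of "- (\<bar>a\<bar> + 1) / (2 * b)"] True
      by (simp only: mult_zero_right add_0_right)
  qed
  then show ?thesis using True by simp
next
  case False
  have "0 \<le> c"
  proof (rule ccontr)
    assume "\<not> 0 \<le> c"
    then have c: "c < 0" by simp
    \<comment> \<open>Averaging over s and -s removes b; a large s then contradicts c < 0.\<close>
    have "0 \<le> (a + 2 * s * b + s\<^sup>2 * c) + (a + 2 * (-s) * b + (-s)\<^sup>2 * c)" for s
      using assms[of s] assms[of "-s"] by linarith
    then have *: "0 \<le> a + s\<^sup>2 * c" for s by (drule_tac meta_spec[of _ s]) (simp add: mult.commute)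
    have "0 \<le> (\<bar>a\<bar> + 1) / (- c)" using c by (intro divide_nonneg_pos) auto
    then have "(sqrt ((\<bar>a\<bar> + 1) / (- c)))\<^sup>2 * c = (\<bar>a\<bar> + 1) / (- c) * c"
      by (simp only: real_sqrt_pow2)
    also have "\<dots> = - (\<bar>a\<bar> + 1)" using c by simp
    finally have "(sqrt ((\<bar>a\<bar> + 1) / (- c)))\<^sup>2 * c = - (\<bar>a\<bar> + 1)" .
    then show False using *[of "sqrt ((\<bar>a\<bar> + 1) / (- c))"] by linarith
  qed
  then have c: "c > 0" using False by simp
  have "0 \<le> a - b\<^sup>2 / c"
    using assms[of "- b / c"] c by (simp add: power2_eq_square field_simps)
  then show ?thesis using c by (simp add: field_simps)
qed

lemma Cauchy_Schwarz_integral: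
  assumes "sq_integrable M f" "sq_integrable M g"
  shows "(LINT x|M. f x \<bullet> g x)\<^sup>2 \<le> (LINT x|M. (norm (f x))\<^sup>2) * (LINT x|M. (norm (g x))\<^sup>2)"
proof (rule quadratic_nonneg_imp)
  fix s :: real
  have "0 \<le> (LINT x|M. (norm (f x + s *\<^sub>R g x))\<^sup>2)" by simp
  also have "(\<lambda>x. (norm (f x + s *\<^sub>R g x))\<^sup>2) = (\<lambda>x. (norm (f x))\<^sup>2 + 2 * s * (f x \<bullet> g x) + s\<^sup>2 * (norm (g x))\<^sup>2)"
    unfolding power2_norm_eq_inner
    by (auto simp: inner_add inner_commute power2_eq_square algebra_simps)
  also have "(LINT x|M. (norm (f x))\<^sup>2 + 2 * s * (f x \<bullet> g x) + s\<^sup>2 * (norm (g x))\<^sup>2)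
      = (LINT x|M. (norm (f x))\<^sup>2) + 2 * s * (LINT x|M. f x \<bullet> g x) + s\<^sup>2 * (LINT x|M. (norm (g x))\<^sup>2)"
    using sq_integrable_inner[OF assms] assms[THEN sq_integrable_norm_sq] by simp
  finally show "0 \<le> \<dots>" .
qed

lemma tendsto_integral_inner:
  assumes f: "\<And>n. sq_integrable M (f n)" "sq_integrable M h" and g: "sq_integrable M g"
    and lim: "(\<lambda>n. LINT x|M. (norm (f n x - h x))\<^sup>2) \<longlonglongrightarrow> 0"
  shows "(\<lambda>n. LINT x|M. f n x \<bullet> g x) \<longlonglongrightarrow> (LINT x|M. h x \<bullet> g x)"
proof -
  have "(\<lambda>n. (LINT x|M. (norm (f n x - h x))\<^sup>2) * (LINT x|M. (norm (g x))\<^sup>2)) \<longlonglongrightarrow> 0"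
    using tendsto_mult_right[OF lim] by simp
  then have "(\<lambda>n. (LINT x|M. (f n x - h x) \<bullet> g x)\<^sup>2) \<longlonglongrightarrow> 0"
    by (rule tendsto_sandwich[OF _ _ tendsto_const, rotated 2])
      (use Cauchy_Schwarz_integral[OF sq_integrable_diff[OF f] g] in \<open>auto simp del: power2_eq_square\<close>)
  from tendsto_real_sqrt[OF this]
  have "(\<lambda>n. LINT x|M. (f n x - h x) \<bullet> g x) \<longlonglongrightarrow> 0"
    by (simp add: tendsto_rabs_zero_iff)
  moreover have "(LINT x|M. (f n x - h x) \<bullet> g x) = (LINT x|M. f n x \<bullet> g x) - (LINT x|M. h x \<bullet> g x)" for n
    using sq_integrable_inner[OF f(1) g] sq_integrable_inner[OF f(2) g] by (simp add: inner_diff_left)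
  ultimately show ?thesis by (simp add: LIM_zero_iff)
qed

lemma tendsto_integral_norm_sq:
  assumes f: "\<And>n. sq_integrable M (f n)" "sq_integrable M h"
    and lim: "(\<lambda>n. LINT x|M. (norm (f n x - h x))\<^sup>2) \<longlonglongrightarrow> 0"
  shows "(\<lambda>n. LINT x|M. (norm (f n x))\<^sup>2) \<longlonglongrightarrow> (LINT x|M. (norm (h x))\<^sup>2)"
proof -
  have "(norm (f n x))\<^sup>2 = (norm (f n x - h x))\<^sup>2 + 2 * (f n x \<bullet> h x) - (norm (h x))\<^sup>2" for n x
    by (simp add: power2_norm_eq_inner inner_diff inner_commute)
  then have "(LINT x|M. (norm (f n x))\<^sup>2)
      = (LINT x|M. (norm (f n x - h x))\<^sup>2) + 2 * (LINT x|M. f n x \<bullet> h x) - (LINT x|M. (norm (h x))\<^sup>2)" for n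
    using sq_integrable_inner[OF f(1) f(2), of n] sq_integrable_norm_sq[OF f(2)]
      sq_integrable_norm_sq[OF sq_integrable_diff[OF f], of n]
    by simp
  moreover have "(\<lambda>n. (LINT x|M. (norm (f n x - h x))\<^sup>2) + 2 * (LINT x|M. f n x \<bullet> h x) - (LINT x|M. (norm (h x))\<^sup>2))
      \<longlonglongrightarrow> 0 + 2 * (LINT x|M. h x \<bullet> h x) - (LINT x|M. (norm (h x))\<^sup>2)"
    by (intro tendsto_intros lim tendsto_integral_inner[OF f f(2) lim])
  ultimately show ?thesis by (simp add: power2_norm_eq_inner)
qed

text \<open>Fatou's lemma with upper bounds \<open>c i\<close> that converge, so that no liminf of
  real numbers has to be handled and integrability of the limit comes along with its bound. A
  constant sequence of bounds is a frequent case.\<close>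

lemma Fatou_AE_limit:
  fixes u :: "nat \<Rightarrow> 'a \<Rightarrow> real"
  assumes u: "\<And>i. integrable M (u i)" "\<And>i x. 0 \<le> u i x" and v: "v \<in> borel_measurable M"
    and lim: "AE x in M. (\<lambda>i. u i x) \<longlonglongrightarrow> v x"
    and c: "\<And>i. (LINT x|M. u i x) \<le> c i" "c \<longlonglongrightarrow> C"
  shows "integrable M v" "(LINT x|M. v x) \<le> C"
proof -
  have [measurable]: "u i \<in> borel_measurable M" for i using u(1) by auto
  have v0: "AE x in M. 0 \<le> v x"
    using lim by eventually_elim (rule LIMSEQ_le_const, use u(2) in auto)
  have "(\<integral>\<^sup>+ x. ennreal (v x) \<partial>M) = (\<integral>\<^sup>+ x. liminf (\<lambda>i. ennreal (u i x)) \<partial>M)"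
  proof (rule nn_integral_cong_AE)
    show "AE x in M. ennreal (v x) = liminf (\<lambda>i. ennreal (u i x))"
      using lim
    proof eventually_elim
      case (elim x)
      then have "(\<lambda>i. ennreal (u i x)) \<longlonglongrightarrow> ennreal (v x)" by (rule tendsto_ennrealI)
      then show ?case by (simp add: lim_imp_Liminf)
    qed
  qed
  also have "\<dots> \<le> liminf (\<lambda>i. \<integral>\<^sup>+ x. ennreal (u i x) \<partial>M)"
    by (rule nn_integral_liminf) measurable
  also have "\<dots> \<le> liminf (\<lambda>i. ennreal (c i))"
    using c(1) u by (intro Liminf_mono always_eventually)
      (auto simp: nn_integral_eq_integral ennreal_leI)
  also have "\<dots> = ennreal C"
    using tendsto_ennrealI[OF c(2)] by (simp add: lim_imp_Liminf)
  finally have le: "(\<integral>\<^sup>+ x. ennreal (v x) \<partial>M) \<le> ennreal C" .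
  also have "\<dots> < \<infinity>" by simp
  finally show iv: "integrable M v"
    using v v0 by (intro integrableI_nonneg) auto
  have "0 \<le> c i" for i
  proof -
    have "0 \<le> (LINT x|M. u i x)" using u(2) by (intro Bochner_Integration.integral_nonneg) auto
    then show ?thesis using c(1)[of i] by linarith
  qed
  then have "0 \<le> C" using c(2) by (intro LIMSEQ_le_const) auto
  then show "(LINT x|M. v x) \<le> C"
    using le iv v0 by (simp add: nn_integral_eq_integral)
qed

text \<open>Riesz-Fischer. A finite measure lets L^2 Cauchyness pass to L^1, where a subsequence is
  Cauchy almost everywhere; Fatou's lemma then carries the L^2 estimate over to its limit.\<close>

lemma sq_integrable_complete:
  fixes f :: "nat \<Rightarrow> 'a \<Rightarrow> 'b::euclidean_space"
  assumes M: "finite_measure M" and f: "\<And>n. sq_integrable M (f n)"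
    and cau: "\<And>e. e > 0 \<Longrightarrow> \<exists>N. \<forall>i\<ge>N. \<forall>j\<ge>N. (LINT x|M. (norm (f i x - f j x))\<^sup>2) < e"
  obtains g where "sq_integrable M g" "(\<lambda>n. LINT x|M. (norm (f n x - g x))\<^sup>2) \<longlonglongrightarrow> 0"
proof -
  interpret finite_measure M by fact
  have [measurable]: "f n \<in> borel_measurable M" for n using f by (rule sq_integrable_measurable)
  have one: "sq_integrable M (\<lambda>x. 1::real)" by (simp add: sq_integrable_def)
  have nrm: "sq_integrable M (\<lambda>x. norm (h x))" if "sq_integrable M h" for h :: "'a \<Rightarrow> 'b"
    using that by (auto simp: sq_integrable_def)
  have int: "integrable M h" if "sq_integrable M h" for h :: "'a \<Rightarrow> 'b"
  proof -
    have "integrable M (\<lambda>x. norm (h x) \<bullet> (1::real))" by (rule sq_integrable_inner[OF nrm[OF that] one])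
    then have "integrable M (\<lambda>x. norm (h x))" by simp
    then show ?thesis using that by (auto simp: integrable_norm_iff sq_integrable_def)
  qed
  have L1: "\<exists>N. \<forall>i\<ge>N. \<forall>j\<ge>N. (LINT x|M. norm (f i x - f j x)) < e" if "e > 0" for e
  proof -
    \<comment> \<open>The added 1 keeps the divisor positive on a null space.\<close>
    let ?m = "measure M (space M) + 1"
    have m: "?m > 0" using measure_nonneg[of M "space M"] by linarith
    then have "0 < e\<^sup>2 / ?m" using that by simp
    from cau[OF this] obtain N where
      N: "i \<ge> N \<Longrightarrow> j \<ge> N \<Longrightarrow> (LINT x|M. (norm (f i x - f j x))\<^sup>2) < e\<^sup>2 / ?m" for i j
      by blast
    have "(LINT x|M. norm (f i x - f j x)) < e" if ij: "i \<ge> N" "j \<ge> N" for i j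
    proof -
      have "(LINT x|M. norm (f i x - f j x) \<bullet> (1::real))\<^sup>2
          \<le> (LINT x|M. (norm (norm (f i x - f j x)))\<^sup>2) * (LINT x|M. (norm (1::real))\<^sup>2)"
        by (rule Cauchy_Schwarz_integral[OF nrm[OF sq_integrable_diff[OF f f]] one])
      also have "\<dots> \<le> (LINT x|M. (norm (f i x - f j x))\<^sup>2) * ?m"
        by (auto intro: mult_left_mono)
      also have "\<dots> < e\<^sup>2" using N[OF ij] m by (simp add: field_simps)
      finally show ?thesis using \<open>e > 0\<close> by (auto intro: power2_less_imp_less)
    qed
    then show ?thesis by blast
  qed
  obtain r where r: "strict_mono r" "AE x in M. Cauchy (\<lambda>i. f (r i) x)"
    using cauchy_L1_AE_cauchy_subseq[of M f, OF int[OF f] L1] by blast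
  define g where "g x = lim (\<lambda>i. f (r i) x)" for x
  have [measurable]: "g \<in> borel_measurable M"
    unfolding g_def[abs_def] by (rule borel_measurable_lim_metric) measurable
  have lim: "AE x in M. (\<lambda>i. f (r i) x) \<longlonglongrightarrow> g x"
    using r(2)
    by eventually_elim (use Cauchy_convergent convergent_LIMSEQ_iff in \<open>auto simp: g_def\<close>)
  have est: "integrable M (\<lambda>x. (norm (f n x - g x))\<^sup>2) \<and> (LINT x|M. (norm (f n x - g x))\<^sup>2) \<le> e"
    if N: "\<And>i j. i \<ge> N \<Longrightarrow> j \<ge> N \<Longrightarrow> (LINT x|M. (norm (f i x - f j x))\<^sup>2) < e" and n: "n \<ge> N" for n N e
  proof -
    have "AE x in M. (\<lambda>i. (norm (f n x - f (r (i + N)) x))\<^sup>2) \<longlonglongrightarrow> (norm (f n x - g x))\<^sup>2"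
      using lim
    proof eventually_elim
      case (elim x)
      then show ?case by (intro tendsto_intros LIMSEQ_ignore_initial_segment)
    qed
    moreover have "(LINT x|M. (norm (f n x - f (r (i + N)) x))\<^sup>2) \<le> e" for i
    proof -
      have "r (i + N) \<ge> N" using seq_suble[OF r(1), of "i + N"] by linarith
      then show ?thesis using N[OF n] by (simp add: less_imp_le)
    qed
    ultimately show ?thesis
      using Fatou_AE_limit[of M "\<lambda>i x. (norm (f n x - f (r (i + N)) x))\<^sup>2" "\<lambda>x. (norm (f n x - g x))\<^sup>2" "\<lambda>_. e" e]
        sq_integrable_norm_sq[OF sq_integrable_diff[OF f f]]
      by auto
  qed
  have lim0: "(\<lambda>n. LINT x|M. (norm (f n x - g x))\<^sup>2) \<longlonglongrightarrow> 0"
  proof (rule LIMSEQ_I)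
    fix e :: real assume "e > 0"
    then obtain N where N: "\<forall>i\<ge>N. \<forall>j\<ge>N. (LINT x|M. (norm (f i x - f j x))\<^sup>2) < e / 2"
      using cau[of "e / 2"] by auto
    show "\<exists>N. \<forall>n\<ge>N. norm ((LINT x|M. (norm (f n x - g x))\<^sup>2) - 0) < e"
    proof (intro exI[of _ N] allI impI)
      fix n assume "n \<ge> N"
      then show "norm ((LINT x|M. (norm (f n x - g x))\<^sup>2) - 0) < e"
        using est[of N "e / 2" n] N \<open>e > 0\<close> by auto
    qed
  qed
  obtain N where N: "\<forall>i\<ge>N. \<forall>j\<ge>N. (LINT x|M. (norm (f i x - f j x))\<^sup>2) < 1"
    using cau[of 1] by auto
  then have "sq_integrable M (\<lambda>x. f N x - g x)"
    using est[of N 1 N] by (auto simp: sq_integrable_def)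
  then have "sq_integrable M (\<lambda>x. f N x - (f N x - g x))" by (rule sq_integrable_diff[OF f])
  then have "sq_integrable M g" by simp
  then show ?thesis using lim0 by (rule that)
qed

section \<open>Lebesgue measure on an open set\<close>

lemma borel_measurable_lebesgue_on:
  "f \<in> borel_measurable borel \<Longrightarrow> f \<in> borel_measurable (lebesgue_on S)"
  by (intro measurable_restrict_space1 measurable_completion) simp

lemma integral_lebesgue_on_eq_lborel:
  fixes f :: "'a::euclidean_space \<Rightarrow> real"
  assumes "open \<Omega>" "f \<in> borel_measurable borel" "\<And>x. x \<notin> \<Omega> \<Longrightarrow> f x = 0"
  shows "(LINT x|lebesgue_on \<Omega>. f x) = (LINT x|lborel. f x)"
    and "integrable (lebesgue_on \<Omega>) f \<longleftrightarrow> integrable lborel f"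
proof -
  have \<Omega>: "\<Omega> \<inter> space lebesgue \<in> sets lebesgue" using assms(1) by auto
  have eq: "(\<lambda>x. indicator \<Omega> x *\<^sub>R f x) = f" using assms(3) by (auto simp: indicator_def fun_eq_iff)
  have "(LINT x|lebesgue_on \<Omega>. f x) = (LINT x|lebesgue. f x)"
    using integral_restrict_space[OF \<Omega>, of f] eq by simp
  also have "\<dots> = (LINT x|lborel. f x)" using assms(2) by (intro integral_completion) simp
  finally show "(LINT x|lebesgue_on \<Omega>. f x) = (LINT x|lborel. f x)" .
  have "integrable (lebesgue_on \<Omega>) f \<longleftrightarrow> integrable lebesgue f"
    using integrable_restrict_space[OF \<Omega>, of f] eq by simp
  also have "\<dots> \<longleftrightarrow> integrable lborel f" using assms(2) by (intro integrable_completion) simp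
  finally show "integrable (lebesgue_on \<Omega>) f \<longleftrightarrow> integrable lborel f" .
qed

text \<open>Elements of L^1(\<Omega>) are only Lebesgue measurable and arbitrary outside \<Omega>.
  Fubini, translation and pairing with Borel functions are carried out on the whole space, so each
  element is exchanged once for a Borel function that vanishes outside \<Omega>.\<close>

lemma borel_representative:
  fixes h :: "'a::euclidean_space \<Rightarrow> real"
  assumes \<Omega>: "open \<Omega>" and h: "integrable (lebesgue_on \<Omega>) h"
  obtains w where "integrable lborel w" "\<And>x. x \<notin> \<Omega> \<Longrightarrow> w x = 0" "AE x in lebesgue_on \<Omega>. h x = w x"
    "\<And>g. g \<in> borel_measurable borel \<Longrightarrow> (LINT x|lebesgue_on \<Omega>. h x * g x) = (LINT x|lborel. w x * g x)"
proof -
  have \<Omega>': "\<Omega> \<inter> space lebesgue \<in> sets lebesgue" "\<Omega> \<in> sets lebesgue" "\<Omega> \<in> sets borel" using \<Omega> by auto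
  let ?H = "\<lambda>x. indicator \<Omega> x *\<^sub>R h x"
  have H: "integrable lebesgue ?H" using h integrable_restrict_space[OF \<Omega>'(1), of h] by simp
  from completion_ex_borel_measurable_real[OF borel_measurable_integrable[OF H]]
  obtain h' where h'[measurable]: "h' \<in> borel_measurable lborel" and "AE x in lborel. ?H x = h' x"
    by blast
  then have ae: "AE x in lebesgue. ?H x = h' x" by (simp add: AE_completion)
  define w where "w x = indicator \<Omega> x * h' x" for x
  have w[measurable]: "w \<in> borel_measurable borel"
    unfolding w_def[abs_def] using h' \<Omega>'(3) by measurable
  have out: "x \<notin> \<Omega> \<Longrightarrow> w x = 0" for x by (simp add: w_def)
  have ae': "AE x in lebesgue. ?H x = w x"
    using ae by eventually_elim (auto simp: w_def indicator_def split: if_splits)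
  have aeO: "AE x in lebesgue_on \<Omega>. h x = w x"
    unfolding AE_restrict_space_iff[OF \<Omega>'(1)] using ae' by eventually_elim auto
  have "integrable lebesgue w"
    by (rule integrable_cong_AE_imp[OF H _ ae']) (intro measurable_completion, simp)
  then have int: "integrable lborel w" by (subst (asm) integrable_completion) simp_all
  show ?thesis
  proof (rule that[of w])
    fix g :: "'a \<Rightarrow> real" assume g[measurable]: "g \<in> borel_measurable borel"
    have "(LINT x|lebesgue_on \<Omega>. h x * g x) = (LINT x|lebesgue_on \<Omega>. w x * g x)"
    proof (rule integral_cong_AE)
      show "(\<lambda>x. h x * g x) \<in> borel_measurable (lebesgue_on \<Omega>)"
        by (intro borel_measurable_times borel_measurable_integrable[OF h] borel_measurable_lebesgue_on[OF g])
      show "(\<lambda>x. w x * g x) \<in> borel_measurable (lebesgue_on \<Omega>)"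
        by (intro borel_measurable_times borel_measurable_lebesgue_on g w)
      show "AE x in lebesgue_on \<Omega>. h x * g x = w x * g x" using aeO by eventually_elim simp
    qed
    also have "\<dots> = (LINT x|lborel. w x * g x)"
      by (rule integral_lebesgue_on_eq_lborel[OF \<Omega>]) (simp_all add: out)
    finally show "(LINT x|lebesgue_on \<Omega>. h x * g x) = (LINT x|lborel. w x * g x)" .
  qed (fact int, rule out, assumption, fact aeO)
qed

text \<open>The dual bound for the L^1 norm with constant 0, applied to the Borel
  representative.\<close>

lemma fundamental_lemma_calculus_of_variations:
  fixes h :: "'a::euclidean_space \<Rightarrow> real"
  assumes \<Omega>: "open \<Omega>" and h: "integrable (lebesgue_on \<Omega>) h"
    and 0: "\<And>\<phi>. \<phi> \<in> test_functions \<Omega> \<Longrightarrow> (LINT x|lebesgue_on \<Omega>. h x * \<phi> x) = 0"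
  shows "AE x in lebesgue_on \<Omega>. h x = 0"
proof -
  obtain w where w: "integrable lborel w" "\<And>x. x \<notin> \<Omega> \<Longrightarrow> w x = 0" "AE x in lebesgue_on \<Omega>. h x = w x"
    "\<And>g. g \<in> borel_measurable borel \<Longrightarrow> (LINT x|lebesgue_on \<Omega>. h x * g x) = (LINT x|lborel. w x * g x)"
    using borel_representative[OF \<Omega> h] by blast
  have "(LINT x|lborel. \<bar>w x\<bar>) \<le> 0"
    by (rule integral_abs_le_dual[OF \<Omega> w(1,2)]) (simp_all add: w(4)[OF test_functions_borel, symmetric] 0)
  then have "(LINT x|lborel. \<bar>w x\<bar>) = 0" by (intro antisym) auto
  then have "AE x in lborel. w x = 0"
    using w(1) integral_nonneg_eq_0_iff_AE[of lborel "\<lambda>x. \<bar>w x\<bar>"] by auto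
  then have "AE x in lebesgue. w x = 0" by (simp add: AE_completion)
  then have "AE x in lebesgue_on \<Omega>. w x = 0"
    using \<Omega> by (subst AE_restrict_space_iff) auto
  with w(3) show ?thesis by eventually_elim simp
qed

section \<open>Weak gradients and the space of functions vanishing on the boundary\<close>

definition grad :: "('a::euclidean_space \<Rightarrow> real) \<Rightarrow> 'a \<Rightarrow> 'a" where
  "grad \<phi> x = (\<Sum>b\<in>Basis. partial_deriv b \<phi> x *\<^sub>R b)"

lemma grad_inner: "b \<in> Basis \<Longrightarrow> grad \<phi> x \<bullet> b = partial_deriv b \<phi> x"
  by (simp add: grad_def inner_sum_left inner_Basis if_distrib cong: if_cong)

lemma grad_add: "smooth f \<Longrightarrow> smooth g \<Longrightarrow> grad (\<lambda>x. f x + g x) x = grad f x + grad g x"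
  by (simp add: grad_def partial_deriv_add scaleR_add_left sum.distrib)

lemma grad_cmult: "smooth f \<Longrightarrow> grad (\<lambda>x. c * f x) x = c *\<^sub>R grad f x"
  by (simp add: grad_def partial_deriv_cmult scaleR_sum_right)

lemma grad_diff: "smooth f \<Longrightarrow> smooth g \<Longrightarrow> grad (\<lambda>x. f x - g x) x = grad f x - grad g x"
  using grad_add[of f "\<lambda>x. -1 * g x" x] grad_cmult[of g "-1" x] smooth_cmult[of g "-1"] by simp

lemma L2_iff_sq_integrable: "v \<in> L2 \<Omega> \<longleftrightarrow> sq_integrable (lebesgue_on \<Omega>) v"
  by (simp add: L2_def sq_integrable_def)

lemma L2_norm_sq: "(L2_norm \<Omega> v)\<^sup>2 = (LINT x|lebesgue_on \<Omega>. (norm (v x))\<^sup>2)"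
  by (simp add: L2_norm_def)

section \<open>Sobolev functions on a bounded open set\<close>

locale bounded_open_set =
  fixes \<Omega> :: "'a::euclidean_space set"
  assumes open_\<Omega>: "open \<Omega>" and bounded_\<Omega>: "bounded \<Omega>"
begin

abbreviation "M \<equiv> lebesgue_on \<Omega>"

lemma finite_measure_M: "finite_measure M"
proof (rule finite_measureI)
  have "\<Omega> \<in> lmeasurable" using open_\<Omega> bounded_\<Omega> by (simp add: lmeasurable_open)
  then show "emeasure M (space M) \<noteq> \<infinity>"
    by (auto simp: emeasure_restrict_space fmeasurable_def)
qed

sublocale finite_measure M by (rule finite_measure_M)

lemma bounded_borel_sq_integrable:
  fixes h :: "'a \<Rightarrow> 'b::euclidean_space"
  assumes "h \<in> borel_measurable borel" "\<And>x. norm (h x) \<le> B"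
  shows "sq_integrable M h"
proof (rule sq_integrable_bound[where g = "\<lambda>_. B\<^sup>2"])
  show "h \<in> borel_measurable M" by (rule borel_measurable_lebesgue_on[OF assms(1)])
  show "(norm (h x))\<^sup>2 \<le> B\<^sup>2" for x using assms(2)[of x] by (simp add: power_mono)
qed simp

lemma test_function_sq_integrable:
  assumes "\<phi> \<in> test_functions S"
  shows "sq_integrable M \<phi>"
proof -
  obtain B where B: "\<And>x. \<bar>\<phi> x\<bar> \<le> B" using test_functions_bounded[OF assms] by blast
  show ?thesis
    by (rule bounded_borel_sq_integrable[OF test_functions_borel[OF assms]]) (use B in simp)
qed

lemma sq_integrable_mult_integrable:
  fixes v g :: "'a \<Rightarrow> real"
  assumes "sq_integrable M v" "sq_integrable M g"
  shows "integrable M (\<lambda>x. v x * g x)"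
  using sq_integrable_inner[OF assms] by simp

lemma sq_integrable_inner_Basis:
  assumes "sq_integrable M V" "b \<in> Basis"
  shows "sq_integrable M (\<lambda>x. V x \<bullet> b)"
proof (rule sq_integrable_bound[OF _ sq_integrable_norm_sq[OF assms(1)]])
  show "(\<lambda>x. V x \<bullet> b) \<in> borel_measurable M" using sq_integrable_measurable[OF assms(1)] by simp
  show "(norm (V x \<bullet> b))\<^sup>2 \<le> (norm (V x))\<^sup>2" for x
    using power_mono[OF Basis_le_norm[OF assms(2), of "V x"] abs_ge_zero, of 2] by simp
qed

lemma grad_sq_integrable:
  assumes "\<phi> \<in> test_functions S"
  shows "sq_integrable M (grad \<phi>)"
proof -
  have "sq_integrable M (\<lambda>x. \<Sum>b\<in>B. partial_deriv b \<phi> x *\<^sub>R b)" if "B \<subseteq> Basis" "finite B" for B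
    using that(2,1)
  proof (induction B rule: finite_induct)
    case empty
    then show ?case by (simp add: sq_integrable_def)
  next
    case (insert b B)
    have t: "partial_deriv b \<phi> \<in> test_functions S"
      using insert.prems by (intro test_functions_partial_deriv[OF assms]) auto
    have "sq_integrable M (\<lambda>x. partial_deriv b \<phi> x *\<^sub>R b)"
    proof (rule sq_integrable_bound[OF _ sq_integrable_norm_sq[OF test_function_sq_integrable[OF t]]])
      show "(\<lambda>x. partial_deriv b \<phi> x *\<^sub>R b) \<in> borel_measurable M"
        using borel_measurable_lebesgue_on[OF test_functions_borel[OF t]] by simp
    qed (use insert.prems in \<open>auto simp: power_mult_distrib\<close>)
    then show ?case using insert by (auto intro!: sq_integrable_add)
  qed
  from this[of Basis] show ?thesis by (simp add: grad_def[abs_def])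
qed

lemma has_weak_gradient_test_function:
  assumes "\<phi> \<in> test_functions \<Omega>"
  shows "has_weak_gradient \<Omega> \<phi> (grad \<phi>)"
  unfolding has_weak_gradient_def
proof (intro ballI)
  fix \<psi> b :: "_" assume \<psi>: "\<psi> \<in> test_functions \<Omega>" and b: "(b::'a) \<in> Basis"
  have \<phi>': "\<phi> \<in> test_functions UNIV" using assms test_functions_mono by blast
  have d: "partial_deriv b \<phi> \<in> test_functions \<Omega>" "partial_deriv b \<psi> \<in> test_functions \<Omega>"
    by (intro test_functions_partial_deriv assms \<psi> b)+
  note [measurable] = test_functions_borel[OF assms] test_functions_borel[OF \<psi>]
    test_functions_borel[OF d(1)] test_functions_borel[OF d(2)]
  have "(LINT x|M. \<phi> x * partial_deriv b \<psi> x) = (LINT x|lborel. \<phi> x * partial_deriv b \<psi> x)"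
    by (rule integral_lebesgue_on_eq_lborel[OF open_\<Omega>])
      (simp_all add: test_functions_outside[OF assms])
  also have "\<dots> = - (LINT x|lborel. partial_deriv b \<phi> x * \<psi> x)"
    by (rule integral_by_parts[OF \<phi>' test_functions_smooth[OF \<psi>] b])
  also have "(LINT x|lborel. partial_deriv b \<phi> x * \<psi> x) = (LINT x|M. partial_deriv b \<phi> x * \<psi> x)"
    by (rule integral_lebesgue_on_eq_lborel[OF open_\<Omega>, symmetric])
      (simp_all add: test_functions_outside[OF \<psi>])
  finally show "(LINT x|M. \<phi> x * partial_deriv b \<psi> x) = - (LINT x|M. (grad \<phi> x \<bullet> b) * \<psi> x)"
    using b by (simp add: grad_inner)
qed

lemma has_weak_gradient_diff:
  assumes "has_weak_gradient \<Omega> v V" "has_weak_gradient \<Omega> w W"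
    and v: "sq_integrable M v" "sq_integrable M V" and w: "sq_integrable M w" "sq_integrable M W"
  shows "has_weak_gradient \<Omega> (\<lambda>x. v x - w x) (\<lambda>x. V x - W x)"
  unfolding has_weak_gradient_def
proof (intro ballI)
  fix \<psi> b assume \<psi>: "\<psi> \<in> test_functions \<Omega>" and b: "(b::'a) \<in> Basis"
  have t: "sq_integrable M \<psi>" "sq_integrable M (partial_deriv b \<psi>)"
    by (intro test_function_sq_integrable[of _ \<Omega>] test_functions_partial_deriv \<psi> b)+
  show "(LINT x|M. (v x - w x) * partial_deriv b \<psi> x) = - (LINT x|M. ((V x - W x) \<bullet> b) * \<psi> x)"
    using assms(1,2) \<psi> b
      sq_integrable_mult_integrable[OF v(1) t(2)] sq_integrable_mult_integrable[OF w(1) t(2)]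
      sq_integrable_mult_integrable[OF sq_integrable_inner_Basis[OF v(2) b] t(1)]
      sq_integrable_mult_integrable[OF sq_integrable_inner_Basis[OF w(2) b] t(1)]
    by (simp add: has_weak_gradient_def left_diff_distrib inner_diff_left)
qed

lemma has_weak_gradient_unique:
  assumes "has_weak_gradient \<Omega> v V" "has_weak_gradient \<Omega> v W"
    and V: "sq_integrable M V" and W: "sq_integrable M W"
  shows "AE x in M. V x = W x"
proof -
  have "AE x in M. (V x - W x) \<bullet> b = 0" if b: "b \<in> Basis" for b
  proof (rule fundamental_lemma_calculus_of_variations[OF open_\<Omega>])
    have i: "sq_integrable M (\<lambda>x. (V x - W x) \<bullet> b)"
      by (intro sq_integrable_inner_Basis sq_integrable_diff V W b)
    have "integrable M (\<lambda>x. ((V x - W x) \<bullet> b) * 1)"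
      by (intro sq_integrable_mult_integrable[OF i] bounded_borel_sq_integrable[where B = 1]) auto
    then show "integrable M (\<lambda>x. (V x - W x) \<bullet> b)" by simp
    fix \<psi> assume \<psi>: "\<psi> \<in> test_functions \<Omega>"
    have t: "sq_integrable M \<psi>" by (rule test_function_sq_integrable[OF \<psi>])
    show "(LINT x|M. ((V x - W x) \<bullet> b) * \<psi> x) = 0"
      using assms(1,2) \<psi> b
        sq_integrable_mult_integrable[OF sq_integrable_inner_Basis[OF V b] t]
        sq_integrable_mult_integrable[OF sq_integrable_inner_Basis[OF W b] t]
      by (simp add: has_weak_gradient_def left_diff_distrib inner_diff_left)
  qed
  then have "AE x in M. \<forall>b\<in>Basis. (V x - W x) \<bullet> b = 0"
    by (intro AE_finite_allI) auto
  then show ?thesis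
    by eventually_elim (metis euclidean_all_zero_iff eq_iff_diff_eq_0)
qed

lemma weak_gradient_AE_eq:
  assumes "has_weak_gradient \<Omega> v V" "sq_integrable M V"
  shows "sq_integrable M (weak_gradient \<Omega> v)" "has_weak_gradient \<Omega> v (weak_gradient \<Omega> v)"
    "AE x in M. weak_gradient \<Omega> v x = V x"
proof -
  have "weak_gradient \<Omega> v \<in> L2 \<Omega> \<and> has_weak_gradient \<Omega> v (weak_gradient \<Omega> v)"
    unfolding weak_gradient_def
    by (rule someI[of "\<lambda>V. V \<in> L2 \<Omega> \<and> has_weak_gradient \<Omega> v V" V])
      (use assms in \<open>auto simp: L2_iff_sq_integrable\<close>)
  then show "sq_integrable M (weak_gradient \<Omega> v)" "has_weak_gradient \<Omega> v (weak_gradient \<Omega> v)"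
    by (auto simp: L2_iff_sq_integrable)
  then show "AE x in M. weak_gradient \<Omega> v x = V x"
    using assms by (intro has_weak_gradient_unique)
qed

text \<open>\<open>weak_gradient\<close> is a choice that is fixed only up to null sets, so it
  commutes with differences only almost everywhere. Pairs of a function and a gradient, taken in the
  L^2 closure of the pairs (\<phi>, grad \<phi>), can be subtracted and passed to the limit without
  such a choice.\<close>

definition H10_with_gradient :: "('a \<Rightarrow> real) \<Rightarrow> ('a \<Rightarrow> 'a) \<Rightarrow> bool" where
  "H10_with_gradient y V \<longleftrightarrow> sq_integrable M y \<and> sq_integrable M V \<and>
     (\<exists>\<phi>. (\<forall>k. \<phi> k \<in> test_functions \<Omega>) \<and>
       (\<lambda>k. LINT x|M. (norm (\<phi> k x - y x))\<^sup>2) \<longlonglongrightarrow> 0 \<and>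
       (\<lambda>k. LINT x|M. (norm (grad (\<phi> k) x - V x))\<^sup>2) \<longlonglongrightarrow> 0)"

lemma H10_with_gradientE:
  assumes "H10_with_gradient y V"
  obtains \<phi> where "sq_integrable M y" "sq_integrable M V" "\<And>k::nat. \<phi> k \<in> test_functions \<Omega>"
    "(\<lambda>k. LINT x|M. (norm (\<phi> k x - y x))\<^sup>2) \<longlonglongrightarrow> 0"
    "(\<lambda>k. LINT x|M. (norm (grad (\<phi> k) x - V x))\<^sup>2) \<longlonglongrightarrow> 0"
  using assms unfolding H10_with_gradient_def by blast

lemma tendsto_0_L2_diff:
  fixes f g :: "nat \<Rightarrow> 'a \<Rightarrow> 'b::euclidean_space"
  assumes f: "\<And>n. sq_integrable M (f n)" "sq_integrable M f'" "(\<lambda>k. LINT x|M. (norm (f k x - f' x))\<^sup>2) \<longlonglongrightarrow> 0"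
    and g: "\<And>n. sq_integrable M (g n)" "sq_integrable M g'" "(\<lambda>k. LINT x|M. (norm (g k x - g' x))\<^sup>2) \<longlonglongrightarrow> 0"
  shows "(\<lambda>k. LINT x|M. (norm ((f k x - g k x) - (f' x - g' x)))\<^sup>2) \<longlonglongrightarrow> 0"
proof (rule tendsto_sandwich[OF _ _ tendsto_const])
  show "(\<lambda>k. 2 * (LINT x|M. (norm (f k x - f' x))\<^sup>2) + 2 * (LINT x|M. (norm (g k x - g' x))\<^sup>2)) \<longlonglongrightarrow> 0"
    using tendsto_add[OF tendsto_mult_right[OF f(3)] tendsto_mult_right[OF g(3)], of 2 2]
    by (simp add: mult.commute)
  show "\<forall>\<^sub>F k in sequentially. (LINT x|M. (norm ((f k x - g k x) - (f' x - g' x)))\<^sup>2)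
      \<le> 2 * (LINT x|M. (norm (f k x - f' x))\<^sup>2) + 2 * (LINT x|M. (norm (g k x - g' x))\<^sup>2)"
  proof (intro always_eventually allI)
    fix k
    have i: "integrable M (\<lambda>x. (norm (f k x - f' x))\<^sup>2)" "integrable M (\<lambda>x. (norm (g k x - g' x))\<^sup>2)"
      "integrable M (\<lambda>x. (norm ((f k x - g k x) - (f' x - g' x)))\<^sup>2)"
      by (intro sq_integrable_norm_sq sq_integrable_diff f g)+
    have "(LINT x|M. (norm ((f k x - g k x) - (f' x - g' x)))\<^sup>2)
        \<le> (LINT x|M. 2 * (norm (f k x - f' x))\<^sup>2 + 2 * (norm (g k x - g' x))\<^sup>2)"
    proof (rule integral_mono)
      fix x
      have "(f k x - g k x) - (f' x - g' x) = (f k x - f' x) + - (g k x - g' x)" by simp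
      then show "(norm ((f k x - g k x) - (f' x - g' x)))\<^sup>2 \<le> 2 * (norm (f k x - f' x))\<^sup>2 + 2 * (norm (g k x - g' x))\<^sup>2"
        using norm_add_sq_le[of "f k x - f' x" "- (g k x - g' x)"] by (simp only: norm_minus_cancel)
    qed (use i in auto)
    then show "(LINT x|M. (norm ((f k x - g k x) - (f' x - g' x)))\<^sup>2)
      \<le> 2 * (LINT x|M. (norm (f k x - f' x))\<^sup>2) + 2 * (LINT x|M. (norm (g k x - g' x))\<^sup>2)"
      using i by simp
  qed
qed simp

lemma H10_with_gradient_diff:
  assumes "H10_with_gradient y V" "H10_with_gradient z W"
  shows "H10_with_gradient (\<lambda>x. y x - z x) (\<lambda>x. V x - W x)"
proof -
  obtain \<phi> where 1: "sq_integrable M y" "sq_integrable M V" and \<phi>: "\<And>k::nat. \<phi> k \<in> test_functions \<Omega>"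
    "(\<lambda>k. LINT x|M. (norm (\<phi> k x - y x))\<^sup>2) \<longlonglongrightarrow> 0"
    "(\<lambda>k. LINT x|M. (norm (grad (\<phi> k) x - V x))\<^sup>2) \<longlonglongrightarrow> 0"
    using H10_with_gradientE[OF assms(1)] by blast
  obtain \<psi> where 2: "sq_integrable M z" "sq_integrable M W" and \<psi>: "\<And>k::nat. \<psi> k \<in> test_functions \<Omega>"
    "(\<lambda>k. LINT x|M. (norm (\<psi> k x - z x))\<^sup>2) \<longlonglongrightarrow> 0"
    "(\<lambda>k. LINT x|M. (norm (grad (\<psi> k) x - W x))\<^sup>2) \<longlonglongrightarrow> 0"
    using H10_with_gradientE[OF assms(2)] by blast
  have "(\<lambda>k. LINT x|M. (norm ((\<phi> k x - \<psi> k x) - (y x - z x)))\<^sup>2) \<longlonglongrightarrow> 0"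
    by (intro tendsto_0_L2_diff \<phi> \<psi> 1 2 test_function_sq_integrable[OF \<phi>(1)] test_function_sq_integrable[OF \<psi>(1)])
  moreover have "(\<lambda>k. LINT x|M. (norm ((grad (\<phi> k) x - grad (\<psi> k) x) - (V x - W x)))\<^sup>2) \<longlonglongrightarrow> 0"
    by (intro tendsto_0_L2_diff \<phi> \<psi> 1 2 grad_sq_integrable[OF \<phi>(1)] grad_sq_integrable[OF \<psi>(1)])
  moreover have "grad (\<lambda>x. \<phi> k x - \<psi> k x) x = grad (\<phi> k) x - grad (\<psi> k) x" for k x
    by (rule grad_diff[OF test_functions_smooth[OF \<phi>(1)] test_functions_smooth[OF \<psi>(1)]])
  moreover have "(\<lambda>x. \<phi> k x - \<psi> k x) \<in> test_functions \<Omega>" for k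
    by (rule test_functions_diff[OF \<phi>(1) \<psi>(1)])
  ultimately show ?thesis
    unfolding H10_with_gradient_def
    using sq_integrable_diff[OF 1(1) 2(1)] sq_integrable_diff[OF 1(2) 2(2)]
    by (intro conjI exI[of _ "\<lambda>k x. \<phi> k x - \<psi> k x"]) simp_all
qed

text \<open>The defining identity holds for the approximating test functions, and both of its sides
  are continuous in L^2.\<close>

lemma H10_with_gradient_weak:
  assumes "H10_with_gradient y V"
  shows "has_weak_gradient \<Omega> y V"
  unfolding has_weak_gradient_def
proof (intro ballI)
  fix \<psi> b assume \<psi>: "\<psi> \<in> test_functions \<Omega>" and b: "(b::'a) \<in> Basis"
  obtain \<phi> where 1: "sq_integrable M y" "sq_integrable M V" and \<phi>: "\<And>k::nat. \<phi> k \<in> test_functions \<Omega>"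
    "(\<lambda>k. LINT x|M. (norm (\<phi> k x - y x))\<^sup>2) \<longlonglongrightarrow> 0"
    "(\<lambda>k. LINT x|M. (norm (grad (\<phi> k) x - V x))\<^sup>2) \<longlonglongrightarrow> 0"
    using H10_with_gradientE[OF assms(1)] by blast
  have t: "sq_integrable M \<psi>" "sq_integrable M (partial_deriv b \<psi>)"
    by (intro test_function_sq_integrable[of _ \<Omega>] test_functions_partial_deriv \<psi> b)+
  have "sq_integrable M (\<lambda>x. \<psi> x *\<^sub>R b)"
    using t(1) b by (auto simp: sq_integrable_def power_mult_distrib)
  from tendsto_integral_inner[OF grad_sq_integrable[OF \<phi>(1)] 1(2) this \<phi>(3)]
  have "(\<lambda>k. LINT x|M. (grad (\<phi> k) x \<bullet> b) * \<psi> x) \<longlonglongrightarrow> (LINT x|M. (V x \<bullet> b) * \<psi> x)"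
    by (simp add: mult.commute)
  moreover have "(LINT x|M. \<phi> k x * partial_deriv b \<psi> x) = - (LINT x|M. (grad (\<phi> k) x \<bullet> b) * \<psi> x)" for k
    using has_weak_gradient_test_function[OF \<phi>(1)] \<psi> b by (auto simp: has_weak_gradient_def)
  ultimately have "(\<lambda>k. LINT x|M. \<phi> k x * partial_deriv b \<psi> x) \<longlonglongrightarrow> - (LINT x|M. (V x \<bullet> b) * \<psi> x)"
    by (simp add: tendsto_minus)
  moreover have "(\<lambda>k. LINT x|M. \<phi> k x * partial_deriv b \<psi> x) \<longlonglongrightarrow> (LINT x|M. y x * partial_deriv b \<psi> x)"
    using tendsto_integral_inner[OF test_function_sq_integrable[OF \<phi>(1)] 1(1) t(2) \<phi>(2)] by simp
  ultimately show "(LINT x|M. y x * partial_deriv b \<psi> x) = - (LINT x|M. (V x \<bullet> b) * \<psi> x)"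
    using LIMSEQ_unique by blast
qed

lemma H1_norm_sq: "(H1_norm \<Omega> v)\<^sup>2
    = (LINT x|M. (norm (v x))\<^sup>2) + (LINT x|M. (norm (weak_gradient \<Omega> v x))\<^sup>2)"
  by (simp add: H1_norm_def L2_norm_sq)

lemma H1_norm_diff_test_function:
  assumes y: "sq_integrable M y" "sq_integrable M V" "has_weak_gradient \<Omega> y V" and \<phi>: "\<phi> \<in> test_functions \<Omega>"
  shows "(H1_norm \<Omega> (\<lambda>x. y x - \<phi> x))\<^sup>2
    = (LINT x|M. (norm (\<phi> x - y x))\<^sup>2) + (LINT x|M. (norm (grad \<phi> x - V x))\<^sup>2)"
proof -
  have g: "sq_integrable M (\<lambda>x. V x - grad \<phi> x)"
    by (rule sq_integrable_diff[OF y(2) grad_sq_integrable[OF \<phi>]])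
  have "has_weak_gradient \<Omega> (\<lambda>x. y x - \<phi> x) (\<lambda>x. V x - grad \<phi> x)"
    by (rule has_weak_gradient_diff[OF y(3) has_weak_gradient_test_function[OF \<phi>] y(1,2)
          test_function_sq_integrable[OF \<phi>] grad_sq_integrable[OF \<phi>]])
  note w = weak_gradient_AE_eq[OF this g]
  have "(LINT x|M. (norm (weak_gradient \<Omega> (\<lambda>x. y x - \<phi> x) x))\<^sup>2) = (LINT x|M. (norm (V x - grad \<phi> x))\<^sup>2)"
  proof (rule integral_cong_AE)
    show "AE x in M. (norm (weak_gradient \<Omega> (\<lambda>x. y x - \<phi> x) x))\<^sup>2 = (norm (V x - grad \<phi> x))\<^sup>2"
      using w(3) by eventually_elim simp
  qed (use sq_integrable_norm_sq[OF w(1)] sq_integrable_norm_sq[OF g] in auto)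
  then show ?thesis
    unfolding H1_norm_sq norm_minus_commute[of "\<phi> _"] norm_minus_commute[of "grad \<phi> _"]
    by (rule arg_cong2[of _ _ _ _ "(+)", OF refl])
qed

lemma H10_with_gradient_imp_H10:
  assumes "H10_with_gradient y V"
  shows "y \<in> H10 \<Omega>" "AE x in M. weak_gradient \<Omega> y x = V x"
proof -
  obtain \<phi> where 1: "sq_integrable M y" "sq_integrable M V" and \<phi>: "\<And>k::nat. \<phi> k \<in> test_functions \<Omega>"
    "(\<lambda>k. LINT x|M. (norm (\<phi> k x - y x))\<^sup>2) \<longlonglongrightarrow> 0"
    "(\<lambda>k. LINT x|M. (norm (grad (\<phi> k) x - V x))\<^sup>2) \<longlonglongrightarrow> 0"
    using H10_with_gradientE[OF assms(1)] by blast
  note wk = H10_with_gradient_weak[OF assms]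
  show "AE x in M. weak_gradient \<Omega> y x = V x" by (rule weak_gradient_AE_eq(3)[OF wk 1(2)])
  have "y \<in> H1 \<Omega>" unfolding H1_def using 1 wk by (auto simp: L2_iff_sq_integrable)
  moreover have "\<exists>\<phi>\<in>test_functions \<Omega>. H1_norm \<Omega> (\<lambda>x. y x - \<phi> x) < \<delta>" if "\<delta> > 0" for \<delta>
  proof -
    have "(\<lambda>k. (H1_norm \<Omega> (\<lambda>x. y x - \<phi> k x))\<^sup>2) \<longlonglongrightarrow> 0 + 0"
      unfolding H1_norm_diff_test_function[OF 1 wk \<phi>(1)] by (intro tendsto_add \<phi>)
    from order_tendstoD(2)[OF this, of "\<delta>\<^sup>2"] that
    have "\<forall>\<^sub>F k in sequentially. (H1_norm \<Omega> (\<lambda>x. y x - \<phi> k x))\<^sup>2 < \<delta>\<^sup>2" by simp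
    then obtain k where "(H1_norm \<Omega> (\<lambda>x. y x - \<phi> k x))\<^sup>2 < \<delta>\<^sup>2"
      using eventually_happens'[OF sequentially_bot] by blast
    then have "H1_norm \<Omega> (\<lambda>x. y x - \<phi> k x) < \<delta>"
      by (rule power2_less_imp_less) (use that in simp)
    then show ?thesis using \<phi>(1) by blast
  qed
  ultimately show "y \<in> H10 \<Omega>" unfolding H10_def by blast
qed

lemma H10_imp_H10_with_gradient:
  assumes "y \<in> H10 \<Omega>"
  shows "H10_with_gradient y (weak_gradient \<Omega> y)"
proof -
  obtain V where V: "sq_integrable M y" "sq_integrable M V" "has_weak_gradient \<Omega> y V"
    using assms by (auto simp: H10_def H1_def L2_iff_sq_integrable)
  let ?W = "weak_gradient \<Omega> y"
  note W = weak_gradient_AE_eq[OF V(3,2)]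
  have "\<forall>k. \<exists>\<phi>. \<phi> \<in> test_functions \<Omega> \<and> H1_norm \<Omega> (\<lambda>x. y x - \<phi> x) < inverse (real (Suc k))"
  proof
    fix k
    have "0 < inverse (real (Suc k))" by simp
    then show "\<exists>\<phi>. \<phi> \<in> test_functions \<Omega> \<and> H1_norm \<Omega> (\<lambda>x. y x - \<phi> x) < inverse (real (Suc k))"
      using assms unfolding H10_def by blast
  qed
  then obtain \<phi> where \<phi>: "\<And>k. \<phi> k \<in> test_functions \<Omega>"
    "\<And>k. H1_norm \<Omega> (\<lambda>x. y x - \<phi> k x) < inverse (real (Suc k))" by metis
  have "0 \<le> H1_norm \<Omega> v" for v :: "'a \<Rightarrow> real" by (simp add: H1_norm_def)
  then have "norm (H1_norm \<Omega> (\<lambda>x. y x - \<phi> k x)) \<le> inverse (real (Suc k))" for k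
    using \<phi>(2)[of k] by (simp only: real_norm_def abs_of_nonneg less_imp_le)
  then have "(\<lambda>k. H1_norm \<Omega> (\<lambda>x. y x - \<phi> k x)) \<longlonglongrightarrow> 0"
    by (intro Lim_null_comparison[OF always_eventually LIMSEQ_inverse_real_of_nat] allI)
  from tendsto_power[OF this, of 2]
  have lim: "(\<lambda>k. (LINT x|M. (norm (\<phi> k x - y x))\<^sup>2) + (LINT x|M. (norm (grad (\<phi> k) x - ?W x))\<^sup>2)) \<longlonglongrightarrow> 0"
    unfolding H1_norm_diff_test_function[OF V(1) W(1,2) \<phi>(1)] by simp
  have "(\<lambda>k. LINT x|M. (norm (\<phi> k x - y x))\<^sup>2) \<longlonglongrightarrow> 0"
    by (rule tendsto_sandwich[OF _ _ tendsto_const lim]) auto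
  moreover have "(\<lambda>k. LINT x|M. (norm (grad (\<phi> k) x - ?W x))\<^sup>2) \<longlonglongrightarrow> 0"
    by (rule tendsto_sandwich[OF _ _ tendsto_const lim]) auto
  ultimately show ?thesis
    unfolding H10_with_gradient_def using V(1) W(1) \<phi>(1) by (intro conjI exI[of _ \<phi>] allI)
qed

section \<open>Poincare's inequality\<close>

lemma poincare_grad:
  obtains K where "K > 0"
    "\<And>\<phi>. \<phi> \<in> test_functions \<Omega> \<Longrightarrow> (LINT x|M. (norm (\<phi> x))\<^sup>2) \<le> K * (LINT x|M. (norm (grad \<phi> x))\<^sup>2)"
proof -
  obtain R where R: "R > 0" "\<And>x. x \<in> \<Omega> \<Longrightarrow> norm x \<le> R" using bounded_\<Omega> bounded_pos by blast
  have "(LINT x|M. (norm (\<phi> x))\<^sup>2) \<le> 4 * R\<^sup>2 * (LINT x|M. (norm (grad \<phi> x))\<^sup>2)" if \<phi>: "\<phi> \<in> test_functions \<Omega>" for \<phi>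
  proof -
    \<comment> \<open>A single coordinate direction suffices, since its partial derivative is
      dominated by the gradient.\<close>
    obtain b :: 'a where b: "b \<in> Basis" by (meson nonempty_Basis ex_in_conv)
    have d: "partial_deriv b \<phi> \<in> test_functions \<Omega>" by (rule test_functions_partial_deriv[OF \<phi> b])
    have "(LINT x|M. (norm (\<phi> x))\<^sup>2) = (LINT x|lborel. (\<phi> x)\<^sup>2)"
      using integral_lebesgue_on_eq_lborel(1)[OF open_\<Omega>, of "\<lambda>x. (\<phi> x)\<^sup>2"] test_functions_borel[OF \<phi>]
      by (simp add: test_functions_outside[OF \<phi>])
    also have "\<dots> \<le> 4 * R\<^sup>2 * (LINT x|lborel. (partial_deriv b \<phi> x)\<^sup>2)"
      by (rule poincare_test_function[OF \<phi> b R(2)])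
    also have "(LINT x|lborel. (partial_deriv b \<phi> x)\<^sup>2) = (LINT x|M. (partial_deriv b \<phi> x)\<^sup>2)"
      using integral_lebesgue_on_eq_lborel(1)[OF open_\<Omega>, of "\<lambda>x. (partial_deriv b \<phi> x)\<^sup>2"] test_functions_borel[OF d]
      by (simp add: test_functions_outside[OF d])
    also have "(LINT x|M. (partial_deriv b \<phi> x)\<^sup>2) \<le> (LINT x|M. (norm (grad \<phi> x))\<^sup>2)"
    proof (rule integral_mono)
      show "integrable M (\<lambda>x. (partial_deriv b \<phi> x)\<^sup>2)"
        using sq_integrable_norm_sq[OF test_function_sq_integrable[OF d]] by simp
      show "integrable M (\<lambda>x. (norm (grad \<phi> x))\<^sup>2)" by (rule sq_integrable_norm_sq[OF grad_sq_integrable[OF \<phi>]])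
      show "(partial_deriv b \<phi> x)\<^sup>2 \<le> (norm (grad \<phi> x))\<^sup>2" for x
        using power_mono[OF Basis_le_norm[OF b, of "grad \<phi> x"] abs_ge_zero, of 2]
        by (simp add: grad_inner[OF b])
    qed
    finally show ?thesis by (simp add: mult_left_mono)
  qed
  then show ?thesis using R(1) by (intro that[of "4 * R\<^sup>2"]) auto
qed

lemma poincare_H10:
  obtains K where "K > 0"
    "\<And>y V. H10_with_gradient y V \<Longrightarrow> (LINT x|M. (norm (y x))\<^sup>2) \<le> K * (LINT x|M. (norm (V x))\<^sup>2)"
proof -
  obtain K where K: "K > 0"
    "\<And>\<phi>. \<phi> \<in> test_functions \<Omega> \<Longrightarrow> (LINT x|M. (norm (\<phi> x))\<^sup>2) \<le> K * (LINT x|M. (norm (grad \<phi> x))\<^sup>2)"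
    using poincare_grad by blast
  have "(LINT x|M. (norm (y x))\<^sup>2) \<le> K * (LINT x|M. (norm (V x))\<^sup>2)" if yV: "H10_with_gradient y V" for y V
  proof -
    obtain \<phi> where 1: "sq_integrable M y" "sq_integrable M V" and \<phi>: "\<And>k::nat. \<phi> k \<in> test_functions \<Omega>"
      "(\<lambda>k. LINT x|M. (norm (\<phi> k x - y x))\<^sup>2) \<longlonglongrightarrow> 0"
      "(\<lambda>k. LINT x|M. (norm (grad (\<phi> k) x - V x))\<^sup>2) \<longlonglongrightarrow> 0"
      using H10_with_gradientE[OF yV] by blast
    show ?thesis
    proof (rule LIMSEQ_le)
      show "(\<lambda>k. LINT x|M. (norm (\<phi> k x))\<^sup>2) \<longlonglongrightarrow> (LINT x|M. (norm (y x))\<^sup>2)"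
        by (rule tendsto_integral_norm_sq[OF test_function_sq_integrable[OF \<phi>(1)] 1(1) \<phi>(2)])
      show "(\<lambda>k. K * (LINT x|M. (norm (grad (\<phi> k) x))\<^sup>2)) \<longlonglongrightarrow> K * (LINT x|M. (norm (V x))\<^sup>2)"
        by (intro tendsto_mult_left tendsto_integral_norm_sq[OF grad_sq_integrable[OF \<phi>(1)] 1(2) \<phi>(3)])
    qed (use K(2)[OF \<phi>(1)] in auto)
  qed
  with K(1) show ?thesis by (rule that)
qed

end

section \<open>The state equation\<close>

lemma norm_diff_scaleR_sq:
  "(norm (a - c *\<^sub>R d))\<^sup>2 = (norm a)\<^sup>2 - 2 * c * (a \<bullet> d) + c\<^sup>2 * (norm (d::'a::real_inner))\<^sup>2"
  unfolding power2_norm_eq_inner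
  by (simp add: inner_diff inner_commute[of d a] power2_eq_square algebra_simps)

context bounded_open_set
begin

lemma weighted_integrable:
  assumes w: "w \<in> borel_measurable M" "\<And>x. \<bar>w x\<bar> \<le> C"
    and V: "sq_integrable M V" and W: "sq_integrable M W"
  shows "integrable M (\<lambda>x. w x * (V x \<bullet> W x))"
  using sq_integrable_inner[OF sq_integrable_bounded_scaleR[OF V w] W] by simp

text \<open>Allows any representative of the gradient of the test function in place of the chosen
  \<open>weak_gradient\<close>, in particular the difference of two weak gradients.\<close>

lemma weak_solution_test:
  assumes w: "w \<in> borel_measurable M" "\<And>x. \<bar>w x\<bar> \<le> C"
    and sol: "weak_solution \<Omega> f w y" and \<eta>: "H10_with_gradient \<eta> W"
  shows "(LINT x|M. w x * (weak_gradient \<Omega> y x \<bullet> W x)) = (LINT x|M. f x * \<eta> x)"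
proof -
  have y: "sq_integrable M (weak_gradient \<Omega> y)"
    using sol H10_imp_H10_with_gradient unfolding weak_solution_def H10_with_gradient_def by blast
  have \<eta>': "\<eta> \<in> H10 \<Omega>" "AE x in M. weak_gradient \<Omega> \<eta> x = W x" by (rule H10_with_gradient_imp_H10[OF \<eta>])+
  have W: "sq_integrable M W" using \<eta> by (simp add: H10_with_gradient_def)
  have g: "sq_integrable M (weak_gradient \<Omega> \<eta>)"
    using H10_imp_H10_with_gradient[OF \<eta>'(1)] by (simp add: H10_with_gradient_def)
  have "(LINT x|M. w x * (weak_gradient \<Omega> y x \<bullet> W x))
      = (LINT x|M. w x * (weak_gradient \<Omega> y x \<bullet> weak_gradient \<Omega> \<eta> x))"
  proof (rule integral_cong_AE)
    show "AE x in M. w x * (weak_gradient \<Omega> y x \<bullet> W x) = w x * (weak_gradient \<Omega> y x \<bullet> weak_gradient \<Omega> \<eta> x)"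
      using \<eta>'(2) by eventually_elim simp
  qed (use weighted_integrable[OF w y W] weighted_integrable[OF w y g] in auto)
  also have "\<dots> = (LINT x|M. f x * \<eta> x)" using sol \<eta>'(1) by (simp add: weak_solution_def)
  finally show ?thesis .
qed

text \<open>Dirichlet energy whose Euler-Lagrange equation is the state equation; on test functions
  the classical gradient can be used.\<close>

definition energy :: "('a \<Rightarrow> real) \<Rightarrow> ('a \<Rightarrow> real) \<Rightarrow> ('a \<Rightarrow> real) \<Rightarrow> real" where
  "energy f w \<phi> = (LINT x|M. w x * (grad \<phi> x \<bullet> grad \<phi> x)) / 2 - (LINT x|M. f x * \<phi> x)"

lemma energy_expansion:
  assumes w: "w \<in> borel_measurable M" "\<And>x. \<bar>w x\<bar> \<le> C" and f: "sq_integrable M f"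
    and \<phi>: "\<phi> \<in> test_functions \<Omega>" and \<psi>: "\<psi> \<in> test_functions \<Omega>"
  shows "energy f w (\<lambda>x. \<phi> x + t * \<psi> x) = energy f w \<phi>
    + t * ((LINT x|M. w x * (grad \<phi> x \<bullet> grad \<psi> x)) - (LINT x|M. f x * \<psi> x))
    + t\<^sup>2 / 2 * (LINT x|M. w x * (grad \<psi> x \<bullet> grad \<psi> x))"
proof -
  note g = grad_sq_integrable[OF \<phi>] grad_sq_integrable[OF \<psi>]
  note i = weighted_integrable[OF w g(1) g(1)] weighted_integrable[OF w g(1) g(2)] weighted_integrable[OF w g(2) g(2)]
    sq_integrable_mult_integrable[OF f test_function_sq_integrable[OF \<phi>]]
    sq_integrable_mult_integrable[OF f test_function_sq_integrable[OF \<psi>]]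
  have gr: "grad (\<lambda>x. \<phi> x + t * \<psi> x) x = grad \<phi> x + t *\<^sub>R grad \<psi> x" for x
    using grad_add[OF test_functions_smooth[OF \<phi>] smooth_cmult[OF test_functions_smooth[OF \<psi>]]]
      grad_cmult[OF test_functions_smooth[OF \<psi>]] by simp
  have "w x * (grad (\<lambda>x. \<phi> x + t * \<psi> x) x \<bullet> grad (\<lambda>x. \<phi> x + t * \<psi> x) x)
      = w x * (grad \<phi> x \<bullet> grad \<phi> x) + (2 * t) * (w x * (grad \<phi> x \<bullet> grad \<psi> x))
        + t\<^sup>2 * (w x * (grad \<psi> x \<bullet> grad \<psi> x))" for x
    by (simp add: gr inner_add inner_commute power2_eq_square algebra_simps)
  then have "(LINT x|M. w x * (grad (\<lambda>x. \<phi> x + t * \<psi> x) x \<bullet> grad (\<lambda>x. \<phi> x + t * \<psi> x) x))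
      = (LINT x|M. w x * (grad \<phi> x \<bullet> grad \<phi> x)) + (2 * t) * (LINT x|M. w x * (grad \<phi> x \<bullet> grad \<psi> x))
        + t\<^sup>2 * (LINT x|M. w x * (grad \<psi> x \<bullet> grad \<psi> x))"
    using i by simp
  moreover have "(LINT x|M. f x * (\<phi> x + t * \<psi> x)) = (LINT x|M. f x * \<phi> x) + t * (LINT x|M. f x * \<psi> x)"
  proof -
    have "f x * (\<phi> x + t * \<psi> x) = f x * \<phi> x + t * (f x * \<psi> x)" for x by (simp add: algebra_simps)
    then show ?thesis using i by simp
  qed
  ultimately show ?thesis by (simp add: energy_def algebra_simps add_divide_distrib)
qed

lemma coercive_form:
  assumes w: "w \<in> borel_measurable M" "\<And>x. \<bar>w x\<bar> \<le> C" "\<And>x. c \<le> w x" and V: "sq_integrable M V"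
  shows "c * (LINT x|M. (norm (V x))\<^sup>2) \<le> (LINT x|M. w x * (V x \<bullet> V x))"
proof -
  have "(LINT x|M. c * (norm (V x))\<^sup>2) \<le> (LINT x|M. w x * (V x \<bullet> V x))"
  proof (rule integral_mono)
    show "integrable M (\<lambda>x. c * (norm (V x))\<^sup>2)" using sq_integrable_norm_sq[OF V] by simp
    show "integrable M (\<lambda>x. w x * (V x \<bullet> V x))" by (rule weighted_integrable[OF w(1,2) V V])
    show "c * (norm (V x))\<^sup>2 \<le> w x * (V x \<bullet> V x)" for x
      using w(3)[of x] by (simp add: power2_norm_eq_inner mult_right_mono)
  qed
  then show ?thesis by simp
qed

lemma energy_bounded_below:
  assumes w: "w \<in> borel_measurable M" "\<And>x. \<bar>w x\<bar> \<le> C" "\<And>x. c \<le> w x" and c: "c > 0" and f: "sq_integrable M f"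
  shows "\<exists>L. \<forall>\<phi>\<in>test_functions \<Omega>. L \<le> energy f w \<phi>"
proof -
  obtain K where K: "K > 0"
    "\<And>\<phi>. \<phi> \<in> test_functions \<Omega> \<Longrightarrow> (LINT x|M. (norm (\<phi> x))\<^sup>2) \<le> K * (LINT x|M. (norm (grad \<phi> x))\<^sup>2)"
    using poincare_grad by blast
  \<comment> \<open>The weight in Young's inequality for which the Poincare term equals c / 2 times
    the squared gradient norm, which coercivity absorbs.\<close>
  define s where "s = c / K"
  have s: "s > 0" using c K by (simp add: s_def)
  have "- ((LINT x|M. (norm (f x))\<^sup>2) / (2 * s)) \<le> energy f w \<phi>" if \<phi>: "\<phi> \<in> test_functions \<Omega>" for \<phi>
  proof -
    note i = sq_integrable_norm_sq[OF f] sq_integrable_norm_sq[OF test_function_sq_integrable[OF \<phi>]]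
    have "(LINT x|M. f x * \<phi> x) \<le> (LINT x|M. (norm (f x))\<^sup>2 / (2 * s) + s / 2 * (norm (\<phi> x))\<^sup>2)"
    proof (rule integral_mono)
      show "integrable M (\<lambda>x. f x * \<phi> x)"
        by (rule sq_integrable_mult_integrable[OF f test_function_sq_integrable[OF \<phi>]])
      show "integrable M (\<lambda>x. (norm (f x))\<^sup>2 / (2 * s) + s / 2 * (norm (\<phi> x))\<^sup>2)" using i by simp
      fix x
      have "0 \<le> (f x - s * \<phi> x)\<^sup>2 / (2 * s)" using s by simp
      also have "\<dots> = (norm (f x))\<^sup>2 / (2 * s) + s / 2 * (norm (\<phi> x))\<^sup>2 - f x * \<phi> x"
        using s by (simp add: power2_eq_square field_simps)
      finally show "f x * \<phi> x \<le> (norm (f x))\<^sup>2 / (2 * s) + s / 2 * (norm (\<phi> x))\<^sup>2" by simp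
    qed
    also have "\<dots> = (LINT x|M. (norm (f x))\<^sup>2) / (2 * s) + s / 2 * (LINT x|M. (norm (\<phi> x))\<^sup>2)"
      using i by simp
    also have "s / 2 * (LINT x|M. (norm (\<phi> x))\<^sup>2) \<le> s / 2 * (K * (LINT x|M. (norm (grad \<phi> x))\<^sup>2))"
      using K(2)[OF \<phi>] s by (intro mult_left_mono) auto
    also have "\<dots> = (c * (LINT x|M. (norm (grad \<phi> x))\<^sup>2)) / 2" using K(1) by (simp add: s_def)
    also have "\<dots> \<le> (LINT x|M. w x * (grad \<phi> x \<bullet> grad \<phi> x)) / 2"
      using coercive_form[OF w grad_sq_integrable[OF \<phi>]] by simp
    finally show ?thesis by (simp add: energy_def)
  qed
  then show ?thesis by blast
qed

text \<open>A minimizing sequence of the energy among test functions is Cauchy by the parallelogram law.\<close>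

lemma weak_solution_exists:
  assumes w: "w \<in> borel_measurable M" "\<And>x. \<bar>w x\<bar> \<le> C" "\<And>x. c \<le> w x" and c: "c > 0" and f: "sq_integrable M f"
  shows "\<exists>y. weak_solution \<Omega> f w y"
proof -
  let ?E = "energy f w" and ?T = "test_functions \<Omega>"
  let ?B = "\<lambda>\<phi> \<psi>. LINT x|M. w x * (grad \<phi> x \<bullet> grad \<psi> x)"
  let ?l = "\<lambda>\<phi>. LINT x|M. f x * \<phi> x"
  define I where "I = Inf (?E ` ?T)"
  obtain L where L: "\<And>\<phi>. \<phi> \<in> ?T \<Longrightarrow> L \<le> ?E \<phi>" using energy_bounded_below[OF w c f] by blast
  have bdd: "bdd_below (?E ` ?T)" using L by (intro bdd_belowI[of _ L]) auto
  have ne: "?E ` ?T \<noteq> {}" using test_functions_zero by blast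
  have I_le: "I \<le> ?E \<phi>" if "\<phi> \<in> ?T" for \<phi>
    unfolding I_def using that bdd by (intro cInf_lower) auto
  have "\<exists>\<phi>. \<phi> \<in> ?T \<and> ?E \<phi> < I + inverse (real (Suc n))" for n
    using cInf_lessD[OF ne, of "I + inverse (real (Suc n))"] by (auto simp: I_def)
  then obtain \<phi> where \<phi>: "\<And>n. \<phi> n \<in> ?T" and E\<phi>: "\<And>n. ?E (\<phi> n) < I + inverse (real (Suc n))"
    by metis
  have gr: "grad (\<lambda>x. \<phi> m x - \<phi> n x) x = grad (\<phi> m) x - grad (\<phi> n) x" for m n x
    by (rule grad_diff[OF test_functions_smooth[OF \<phi>] test_functions_smooth[OF \<phi>]])
  have diff: "c * (LINT x|M. (norm (grad (\<phi> m) x - grad (\<phi> n) x))\<^sup>2)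
      \<le> 4 * (inverse (real (Suc n)) + inverse (real (Suc m)))" for m n
  proof -
    let ?\<psi> = "\<lambda>x. \<phi> m x - \<phi> n x"
    have \<psi>: "?\<psi> \<in> ?T" by (rule test_functions_diff[OF \<phi> \<phi>])
    note ex = energy_expansion[OF w(1,2) f \<phi>[of n] \<psi>]
    \<comment> \<open>On the segment the energy is quadratic in t. The mean of its values at t = 0
      and t = 1 exceeds the value at t = 1/2 by one eighth of the quadratic form, whence the factor
      8.\<close>
    have "I \<le> ?E (\<lambda>x. \<phi> n x + (1 / 2) * ?\<psi> x)"
      by (intro I_le test_functions_add test_functions_cmult \<phi> \<psi>)
    moreover have "?E (\<phi> m) = ?E (\<lambda>x. \<phi> n x + 1 * ?\<psi> x)" by simp
    ultimately have "?B ?\<psi> ?\<psi> \<le> 8 * ((?E (\<phi> n) + ?E (\<phi> m)) / 2 - I)"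
      unfolding ex by (simp add: power2_eq_square field_simps)
    also have "\<dots> \<le> 4 * (inverse (real (Suc n)) + inverse (real (Suc m)))"
    proof -
      have "8 * ((a + b) / 2 - I) \<le> 4 * (p + q)" if "a < I + p" "b < I + q" for a b p q :: real
        using that by (simp add: field_simps)
      from this[OF E\<phi>[of n] E\<phi>[of m]] show ?thesis .
    qed
    finally show ?thesis
      using coercive_form[OF w grad_sq_integrable[OF \<psi>]] unfolding gr by linarith
  qed
  have cauV: "\<exists>N. \<forall>i\<ge>N. \<forall>j\<ge>N. (LINT x|M. (norm (grad (\<phi> i) x - grad (\<phi> j) x))\<^sup>2) < e" if "e > 0" for e
  proof -
    have "0 < c * e / 8" using that c by simp
    then obtain N where N: "inverse (real (Suc N)) < c * e / 8" using reals_Archimedean by blast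
    have "(LINT x|M. (norm (grad (\<phi> i) x - grad (\<phi> j) x))\<^sup>2) < e" if "i \<ge> N" "j \<ge> N" for i j
    proof -
      have inv: "inverse (real (Suc i)) \<le> inverse (real (Suc N))" "inverse (real (Suc j)) \<le> inverse (real (Suc N))"
        using that by (auto intro!: le_imp_inverse_le)
      have "c * (LINT x|M. (norm (grad (\<phi> i) x - grad (\<phi> j) x))\<^sup>2) < c * e"
      proof -
        have "x < y" if "p \<le> s" "q \<le> s" "x \<le> 4 * (q + p)" "s < y / 8" for p q s x y :: real
          using that by (simp add: field_simps)
        from this[OF inv diff[of i j] N] show ?thesis .
      qed
      then show ?thesis using c by simp
    qed
    then show ?thesis by blast
  qed
  obtain V where V: "sq_integrable M V" "(\<lambda>n. LINT x|M. (norm (grad (\<phi> n) x - V x))\<^sup>2) \<longlonglongrightarrow> 0"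
    using sq_integrable_complete[OF finite_measure_M grad_sq_integrable[OF \<phi>] cauV] by blast
  obtain K where K: "K > 0"
    "\<And>\<phi>. \<phi> \<in> ?T \<Longrightarrow> (LINT x|M. (norm (\<phi> x))\<^sup>2) \<le> K * (LINT x|M. (norm (grad \<phi> x))\<^sup>2)"
    using poincare_grad by blast
  have cauY: "\<exists>N. \<forall>i\<ge>N. \<forall>j\<ge>N. (LINT x|M. (norm (\<phi> i x - \<phi> j x))\<^sup>2) < e" if "e > 0" for e
  proof -
    have "0 < e / K" using that K by simp
    then obtain N where N: "\<And>i j. i \<ge> N \<Longrightarrow> j \<ge> N \<Longrightarrow> (LINT x|M. (norm (grad (\<phi> i) x - grad (\<phi> j) x))\<^sup>2) < e / K"
      using cauV by meson
    have "(LINT x|M. (norm (\<phi> i x - \<phi> j x))\<^sup>2) < e" if "i \<ge> N" "j \<ge> N" for i j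
    proof -
      have "(LINT x|M. (norm (\<phi> i x - \<phi> j x))\<^sup>2) \<le> K * (LINT x|M. (norm (grad (\<phi> i) x - grad (\<phi> j) x))\<^sup>2)"
        using K(2)[OF test_functions_diff[OF \<phi> \<phi>], of i j] unfolding gr .
      also have "\<dots> < e" using N[OF that] K(1) by (simp add: field_simps)
      finally show ?thesis .
    qed
    then show ?thesis by blast
  qed
  obtain y where y: "sq_integrable M y" "(\<lambda>n. LINT x|M. (norm (\<phi> n x - y x))\<^sup>2) \<longlonglongrightarrow> 0"
    using sq_integrable_complete[OF finite_measure_M test_function_sq_integrable[OF \<phi>] cauY] by blast
  have yV: "H10_with_gradient y V"
    unfolding H10_with_gradient_def using y V \<phi> by blast
  have limB: "(\<lambda>n. LINT x|M. w x * (grad (\<phi> n) x \<bullet> W x)) \<longlonglongrightarrow> (LINT x|M. w x * (V x \<bullet> W x))" if W: "sq_integrable M W" for W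
    using tendsto_integral_inner[OF grad_sq_integrable[OF \<phi>] V(1) sq_integrable_bounded_scaleR[OF W w(1,2)] V(2)]
    by simp
  have limE: "(\<lambda>n. ?E (\<phi> n)) \<longlonglongrightarrow> I"
  proof (rule tendsto_sandwich[OF _ _ tendsto_const])
    show "(\<lambda>n. I + inverse (real (Suc n))) \<longlonglongrightarrow> I"
      using tendsto_add[OF tendsto_const LIMSEQ_inverse_real_of_nat] by simp
    show "\<forall>\<^sub>F n in sequentially. ?E (\<phi> n) \<le> I + inverse (real (Suc n))"
      by (intro always_eventually allI less_imp_le E\<phi>)
    show "\<forall>\<^sub>F n in sequentially. I \<le> ?E (\<phi> n)"
      by (intro always_eventually allI I_le \<phi>)
  qed
  \<comment> \<open>The limit y need not be a test function, so the first variation is expanded at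
    \<open>\<phi> n\<close>, and n tends to infinity for fixed t. A quadratic in t that is
    nonnegative and vanishes at 0 has no linear term.\<close>
  have EL: "(LINT x|M. w x * (V x \<bullet> grad \<eta> x)) = ?l \<eta>" if \<eta>: "\<eta> \<in> ?T" for \<eta>
  proof -
    let ?x = "(LINT x|M. w x * (V x \<bullet> grad \<eta> x)) - ?l \<eta>"
    have "0 \<le> 0 + 2 * t * (?x / 2) + t\<^sup>2 * (?B \<eta> \<eta> / 2)" for t
    proof -
      have "I \<le> I + t * ?x + t\<^sup>2 / 2 * ?B \<eta> \<eta>"
      proof (rule LIMSEQ_le_const)
        show "(\<lambda>n. ?E (\<phi> n) + t * (?B (\<phi> n) \<eta> - ?l \<eta>) + t\<^sup>2 / 2 * ?B \<eta> \<eta>) \<longlonglongrightarrow> I + t * ?x + t\<^sup>2 / 2 * ?B \<eta> \<eta>"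
          by (intro tendsto_add tendsto_mult tendsto_diff tendsto_const limE limB grad_sq_integrable[OF \<eta>])
        have "I \<le> ?E (\<lambda>x. \<phi> n x + t * \<eta> x)" for n
          by (intro I_le test_functions_add test_functions_cmult \<phi> \<eta>)
        then show "\<exists>N. \<forall>n\<ge>N. I \<le> ?E (\<phi> n) + t * (?B (\<phi> n) \<eta> - ?l \<eta>) + t\<^sup>2 / 2 * ?B \<eta> \<eta>"
          unfolding energy_expansion[OF w(1,2) f \<phi> \<eta>] by blast
      qed
      then show ?thesis by simp
    qed
    from quadratic_nonneg_imp[OF this] have "?x = 0" by simp
    then show ?thesis by simp
  qed
  have sol: "(LINT x|M. w x * (V x \<bullet> W x)) = (LINT x|M. f x * \<eta> x)" if \<eta>W: "H10_with_gradient \<eta> W" for \<eta> W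
  proof -
    obtain \<psi> where 1: "sq_integrable M \<eta>" "sq_integrable M W" and \<psi>: "\<And>k::nat. \<psi> k \<in> test_functions \<Omega>"
      "(\<lambda>k. LINT x|M. (norm (\<psi> k x - \<eta> x))\<^sup>2) \<longlonglongrightarrow> 0"
      "(\<lambda>k. LINT x|M. (norm (grad (\<psi> k) x - W x))\<^sup>2) \<longlonglongrightarrow> 0"
      using H10_with_gradientE[OF \<eta>W] by blast
    have "(\<lambda>k. LINT x|M. w x * (V x \<bullet> grad (\<psi> k) x)) \<longlonglongrightarrow> (LINT x|M. w x * (V x \<bullet> W x))"
      using tendsto_integral_inner[OF grad_sq_integrable[OF \<psi>(1)] 1(2) sq_integrable_bounded_scaleR[OF V(1) w(1,2)] \<psi>(3)]
      by (simp add: inner_commute)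
    moreover have "(\<lambda>k. LINT x|M. w x * (V x \<bullet> grad (\<psi> k) x)) \<longlonglongrightarrow> (LINT x|M. f x * \<eta> x)"
      unfolding EL[OF \<psi>(1)]
      using tendsto_integral_inner[OF test_function_sq_integrable[OF \<psi>(1)] 1(1) f \<psi>(2)]
      by (simp add: mult.commute)
    ultimately show ?thesis using LIMSEQ_unique by blast
  qed
  note yH = H10_with_gradient_imp_H10[OF yV]
  note yg = H10_imp_H10_with_gradient[OF yH(1)]
  have "weak_solution \<Omega> f w y"
    unfolding weak_solution_def
  proof (intro conjI ballI)
    show "y \<in> H10 \<Omega>" by (rule yH(1))
    fix \<eta> assume "\<eta> \<in> H10 \<Omega>"
    then have \<eta>: "H10_with_gradient \<eta> (weak_gradient \<Omega> \<eta>)" by (rule H10_imp_H10_with_gradient)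
    have "(LINT x|M. w x * (weak_gradient \<Omega> y x \<bullet> weak_gradient \<Omega> \<eta> x))
        = (LINT x|M. w x * (V x \<bullet> weak_gradient \<Omega> \<eta> x))"
    proof (rule integral_cong_AE)
      show "AE x in M. w x * (weak_gradient \<Omega> y x \<bullet> weak_gradient \<Omega> \<eta> x) = w x * (V x \<bullet> weak_gradient \<Omega> \<eta> x)"
        using yH(2) by eventually_elim simp
      have "sq_integrable M (weak_gradient \<Omega> \<eta>)" "sq_integrable M (weak_gradient \<Omega> y)"
        using \<eta> yg by (simp_all add: H10_with_gradient_def)
      then show "(\<lambda>x. w x * (weak_gradient \<Omega> y x \<bullet> weak_gradient \<Omega> \<eta> x)) \<in> borel_measurable M"
        "(\<lambda>x. w x * (V x \<bullet> weak_gradient \<Omega> \<eta> x)) \<in> borel_measurable M"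
        using weighted_integrable[OF w(1,2)] V(1) by (blast intro: borel_measurable_integrable)+
    qed
    also have "\<dots> = (LINT x|M. f x * \<eta> x)" by (rule sol[OF \<eta>])
    finally show "(LINT x|M. w x * (weak_gradient \<Omega> y x \<bullet> weak_gradient \<Omega> \<eta> x)) = (LINT x|M. f x * \<eta> x)" .
  qed
  then show ?thesis by blast
qed

lemma weak_solution_continuous:
  fixes y :: "nat \<Rightarrow> 'a \<Rightarrow> real"
  assumes w: "\<And>n. w n \<in> borel_measurable M" "\<And>n x. \<bar>w n x\<bar> \<le> C" "\<And>n x. c \<le> w n x"
    and v: "v \<in> borel_measurable M" "\<And>x. \<bar>v x\<bar> \<le> C" and c: "c > 0"
    and lim: "AE x in M. (\<lambda>n. w n x) \<longlonglongrightarrow> v x"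
    and y: "\<And>n. weak_solution \<Omega> f (w n) (y n)" and z: "weak_solution \<Omega> f v z"
  shows "(\<lambda>n. LINT x|M. (norm (y n x - z x))\<^sup>2) \<longlonglongrightarrow> 0"
proof -
  obtain K where K: "K > 0"
    "\<And>y V. H10_with_gradient y V \<Longrightarrow> (LINT x|M. (norm (y x))\<^sup>2) \<le> K * (LINT x|M. (norm (V x))\<^sup>2)"
    using poincare_H10 by blast
  let ?Y = "\<lambda>n. weak_gradient \<Omega> (y n)" and ?Z = "weak_gradient \<Omega> z"
  have yY: "H10_with_gradient (y n) (?Y n)" for n
    using y H10_imp_H10_with_gradient by (auto simp: weak_solution_def)
  have zZ: "H10_with_gradient z ?Z"
    using z H10_imp_H10_with_gradient by (auto simp: weak_solution_def)
  let ?D = "\<lambda>n x. ?Y n x - ?Z x"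
  have d: "H10_with_gradient (\<lambda>x. y n x - z x) (?D n)" for n
    by (rule H10_with_gradient_diff[OF yY zZ])
  have Y: "sq_integrable M (?Y n)" "sq_integrable M (?D n)" for n
    using yY d by (simp_all add: H10_with_gradient_def)
  have Z: "sq_integrable M ?Z" using zZ by (simp add: H10_with_gradient_def)
  have wv: "(\<lambda>x. v x - w n x) \<in> borel_measurable M" "\<bar>v x - w n x\<bar> \<le> 2 * C" for n x
    using w(1) v(1) w(2)[of n x] v(2)[of x] by auto
  have R: "sq_integrable M (\<lambda>x. (v x - w n x) *\<^sub>R ?Z x)" for n
    by (rule sq_integrable_bounded_scaleR[OF Z wv])
  let ?r = "\<lambda>n. LINT x|M. (norm ((v x - w n x) *\<^sub>R ?Z x))\<^sup>2"
  have r: "?r \<longlonglongrightarrow> 0"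
  proof -
    have "?r \<longlonglongrightarrow> (LINT x|M. 0)"
    proof (rule integral_dominated_convergence[where w = "\<lambda>x. (2 * C)\<^sup>2 * (norm (?Z x))\<^sup>2"])
      show "(\<lambda>x. (norm ((v x - w n x) *\<^sub>R ?Z x))\<^sup>2) \<in> borel_measurable M" for n
        using sq_integrable_norm_sq[OF R] by (rule borel_measurable_integrable)
      show "integrable M (\<lambda>x. (2 * C)\<^sup>2 * (norm (?Z x))\<^sup>2)" using sq_integrable_norm_sq[OF Z] by simp
      show "AE x in M. (\<lambda>n. (norm ((v x - w n x) *\<^sub>R ?Z x))\<^sup>2) \<longlonglongrightarrow> 0"
        using lim
      proof eventually_elim
        case (elim x)
        have "(\<lambda>n. (norm ((v x - w n x) *\<^sub>R ?Z x))\<^sup>2) \<longlonglongrightarrow> (norm ((v x - v x) *\<^sub>R ?Z x))\<^sup>2"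
          by (intro tendsto_intros elim)
        then show ?case by simp
      qed
      show "AE x in M. norm ((norm ((v x - w n x) *\<^sub>R ?Z x))\<^sup>2) \<le> (2 * C)\<^sup>2 * (norm (?Z x))\<^sup>2" for n
      proof (rule AE_I2)
        fix x
        have "\<bar>v x - w n x\<bar>\<^sup>2 \<le> (2 * C)\<^sup>2" by (rule power_mono[OF wv(2) abs_ge_zero])
        then show "norm ((norm ((v x - w n x) *\<^sub>R ?Z x))\<^sup>2) \<le> (2 * C)\<^sup>2 * (norm (?Z x))\<^sup>2"
          by (simp add: power_mult_distrib mult_right_mono)
      qed
    qed simp
    then show ?thesis by simp
  qed
  have est: "(LINT x|M. (norm (?D n x))\<^sup>2) \<le> ?r n / c\<^sup>2" for n
  proof -
    note i = weighted_integrable[OF w(1,2) Y(1) Y(2), of n n n] weighted_integrable[OF w(1,2) Z Y(2), of n n]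
      weighted_integrable[OF v Z Y(2), of n]
    have "c * (LINT x|M. (norm (?D n x))\<^sup>2) \<le> (LINT x|M. w n x * (?D n x \<bullet> ?D n x))"
      by (rule coercive_form[OF w(1,2,3) Y(2)])
    also have "\<dots> = (LINT x|M. w n x * (?Y n x \<bullet> ?D n x)) - (LINT x|M. w n x * (?Z x \<bullet> ?D n x))"
      using i by (simp add: inner_diff_left right_diff_distrib)
    \<comment> \<open>Both states solve their equations with the same right-hand side f, so the two
      forms agree on the common test function.\<close>
    also have "(LINT x|M. w n x * (?Y n x \<bullet> ?D n x)) = (LINT x|M. v x * (?Z x \<bullet> ?D n x))"
      using weak_solution_test[OF w(1,2) y d, of n n] weak_solution_test[OF v z d, of n] by simp
    also have "(LINT x|M. v x * (?Z x \<bullet> ?D n x)) - (LINT x|M. w n x * (?Z x \<bullet> ?D n x))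
        = (LINT x|M. ((v x - w n x) *\<^sub>R ?Z x) \<bullet> ?D n x)"
      using i by (simp add: left_diff_distrib)
    \<comment> \<open>Young's inequality with weight c: half of the coercive term is absorbed on the
      left, which leaves 1 / c^2 in front of the remainder.\<close>
    also have "\<dots> \<le> (LINT x|M. (norm ((v x - w n x) *\<^sub>R ?Z x))\<^sup>2 / (2 * c) + c / 2 * (norm (?D n x))\<^sup>2)"
    proof (rule integral_mono)
      show "integrable M (\<lambda>x. ((v x - w n x) *\<^sub>R ?Z x) \<bullet> ?D n x)" by (rule sq_integrable_inner[OF R Y(2)])
      show "integrable M (\<lambda>x. (norm ((v x - w n x) *\<^sub>R ?Z x))\<^sup>2 / (2 * c) + c / 2 * (norm (?D n x))\<^sup>2)"
        using sq_integrable_norm_sq[OF R] sq_integrable_norm_sq[OF Y(2)] by simp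
      fix x
      let ?a = "(v x - w n x) *\<^sub>R ?Z x"
      have "0 \<le> (norm (?a - c *\<^sub>R ?D n x))\<^sup>2 / (2 * c)" using c by simp
      also have "(norm (?a - c *\<^sub>R ?D n x))\<^sup>2 = (norm ?a)\<^sup>2 - 2 * c * (?a \<bullet> ?D n x) + c\<^sup>2 * (norm (?D n x))\<^sup>2"
        by (rule norm_diff_scaleR_sq)
      also have "\<dots> / (2 * c) = (norm ?a)\<^sup>2 / (2 * c) + c / 2 * (norm (?D n x))\<^sup>2 - ?a \<bullet> ?D n x"
        using c by (simp add: add_divide_distrib diff_divide_distrib power2_eq_square)
      finally show "?a \<bullet> ?D n x \<le> (norm ?a)\<^sup>2 / (2 * c) + c / 2 * (norm (?D n x))\<^sup>2" by simp
    qed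
    also have "\<dots> = ?r n / (2 * c) + c / 2 * (LINT x|M. (norm (?D n x))\<^sup>2)"
      using sq_integrable_norm_sq[OF R, of n] sq_integrable_norm_sq[OF Y(2), of n]
      by (simp only: Bochner_Integration.integral_add integrable_divide integrable_mult_right
          integral_divide_zero integral_mult_right_zero)
    finally show ?thesis using c by (simp add: power2_eq_square field_simps)
  qed
  show ?thesis
  proof (rule tendsto_sandwich[OF _ _ tendsto_const])
    show "(\<lambda>n. K * (?r n / c\<^sup>2)) \<longlonglongrightarrow> 0"
      using tendsto_mult_left[OF tendsto_divide[OF r tendsto_const[of "c\<^sup>2"]], of K] c by simp
    show "\<forall>\<^sub>F n in sequentially. (LINT x|M. (norm (y n x - z x))\<^sup>2) \<le> K * (?r n / c\<^sup>2)"
    proof (intro always_eventually allI)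
      fix n
      have "(LINT x|M. (norm (y n x - z x))\<^sup>2) \<le> K * (LINT x|M. (norm (?D n x))\<^sup>2)" by (rule K(2)[OF d])
      also have "\<dots> \<le> K * (?r n / c\<^sup>2)" using est K(1) by (intro mult_left_mono) auto
      finally show "(LINT x|M. (norm (y n x - z x))\<^sup>2) \<le> K * (?r n / c\<^sup>2)" .
    qed
  qed simp
qed

end

section \<open>Weak compactness of bounded sequences of measures\<close>

text \<open>A compact set is encoded in the real line by ternary expansions that record membership in
  countably many small balls. The encoding is only Borel, but its inverse extends continuously to
  the whole line, so that Helly's selection theorem transfers to the compact set.\<close>

lemma ternary_sums: "(\<lambda>i. 2 / 3 ^ Suc i :: real) sums 1"
proof -
  have "(\<lambda>i. 2 / 3 * (1 / 3) ^ i :: real) sums (2 / 3 * (1 / (1 - 1 / 3)))"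
    by (intro sums_mult geometric_sums) auto
  then show ?thesis by (simp add: power_divide)
qed

lemma ternary_summable:
  assumes "\<And>i. \<bar>d i\<bar> \<le> 2 / 3 ^ Suc i"
  shows "summable (d :: nat \<Rightarrow> real)"
  by (rule summable_comparison_test'[OF sums_summable[OF ternary_sums]]) (use assms in auto)

text \<open>All later digits together differ by at most 1 / 3^(k+1), half the jump at the first
  differing digit; these are the gaps of the Cantor set.\<close>

lemma ternary_first_digit:
  fixes d :: "nat \<Rightarrow> real"
  assumes d: "\<And>i. \<bar>d i\<bar> \<le> 2 / 3 ^ Suc i" and 0: "\<And>i. i < k \<Longrightarrow> d i = 0" and k: "\<bar>d k\<bar> = 2 / 3 ^ Suc k"
  shows "1 / 3 ^ Suc k \<le> \<bar>\<Sum>i. d i\<bar>"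
proof -
  have sm: "summable d" by (rule ternary_summable[OF d])
  have "(\<Sum>i. d i) = (\<Sum>i. d (i + Suc k)) + (\<Sum>i<Suc k. d i)"
    by (rule suminf_split_initial_segment[OF sm])
  moreover have "(\<Sum>i<Suc k. d i) = d k" using 0 by simp
  moreover have "\<bar>\<Sum>i. d (i + Suc k)\<bar> \<le> 1 / 3 ^ Suc k"
  proof -
    have s: "(\<lambda>i. 1 / 3 ^ Suc k * (2 / 3 ^ Suc i) :: real) sums (1 / 3 ^ Suc k * 1)"
      by (intro sums_mult ternary_sums)
    have eq: "1 / 3 ^ Suc k * (2 / 3 ^ Suc i) = (2 / 3 ^ Suc (i + Suc k) :: real)" for i
      by (simp add: power_add)
    have "norm (\<Sum>i. d (i + Suc k)) \<le> (\<Sum>i. 1 / 3 ^ Suc k * (2 / 3 ^ Suc i))"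
    proof (rule norm_suminf_le)
      show "norm (d (i + Suc k)) \<le> 1 / 3 ^ Suc k * (2 / 3 ^ Suc i)" for i
        unfolding eq using d[of "i + Suc k"] by simp
      show "summable (\<lambda>i. 1 / 3 ^ Suc k * (2 / 3 ^ Suc i) :: real)" by (rule sums_summable[OF s])
    qed
    then show ?thesis using s by (simp only: sums_iff real_norm_def mult_1_right)
  qed
  moreover have "(1 / 3 ^ Suc k :: real) + 1 / 3 ^ Suc k = 2 / 3 ^ Suc k" by simp
  ultimately show ?thesis using k by linarith
qed

text \<open>The code of x lists, with digits 0 and 2, which balls of the finite covers of radius 1 /
  (j + 1) contain x. It jumps at the boundaries of the balls. The last conclusion says instead that
  its inverse is uniformly continuous, because close codes share their first digits and hence a
  small ball.\<close>

lemma compact_coding: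
  fixes K :: "'a::euclidean_space set"
  assumes K: "compact K" "K \<noteq> {}"
  obtains s :: "'a \<Rightarrow> real" where "s \<in> borel_measurable borel" "\<And>x. 0 \<le> s x" "\<And>x. s x \<le> 1"
    "\<And>e. e > 0 \<Longrightarrow> \<exists>\<delta>>0. \<forall>x\<in>K. \<forall>y\<in>K. \<bar>s x - s y\<bar> < \<delta> \<longrightarrow> dist x y < e"
proof -
  have "\<exists>C. finite C \<and> C \<subseteq> K \<and> K \<subseteq> (\<Union>x\<in>C. ball x (inverse (real (Suc j))))" for j
  proof -
    have "K \<subseteq> (\<Union>x\<in>K. ball x (inverse (real (Suc j))))" by auto
    from compactE_image[OF K(1) _ this] show ?thesis by (metis open_ball)
  qed
  then obtain C where C: "\<And>j. finite (C j)" "\<And>j. C j \<subseteq> K"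
    "\<And>j. K \<subseteq> (\<Union>x\<in>C j. ball x (inverse (real (Suc j))))" by metis
  define F where "F j = (\<lambda>x. ball x (inverse (real (Suc j)))) ` C j" for j
  define A where "A = (\<Union>j. F j)"
  have fin: "finite (F j)" for j using C by (simp add: F_def)
  have A: "countable A" unfolding A_def by (simp add: fin countable_finite)
  have "C 0 \<noteq> {}"
  proof
    assume "C 0 = {}"
    then have "K \<subseteq> {}" using C(3)[of 0] by simp
    then show False using K(2) by simp
  qed
  then have ne: "A \<noteq> {}" by (auto simp: A_def F_def)
  define B where "B = from_nat_into A"
  have rB: "range B = A" unfolding B_def by (rule range_from_nat_into[OF ne A])
  have "B k \<in> A" for k using rB by blast
  moreover have "open X" if "X \<in> A" for X using that unfolding A_def F_def by auto
  ultimately have "open (B k)" for k by blast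
  then have Bm[measurable]: "B k \<in> sets borel" for k by auto
  define a where "a k x = (2 * indicator (B k) x / 3 ^ Suc k :: real)" for k x
  have a: "0 \<le> a k x" "a k x \<le> 2 / 3 ^ Suc k" for k x by (auto simp: a_def indicator_def)
  have sm: "summable (\<lambda>k. a k x)" for x
    by (rule ternary_summable) (use a in auto)
  define s where "s x = (\<Sum>k. a k x)" for x
  show ?thesis
  proof (rule that[of s])
    show "s \<in> borel_measurable borel" unfolding s_def[abs_def] a_def by measurable
    show "0 \<le> s x" for x unfolding s_def by (rule suminf_nonneg[OF sm a(1)])
    show "s x \<le> 1" for x
    proof -
      have "s x \<le> (\<Sum>i. 2 / 3 ^ Suc i)"
        unfolding s_def by (rule suminf_le[OF a(2) sm sums_summable[OF ternary_sums]])
      then show ?thesis using ternary_sums by (simp only: sums_iff)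
    qed
    fix e :: real assume "e > 0"
    then obtain j where j: "inverse (real (Suc j)) < e / 2" using reals_Archimedean[of "e / 2"] by auto
    have "\<forall>X\<in>F j. \<exists>k. B k = X"
    proof
      fix X assume "X \<in> F j"
      then have "X \<in> range B" unfolding rB A_def by blast
      then show "\<exists>k. B k = X" by blast
    qed
    then obtain idx where idx: "\<And>X. X \<in> F j \<Longrightarrow> B (idx X) = X" by metis
    \<comment> \<open>Beyond the index of every ball in the cover of radius 1 / (j + 1), so that N
      common digits settle membership in each of them. The \<open>insert 0\<close> keeps
      \<open>Max\<close> away from an empty set.\<close>
    define N where "N = Suc (Max (insert 0 (idx ` F j)))"
    have N: "idx X < N" if "X \<in> F j" for X
      unfolding N_def using that fin by (auto simp: less_Suc_eq_le intro: Max_ge)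
    show "\<exists>\<delta>>0. \<forall>x\<in>K. \<forall>y\<in>K. \<bar>s x - s y\<bar> < \<delta> \<longrightarrow> dist x y < e"
    \<comment> \<open>A first disagreement among the first N digits would separate the codes by at
      least 1 / 3^N.\<close>
    proof (intro exI[of _ "1 / 3 ^ N"] conjI ballI impI)
      fix x y assume xy: "x \<in> K" "y \<in> K" "\<bar>s x - s y\<bar> < 1 / 3 ^ N"
      have agree: "x \<in> B k \<longleftrightarrow> y \<in> B k" if "k < N" for k
      proof (rule ccontr)
        assume neq: "\<not> ?thesis"
        then have ex: "\<exists>k. (x \<in> B k) \<noteq> (y \<in> B k)" by blast
        define l where "l = (LEAST k. (x \<in> B k) \<noteq> (y \<in> B k))"
        have l: "(x \<in> B l) \<noteq> (y \<in> B l)" unfolding l_def by (rule LeastI_ex[OF ex])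
        have lk: "l \<le> k" unfolding l_def by (rule Least_le) (use neq in blast)
        have less: "(x \<in> B i) = (y \<in> B i)" if "i < l" for i
          using that not_less_Least unfolding l_def by blast
        have "1 / 3 ^ Suc l \<le> \<bar>\<Sum>i. a i x - a i y\<bar>"
        proof (rule ternary_first_digit)
          show "\<bar>a i x - a i y\<bar> \<le> 2 / 3 ^ Suc i" for i
            using a[of i x] a[of i y] by linarith
          show "a i x - a i y = 0" if "i < l" for i
            using less[OF that] by (simp add: a_def indicator_def)
          show "\<bar>a l x - a l y\<bar> = 2 / 3 ^ Suc l" using l by (auto simp: a_def indicator_def)
        qed
        also have "(\<Sum>i. a i x - a i y) = s x - s y" unfolding s_def by (rule suminf_diff[OF sm sm, symmetric])
        finally have "1 / 3 ^ Suc l < (1 / 3 ^ N :: real)" using xy(3) by linarith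
        moreover have "(1 / 3 ^ N :: real) \<le> 1 / 3 ^ Suc l"
          using lk \<open>k < N\<close> by (intro divide_left_mono power_increasing) auto
        ultimately show False by linarith
      qed
      obtain c where c: "c \<in> C j" "x \<in> ball c (inverse (real (Suc j)))" using C(3)[of j] xy(1) by blast
      then have X: "ball c (inverse (real (Suc j))) \<in> F j" by (simp add: F_def)
      have "y \<in> ball c (inverse (real (Suc j)))"
        using agree[OF N[OF X]] idx[OF X] c(2) by simp
      then have "dist c x < e / 2" "dist c y < e / 2" using c(2) j by auto
      then show "dist x y < e" using dist_triangle_half_r by blast
    qed simp
  qed
qed

text \<open>Prokhorov's theorem on a fixed ball. Helly's theorem concerns probabilities on the line,
  so the masses are made to converge first and are divided out; a vanishing limit mass has to be
  treated apart.\<close>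

lemma bounded_measures_weakly_compact:
  fixes \<mu> :: "nat \<Rightarrow> 'a::euclidean_space measure"
  assumes R: "R \<ge> 0"
    and \<mu>: "\<And>n. finite_measure (\<mu> n)" "\<And>n. sets (\<mu> n) = sets borel" "\<And>n. AE x in \<mu> n. norm x \<le> R"
    and C: "\<And>n. measure (\<mu> n) UNIV \<le> C"
  obtains r \<nu> where "strict_mono (r :: nat \<Rightarrow> nat)" "finite_measure \<nu>" "sets \<nu> = sets borel"
    "AE x in \<nu>. norm x \<le> R"
    "\<And>\<phi> :: 'a \<Rightarrow> real. continuous_on UNIV \<phi> \<Longrightarrow> (\<lambda>n. LINT x|\<mu> (r n). \<phi> x) \<longlonglongrightarrow> (LINT x|\<nu>. \<phi> x)"
proof -
  let ?K = "cball (0::'a) R"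
  have K: "compact ?K" "?K \<noteq> {}" using R by auto
  obtain s :: "'a \<Rightarrow> real" where s[measurable]: "s \<in> borel_measurable borel" and s01: "\<And>x. 0 \<le> s x" "\<And>x. s x \<le> 1"
    and sep: "\<And>e. e > 0 \<Longrightarrow> \<exists>\<delta>>0. \<forall>x\<in>?K. \<forall>y\<in>?K. \<bar>s x - s y\<bar> < \<delta> \<longrightarrow> dist x y < e"
    using compact_coding[OF K] by blast
  have inj: "inj_on s ?K"
  proof (rule inj_onI, rule ccontr)
    fix x y assume xy: "x \<in> ?K" "y \<in> ?K" "s x = s y" "x \<noteq> y"
    then obtain \<delta> where "\<delta> > 0" "\<forall>x'\<in>?K. \<forall>y'\<in>?K. \<bar>s x' - s y'\<bar> < \<delta> \<longrightarrow> dist x' y' < dist x y"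
      using sep[of "dist x y"] by (meson zero_less_dist_iff)
    then have "\<bar>s x - s y\<bar> < \<delta> \<longrightarrow> dist x y < dist x y" using xy(1,2) by blast
    then show False using xy(3) \<open>\<delta> > 0\<close> by simp
  qed
  define q where "q = the_inv_into ?K s"
  have q: "q (s x) = x" if "x \<in> ?K" for x unfolding q_def using inj that by (rule the_inv_into_f_f)
  have "uniformly_continuous_on (s ` ?K) q"
    unfolding uniformly_continuous_on_def
  proof (intro allI impI)
    fix e :: real assume "e > 0"
    then obtain \<delta> where "\<delta> > 0" "\<forall>x\<in>?K. \<forall>y\<in>?K. \<bar>s x - s y\<bar> < \<delta> \<longrightarrow> dist x y < e" using sep by blast
    then show "\<exists>d>0. \<forall>x\<in>s ` ?K. \<forall>x'\<in>s ` ?K. dist x' x < d \<longrightarrow> dist (q x') (q x) < e"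
      by (intro exI[of _ \<delta>]) (simp add: q dist_real_def del: mem_cball)
  qed
  then obtain g where g: "uniformly_continuous_on (closure (s ` ?K)) g" "\<And>t. t \<in> s ` ?K \<Longrightarrow> q t = g t"
    by (rule uniformly_continuous_on_extension_on_closure) blast
  have gc: "continuous_on (closure (s ` ?K)) g" by (rule uniformly_continuous_imp_continuous[OF g(1)])
  have gK: "g ` closure (s ` ?K) \<subseteq> ?K"
  proof (rule image_closure_subset[OF gc])
    show "g ` s ` ?K \<subseteq> ?K"
    proof
      fix y assume "y \<in> g ` s ` ?K"
      then obtain x where x: "x \<in> ?K" "y = g (s x)" by blast
      then have "y = x" using g(2)[OF imageI[OF x(1)]] q[OF x(1)] by simp
      then show "y \<in> ?K" using x(1) by simp
    qed
  qed simp
  have clo: "closedin (top_of_set UNIV) (closure (s ` ?K))" by simp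
  \<comment> \<open>Convexity of the ball keeps the values of the extension inside it, so that
    \<phi> composed with p is bounded for every continuous \<phi>.\<close>
  obtain p where p: "continuous_on UNIV p" "p ` UNIV \<subseteq> ?K" "\<And>t. t \<in> closure (s ` ?K) \<Longrightarrow> p t = g t"
    using Dugundji[OF convex_cball K(2) clo gc gK] by blast
  have ps: "p (s x) = x" if "norm x \<le> R" for x
  proof -
    have x: "x \<in> ?K" using that by simp
    have sx: "s x \<in> s ` ?K" by (rule imageI[OF x])
    have "p (s x) = g (s x)" by (rule p(3)[OF subsetD[OF closure_subset sx]])
    also have "\<dots> = q (s x)" by (rule g(2)[OF sx, symmetric])
    finally show ?thesis using q[OF x] by (rule trans)
  qed
  have pR: "norm (p t) \<le> R" for t
    using subsetD[OF p(2) rangeI[of p t]] by simp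
  have [measurable]: "p \<in> borel_measurable borel" by (rule borel_measurable_continuous_onI[OF p(1)])
  define m where "m n = measure (\<mu> n) UNIV" for n
  have m: "0 \<le> m n" "m n \<le> C" for n using C by (auto simp: m_def)
  then have "\<forall>n. m n \<in> {0..C}" by simp
  then obtain l r0 where r0: "strict_mono r0" "(m \<circ> r0) \<longlonglongrightarrow> l" "l \<in> {0..C}"
    using seq_compactE[OF compact_imp_seq_compact[OF compact_Icc[of 0 C]], of m] by metis
  have sp: "space (\<mu> n) = UNIV" for n using sets_eq_imp_space_eq[OF \<mu>(2)] by simp
  have bd: "\<exists>B. \<forall>x. norm x \<le> R \<longrightarrow> \<bar>\<phi> x\<bar> \<le> B" if "continuous_on UNIV \<phi>" for \<phi> :: "'a \<Rightarrow> real"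
  proof -
    have "compact (\<phi> ` ?K)" using that K(1) by (meson compact_continuous_image continuous_on_subset subset_UNIV)
    then obtain B where "\<forall>y\<in>\<phi> ` ?K. norm y \<le> B" using compact_imp_bounded bounded_iff by blast
    then show ?thesis by (intro exI[of _ B]) simp
  qed
  show ?thesis
  proof (cases "l = 0")
    case True
    show ?thesis
    proof (rule that[of r0 "null_measure borel"])
      show "finite_measure (null_measure (borel :: 'a measure))" by (rule finite_measureI) simp
      show "AE x in null_measure borel. norm (x::'a) \<le> R" by (rule AE_I[where N = UNIV]) auto
      fix \<phi> :: "'a \<Rightarrow> real" assume \<phi>: "continuous_on UNIV \<phi>"
      then obtain B where B: "\<And>x. norm x \<le> R \<Longrightarrow> \<bar>\<phi> x\<bar> \<le> B" using bd by blast
      have [measurable]: "\<phi> \<in> borel_measurable borel" by (rule borel_measurable_continuous_onI[OF \<phi>])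
      have "\<bar>LINT x|\<mu> n. \<phi> x\<bar> \<le> B * m n" for n
      proof -
        interpret finite_measure "\<mu> n" by (rule \<mu>)
        have ae: "AE x in \<mu> n. norm (\<phi> x) \<le> B" using \<mu>(3)[of n] by eventually_elim (simp add: B)
        have meas: "\<phi> \<in> borel_measurable (\<mu> n)" using \<mu>(2)[of n] by (simp cong: measurable_cong_sets)
        then have i: "integrable (\<mu> n) \<phi>" using ae by (intro integrable_const_bound)
        have "\<bar>LINT x|\<mu> n. \<phi> x\<bar> \<le> (LINT x|\<mu> n. norm (\<phi> x))" using integral_norm_bound[of "\<mu> n" \<phi>] by simp
        also have "\<dots> \<le> (LINT x|\<mu> n. B)" using i ae by (intro integral_mono_AE) auto
        finally show ?thesis by (simp add: m_def sp mult.commute)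
      qed
      then have b: "norm (LINT x|\<mu> (r0 n). \<phi> x) \<le> B * (m \<circ> r0) n" for n by simp
      have "(\<lambda>n. B * (m \<circ> r0) n) \<longlonglongrightarrow> 0"
        using tendsto_mult_left[OF r0(2), of B] True by simp
      then have "(\<lambda>n. LINT x|\<mu> (r0 n). \<phi> x) \<longlonglongrightarrow> 0"
        by (rule Lim_null_comparison[OF always_eventually, rotated]) (use b in blast)
      then show "(\<lambda>n. LINT x|\<mu> (r0 n). \<phi> x) \<longlonglongrightarrow> (LINT x|null_measure borel. \<phi> x)"
        by simp
    qed (use r0 in auto)
  next
    case False
    then have l: "l > 0" using r0(3) by auto
    then have "\<forall>\<^sub>F n in sequentially. (m \<circ> r0) n > 0" using order_tendstoD(1)[OF r0(2)] by blast
    then obtain N where N: "\<And>n. n \<ge> N \<Longrightarrow> m (r0 n) > 0" unfolding eventually_sequentially by auto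
    \<comment> \<open>Dropping the first N terms makes every mass positive, so that each measure can
      be normalized.\<close>
    define r1 where "r1 n = r0 (n + N)" for n
    have r1: "strict_mono r1" unfolding r1_def strict_mono_def
      using r0(1) by (simp add: strict_mono_less)
    have m1: "m (r1 n) > 0" for n unfolding r1_def using N by simp
    have m1l: "(\<lambda>n. m (r1 n)) \<longlonglongrightarrow> l"
      using LIMSEQ_ignore_initial_segment[OF r0(2), of N] by (simp add: r1_def)
    define P where "P n = distr (density (\<mu> (r1 n)) (\<lambda>_. ennreal (1 / m (r1 n)))) borel s" for n
    have s_meas: "s \<in> borel_measurable (\<mu> n)" for n using \<mu>(2)[of n] by (simp cong: measurable_cong_sets)
    have prob: "prob_space (density (\<mu> (r1 n)) (\<lambda>_. ennreal (1 / m (r1 n))))" for n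
    proof
      interpret finite_measure "\<mu> (r1 n)" by (rule \<mu>)
      show "emeasure (density (\<mu> (r1 n)) (\<lambda>_. ennreal (1 / m (r1 n)))) (space (density (\<mu> (r1 n)) (\<lambda>_. ennreal (1 / m (r1 n))))) = 1"
      proof -
        have "emeasure (density (\<mu> (r1 n)) (\<lambda>_. ennreal (1 / m (r1 n)))) UNIV
            = (\<integral>\<^sup>+ x. ennreal (1 / m (r1 n)) * indicator UNIV x \<partial>\<mu> (r1 n))"
          by (rule emeasure_density) (simp_all add: \<mu>(2))
        also have "\<dots> = ennreal (1 / m (r1 n)) * emeasure (\<mu> (r1 n)) UNIV"
          by (simp add: sp)
        also have "\<dots> = 1"
          using m1[of n] by (simp add: emeasure_eq_measure m_def flip: ennreal_mult)
        finally show ?thesis by (simp add: sp)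
      qed
    qed
    have Pd: "real_distribution (P n)" for n
      unfolding P_def by (rule prob_space.real_distribution_distr[OF prob]) (use s_meas in simp)
    have Pint: "(LINT t|P n. h t) = (LINT x|\<mu> (r1 n). h (s x)) / m (r1 n)"
      if [measurable]: "h \<in> borel_measurable borel" for h :: "real \<Rightarrow> real" and n
    proof -
      have hs: "(\<lambda>x. h (s x)) \<in> borel_measurable (\<mu> (r1 n))"
        using measurable_comp[OF s_meas that] by (simp add: comp_def)
      have "(LINT t|P n. h t) = (LINT x|density (\<mu> (r1 n)) (\<lambda>_. ennreal (1 / m (r1 n))). h (s x))"
        unfolding P_def using s_meas that by (intro integral_distr) auto
      also have "\<dots> = (LINT x|\<mu> (r1 n). (1 / m (r1 n)) *\<^sub>R h (s x))"
        using hs m1[of n] by (intro integral_density) auto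
      finally show ?thesis by simp
    qed
    have tight: "tight P"
      unfolding tight_def
    proof (intro conjI allI impI Pd)
      fix e :: real assume "e > 0"
      \<comment> \<open>Codes lie in [0, 1] and may equal 0, while tightness is stated with
        left-open intervals; hence the endpoint -1.\<close>
      have "measure (P n) {-1<..1} = 1" for n
      proof -
        interpret real_distribution "P n" by (rule Pd)
        have "AE t in P n. t \<in> {-1<..1}"
          unfolding P_def
          by (subst AE_distr_iff) (use s_meas s01 in \<open>auto intro!: AE_I2 simp: less_le_trans[of "-1" 0]\<close>)
        then show ?thesis by (simp add: prob_eq_1)
      qed
      then show "\<exists>a b. a < b \<and> (\<forall>n. 1 - e < measure (P n) {a<..b})"
        using \<open>e > 0\<close> by (intro exI[of _ "-1"] exI[of _ 1]) auto
    qed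
    obtain r2 Q where r2: "strict_mono (r2 :: nat \<Rightarrow> nat)" "real_distribution Q" "weak_conv_m (P \<circ> id \<circ> r2) Q"
      using tight_imp_convergent_subsubsequence[OF tight, of id] by (auto simp: strict_mono_def)
    interpret Q: real_distribution Q by fact
    define \<nu> where "\<nu> = distr (density Q (\<lambda>_. ennreal l)) borel p"
    show ?thesis
    proof (rule that[of "r1 \<circ> r2" \<nu>])
      show "strict_mono (r1 \<circ> r2)" using r1 r2(1) by (rule strict_mono_o)
      have "finite_measure (density Q (\<lambda>_. ennreal l))"
        by (rule finite_measureI) (simp add: emeasure_density Q.emeasure_eq_measure ennreal_mult_eq_top_iff)
      then show "finite_measure \<nu>" unfolding \<nu>_def by (rule finite_measure.finite_measure_distr) simp
      show "sets \<nu> = sets borel" by (simp add: \<nu>_def)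
      show "AE x in \<nu>. norm x \<le> R"
        unfolding \<nu>_def by (subst AE_distr_iff) (auto simp: pR)
      fix \<phi> :: "'a \<Rightarrow> real" assume \<phi>: "continuous_on UNIV \<phi>"
      then obtain B where B: "\<And>x. norm x \<le> R \<Longrightarrow> \<bar>\<phi> x\<bar> \<le> B" using bd by blast
      have [measurable]: "\<phi> \<in> borel_measurable borel" by (rule borel_measurable_continuous_onI[OF \<phi>])
      \<comment> \<open>The encoding s is merely Borel, but only p enters the test function on the
        line. The identity p (s x) = x, valid almost everywhere, turns its integrals back into those
        of \<phi>.\<close>
      have \<phi>p: "continuous_on UNIV (\<lambda>t. \<phi> (p t))"
        by (rule continuous_on_compose2[OF \<phi> p(1)]) auto
      have "(\<lambda>n. integral\<^sup>L ((P \<circ> id \<circ> r2) n) (\<lambda>t. \<phi> (p t))) \<longlonglongrightarrow> integral\<^sup>L Q (\<lambda>t. \<phi> (p t))"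
      proof (rule weak_conv_imp_integral_bdd_continuous_conv[OF _ r2(2,3)])
        show "real_distribution ((P \<circ> id \<circ> r2) n)" for n using Pd by simp
        show "isCont (\<lambda>t. \<phi> (p t)) t" for t using \<phi>p continuous_on_eq_continuous_at open_UNIV by blast
        show "norm (\<phi> (p t)) \<le> B" for t using B pR by simp
      qed
      then have "(\<lambda>n. m (r1 (r2 n)) * (LINT t|P (r2 n). \<phi> (p t))) \<longlonglongrightarrow> l * (LINT t|Q. \<phi> (p t))"
        using LIMSEQ_subseq_LIMSEQ[OF m1l r2(1)] by (intro tendsto_mult) (auto simp: comp_def)
      moreover have "m (r1 n) * (LINT t|P n. \<phi> (p t)) = (LINT x|\<mu> (r1 n). \<phi> x)" for n
      proof -
        have "m (r1 n) * (LINT t|P n. \<phi> (p t)) = (LINT x|\<mu> (r1 n). \<phi> (p (s x)))"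
          using m1[of n] by (subst Pint) auto
        also have "\<dots> = (LINT x|\<mu> (r1 n). \<phi> x)"
        proof (rule integral_cong_AE)
          show "(\<lambda>x. \<phi> (p (s x))) \<in> borel_measurable (\<mu> (r1 n))" "\<phi> \<in> borel_measurable (\<mu> (r1 n))"
            using \<mu>(2)[of "r1 n"] by (simp_all cong: measurable_cong_sets)
          show "AE x in \<mu> (r1 n). \<phi> (p (s x)) = \<phi> x"
            using \<mu>(3)[of "r1 n"] by eventually_elim (simp add: ps)
        qed
        finally show ?thesis .
      qed
      moreover have "l * (LINT t|Q. \<phi> (p t)) = (LINT x|\<nu>. \<phi> x)"
      proof -
        have "(LINT x|\<nu>. \<phi> x) = (LINT t|density Q (\<lambda>_. ennreal l). \<phi> (p t))"
          unfolding \<nu>_def by (intro integral_distr) auto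
        also have "\<dots> = (LINT t|Q. l *\<^sub>R \<phi> (p t))"
          using l by (intro integral_density) auto
        finally show ?thesis by simp
      qed
      ultimately show "(\<lambda>n. LINT x|\<mu> ((r1 \<circ> r2) n). \<phi> x) \<longlonglongrightarrow> (LINT x|\<nu>. \<phi> x)" by simp
    qed
  qed
qed

section \<open>Vector measures\<close>

text \<open>Here \<open>M\<close> only fixes the space and the sigma-algebra. A sum dominates each
  summand and so serves as common reference measure for Radon-Nikodym; it also lets an identity
  between differences of measures be written as an identity between positive measures.\<close>

definition sum_measure :: "'i set \<Rightarrow> 'a measure \<Rightarrow> ('i \<Rightarrow> 'a measure) \<Rightarrow> 'a measure" where
  "sum_measure I M F = measure_of (space M) (sets M) (\<lambda>A. \<Sum>i\<in>I. emeasure (F i) A)"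

lemma sets_sum_measure[simp, measurable_cong]: "sets (sum_measure I M F) = sets M"
  by (simp add: sum_measure_def)

lemma space_sum_measure[simp]: "space (sum_measure I M F) = space M"
  by (simp add: sum_measure_def)

lemma emeasure_sum_measure:
  assumes F: "\<And>i. i \<in> I \<Longrightarrow> sets (F i) = sets M" and A: "A \<in> sets M"
  shows "emeasure (sum_measure I M F) A = (\<Sum>i\<in>I. emeasure (F i) A)"
proof (rule emeasure_measure_of[OF sum_measure_def])
  show "sets M \<subseteq> Pow (space M)" by (rule sets.space_closed)
  show "A \<in> sets (sum_measure I M F)" using A by simp
  show "positive (sets (sum_measure I M F)) (\<lambda>A. \<Sum>i\<in>I. emeasure (F i) A)"
    by (simp add: positive_def)
  show "countably_additive (sets (sum_measure I M F)) (\<lambda>A. \<Sum>i\<in>I. emeasure (F i) A)"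
  proof (rule countably_additiveI)
    fix A :: "nat \<Rightarrow> 'b set"
    assume A: "range A \<subseteq> sets (sum_measure I M F)" "disjoint_family A"
    have "(\<Sum>n. \<Sum>i\<in>I. emeasure (F i) (A n)) = (\<Sum>i\<in>I. \<Sum>n. emeasure (F i) (A n))"
      by (rule suminf_sum) simp
    also have "\<dots> = (\<Sum>i\<in>I. emeasure (F i) (\<Union>n. A n))"
      using A F by (intro sum.cong refl suminf_emeasure) auto
    finally show "(\<Sum>n. \<Sum>i\<in>I. emeasure (F i) (A n)) = (\<Sum>i\<in>I. emeasure (F i) (\<Union>n. A n))" .
  qed
qed

lemma finite_measure_sum_measure:
  assumes "finite I" "\<And>i. i \<in> I \<Longrightarrow> sets (F i) = sets M" "\<And>i. i \<in> I \<Longrightarrow> finite_measure (F i)"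
  shows "finite_measure (sum_measure I M F)"
proof (rule finite_measureI)
  have "emeasure (F i) (space M) \<noteq> \<top>" if "i \<in> I" for i
    using finite_measure.emeasure_finite[OF assms(3)[OF that]] by simp
  then show "emeasure (sum_measure I M F) (space (sum_measure I M F)) \<noteq> \<infinity>"
    using assms(1,2) by (simp add: emeasure_sum_measure)
qed

lemma nn_integral_sum_measure:
  assumes I: "finite I" and F: "\<And>i. i \<in> I \<Longrightarrow> sets (F i) = sets M" and f: "f \<in> borel_measurable M"
  shows "(\<integral>\<^sup>+ x. f x \<partial>sum_measure I M F) = (\<Sum>i\<in>I. \<integral>\<^sup>+ x. f x \<partial>F i)"
proof -
  have sp: "space (F i) = space M" if "i \<in> I" for i using sets_eq_imp_space_eq[OF F[OF that]] .
  have meas: "g \<in> borel_measurable (F i)" if "g \<in> borel_measurable M" "i \<in> I" for g :: "'b \<Rightarrow> ennreal" and i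
    using that F by (simp cong: measurable_cong_sets)
  have meas': "g \<in> borel_measurable (sum_measure I M F)" if "g \<in> borel_measurable M" for g :: "'b \<Rightarrow> ennreal"
    using that by (simp cong: measurable_cong_sets)
  show ?thesis
    using f
  proof (induction rule: borel_measurable_induct)
    case (cong f g)
    have "(\<integral>\<^sup>+ x. f x \<partial>sum_measure I M F) = (\<integral>\<^sup>+ x. g x \<partial>sum_measure I M F)"
      using cong(3) by (intro nn_integral_cong) simp
    moreover have "(\<integral>\<^sup>+ x. f x \<partial>F i) = (\<integral>\<^sup>+ x. g x \<partial>F i)" if "i \<in> I" for i
      using cong(3) sp[OF that] by (intro nn_integral_cong) simp
    ultimately show ?case using cong(4) by simp
  next
    case (set A)
    then show ?case using F by (simp add: emeasure_sum_measure)
  next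
    case (mult u c)
    then show ?case by (simp add: nn_integral_cmult meas meas' sum_distrib_left)
  next
    case (add u v)
    then show ?case by (simp add: nn_integral_add meas meas' sum.distrib)
  next
    case (seq U)
    have mono: "mono (\<lambda>n. \<integral>\<^sup>+ x. U n x \<partial>F i)" for i
      using \<open>incseq U\<close> by (auto simp: mono_def le_fun_def intro!: nn_integral_mono)
    have U: "(\<lambda>x. (SUP n. U n) x) = (\<lambda>x. SUP n. U n x)" by (simp add: image_comp)
    have "(\<integral>\<^sup>+ x. (SUP n. U n) x \<partial>sum_measure I M F) = (SUP n. \<integral>\<^sup>+ x. U n x \<partial>sum_measure I M F)"
      unfolding U using seq(1) \<open>incseq U\<close> by (intro nn_integral_monotone_convergence_SUP meas') auto
    also have "\<dots> = (SUP n. \<Sum>i\<in>I. \<integral>\<^sup>+ x. U n x \<partial>F i)" using seq by simp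
    also have "\<dots> = (\<Sum>i\<in>I. SUP n. \<integral>\<^sup>+ x. U n x \<partial>F i)"
      using mono by (intro ennreal_SUP_sum) auto
    also have "\<dots> = (\<Sum>i\<in>I. \<integral>\<^sup>+ x. (SUP n. U n) x \<partial>F i)"
      unfolding U using seq(1) \<open>incseq U\<close>
      by (intro sum.cong refl nn_integral_monotone_convergence_SUP[symmetric] meas) auto
    finally show ?case .
  qed
qed

lemma integral_sum_measure:
  fixes f :: "'a \<Rightarrow> real"
  assumes I: "finite I" and F: "\<And>i. i \<in> I \<Longrightarrow> sets (F i) = sets M"
    and f: "f \<in> borel_measurable M" "\<And>i. i \<in> I \<Longrightarrow> integrable (F i) f"
  shows "integrable (sum_measure I M F) f" "(LINT x|sum_measure I M F. f x) = (\<Sum>i\<in>I. LINT x|F i. f x)"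
proof -
  have pos: "integrable (sum_measure I M F) g \<and> (LINT x|sum_measure I M F. g x) = (\<Sum>i\<in>I. LINT x|F i. g x)"
    if g: "g \<in> borel_measurable M" "\<And>i. i \<in> I \<Longrightarrow> integrable (F i) g" "\<And>x. 0 \<le> g x" for g :: "'a \<Rightarrow> real"
  proof -
    have "(\<integral>\<^sup>+ x. ennreal (g x) \<partial>sum_measure I M F) = (\<Sum>i\<in>I. \<integral>\<^sup>+ x. ennreal (g x) \<partial>F i)"
      using g(1) by (intro nn_integral_sum_measure I F) auto
    also have "\<dots> = (\<Sum>i\<in>I. ennreal (LINT x|F i. g x))"
      using g by (intro sum.cong refl nn_integral_eq_integral) auto
    also have "\<dots> = ennreal (\<Sum>i\<in>I. LINT x|F i. g x)"
      using g by (intro sum_ennreal) auto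
    finally have "has_bochner_integral (sum_measure I M F) g (\<Sum>i\<in>I. LINT x|F i. g x)"
      using g by (intro has_bochner_integral_nn_integral)
        (auto intro!: sum_nonneg simp: cong: measurable_cong_sets)
    then show ?thesis by (simp add: has_bochner_integral_iff)
  qed
  have p: "integrable (F i) (\<lambda>x. max 0 (f x))" "integrable (F i) (\<lambda>x. max 0 (- f x))" if "i \<in> I" for i
    using f(2)[OF that] by auto
  note P = pos[of "\<lambda>x. max 0 (f x)"] and N = pos[of "\<lambda>x. max 0 (- f x)"]
  have eq: "f x = max 0 (f x) - max 0 (- f x)" for x by (simp add: max_def)
  have P': "integrable (sum_measure I M F) (\<lambda>x. max 0 (f x))"
    "(LINT x|sum_measure I M F. max 0 (f x)) = (\<Sum>i\<in>I. LINT x|F i. max 0 (f x))"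
    using P p f(1) by auto
  have N': "integrable (sum_measure I M F) (\<lambda>x. max 0 (- f x))"
    "(LINT x|sum_measure I M F. max 0 (- f x)) = (\<Sum>i\<in>I. LINT x|F i. max 0 (- f x))"
    using N p f(1) by auto
  have "integrable (sum_measure I M F) (\<lambda>x. max 0 (f x) - max 0 (- f x))"
    by (intro Bochner_Integration.integrable_diff P' N')
  then show "integrable (sum_measure I M F) f" by (simp only: eq[symmetric])
  have "(LINT x|sum_measure I M F. max 0 (f x) - max 0 (- f x))
      = (\<Sum>i\<in>I. LINT x|F i. max 0 (f x)) - (\<Sum>i\<in>I. LINT x|F i. max 0 (- f x))"
    using P' N' by simp
  also have "\<dots> = (\<Sum>i\<in>I. (LINT x|F i. max 0 (f x) - max 0 (- f x)))"
    using p by (simp add: sum_subtractf)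
  finally show "(LINT x|sum_measure I M F. f x) = (\<Sum>i\<in>I. LINT x|F i. f x)"
    by (simp only: eq[symmetric])
qed

lemma sums_integral_disjoint:
  fixes f :: "'a \<Rightarrow> 'b::{banach, second_countable_topology}"
  assumes f: "integrable M f" and A: "\<And>n::nat. A n \<in> sets M" "disjoint_family A"
  shows "(\<lambda>n. LINT x|M. indicator (A n) x *\<^sub>R f x) sums (LINT x|M. indicator (\<Union>n. A n) x *\<^sub>R f x)"
proof -
  have i: "integrable M (\<lambda>x. indicator (A n) x *\<^sub>R f x)" for n
    using f A by (intro integrable_mult_indicator)
  have U: "(\<Union>n. A n) \<in> sets M" using A by auto
  have dj: "A i \<inter> A j = {}" if "i \<noteq> j" for i j
    using A(2) that by (auto simp: disjoint_family_on_def)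
  have s: "(\<lambda>n. indicator (A n) x *\<^sub>R f x) sums (indicator (\<Union>n. A n) x *\<^sub>R f x)" for x
    by (intro sums_scaleR_left indicator_sums dj)
  have le: "norm (\<Sum>n<N. indicator (A n) x *\<^sub>R f x) \<le> norm (f x)" for N x
  proof -
    have "(\<Sum>n<N. indicator (A n) x *\<^sub>R f x) = (\<Sum>n<N. indicator (A n) x :: real) *\<^sub>R f x"
      by (simp add: scaleR_sum_left)
    moreover have "(\<Sum>n<N. indicator (A n) x :: real) \<le> indicator (\<Union>n. A n) x"
      using indicator_sums[of A x, OF dj] by (intro sum_le_suminf[THEN order_trans]) (auto simp: sums_iff)
    then have "(\<Sum>n<N. indicator (A n) x :: real) \<le> 1"
      by (rule order_trans) (rule indicator_le_1)
    moreover have "0 \<le> (\<Sum>n<N. indicator (A n) x :: real)" by (intro sum_nonneg) simp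
    ultimately show ?thesis by (simp add: mult_left_le_one_le)
  qed
  have "(\<lambda>N. LINT x|M. (\<Sum>n<N. indicator (A n) x *\<^sub>R f x)) \<longlonglongrightarrow> (LINT x|M. indicator (\<Union>n. A n) x *\<^sub>R f x)"
  proof (rule integral_dominated_convergence[where w = "\<lambda>x. norm (f x)"])
    show "(\<lambda>x. indicator (\<Union>n. A n) x *\<^sub>R f x) \<in> borel_measurable M"
      using f U by (intro borel_measurable_integrable integrable_mult_indicator)
    show "(\<lambda>x. \<Sum>n<N. indicator (A n) x *\<^sub>R f x) \<in> borel_measurable M" for N
      using i by (intro borel_measurable_sum borel_measurable_integrable)
    show "AE x in M. (\<lambda>N. \<Sum>n<N. indicator (A n) x *\<^sub>R f x) \<longlonglongrightarrow> indicator (\<Union>n. A n) x *\<^sub>R f x"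
      using s by (simp add: sums_def)
  qed (use f le in auto)
  then show ?thesis unfolding sums_def Bochner_Integration.integral_sum[OF i] .
qed

text \<open>The map X allows the density to live on another space than \<Omega>: it is the identity
  for densities on \<Omega>, and \<open>fst\<close> for measures on pairs of a point and a
  direction.\<close>

lemma variation_le:
  fixes X :: "'c \<Rightarrow> 'a::euclidean_space" and h :: "'c \<Rightarrow> 'b::euclidean_space"
  assumes h: "integrable M h"
    and X: "\<And>A. A \<in> sets (restrict_space borel \<Omega>) \<Longrightarrow> X -` A \<inter> space M \<in> sets M"
    and \<mu>: "\<And>A. A \<in> sets (restrict_space borel \<Omega>) \<Longrightarrow> \<mu> A = (LINT z|M. indicator A (X z) *\<^sub>R h z)"
  shows "variation \<Omega> \<mu> \<le> ennreal (LINT z|M. norm (h z))"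
  unfolding variation_def
proof (rule SUP_least)
  fix A :: "nat \<Rightarrow> 'a set"
  assume "A \<in> {A. range A \<subseteq> sets (restrict_space borel \<Omega>) \<and> disjoint_family A \<and> (\<Union>n. A n) = \<Omega>}"
  then have A: "\<And>n. A n \<in> sets (restrict_space borel \<Omega>)" "disjoint_family A" by auto
  define B where "B n = X -` A n \<inter> space M" for n
  have "\<And>n. B n \<in> sets M" unfolding B_def by (rule X[OF A(1)])
  moreover have "disjoint_family B" using A(2) unfolding B_def disjoint_family_on_def by blast
  ultimately have B: "\<And>n. B n \<in> sets M" "disjoint_family B" by blast+
  have UB: "(\<Union>n. B n) \<in> sets M" using B by auto
  have hn: "integrable M (\<lambda>z. norm (h z))" using h by simp
  have le: "norm (\<mu> (A n)) \<le> (LINT z|M. indicator (B n) z *\<^sub>R norm (h z))" for n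
  proof -
    have "norm (\<mu> (A n)) \<le> (LINT z|M. norm (indicator (A n) (X z) *\<^sub>R h z))"
      unfolding \<mu>[OF A(1)] by (rule integral_norm_bound)
    also have "\<dots> = (LINT z|M. indicator (B n) z *\<^sub>R norm (h z))"
      by (intro Bochner_Integration.integral_cong) (auto simp: B_def indicator_def)
    finally show ?thesis .
  qed
  note s = sums_integral_disjoint[OF hn B]
  have nn: "0 \<le> (LINT z|M. indicator (B n) z *\<^sub>R norm (h z))" for n
    by (intro Bochner_Integration.integral_nonneg) simp
  have "(\<Sum>n. ennreal (norm (\<mu> (A n)))) \<le> (\<Sum>n. ennreal (LINT z|M. indicator (B n) z *\<^sub>R norm (h z)))"
    using le by (intro suminf_le) (auto intro: ennreal_leI)
  also have "\<dots> = ennreal (LINT z|M. indicator (\<Union>n. B n) z *\<^sub>R norm (h z))"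
    using s nn by (simp only: suminf_ennreal2 sums_iff)
  also have "\<dots> \<le> ennreal (LINT z|M. norm (h z))"
    using hn UB by (intro ennreal_leI integral_mono integrable_mult_indicator) (auto simp: indicator_def)
  finally show "(\<Sum>n. ennreal (norm (\<mu> (A n)))) \<le> ennreal (LINT z|M. norm (h z))" .
qed

text \<open>The lower bound uses the level sets of a simple function close to the density.\<close>

lemma variation_density:
  fixes h :: "'a::euclidean_space \<Rightarrow> 'b::euclidean_space"
  assumes \<Omega>: "open \<Omega>" and M: "sets M = sets (restrict_space borel \<Omega>)" and h: "integrable M h"
    and \<mu>: "\<And>A. A \<in> sets (restrict_space borel \<Omega>) \<Longrightarrow> \<mu> A = (LINT x|M. indicator A x *\<^sub>R h x)"
  shows "variation \<Omega> \<mu> = ennreal (LINT x|M. norm (h x))"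
proof (rule antisym)
  show "variation \<Omega> \<mu> \<le> ennreal (LINT x|M. norm (h x))"
    by (rule variation_le[OF h, where X = "\<lambda>x. x"]) (use M \<mu> in auto)
  have sp: "space M = \<Omega>" using sets_eq_imp_space_eq[OF M] by (simp add: space_restrict_space)
  have hm: "h \<in> borel_measurable M" using h by simp
  have "\<exists>F. (\<forall>i. simple_function M (F i)) \<and> (\<forall>x\<in>space M. (\<lambda>i. F i x) \<longlonglongrightarrow> h x) \<and>
      (\<forall>i. \<forall>x\<in>space M. norm (F i x) \<le> 2 * norm (h x))"
    using borel_measurable_implies_sequence_metric[OF hm, of 0] by simp
  then obtain s where s: "\<And>i. simple_function M (s i)"
    "\<And>x. x \<in> space M \<Longrightarrow> (\<lambda>i. s i x) \<longlonglongrightarrow> h x" "\<And>i x. x \<in> space M \<Longrightarrow> norm (s i x) \<le> 2 * norm (h x)"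
    by blast
  have sm: "s i \<in> borel_measurable M" for i using s(1) by (rule borel_measurable_simple_function)
  have si: "integrable M (s i)" for i
    by (rule Bochner_Integration.integrable_bound[of M "\<lambda>x. 2 * norm (h x)"])
      (use h s(3) sm in \<open>auto intro!: AE_I2\<close>)
  have bound: "ennreal ((LINT x|M. norm (h x)) - 2 * (LINT x|M. norm (h x - s i x))) \<le> variation \<Omega> \<mu>" for i
  proof -
    let ?r = "s i ` space M"
    have fin: "finite ?r" using s(1) by (rule simple_functionD)
    define k where "k = to_nat_on ?r"
    have k: "inj_on k ?r" unfolding k_def by (intro inj_on_to_nat_on countable_finite fin)
    define A where "A n = {x \<in> \<Omega>. k (s i x) = n}" for n
    have "A n = s i -` {v. k v = n} \<inter> space M" for n by (auto simp: A_def sp)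
    then have Am: "A n \<in> sets M" for n using s(1) by (simp add: simple_functionD(2))
    then have AM: "A n \<in> sets (restrict_space borel \<Omega>)" for n using M by simp
    have Ad: "disjoint_family A" by (auto simp: disjoint_family_on_def A_def)
    have AU: "(\<Union>n. A n) = \<Omega>" by (auto simp: A_def)
    have const: "\<exists>v. \<forall>x\<in>A n. s i x = v" for n
    proof (cases "A n = {}")
      case False
      then obtain x0 where x0: "x0 \<in> A n" by blast
      have "s i x = s i x0" if "x \<in> A n" for x
        using inj_onD[OF k, of "s i x" "s i x0"] that x0 by (auto simp: A_def sp)
      then show ?thesis by blast
    qed auto
    have hs: "integrable M (\<lambda>x. h x - s i x)" using h si by simp
    note int = integrable_mult_indicator[OF Am h] integrable_mult_indicator[OF Am si]
      integrable_mult_indicator[OF Am hs] integrable_mult_indicator[OF Am integrable_norm[OF h]]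
      integrable_mult_indicator[OF Am integrable_norm[OF si]]
      integrable_mult_indicator[OF Am integrable_norm[OF hs]]
    let ?H = "\<lambda>n. LINT x|M. indicator (A n) x *\<^sub>R norm (h x)"
    let ?D = "\<lambda>n. LINT x|M. indicator (A n) x *\<^sub>R norm (h x - s i x)"
    \<comment> \<open>The simple function replaces the density twice, inside the norm of the
      integral and inside the integral of the norm; this explains the factor 2.\<close>
    have low: "?H n - 2 * ?D n \<le> norm (\<mu> (A n))" for n
    proof -
      obtain v where v: "\<And>x. x \<in> A n \<Longrightarrow> s i x = v" using const by blast
      have "(LINT x|M. indicator (A n) x *\<^sub>R s i x) = (LINT x|M. indicator (A n) x *\<^sub>R v)"
        using v by (intro Bochner_Integration.integral_cong) (auto simp: indicator_def)
      also have "\<dots> = (LINT x|M. indicator (A n) x) *\<^sub>R v"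
      \<comment> \<open>M may be infinite. The integrability of \<open>s i\<close> bounds the
        measure of \<open>A n\<close> only if v is nonzero.\<close>
      proof (cases "v = 0")
        case False
        have "integrable M (\<lambda>x. indicator (A n) x *\<^sub>R v)"
        proof -
          have "(\<lambda>x. indicator (A n) x *\<^sub>R v) = (\<lambda>x. indicator (A n) x *\<^sub>R s i x)"
            using v by (auto simp: indicator_def fun_eq_iff)
          then show ?thesis using int(2) by simp
        qed
        then have "integrable M (\<lambda>x. norm (indicator (A n) x *\<^sub>R v))" by (rule integrable_norm)
        then have "integrable M (indicator (A n) :: 'a \<Rightarrow> real)" using False by simp
        then show ?thesis by (intro integral_scaleR_left) simp
      qed simp
      finally have "norm (LINT x|M. indicator (A n) x *\<^sub>R s i x) = measure M (A n) * norm v"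
        using Am by simp
      also have "\<dots> = (LINT x|M. indicator (A n) x *\<^sub>R norm v)" using Am by simp
      also have "\<dots> = (LINT x|M. indicator (A n) x *\<^sub>R norm (s i x))"
        using v by (intro Bochner_Integration.integral_cong) (auto simp: indicator_def)
      finally have 1: "norm (LINT x|M. indicator (A n) x *\<^sub>R s i x) = (LINT x|M. indicator (A n) x *\<^sub>R norm (s i x))" .
      have 2: "?H n \<le> (LINT x|M. indicator (A n) x *\<^sub>R norm (s i x)) + ?D n"
      proof -
        have "?H n \<le> (LINT x|M. indicator (A n) x *\<^sub>R norm (s i x) + indicator (A n) x *\<^sub>R norm (h x - s i x))"
        proof (rule integral_mono[OF int(4) Bochner_Integration.integrable_add[OF int(5,6)]])
          show "indicator (A n) x *\<^sub>R norm (h x) \<le> indicator (A n) x *\<^sub>R norm (s i x) + indicator (A n) x *\<^sub>R norm (h x - s i x)" for x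
            using norm_triangle_sub[of "h x" "s i x"] by (simp add: indicator_def)
        qed
        then show ?thesis using int by simp
      qed
      have 3: "norm ((LINT x|M. indicator (A n) x *\<^sub>R s i x) - \<mu> (A n)) \<le> ?D n"
      proof -
        have "(LINT x|M. indicator (A n) x *\<^sub>R s i x) - \<mu> (A n) = - (LINT x|M. indicator (A n) x *\<^sub>R (h x - s i x))"
          unfolding \<mu>[OF AM] using int by (simp add: scaleR_diff_right)
        then have "norm ((LINT x|M. indicator (A n) x *\<^sub>R s i x) - \<mu> (A n)) \<le> (LINT x|M. norm (indicator (A n) x *\<^sub>R (h x - s i x)))"
          using integral_norm_bound[of M "\<lambda>x. indicator (A n) x *\<^sub>R (h x - s i x)"] by simp
        then show ?thesis by simp
      qed
      have "norm (LINT x|M. indicator (A n) x *\<^sub>R s i x) \<le> norm (\<mu> (A n)) + ?D n"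
        using norm_triangle_sub[of "LINT x|M. indicator (A n) x *\<^sub>R s i x" "\<mu> (A n)"] 3 by linarith
      then show ?thesis using 1 2 by linarith
    qed
    have up: "norm (\<mu> (A n)) \<le> ?H n" for n
      unfolding \<mu>[OF AM] using integral_norm_bound[of M "\<lambda>x. indicator (A n) x *\<^sub>R h x"] by simp
    have full: "(LINT x|M. indicator (\<Union>n. A n) x *\<^sub>R g x) = (LINT x|M. g x)" for g :: "'a \<Rightarrow> real"
      by (intro Bochner_Integration.integral_cong) (auto simp: AU sp)
    have H: "?H sums (LINT x|M. norm (h x))"
      using sums_integral_disjoint[OF integrable_norm[OF h] Am Ad] unfolding full .
    have D: "?D sums (LINT x|M. norm (h x - s i x))"
      using sums_integral_disjoint[OF integrable_norm[OF hs] Am Ad] unfolding full .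
    have HD: "(\<lambda>n. ?H n - 2 * ?D n) sums ((LINT x|M. norm (h x)) - 2 * (LINT x|M. norm (h x - s i x)))"
      by (intro sums_diff H sums_mult D)
    have sum\<mu>: "summable (\<lambda>n. norm (\<mu> (A n)))"
      by (rule summable_comparison_test'[OF sums_summable[OF H]]) (use up in auto)
    have "(LINT x|M. norm (h x)) - 2 * (LINT x|M. norm (h x - s i x)) \<le> (\<Sum>n. norm (\<mu> (A n)))"
      using suminf_le[OF low sums_summable[OF HD] sum\<mu>] HD by (simp only: sums_iff)
    then have "ennreal ((LINT x|M. norm (h x)) - 2 * (LINT x|M. norm (h x - s i x))) \<le> ennreal (\<Sum>n. norm (\<mu> (A n)))"
      by (rule ennreal_leI)
    also have "\<dots> = (\<Sum>n. ennreal (norm (\<mu> (A n))))"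
      by (rule suminf_ennreal2[symmetric]) (use sum\<mu> in auto)
    also have "\<dots> \<le> variation \<Omega> \<mu>"
      unfolding variation_def by (rule SUP_upper) (use AM Ad AU in auto)
    finally show ?thesis .
  qed
  have "(\<lambda>i. LINT x|M. norm (h x - s i x)) \<longlonglongrightarrow> (LINT x|M. 0)"
  proof (rule integral_dominated_convergence[where w = "\<lambda>x. 3 * norm (h x)"])
    show "AE x in M. (\<lambda>i. norm (h x - s i x)) \<longlonglongrightarrow> 0"
    proof (rule AE_I2)
      fix x assume "x \<in> space M"
      from s(2)[OF this] have "(\<lambda>i. norm (h x - s i x)) \<longlonglongrightarrow> norm (h x - h x)" by (intro tendsto_intros)
      then show "(\<lambda>i. norm (h x - s i x)) \<longlonglongrightarrow> 0" by simp
    qed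
    show "AE x in M. norm (norm (h x - s i x)) \<le> 3 * norm (h x)" for i
    proof (rule AE_I2)
      fix x assume "x \<in> space M"
      from s(3)[OF this, of i] show "norm (norm (h x - s i x)) \<le> 3 * norm (h x)"
        using norm_triangle_ineq4[of "h x" "s i x"] by simp
    qed
    show "(\<lambda>x. norm (h x - s i x)) \<in> borel_measurable M" for i using hm sm[of i] by simp
  qed (use h in auto)
  then have "(\<lambda>i. (LINT x|M. norm (h x)) - 2 * (LINT x|M. norm (h x - s i x))) \<longlonglongrightarrow> (LINT x|M. norm (h x)) - 2 * 0"
    by (intro tendsto_intros) simp
  then have "(\<lambda>i. ennreal ((LINT x|M. norm (h x)) - 2 * (LINT x|M. norm (h x - s i x)))) \<longlonglongrightarrow> ennreal (LINT x|M. norm (h x))"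
    by (intro tendsto_ennrealI) simp
  then show "ennreal (LINT x|M. norm (h x)) \<le> variation \<Omega> \<mu>"
    by (rule LIMSEQ_le_const2) (use bound in blast)
qed

section \<open>Derivatives of functions of bounded variation\<close>

lemma Radon_Nikodym_real:
  assumes \<sigma>: "finite_measure \<sigma>" and Q: "finite_measure Q" "sets Q = sets \<sigma>"
    and le: "\<And>A. A \<in> sets \<sigma> \<Longrightarrow> emeasure Q A \<le> emeasure \<sigma> A"
  obtains q :: "'a \<Rightarrow> real" where "integrable \<sigma> q"
    "\<And>A. A \<in> sets \<sigma> \<Longrightarrow> measure Q A = (LINT x|\<sigma>. indicator A x * q x)"
proof -
  interpret finite_measure \<sigma> by fact
  interpret Q: finite_measure Q by fact
  have "absolutely_continuous \<sigma> Q"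
    unfolding absolutely_continuous_def
  proof
    fix A assume "A \<in> null_sets \<sigma>"
    then have A: "emeasure \<sigma> A = 0" "A \<in> sets \<sigma>" by auto
    with le[OF A(2)] show "A \<in> null_sets Q" using Q(2) by (intro null_setsI) auto
  qed
  then obtain f where f[measurable]: "f \<in> borel_measurable \<sigma>" and dens: "density \<sigma> f = Q"
    using Radon_Nikodym Q(2) by blast
  have e: "emeasure Q A = (\<integral>\<^sup>+ x. f x * indicator A x \<partial>\<sigma>)" if "A \<in> sets \<sigma>" for A
    using that unfolding dens[symmetric] by (rule emeasure_density[OF f])
  have tot: "(\<integral>\<^sup>+ x. f x \<partial>\<sigma>) \<noteq> \<infinity>"
  proof -
    have "(\<integral>\<^sup>+ x. f x \<partial>\<sigma>) = (\<integral>\<^sup>+ x. f x * indicator (space \<sigma>) x \<partial>\<sigma>)"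
      by (intro nn_integral_cong) simp
    also have "\<dots> = emeasure Q (space \<sigma>)" by (rule e[symmetric]) simp
    finally show ?thesis by simp
  qed
  then have fin: "AE x in \<sigma>. f x \<noteq> \<infinity>" by (intro nn_integral_PInf_AE) auto
  define q where "q x = enn2real (f x)" for x
  have [measurable]: "q \<in> borel_measurable \<sigma>" unfolding q_def[abs_def] by measurable
  have fq: "AE x in \<sigma>. f x = ennreal (q x)"
    using fin by eventually_elim (simp add: q_def top.not_eq_extremum)
  have "(\<integral>\<^sup>+ x. ennreal (q x) \<partial>\<sigma>) = (\<integral>\<^sup>+ x. f x \<partial>\<sigma>)"
    by (intro nn_integral_cong_AE) (use fq in \<open>eventually_elim, simp\<close>)
  then have int: "integrable \<sigma> q"
    using tot by (intro integrableI_nonneg) (auto simp: q_def top.not_eq_extremum)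
  have "measure Q A = (LINT x|\<sigma>. indicator A x * q x)" if A[measurable]: "A \<in> sets \<sigma>" for A
  proof -
    have "(LINT x|\<sigma>. indicator A x * q x) = enn2real (\<integral>\<^sup>+ x. ennreal (indicator A x * q x) \<partial>\<sigma>)"
      by (intro integral_eq_nn_integral) (auto simp: q_def)
    also have "(\<integral>\<^sup>+ x. ennreal (indicator A x * q x) \<partial>\<sigma>) = (\<integral>\<^sup>+ x. f x * indicator A x \<partial>\<sigma>)"
    proof (rule nn_integral_cong_AE)
      show "AE x in \<sigma>. ennreal (indicator A x * q x) = f x * indicator A x"
        using fq by eventually_elim (simp add: indicator_def)
    qed
    finally show ?thesis using e[OF A] by (simp add: measure_def)
  qed
  with int show ?thesis by (rule that)
qed

lemma density_real_facts:
  fixes g :: "'a \<Rightarrow> real"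
  assumes \<sigma>: "integrable \<sigma> g" and g0: "\<And>x. 0 \<le> g x"
  shows "finite_measure (density \<sigma> (\<lambda>x. ennreal (g x)))"
    and "A \<in> sets \<sigma> \<Longrightarrow> emeasure (density \<sigma> (\<lambda>x. ennreal (g x))) A = ennreal (LINT x|\<sigma>. indicator A x * g x)"
    and "\<phi> \<in> borel_measurable \<sigma> \<Longrightarrow>
      (LINT x|density \<sigma> (\<lambda>x. ennreal (g x)). \<phi> x) = (LINT x|\<sigma>. \<phi> x * (g x :: real))"
proof -
  have [measurable]: "g \<in> borel_measurable \<sigma>" using \<sigma> by simp
  have e: "emeasure (density \<sigma> (\<lambda>x. ennreal (g x))) A = ennreal (LINT x|\<sigma>. indicator A x * g x)" if [measurable]: "A \<in> sets \<sigma>" for A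
  proof -
    have "emeasure (density \<sigma> (\<lambda>x. ennreal (g x))) A = (\<integral>\<^sup>+ x. ennreal (indicator A x * g x) \<partial>\<sigma>)"
      by (subst emeasure_density) (auto intro!: nn_integral_cong simp: indicator_def)
    also have "\<dots> = ennreal (LINT x|\<sigma>. indicator A x * g x)"
      using \<sigma> g0 integrable_real_mult_indicator[OF that \<sigma>]
      by (intro nn_integral_eq_integral) (auto simp: mult.commute)
    finally show ?thesis .
  qed
  then show "A \<in> sets \<sigma> \<Longrightarrow> emeasure (density \<sigma> (\<lambda>x. ennreal (g x))) A = ennreal (LINT x|\<sigma>. indicator A x * g x)" .
  show "finite_measure (density \<sigma> (\<lambda>x. ennreal (g x)))"
    by (rule finite_measureI) (simp add: e)
  show "(LINT x|density \<sigma> (\<lambda>x. ennreal (g x)). \<phi> x) = (LINT x|\<sigma>. \<phi> x * g x)" if "\<phi> \<in> borel_measurable \<sigma>"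
    using that g0 by (subst integral_density) (auto simp: mult.commute)
qed

lemma integrable_bounded_finite_measure:
  fixes \<phi> :: "'a \<Rightarrow> real"
  assumes "finite_measure Q" "\<phi> \<in> borel_measurable Q" "\<And>x. \<bar>\<phi> x\<bar> \<le> B"
  shows "integrable Q \<phi>"
  using assms by (intro finite_measure.integrable_const_bound[where B = B]) auto

lemma integrable_bounded_mult:
  fixes \<phi> k :: "'a \<Rightarrow> real"
  assumes k: "integrable Q k" and \<phi>: "\<phi> \<in> borel_measurable Q" "\<And>x. \<bar>\<phi> x\<bar> \<le> B"
  shows "integrable Q (\<lambda>x. \<phi> x * k x)"
proof (rule Bochner_Integration.integrable_bound)
  show "integrable Q (\<lambda>x. B * \<bar>k x\<bar>)" using k by simp
  show "(\<lambda>x. \<phi> x * k x) \<in> borel_measurable Q" using \<phi>(1) k by simp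
  have "\<bar>\<phi> x\<bar> * \<bar>k x\<bar> \<le> B * \<bar>k x\<bar>" for x using \<phi>(2) by (intro mult_right_mono) auto
  then show "AE x in Q. norm (\<phi> x * k x) \<le> norm (B * \<bar>k x\<bar>)"
    by (intro AE_I2) (metis abs_ge_self abs_mult order_trans real_norm_def)
qed

lemma variation_cong:
  assumes "\<And>A. A \<in> sets (restrict_space borel \<Omega>) \<Longrightarrow> \<mu> A = \<nu> A"
  shows "variation \<Omega> \<mu> = variation \<Omega> \<nu>"
  unfolding variation_def
proof (rule SUP_cong[OF refl])
  fix A :: "nat \<Rightarrow> _"
  assume "A \<in> {A. range A \<subseteq> sets (restrict_space borel \<Omega>) \<and> disjoint_family A \<and> \<Union> (range A) = \<Omega>}"
  then have "A n \<in> sets (restrict_space borel \<Omega>)" for n by blast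
  then have "\<mu> (A n) = \<nu> (A n)" for n by (rule assms)
  then show "(\<Sum>n. ennreal (norm (\<mu> (A n)))) = (\<Sum>n. ennreal (norm (\<nu> (A n))))" by simp
qed

context bounded_open_set
begin

abbreviation "BO \<equiv> restrict_space borel \<Omega>"

lemma measurable_BO:
  assumes "sets \<sigma> = sets BO" "f \<in> measurable borel L"
  shows "f \<in> measurable \<sigma> L"
  using measurable_restrict_space1[OF assms(2)] measurable_cong_sets[OF assms(1) refl] by blast

lemma sets_BO_iff: "A \<in> sets BO \<longleftrightarrow> A \<in> sets borel \<and> A \<subseteq> \<Omega>"
  using open_\<Omega> by (subst sets_restrict_space_iff) auto

text \<open>Each of the finitely many positive measures is dominated by their sum \<sigma>, so
  Radon-Nikodym provides densities with respect to one common measure; their differences are the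
  components of h.\<close>

lemma signed_difference_density:
  assumes PN: "\<And>b. b \<in> Basis \<Longrightarrow> \<exists>P N. finite_measure P \<and> sets P = sets BO \<and> finite_measure N \<and>
      sets N = sets BO \<and> (\<forall>A\<in>sets BO. \<mu> A \<bullet> b = measure P A - measure N A)"
  obtains \<sigma> and h :: "'a \<Rightarrow> 'a" where "finite_measure \<sigma>" "sets \<sigma> = sets BO" "integrable \<sigma> h"
    "\<And>A. A \<in> sets BO \<Longrightarrow> \<mu> A = (LINT x|\<sigma>. indicator A x *\<^sub>R h x)"
proof -
  obtain P N where PN: "\<And>b. b \<in> Basis \<Longrightarrow> finite_measure (P b)" "\<And>b. b \<in> Basis \<Longrightarrow> sets (P b) = sets BO"
    "\<And>b. b \<in> Basis \<Longrightarrow> finite_measure (N b)" "\<And>b. b \<in> Basis \<Longrightarrow> sets (N b) = sets BO"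
    "\<And>b A. b \<in> Basis \<Longrightarrow> A \<in> sets BO \<Longrightarrow> \<mu> A \<bullet> b = measure (P b) A - measure (N b) A"
    using PN by metis
  define I where "I = (Basis :: 'a set) \<times> (UNIV :: bool set)"
  define F where "F i = (if snd i then P (fst i) else N (fst i))" for i
  define \<sigma> where "\<sigma> = sum_measure I BO F"
  have I: "finite I" by (simp add: I_def)
  have F: "finite_measure (F i)" "sets (F i) = sets BO" if "i \<in> I" for i
    using that PN by (auto simp: I_def F_def)
  have \<sigma>: "finite_measure \<sigma>" "sets \<sigma> = sets BO"
    unfolding \<sigma>_def using I F by (auto intro: finite_measure_sum_measure)
  have "\<exists>q. integrable \<sigma> q \<and> (\<forall>A\<in>sets BO. measure (F i) A = (LINT x|\<sigma>. indicator A x * q x))" if i: "i \<in> I" for i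
  proof -
    have le: "emeasure (F i) A \<le> emeasure \<sigma> A" if "A \<in> sets \<sigma>" for A
    proof -
      have A: "A \<in> sets BO" using that \<sigma>(2) by simp
      have "emeasure \<sigma> A = (\<Sum>i\<in>I. emeasure (F i) A)"
        unfolding \<sigma>_def by (rule emeasure_sum_measure[OF F(2) A])
      moreover have "emeasure (F i) A \<le> (\<Sum>i\<in>I. emeasure (F i) A)"
        using i I by (intro member_le_sum) auto
      ultimately show ?thesis by simp
    qed
    obtain q :: "'a \<Rightarrow> real" where "integrable \<sigma> q"
      "\<And>A. A \<in> sets \<sigma> \<Longrightarrow> measure (F i) A = (LINT x|\<sigma>. indicator A x * q x)"
      using Radon_Nikodym_real[OF \<sigma>(1) F(1)[OF i] _ le] F(2)[OF i] \<sigma>(2) by metis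
    then show ?thesis using \<sigma>(2) by auto
  qed
  then obtain q where q: "\<And>i. i \<in> I \<Longrightarrow> integrable \<sigma> (q i)"
    "\<And>i A. i \<in> I \<Longrightarrow> A \<in> sets BO \<Longrightarrow> measure (F i) A = (LINT x|\<sigma>. indicator A x * q i x)"
    by metis
  define h where "h x = (\<Sum>b\<in>Basis. (q (b, True) x - q (b, False) x) *\<^sub>R b)" for x
  have bI: "(b, c) \<in> I" if "b \<in> Basis" for b c using that by (simp add: I_def)
  have h: "integrable \<sigma> h"
    unfolding h_def[abs_def] using q(1)[OF bI]
    by (intro Bochner_Integration.integrable_sum integrable_scaleR_left Bochner_Integration.integrable_diff) auto
  have "\<mu> A = (LINT x|\<sigma>. indicator A x *\<^sub>R h x)" if A: "A \<in> sets BO" for A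
  proof (rule euclidean_eqI)
    fix b :: 'a assume b: "b \<in> Basis"
    have A': "A \<in> sets \<sigma>" using A \<sigma>(2) by simp
    have i: "integrable \<sigma> (\<lambda>x. indicator A x * q (b, c) x)" for c
      using integrable_real_mult_indicator[OF A' q(1)[OF bI[OF b]]] by (simp add: mult.commute)
    have hb: "h x \<bullet> b = q (b, True) x - q (b, False) x" for x
      using b by (simp add: h_def inner_sum_left inner_Basis if_distrib cong: if_cong)
    have "(LINT x|\<sigma>. indicator A x *\<^sub>R h x) \<bullet> b = (LINT x|\<sigma>. (indicator A x *\<^sub>R h x) \<bullet> b)"
      by (rule integral_inner_left[symmetric]) (rule integrable_mult_indicator[OF A' h])
    also have "\<dots> = (LINT x|\<sigma>. indicator A x * q (b, True) x - indicator A x * q (b, False) x)"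
      by (simp add: hb right_diff_distrib)
    also have "\<dots> = measure (F (b, True)) A - measure (F (b, False)) A"
      using i q(2)[OF bI[OF b] A] by simp
    finally show "\<mu> A \<bullet> b = (LINT x|\<sigma>. indicator A x *\<^sub>R h x) \<bullet> b"
      using PN(5)[OF b A] by (simp add: F_def)
  qed
  with \<sigma> h show ?thesis by (rule that)
qed

text \<open>P and N need not be the Jordan parts of m. Writing g as g+ - g-, the equation for m says
  that P + g- \<sigma> and N + g+ \<sigma> are the same positive measure, and integrating \<phi>
  against both gives the claim.\<close>

lemma has_signed_integral_density:
  fixes g \<phi> :: "'a \<Rightarrow> real"
  assumes I: "has_signed_integral \<Omega> m \<phi> I"
    and \<sigma>: "finite_measure \<sigma>" "sets \<sigma> = sets BO" and g: "integrable \<sigma> g"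
    and m: "\<And>A. A \<in> sets BO \<Longrightarrow> m A = (LINT x|\<sigma>. indicator A x * g x)"
    and \<phi>: "\<phi> \<in> borel_measurable borel" "\<And>x. \<bar>\<phi> x\<bar> \<le> B"
  shows "I = (LINT x|\<sigma>. \<phi> x * g x)"
proof -
  obtain P N where PN: "finite_measure P" "sets P = sets BO" "finite_measure N" "sets N = sets BO"
    "\<And>A. A \<in> sets BO \<Longrightarrow> m A = measure P A - measure N A"
    "I = (LINT x|P. \<phi> x) - (LINT x|N. \<phi> x)"
    using I unfolding has_signed_integral_def by blast
  interpret P: finite_measure P by fact
  interpret N: finite_measure N by fact
  define gp gn where "gp x = max 0 (g x)" and "gn x = max 0 (- g x)" for x
  have "integrable \<sigma> gp" "integrable \<sigma> gn" unfolding gp_def[abs_def] gn_def[abs_def] using g by auto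
  then have gpn: "integrable \<sigma> gp" "integrable \<sigma> gn" "0 \<le> gp x" "0 \<le> gn x" "g x = gp x - gn x" for x
    by (auto simp: gp_def gn_def max_def)
  \<comment> \<open>Families over the two truth values express sums of two measures: F1 stands for P
    + gn \<sigma> and F2 for N + gp \<sigma>.\<close>
  define F1 F2 where "F1 c = (if c then P else density \<sigma> (\<lambda>x. ennreal (gn x)))"
    and "F2 c = (if c then N else density \<sigma> (\<lambda>x. ennreal (gp x)))" for c
  have F: "sets (F1 c) = sets BO" "sets (F2 c) = sets BO" "finite_measure (F1 c)" "finite_measure (F2 c)" for c
    using PN \<sigma> density_real_facts(1)[OF gpn(1,3)] density_real_facts(1)[OF gpn(2,4)]
    by (auto simp: F1_def F2_def)
  have eq: "sum_measure UNIV BO F1 = sum_measure UNIV BO F2"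
  proof (rule measure_eqI)
    fix A assume "A \<in> sets (sum_measure UNIV BO F1)"
    then have A: "A \<in> sets BO" "A \<in> sets \<sigma>" using \<sigma> by auto
    have i: "integrable \<sigma> (\<lambda>x. indicator A x * gp x)" "integrable \<sigma> (\<lambda>x. indicator A x * gn x)"
      using integrable_real_mult_indicator[OF A(2) gpn(1)] integrable_real_mult_indicator[OF A(2) gpn(2)]
      by (simp_all add: mult.commute)
    have nn: "0 \<le> (LINT x|\<sigma>. indicator A x * gp x)" "0 \<le> (LINT x|\<sigma>. indicator A x * gn x)"
      using gpn by (auto intro!: Bochner_Integration.integral_nonneg)
    have "measure P A - measure N A = (LINT x|\<sigma>. indicator A x * gp x) - (LINT x|\<sigma>. indicator A x * gn x)"
      using PN(5)[OF A(1)] m[OF A(1)] i by (simp add: gpn(5) right_diff_distrib)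
    then have "ennreal (measure P A + (LINT x|\<sigma>. indicator A x * gn x)) = ennreal (measure N A + (LINT x|\<sigma>. indicator A x * gp x))"
      by (intro arg_cong[of _ _ ennreal]) simp
    then show "emeasure (sum_measure UNIV BO F1) A = emeasure (sum_measure UNIV BO F2) A"
      using nn A density_real_facts(2)[OF gpn(1,3) A(2)] density_real_facts(2)[OF gpn(2,4) A(2)]
      unfolding emeasure_sum_measure[OF F(1) A(1)] emeasure_sum_measure[OF F(2) A(1)]
      by (simp add: UNIV_bool F1_def F2_def P.emeasure_eq_measure N.emeasure_eq_measure add.commute)
  qed simp
  have \<phi>m: "\<phi> \<in> borel_measurable Q" if "sets Q = sets BO" for Q using that \<phi>(1) by (rule measurable_BO)
  have i: "integrable (F1 c) \<phi>" "integrable (F2 c) \<phi>" for c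
    by (rule integrable_bounded_finite_measure[OF F(3) \<phi>m[OF F(1)] \<phi>(2)])
      (rule integrable_bounded_finite_measure[OF F(4) \<phi>m[OF F(2)] \<phi>(2)])
  have "(LINT x|sum_measure UNIV BO F1. \<phi> x) = (LINT x|P. \<phi> x) + (LINT x|\<sigma>. \<phi> x * gn x)"
    using integral_sum_measure(2)[of UNIV F1 BO \<phi>, OF finite F(1) \<phi>m[OF refl] i(1)]
      density_real_facts(3)[OF gpn(2,4) \<phi>m[OF \<sigma>(2)]] by (simp add: UNIV_bool F1_def add.commute)
  moreover have "(LINT x|sum_measure UNIV BO F2. \<phi> x) = (LINT x|N. \<phi> x) + (LINT x|\<sigma>. \<phi> x * gp x)"
    using integral_sum_measure(2)[of UNIV F2 BO \<phi>, OF finite F(2) \<phi>m[OF refl] i(2)]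
      density_real_facts(3)[OF gpn(1,3) \<phi>m[OF \<sigma>(2)]] by (simp add: UNIV_bool F2_def add.commute)
  moreover have "(LINT x|\<sigma>. \<phi> x * g x) = (LINT x|\<sigma>. \<phi> x * gp x) - (LINT x|\<sigma>. \<phi> x * gn x)"
  proof -
    have "integrable \<sigma> (\<lambda>x. \<phi> x * gp x)" "integrable \<sigma> (\<lambda>x. \<phi> x * gn x)"
      by (rule integrable_bounded_mult[OF gpn(1) \<phi>m[OF \<sigma>(2)] \<phi>(2)])
        (rule integrable_bounded_mult[OF gpn(2) \<phi>m[OF \<sigma>(2)] \<phi>(2)])
    then show ?thesis by (simp add: gpn(5) right_diff_distrib)
  qed
  ultimately show ?thesis using eq PN(6) by simp
qed

text \<open>Moving negative parts across the equation leaves two positive measures, g+ \<sigma> +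
  g'- \<sigma>' and g- \<sigma> + g'+ \<sigma>', which agree on test functions and therefore
  coincide.\<close>

lemma density_unique_test_functions:
  fixes g g' :: "'a \<Rightarrow> real"
  assumes \<sigma>: "finite_measure \<sigma>" "sets \<sigma> = sets BO" and g: "integrable \<sigma> g"
    and \<sigma>': "finite_measure \<sigma>'" "sets \<sigma>' = sets BO" and g': "integrable \<sigma>' g'"
    and eq: "\<And>\<phi>. \<phi> \<in> test_functions \<Omega> \<Longrightarrow> (LINT x|\<sigma>. \<phi> x * g x) = (LINT x|\<sigma>'. \<phi> x * g' x)"
    and A: "A \<in> sets BO"
  shows "(LINT x|\<sigma>. indicator A x * g x) = (LINT x|\<sigma>'. indicator A x * g' x)"
proof -
  define gp gn where "gp x = max 0 (g x)" and "gn x = max 0 (- g x)" for x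
  have "integrable \<sigma> gp" "integrable \<sigma> gn" unfolding gp_def[abs_def] gn_def[abs_def] using g by auto
  then have gpn: "integrable \<sigma> gp" "integrable \<sigma> gn" "0 \<le> gp x" "0 \<le> gn x" "g x = gp x - gn x" for x
    by (auto simp: gp_def gn_def max_def)
  define gp' gn' where "gp' x = max 0 (g' x)" and "gn' x = max 0 (- g' x)" for x
  have "integrable \<sigma>' gp'" "integrable \<sigma>' gn'" unfolding gp'_def[abs_def] gn'_def[abs_def] using g' by auto
  then have gpn': "integrable \<sigma>' gp'" "integrable \<sigma>' gn'" "0 \<le> gp' x" "0 \<le> gn' x" "g' x = gp' x - gn' x" for x
    by (auto simp: gp'_def gn'_def max_def)
  define F1 F2 where "F1 c = (if c then density \<sigma> (\<lambda>x. ennreal (gp x)) else density \<sigma>' (\<lambda>x. ennreal (gn' x)))"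
    and "F2 c = (if c then density \<sigma> (\<lambda>x. ennreal (gn x)) else density \<sigma>' (\<lambda>x. ennreal (gp' x)))" for c
  have F: "sets (F1 c) = sets BO" "sets (F2 c) = sets BO" "finite_measure (F1 c)" "finite_measure (F2 c)" for c
    using \<sigma> \<sigma>' density_real_facts(1)[OF gpn(1,3)] density_real_facts(1)[OF gpn(2,4)]
      density_real_facts(1)[OF gpn'(1,3)] density_real_facts(1)[OF gpn'(2,4)]
    by (auto simp: F1_def F2_def)
  have "sum_measure UNIV BO F1 = sum_measure UNIV BO F2"
  proof (rule finite_measure_eqI_test_functions[OF open_\<Omega>])
    show "finite_measure (sum_measure UNIV BO F1)" "finite_measure (sum_measure UNIV BO F2)"
      by (intro finite_measure_sum_measure F finite)+
    fix \<phi> assume \<phi>: "\<phi> \<in> test_functions \<Omega>"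
    obtain B where B: "\<And>x. \<bar>\<phi> x\<bar> \<le> B" using test_functions_bounded[OF \<phi>] by blast
    have \<phi>m: "\<phi> \<in> borel_measurable Q" if "sets Q = sets BO" for Q
      using that test_functions_borel[OF \<phi>] by (rule measurable_BO)
    have i: "integrable (F1 c) \<phi>" "integrable (F2 c) \<phi>" for c
      by (rule integrable_bounded_finite_measure[OF F(3) \<phi>m[OF F(1)] B])
        (rule integrable_bounded_finite_measure[OF F(4) \<phi>m[OF F(2)] B])
    have j: "integrable Q (\<lambda>x. \<phi> x * k x)" if "integrable Q k" "sets Q = sets BO" for Q k
      by (rule integrable_bounded_mult[OF that(1) \<phi>m[OF that(2)] B])
    have "(LINT x|sum_measure UNIV BO F1. \<phi> x) = (LINT x|\<sigma>. \<phi> x * gp x) + (LINT x|\<sigma>'. \<phi> x * gn' x)"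
      using integral_sum_measure(2)[of UNIV F1 BO \<phi>, OF finite F(1) \<phi>m[OF refl] i(1)]
        density_real_facts(3)[OF gpn(1,3) \<phi>m[OF \<sigma>(2)]] density_real_facts(3)[OF gpn'(2,4) \<phi>m[OF \<sigma>'(2)]]
      by (simp add: UNIV_bool F1_def add.commute)
    moreover have "(LINT x|sum_measure UNIV BO F2. \<phi> x) = (LINT x|\<sigma>. \<phi> x * gn x) + (LINT x|\<sigma>'. \<phi> x * gp' x)"
      using integral_sum_measure(2)[of UNIV F2 BO \<phi>, OF finite F(2) \<phi>m[OF refl] i(2)]
        density_real_facts(3)[OF gpn(2,4) \<phi>m[OF \<sigma>(2)]] density_real_facts(3)[OF gpn'(1,3) \<phi>m[OF \<sigma>'(2)]]
      by (simp add: UNIV_bool F2_def add.commute)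
    moreover have "(LINT x|\<sigma>. \<phi> x * g x) = (LINT x|\<sigma>. \<phi> x * gp x) - (LINT x|\<sigma>. \<phi> x * gn x)"
      using j[OF gpn(1) \<sigma>(2)] j[OF gpn(2) \<sigma>(2)] by (simp add: gpn(5) right_diff_distrib)
    moreover have "(LINT x|\<sigma>'. \<phi> x * g' x) = (LINT x|\<sigma>'. \<phi> x * gp' x) - (LINT x|\<sigma>'. \<phi> x * gn' x)"
      using j[OF gpn'(1) \<sigma>'(2)] j[OF gpn'(2) \<sigma>'(2)] by (simp add: gpn'(5) right_diff_distrib)
    ultimately show "(LINT x|sum_measure UNIV BO F1. \<phi> x) = (LINT x|sum_measure UNIV BO F2. \<phi> x)"
      using eq[OF \<phi>] by linarith
  qed simp_all
  then have e: "emeasure (sum_measure UNIV BO F1) A = emeasure (sum_measure UNIV BO F2) A" by simp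
  have A': "A \<in> sets \<sigma>" "A \<in> sets \<sigma>'" using A \<sigma> \<sigma>' by auto
  have i: "integrable \<sigma> (\<lambda>x. indicator A x * gp x)" "integrable \<sigma> (\<lambda>x. indicator A x * gn x)"
    "integrable \<sigma>' (\<lambda>x. indicator A x * gp' x)" "integrable \<sigma>' (\<lambda>x. indicator A x * gn' x)"
    using integrable_real_mult_indicator[OF A'(1) gpn(1)] integrable_real_mult_indicator[OF A'(1) gpn(2)]
      integrable_real_mult_indicator[OF A'(2) gpn'(1)] integrable_real_mult_indicator[OF A'(2) gpn'(2)]
    by (simp_all add: mult.commute)
  have nn: "0 \<le> (LINT x|\<sigma>. indicator A x * gp x)" "0 \<le> (LINT x|\<sigma>. indicator A x * gn x)"
    "0 \<le> (LINT x|\<sigma>'. indicator A x * gp' x)" "0 \<le> (LINT x|\<sigma>'. indicator A x * gn' x)"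
    using gpn gpn' by (auto intro!: Bochner_Integration.integral_nonneg)
  have "ennreal ((LINT x|\<sigma>. indicator A x * gp x) + (LINT x|\<sigma>'. indicator A x * gn' x))
      = ennreal ((LINT x|\<sigma>. indicator A x * gn x) + (LINT x|\<sigma>'. indicator A x * gp' x))"
    using e A nn density_real_facts(2)[OF gpn(1,3) A'(1)] density_real_facts(2)[OF gpn(2,4) A'(1)]
      density_real_facts(2)[OF gpn'(1,3) A'(2)] density_real_facts(2)[OF gpn'(2,4) A'(2)]
    unfolding emeasure_sum_measure[OF F(1) A] emeasure_sum_measure[OF F(2) A]
    by (simp add: UNIV_bool F1_def F2_def add.commute)
  then have "(LINT x|\<sigma>. indicator A x * gp x) + (LINT x|\<sigma>'. indicator A x * gn' x)
      = (LINT x|\<sigma>. indicator A x * gn x) + (LINT x|\<sigma>'. indicator A x * gp' x)"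
    using nn by (subst (asm) ennreal_inj) auto
  then show ?thesis using i by (simp add: gpn(5) gpn'(5) right_diff_distrib)
qed

section \<open>Distributional derivatives as densities\<close>

lemma measure_derivative_density:
  assumes "has_measure_derivative \<Omega> v \<mu>"
  obtains \<sigma> and h :: "'a \<Rightarrow> 'a" where "finite_measure \<sigma>" "sets \<sigma> = sets BO" "integrable \<sigma> h"
    "\<And>A. A \<in> sets BO \<Longrightarrow> \<mu> A = (LINT x|\<sigma>. indicator A x *\<^sub>R h x)"
    "\<And>\<phi> b. \<phi> \<in> test_functions \<Omega> \<Longrightarrow> b \<in> Basis \<Longrightarrow>
      (LINT x|M. v x * partial_deriv b \<phi> x) = - (LINT x|\<sigma>. \<phi> x * (h x \<bullet> b))"
proof -
  have hs: "has_signed_integral \<Omega> (\<lambda>A. \<mu> A \<bullet> b) \<phi> (- (LINT x|M. v x * partial_deriv b \<phi> x))"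
    if "\<phi> \<in> test_functions \<Omega>" "b \<in> Basis" for \<phi> b
    using assms that by (simp add: has_measure_derivative_def)
  \<comment> \<open>The decomposition into P and N is a by-product of
    \<open>has_signed_integral\<close> for any single test function, such as zero.\<close>
  have "\<exists>P N. finite_measure P \<and> sets P = sets BO \<and> finite_measure N \<and>
      sets N = sets BO \<and> (\<forall>A\<in>sets BO. \<mu> A \<bullet> b = measure P A - measure N A)" if "b \<in> Basis" for b
    using hs[OF test_functions_zero that] unfolding has_signed_integral_def by blast
  then obtain \<sigma> and h :: "'a \<Rightarrow> 'a" where \<sigma>: "finite_measure \<sigma>" "sets \<sigma> = sets BO" and h: "integrable \<sigma> h"
    and \<mu>: "\<And>A. A \<in> sets BO \<Longrightarrow> \<mu> A = (LINT x|\<sigma>. indicator A x *\<^sub>R h x)"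
    using signed_difference_density[of \<mu>] by blast
  have "(LINT x|M. v x * partial_deriv b \<phi> x) = - (LINT x|\<sigma>. \<phi> x * (h x \<bullet> b))"
    if \<phi>: "\<phi> \<in> test_functions \<Omega>" and b: "b \<in> Basis" for \<phi> b
  proof -
    obtain B where B: "\<And>x. \<bar>\<phi> x\<bar> \<le> B" using test_functions_bounded[OF \<phi>] by blast
    have m: "\<mu> A \<bullet> b = (LINT x|\<sigma>. indicator A x * (h x \<bullet> b))" if A: "A \<in> sets BO" for A
    proof -
      have "integrable \<sigma> (\<lambda>x. indicator A x *\<^sub>R h x)" using A \<sigma>(2) h by (intro integrable_mult_indicator) auto
      from integral_inner_left[OF this, of b] show ?thesis using \<mu>[OF A] by simp
    qed
    have "- (LINT x|M. v x * partial_deriv b \<phi> x) = (LINT x|\<sigma>. \<phi> x * (h x \<bullet> b))"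
      by (rule has_signed_integral_density[OF hs[OF \<phi> b] \<sigma> _ m test_functions_borel[OF \<phi>] B]) (use h in simp)
    then show ?thesis by simp
  qed
  with \<sigma> h \<mu> show ?thesis by (rule that)
qed

text \<open>Makes the choice of \<mu> in \<open>TV\<close> immaterial, so that a bound for the
  variation of any one derivative measure is a bound for \<open>TV\<close>.\<close>

lemma measure_derivative_unique:
  assumes "has_measure_derivative \<Omega> v \<mu>" "has_measure_derivative \<Omega> v \<nu>" and A: "A \<in> sets BO"
  shows "\<mu> A = \<nu> A"
proof -
  obtain \<sigma> and h :: "'a \<Rightarrow> 'a" where \<sigma>: "finite_measure \<sigma>" "sets \<sigma> = sets BO" and h: "integrable \<sigma> h"
    and \<mu>: "\<And>A. A \<in> sets BO \<Longrightarrow> \<mu> A = (LINT x|\<sigma>. indicator A x *\<^sub>R h x)"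
    and d: "\<And>\<phi> b. \<phi> \<in> test_functions \<Omega> \<Longrightarrow> b \<in> Basis \<Longrightarrow>
      (LINT x|M. v x * partial_deriv b \<phi> x) = - (LINT x|\<sigma>. \<phi> x * (h x \<bullet> b))"
    using measure_derivative_density[OF assms(1)] by blast
  obtain \<sigma>' and h' :: "'a \<Rightarrow> 'a" where \<sigma>': "finite_measure \<sigma>'" "sets \<sigma>' = sets BO" and h': "integrable \<sigma>' h'"
    and \<nu>: "\<And>A. A \<in> sets BO \<Longrightarrow> \<nu> A = (LINT x|\<sigma>'. indicator A x *\<^sub>R h' x)"
    and d': "\<And>\<phi> b. \<phi> \<in> test_functions \<Omega> \<Longrightarrow> b \<in> Basis \<Longrightarrow>
      (LINT x|M. v x * partial_deriv b \<phi> x) = - (LINT x|\<sigma>'. \<phi> x * (h' x \<bullet> b))"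
    using measure_derivative_density[OF assms(2)] by blast
  show ?thesis
  proof (rule euclidean_eqI)
    fix b :: 'a assume b: "b \<in> Basis"
    have i: "integrable \<sigma> (\<lambda>x. indicator A x *\<^sub>R h x)" "integrable \<sigma>' (\<lambda>x. indicator A x *\<^sub>R h' x)"
      using A \<sigma> \<sigma>' h h' by (auto intro!: integrable_mult_indicator)
    have "(LINT x|\<sigma>. indicator A x * (h x \<bullet> b)) = (LINT x|\<sigma>'. indicator A x * (h' x \<bullet> b))"
    proof (rule density_unique_test_functions[OF \<sigma> _ \<sigma>' _ _ A])
      show "(LINT x|\<sigma>. \<phi> x * (h x \<bullet> b)) = (LINT x|\<sigma>'. \<phi> x * (h' x \<bullet> b))" if "\<phi> \<in> test_functions \<Omega>" for \<phi>
        using d[OF that b] d'[OF that b] by simp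
    qed (use h h' in auto)
    moreover have "(LINT x|\<sigma>. indicator A x *\<^sub>R h x) \<bullet> b = (LINT x|\<sigma>. indicator A x * (h x \<bullet> b))"
      using integral_inner_left[OF i(1), of b] by simp
    moreover have "(LINT x|\<sigma>'. indicator A x *\<^sub>R h' x) \<bullet> b = (LINT x|\<sigma>'. indicator A x * (h' x \<bullet> b))"
      using integral_inner_left[OF i(2), of b] by simp
    ultimately show "\<mu> A \<bullet> b = \<nu> A \<bullet> b" using \<mu>[OF A] \<nu>[OF A] by simp
  qed
qed

lemma BV_density:
  assumes "v \<in> BV \<Omega>"
  obtains \<sigma> and h :: "'a \<Rightarrow> 'a" where "finite_measure \<sigma>" "sets \<sigma> = sets BO" "integrable \<sigma> h"
    "\<And>\<phi> b. \<phi> \<in> test_functions \<Omega> \<Longrightarrow> b \<in> Basis \<Longrightarrow>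
      (LINT x|M. v x * partial_deriv b \<phi> x) = - (LINT x|\<sigma>. \<phi> x * (h x \<bullet> b))"
    "TV \<Omega> v = (LINT x|\<sigma>. norm (h x))"
proof -
  define \<mu> where "\<mu> = (SOME \<mu>. has_measure_derivative \<Omega> v \<mu>)"
  have D: "has_measure_derivative \<Omega> v \<mu>"
    using assms unfolding BV_def \<mu>_def by (auto intro: someI_ex[of "has_measure_derivative \<Omega> v"])
  obtain \<sigma> and h :: "'a \<Rightarrow> 'a" where \<sigma>: "finite_measure \<sigma>" "sets \<sigma> = sets BO" and h: "integrable \<sigma> h"
    and \<mu>: "\<And>A. A \<in> sets BO \<Longrightarrow> \<mu> A = (LINT x|\<sigma>. indicator A x *\<^sub>R h x)"
    and d: "\<And>\<phi> b. \<phi> \<in> test_functions \<Omega> \<Longrightarrow> b \<in> Basis \<Longrightarrow>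
      (LINT x|M. v x * partial_deriv b \<phi> x) = - (LINT x|\<sigma>. \<phi> x * (h x \<bullet> b))"
    using measure_derivative_density[OF D] by blast
  have "variation \<Omega> \<mu> = ennreal (LINT x|\<sigma>. norm (h x))"
    by (rule variation_density[OF open_\<Omega> \<sigma>(2) h \<mu>])
  then have "TV \<Omega> v = (LINT x|\<sigma>. norm (h x))"
    unfolding TV_def \<mu>_def[symmetric] by simp
  with \<sigma> h d show ?thesis by (rule that)
qed

lemma TV_le:
  assumes "integrable M v" "has_measure_derivative \<Omega> v \<nu>" "variation \<Omega> \<nu> \<le> ennreal c" "0 \<le> c"
  shows "v \<in> BV \<Omega>" "TV \<Omega> v \<le> c"
proof -
  show "v \<in> BV \<Omega>" using assms by (auto simp: BV_def)
  define \<mu> where "\<mu> = (SOME \<mu>. has_measure_derivative \<Omega> v \<mu>)"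
  have D: "has_measure_derivative \<Omega> v \<mu>" unfolding \<mu>_def by (rule someI[of "has_measure_derivative \<Omega> v", OF assms(2)])
  have "variation \<Omega> \<mu> = variation \<Omega> \<nu>"
    by (rule variation_cong) (rule measure_derivative_unique[OF D assms(2)])
  then show "TV \<Omega> v \<le> c"
    unfolding TV_def \<mu>_def[symmetric] using assms(3,4) by (simp add: enn2real_leI)
qed

text \<open>The measure \<open>|Dv|\<close> is transported to pairs of a point and the direction of \<open>Dv\<close> at this
  point. Weak limits of these positive measures retain the direction, and integrating the
  direction against the limit yields the derivative of the limit function.\<close>

theorem BV_lower_semicontinuous:
  fixes u :: "nat \<Rightarrow> 'a \<Rightarrow> real"
  assumes u: "\<And>n. u n \<in> BV \<Omega>" and v: "integrable M v"
    and lim: "\<And>\<phi> b. \<phi> \<in> test_functions \<Omega> \<Longrightarrow> b \<in> Basis \<Longrightarrow>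
      (\<lambda>n. LINT x|M. u n x * partial_deriv b \<phi> x) \<longlonglongrightarrow> (LINT x|M. v x * partial_deriv b \<phi> x)"
    and c: "\<And>n. TV \<Omega> (u n) \<le> c n" "c \<longlonglongrightarrow> C"
  shows "v \<in> BV \<Omega>" "TV \<Omega> v \<le> C"
proof -
  \<comment> \<open>Measure, density and all their properties are bundled into one predicate so that
    they can be chosen for all n at once.\<close>
  define P where "P n \<sigma> h \<longleftrightarrow> finite_measure \<sigma> \<and> sets \<sigma> = sets BO \<and> integrable \<sigma> h \<and>
      (\<forall>\<phi>\<in>test_functions \<Omega>. \<forall>b\<in>Basis. (LINT x|M. u n x * partial_deriv b \<phi> x) = - (LINT x|\<sigma>. \<phi> x * (h x \<bullet> b))) \<and>
      TV \<Omega> (u n) = (LINT x|\<sigma>. norm (h x))" for n and \<sigma> :: "'a measure" and h :: "'a \<Rightarrow> 'a"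
  have "\<exists>\<sigma> h. P n \<sigma> h" for n
    unfolding P_def by (rule BV_density[OF u[of n]]) blast
  then obtain \<sigma> h where "\<And>n. P n (\<sigma> n) (h n)" by metis
  then have \<sigma>: "\<And>n. finite_measure (\<sigma> n)" "\<And>n. sets (\<sigma> n) = sets BO"
    and h: "\<And>n. integrable (\<sigma> n) (h n)"
    and d: "\<And>n \<phi> b. \<phi> \<in> test_functions \<Omega> \<Longrightarrow> b \<in> Basis \<Longrightarrow>
      (LINT x|M. u n x * partial_deriv b \<phi> x) = - (LINT x|\<sigma> n. \<phi> x * (h n x \<bullet> b))"
    and TV: "\<And>n. TV \<Omega> (u n) = (LINT x|\<sigma> n. norm (h n x))"
    unfolding P_def by blast+
  obtain R where R: "R > 0" "\<And>x. x \<in> \<Omega> \<Longrightarrow> norm x \<le> R" using bounded_\<Omega> bounded_pos by blast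
  have sp: "space (\<sigma> n) = \<Omega>" for n
    using sets_eq_imp_space_eq[OF \<sigma>(2)] by (simp add: space_restrict_space)
  have fst_borel[measurable]: "fst \<in> borel_measurable (borel :: ('a \<times> 'a) measure)"
    and snd_borel[measurable]: "snd \<in> borel_measurable (borel :: ('a \<times> 'a) measure)"
    by (intro borel_measurable_continuous_onI continuous_on_fst continuous_on_snd continuous_on_id)+
  \<comment> \<open>Where \<open>h n\<close> vanishes the direction is 0 instead of a unit vector,
    but the weight \<open>norm (h n x)\<close> gives such points no mass.\<close>
  define X where "X n x = (x, sgn (h n x))" for n x
  have X: "X n \<in> borel_measurable (\<sigma> n)" for n
  proof -
    have "(\<lambda>x. x) \<in> borel_measurable (\<sigma> n)" by (rule measurable_BO[OF \<sigma>(2)]) simp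
    moreover have "(\<lambda>x. sgn (h n x)) \<in> borel_measurable (\<sigma> n)"
      unfolding sgn_div_norm using h[of n] by simp
    ultimately show ?thesis unfolding X_def[abs_def] by (rule borel_measurable_Pair)
  qed
  let ?d = "\<lambda>n. density (\<sigma> n) (\<lambda>x. ennreal (norm (h n x)))"
  define \<Lambda> where "\<Lambda> n = distr (?d n) borel (X n)" for n
  have hn: "integrable (\<sigma> n) (\<lambda>x. norm (h n x))" for n using h by simp
  have Xd: "X n \<in> borel_measurable (?d n)" for n using X[of n] by simp
  have fin: "finite_measure (\<Lambda> n)" for n
    unfolding \<Lambda>_def using density_real_facts(1)[OF hn] Xd by (intro finite_measure.finite_measure_distr) auto
  have \<Lambda>_int: "(LINT z|\<Lambda> n. \<psi> z) = (LINT x|\<sigma> n. \<psi> (X n x) * norm (h n x))"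
    if \<psi>: "\<psi> \<in> borel_measurable borel" for \<psi> :: "'a \<times> 'a \<Rightarrow> real" and n
  proof -
    have m: "(\<lambda>x. \<psi> (X n x)) \<in> borel_measurable (\<sigma> n)" by (rule measurable_compose[OF X \<psi>])
    have "(LINT z|\<Lambda> n. \<psi> z) = (LINT x|?d n. \<psi> (X n x))"
      unfolding \<Lambda>_def by (rule integral_distr[OF Xd \<psi>])
    also have "\<dots> = (LINT x|\<sigma> n. \<psi> (X n x) * norm (h n x))"
      by (rule density_real_facts(3)[OF hn _ m]) simp
    finally show ?thesis .
  qed
  \<comment> \<open>Points of \<Omega> contribute at most R to the norm of a pair, directions at
    most 1.\<close>
  have \<Lambda>_le: "AE z in \<Lambda> n. norm z \<le> R + 1" for n
    unfolding \<Lambda>_def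
  proof (subst AE_distr_iff[OF Xd])
    show "{x \<in> space borel. norm x \<le> R + 1} \<in> sets borel" by measurable
    have "norm (X n x) \<le> R + 1" if "x \<in> \<Omega>" for x
    proof -
      have "norm (X n x) \<le> norm x + norm (sgn (h n x))" unfolding X_def by (rule norm_Pair_le)
      also have "\<dots> \<le> R + 1" using R(2)[OF that] by (simp add: norm_sgn)
      finally show ?thesis .
    qed
    then show "AE x in ?d n. norm (X n x) \<le> R + 1"
      by (intro AE_I2) (simp add: sp)
  qed
  \<comment> \<open>The bounds \<open>c n\<close> may exceed their limit C; boundedness of a
    convergent sequence gives the uniform mass bound.\<close>
  obtain C' where C'_abs: "\<And>n. norm (c n) \<le> C'"
    using convergent_imp_Bseq[OF convergentI[OF c(2)]] unfolding Bseq_def by blast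
  have C': "c n \<le> C'" for n using C'_abs[of n] by simp
  have mass: "measure (\<Lambda> n) UNIV \<le> C'" for n
  proof -
    have "(LINT z|\<Lambda> n. 1) = TV \<Omega> (u n)" using \<Lambda>_int[of "\<lambda>_. 1" n] TV by simp
    moreover have "(LINT z|\<Lambda> n. 1::real) = measure (\<Lambda> n) UNIV" by (simp add: \<Lambda>_def)
    ultimately show ?thesis using c(1)[of n] C'[of n] by linarith
  qed
  have R1: "0 \<le> R + 1" using R(1) by simp
  have \<Lambda>s: "sets (\<Lambda> n) = sets borel" for n by (simp add: \<Lambda>_def)
  have "\<exists>r L. strict_mono r \<and> finite_measure L \<and> sets L = sets borel \<and> (AE z in L. norm z \<le> R + 1) \<and>
      (\<forall>\<psi> :: 'a \<times> 'a \<Rightarrow> real. continuous_on UNIV \<psi> \<longrightarrow> (\<lambda>n. LINT z|\<Lambda> (r n). \<psi> z) \<longlonglongrightarrow> (LINT z|L. \<psi> z))"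
  proof (rule bounded_measures_weakly_compact[OF R1 fin \<Lambda>s \<Lambda>_le mass])
    fix r :: "nat \<Rightarrow> nat" and L :: "('a \<times> 'a) measure"
    assume "strict_mono r" "finite_measure L" "sets L = sets borel" "AE z in L. norm z \<le> R + 1"
      "\<And>\<psi> :: 'a \<times> 'a \<Rightarrow> real. continuous_on UNIV \<psi> \<Longrightarrow> (\<lambda>n. LINT z|\<Lambda> (r n). \<psi> z) \<longlonglongrightarrow> (LINT z|L. \<psi> z)"
    then show ?thesis by (intro exI[of _ r] exI[of _ L] conjI allI impI)
  qed
  then obtain r and L :: "('a \<times> 'a) measure" where r: "strict_mono (r :: nat \<Rightarrow> nat)"
    and L: "finite_measure L" "sets L = sets borel" "AE z in L. norm z \<le> R + 1"
    and conv: "\<And>\<psi> :: 'a \<times> 'a \<Rightarrow> real. continuous_on UNIV \<psi> \<Longrightarrow> (\<lambda>n. LINT z|\<Lambda> (r n). \<psi> z) \<longlonglongrightarrow> (LINT z|L. \<psi> z)"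
    by blast
  interpret L: finite_measure L by fact
  have spL: "space L = UNIV" using sets_eq_imp_space_eq[OF L(2)] by simp
  have mL: "f \<in> borel_measurable L" if "f \<in> borel_measurable borel" for f :: "'a \<times> 'a \<Rightarrow> 'c::topological_space"
    using that measurable_cong_sets[OF L(2) refl] by blast
  have sndL: "integrable L snd"
  proof (rule L.integrable_const_bound[where B = "R + 1"])
    show "AE z in L. norm (snd z) \<le> R + 1"
      using L(3)
    proof eventually_elim
      case (elim z)
      show ?case using norm_snd_le[of "snd z" "fst z"] elim by simp
    qed
    show "snd \<in> borel_measurable L" by (rule mL[OF snd_borel])
  qed
  \<comment> \<open>Mass of L over points outside \<Omega>, to which part of |Du_n| may have escaped
    in the limit, does not enter \<nu> on Borel subsets of \<Omega>.\<close>
  define \<nu> where "\<nu> A = (LINT z|L. indicator A (fst z) *\<^sub>R snd z)" for A :: "'a set"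
  have vim: "fst -` A \<inter> space L \<in> sets L" if "A \<in> sets BO" for A
  proof -
    have "A \<in> sets borel" using that sets_BO_iff by blast
    then have "fst -` A \<inter> space borel \<in> sets (borel :: ('a \<times> 'a) measure)"
      by (rule measurable_sets[OF fst_borel])
    then show ?thesis using L(2) spL by simp
  qed
  have vim': "fst -` A \<in> sets L" if "A \<in> sets BO" for A using vim[OF that] spL by simp
  have ind: "indicator A (fst z) = indicator (fst -` A) z" for A :: "'a set" and z :: "'a \<times> 'a"
    by (simp add: indicator_def)
  have vec: "vector_measure \<Omega> \<nu>"
    unfolding vector_measure_def
  proof (intro allI impI)
    fix A :: "nat \<Rightarrow> 'a set"
    assume A: "range A \<subseteq> sets BO" "disjoint_family A"
    have "(\<lambda>n. LINT z|L. indicator (fst -` A n) z *\<^sub>R snd z) sums (LINT z|L. indicator (\<Union>n. fst -` A n) z *\<^sub>R snd z)"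
    proof (rule sums_integral_disjoint[OF sndL])
      show "fst -` A n \<in> sets L" for n using A(1) by (intro vim') auto
      show "disjoint_family (\<lambda>n. fst -` A n)" using A(2) unfolding disjoint_family_on_def by blast
    qed
    then show "(\<lambda>n. \<nu> (A n)) sums \<nu> (\<Union>n. A n)"
      unfolding \<nu>_def ind vimage_UN .
  qed
  have der: "has_signed_integral \<Omega> (\<lambda>A. \<nu> A \<bullet> b) \<phi> (- (LINT x|M. v x * partial_deriv b \<phi> x))"
    if \<phi>: "\<phi> \<in> test_functions \<Omega>" and b: "b \<in> Basis" for \<phi> b
  proof -
    have sm: "smooth \<phi>" by (rule test_functions_smooth[OF \<phi>])
    have \<phi>m[measurable]: "\<phi> \<in> borel_measurable borel" by (rule test_functions_borel[OF \<phi>])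
    obtain B where B: "\<And>x. \<bar>\<phi> x\<bar> \<le> B" using test_functions_bounded[OF \<phi>] by blast
    \<comment> \<open>Positive part (s = 1) and negative part (s = -1) of the b-component of the
      direction. The measures with these densities, projected to \<Omega>, serve as P and N in
      \<open>has_signed_integral\<close>.\<close>
    define g where "g s z = max 0 (s * (snd z \<bullet> b))" for s :: real and z :: "'a \<times> 'a"
    have g: "integrable L (g s)" for s unfolding g_def[abs_def] using sndL by simp
    have g0: "0 \<le> g s z" for s z by (simp add: g_def)
    have gdiff: "g 1 z - g (-1) z = snd z \<bullet> b" for z by (simp add: g_def max_def)
    define Q where "Q s = restrict_space (distr (density L (\<lambda>z. ennreal (g s z))) borel fst) \<Omega>" for s
    have fstm: "fst \<in> borel_measurable (density L (\<lambda>z. ennreal (g s z)))" for s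
      using mL[OF fst_borel] by simp
    have \<Omega>d: "\<Omega> \<inter> space (distr (density L (\<lambda>z. ennreal (g s z))) borel fst) \<in> sets (distr (density L (\<lambda>z. ennreal (g s z))) borel fst)" for s
      using open_\<Omega> by simp
    have Qf: "finite_measure (Q s)" for s
      unfolding Q_def using density_real_facts(1)[OF g g0] fstm open_\<Omega>
      by (intro finite_measure_restrict_space finite_measure.finite_measure_distr) auto
    have Qs: "sets (Q s) = sets BO" for s
      unfolding Q_def by (rule sets_restrict_space_cong) simp
    have Qm: "measure (Q s) A = (LINT z|L. indicator A (fst z) * g s z)" if A: "A \<in> sets BO" for s A
    proof -
      have A': "A \<in> sets borel" "A \<subseteq> \<Omega>" using A sets_BO_iff by auto
      have vA: "fst -` A \<in> sets L" by (rule vim'[OF A])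
      have "measure (Q s) A = measure (distr (density L (\<lambda>z. ennreal (g s z))) borel fst) A"
        unfolding Q_def using A' \<Omega>d by (intro measure_restrict_space) auto
      also have "\<dots> = measure (density L (\<lambda>z. ennreal (g s z))) (fst -` A)"
        using A' fstm by (subst measure_distr) (auto simp: spL)
      also have "\<dots> = (LINT z|L. indicator (fst -` A) z * g s z)"
        unfolding measure_def density_real_facts(2)[OF g g0 vA]
        by (intro enn2real_ennreal Bochner_Integration.integral_nonneg) (simp add: g0)
      finally show ?thesis by (simp only: ind)
    qed
    have Q\<phi>: "integrable (Q s) \<phi>" "(LINT x|Q s. \<phi> x) = (LINT z|L. \<phi> (fst z) * g s z)" for s
    proof -
      show "integrable (Q s) \<phi>"
        by (rule integrable_bounded_finite_measure[OF Qf measurable_BO[OF Qs \<phi>m] B])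
      have "(LINT x|Q s. \<phi> x) = (LINT x|distr (density L (\<lambda>z. ennreal (g s z))) borel fst. indicator \<Omega> x *\<^sub>R \<phi> x)"
        unfolding Q_def by (rule integral_restrict_space[OF \<Omega>d])
      also have "(\<lambda>x. indicator \<Omega> x *\<^sub>R \<phi> x) = \<phi>"
        using test_functions_outside[OF \<phi>] by (auto simp: indicator_def fun_eq_iff)
      also have "(LINT x|distr (density L (\<lambda>z. ennreal (g s z))) borel fst. \<phi> x) = (LINT z|density L (\<lambda>z. ennreal (g s z)). \<phi> (fst z))"
        by (rule integral_distr[OF fstm \<phi>m])
      also have "\<dots> = (LINT z|L. \<phi> (fst z) * g s z)"
        by (rule density_real_facts(3)[OF g g0]) (rule mL, measurable)
      finally show "(LINT x|Q s. \<phi> x) = (LINT z|L. \<phi> (fst z) * g s z)" .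
    qed
    have \<phi>g: "integrable L (\<lambda>z. \<phi> (fst z) * g s z)" for s
      by (rule integrable_bounded_mult[OF g _ B]) (rule mL, measurable)
    have "(LINT x|Q 1. \<phi> x) - (LINT x|Q (-1). \<phi> x) = (LINT z|L. \<phi> (fst z) * (snd z \<bullet> b))"
      unfolding Q\<phi>(2) gdiff[symmetric] right_diff_distrib using \<phi>g by simp
    also have "\<dots> = - (LINT x|M. v x * partial_deriv b \<phi> x)"
    proof (rule LIMSEQ_unique)
      show "(\<lambda>n. LINT z|\<Lambda> (r n). \<phi> (fst z) * (snd z \<bullet> b)) \<longlonglongrightarrow> (LINT z|L. \<phi> (fst z) * (snd z \<bullet> b))"
      proof (rule conv)
        have "continuous_on UNIV (\<lambda>z::'a \<times> 'a. \<phi> (fst z))"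
          by (rule continuous_on_compose2[OF smooth_continuous[OF sm, of UNIV]])
            (auto intro: continuous_on_fst)
        moreover have "continuous_on UNIV (\<lambda>z::'a \<times> 'a. snd z \<bullet> b)"
          by (intro continuous_on_inner continuous_on_snd continuous_on_id continuous_on_const)
        ultimately show "continuous_on UNIV (\<lambda>z::'a \<times> 'a. \<phi> (fst z) * (snd z \<bullet> b))"
          by (rule continuous_on_mult)
      qed
      have "(LINT z|\<Lambda> n. \<phi> (fst z) * (snd z \<bullet> b)) = - (LINT x|M. u n x * partial_deriv b \<phi> x)" for n
      proof -
        have "(LINT z|\<Lambda> n. \<phi> (fst z) * (snd z \<bullet> b)) = (LINT x|\<sigma> n. (\<phi> (fst (X n x)) * (snd (X n x) \<bullet> b)) * norm (h n x))"
          by (rule \<Lambda>_int) measurable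
        also have "\<dots> = (LINT x|\<sigma> n. \<phi> x * (h n x \<bullet> b))"
        proof (rule Bochner_Integration.integral_cong[OF refl])
          fix x
          have "norm (h n x) *\<^sub>R sgn (h n x) = h n x" by (cases "h n x = 0") (simp_all add: sgn_div_norm)
          then have "(sgn (h n x) \<bullet> b) * norm (h n x) = h n x \<bullet> b"
            by (metis inner_scaleR_left mult.commute)
          then show "(\<phi> (fst (X n x)) * (snd (X n x) \<bullet> b)) * norm (h n x) = \<phi> x * (h n x \<bullet> b)"
            by (simp add: X_def)
        qed
        finally show ?thesis using d[OF \<phi> b, of n] by simp
      qed
      then show "(\<lambda>n. LINT z|\<Lambda> (r n). \<phi> (fst z) * (snd z \<bullet> b)) \<longlonglongrightarrow> - (LINT x|M. v x * partial_deriv b \<phi> x)"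
        using LIMSEQ_subseq_LIMSEQ[OF tendsto_minus[OF lim[OF \<phi> b]] r] by (simp add: comp_def)
    qed
    finally have I: "- (LINT x|M. v x * partial_deriv b \<phi> x) = (LINT x|Q 1. \<phi> x) - (LINT x|Q (-1). \<phi> x)" by simp
    have m: "\<nu> A \<bullet> b = measure (Q 1) A - measure (Q (-1)) A" if A: "A \<in> sets BO" for A
    proof -
      have i: "integrable L (\<lambda>z. indicator A (fst z) *\<^sub>R snd z)"
        unfolding ind by (rule integrable_mult_indicator[OF vim'[OF A] sndL])
      have j: "integrable L (\<lambda>z. indicator A (fst z) * g s z)" for s
        unfolding ind using integrable_mult_indicator[OF vim'[OF A] g[of s]] by simp
      have "\<nu> A \<bullet> b = (LINT z|L. indicator A (fst z) * (g 1 z - g (-1) z))"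
        unfolding \<nu>_def using integral_inner_left[OF i, of b] by (simp add: gdiff)
      then show ?thesis unfolding Qm[OF A] right_diff_distrib using j by simp
    qed
    show ?thesis
      unfolding has_signed_integral_def
      by (intro exI[of _ "Q 1"] exI[of _ "Q (-1)"] conjI ballI Qf Qs m Q\<phi>(1) I)
  qed
  have D: "has_measure_derivative \<Omega> v \<nu>"
    unfolding has_measure_derivative_def using vec der by blast
  \<comment> \<open>Counting also the mass over points outside \<Omega> is harmless, since C bounds
    the integral over all pairs.\<close>
  have var: "variation \<Omega> \<nu> \<le> ennreal (LINT z|L. norm (snd z))"
    by (rule variation_le[OF sndL vim]) (simp_all add: \<nu>_def)
  have le: "(LINT z|L. norm (snd z)) \<le> C"
  proof (rule LIMSEQ_le)
    show "(\<lambda>n. LINT z|\<Lambda> (r n). norm (snd z)) \<longlonglongrightarrow> (LINT z|L. norm (snd z))"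
      by (intro conv continuous_intros)
    show "(\<lambda>n. c (r n)) \<longlonglongrightarrow> C" using LIMSEQ_subseq_LIMSEQ[OF c(2) r] by (simp add: comp_def)
    have "(LINT z|\<Lambda> n. norm (snd z)) \<le> c n" for n
    proof -
      have "(LINT z|\<Lambda> n. norm (snd z)) = (LINT x|\<sigma> n. norm (snd (X n x)) * norm (h n x))"
        by (rule \<Lambda>_int) measurable
      also have "\<dots> = (LINT x|\<sigma> n. norm (h n x))"
        by (intro Bochner_Integration.integral_cong refl) (simp add: X_def norm_sgn)
      finally show ?thesis using c(1)[of n] TV by simp
    qed
    then show "\<exists>N. \<forall>n\<ge>N. (LINT z|\<Lambda> (r n). norm (snd z)) \<le> c (r n)" by blast
  qed
  have "0 \<le> (LINT z|L. norm (snd z))" by (intro Bochner_Integration.integral_nonneg) simp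
  then have "0 \<le> C" using le by linarith
  from TV_le[OF v D order_trans[OF var ennreal_leI[OF le]] this] show "v \<in> BV \<Omega>" "TV \<Omega> v \<le> C" .
qed

lemma BV_integral_partial_deriv_le:
  assumes v: "v \<in> BV \<Omega>" and \<phi>: "\<phi> \<in> test_functions \<Omega>" "\<And>x. \<bar>\<phi> x\<bar> \<le> B" and b: "b \<in> Basis"
  shows "\<bar>LINT x|M. v x * partial_deriv b \<phi> x\<bar> \<le> B * TV \<Omega> v"
proof -
  obtain \<sigma> and h :: "'a \<Rightarrow> 'a" where \<sigma>: "finite_measure \<sigma>" "sets \<sigma> = sets BO" and h: "integrable \<sigma> h"
    and d: "\<And>\<phi> b. \<phi> \<in> test_functions \<Omega> \<Longrightarrow> b \<in> Basis \<Longrightarrow>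
      (LINT x|M. v x * partial_deriv b \<phi> x) = - (LINT x|\<sigma>. \<phi> x * (h x \<bullet> b))"
    and TV: "TV \<Omega> v = (LINT x|\<sigma>. norm (h x))"
    using BV_density[OF v] by blast
  have i: "integrable \<sigma> (\<lambda>x. \<phi> x * (h x \<bullet> b))"
    by (rule integrable_bounded_mult[OF _ measurable_BO[OF \<sigma>(2) test_functions_borel[OF \<phi>(1)]] \<phi>(2)]) (use h in simp)
  have "\<bar>LINT x|\<sigma>. \<phi> x * (h x \<bullet> b)\<bar> \<le> (LINT x|\<sigma>. \<bar>\<phi> x * (h x \<bullet> b)\<bar>)"
    using integral_norm_bound[of \<sigma> "\<lambda>x. \<phi> x * (h x \<bullet> b)"] by simp
  also have "\<dots> \<le> (LINT x|\<sigma>. B * norm (h x))"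
  proof (rule integral_mono)
    show "\<bar>\<phi> x * (h x \<bullet> b)\<bar> \<le> B * norm (h x)" for x
    proof -
      have "0 \<le> B" using \<phi>(2)[of x] by linarith
      then show ?thesis
        unfolding abs_mult using \<phi>(2)[of x] Basis_le_norm[OF b, of "h x"] by (intro mult_mono) simp_all
    qed
  qed (use i h in auto)
  finally show ?thesis using d[OF \<phi>(1) b] TV by simp
qed

lemma TV_nonneg: "0 \<le> TV \<Omega> v"
  by (simp add: TV_def)

end

section \<open>Compactness in \<open>L\<^sup>1\<close>\<close>

text \<open>Dual form of the statement that every component of Dv is a measure of mass at most C on
  the whole space. It survives differences and cut-offs without any measure being
  constructed.\<close>

definition deriv_bound :: "('a::euclidean_space \<Rightarrow> real) \<Rightarrow> real \<Rightarrow> bool" where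
  "deriv_bound v C \<longleftrightarrow> (\<forall>\<phi>\<in>test_functions UNIV. \<forall>b\<in>Basis. \<forall>B. (\<forall>x. \<bar>\<phi> x\<bar> \<le> B) \<longrightarrow>
     \<bar>LINT x|lborel. v x * partial_deriv b \<phi> x\<bar> \<le> C * B)"

lemma deriv_boundD:
  assumes "deriv_bound v C" "\<phi> \<in> test_functions UNIV" "b \<in> Basis" "\<And>x. \<bar>\<phi> x\<bar> \<le> B"
  shows "\<bar>LINT x|lborel. v x * partial_deriv b \<phi> x\<bar> \<le> C * B"
  using assms unfolding deriv_bound_def by simp

lemma integrable_mult_test_function:
  assumes "integrable lborel v" "\<phi> \<in> test_functions S"
  shows "integrable lborel (\<lambda>x. v x * \<phi> x)"
proof -
  obtain B where "\<And>x. \<bar>\<phi> x\<bar> \<le> B" using test_functions_bounded[OF assms(2)] by blast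
  then have "integrable lborel (\<lambda>x. \<phi> x * v x)"
    using test_functions_borel[OF assms(2)] by (intro integrable_bounded_mult[OF assms(1)]) auto
  then show ?thesis by (simp add: mult.commute)
qed

lemma deriv_bound_diff:
  assumes "integrable lborel v" "integrable lborel w" "deriv_bound v C" "deriv_bound w D"
  shows "deriv_bound (\<lambda>x. v x - w x) (C + D)"
  unfolding deriv_bound_def
proof (intro ballI allI impI)
  fix \<phi> :: "'a \<Rightarrow> real" and b :: 'a and B :: real
  assume \<phi>: "\<phi> \<in> test_functions UNIV" and b: "b \<in> Basis" and B: "\<forall>x. \<bar>\<phi> x\<bar> \<le> B"
  note d = test_functions_partial_deriv[OF \<phi> b]
  have "(LINT x|lborel. (v x - w x) * partial_deriv b \<phi> x)
      = (LINT x|lborel. v x * partial_deriv b \<phi> x) - (LINT x|lborel. w x * partial_deriv b \<phi> x)"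
    using integrable_mult_test_function[OF assms(1) d] integrable_mult_test_function[OF assms(2) d]
    by (simp add: left_diff_distrib)
  moreover have "\<bar>LINT x|lborel. v x * partial_deriv b \<phi> x\<bar> \<le> C * B"
    "\<bar>LINT x|lborel. w x * partial_deriv b \<phi> x\<bar> \<le> D * B"
    using assms(3,4) \<phi> b B by (auto simp: deriv_bound_def)
  ultimately show "\<bar>LINT x|lborel. (v x - w x) * partial_deriv b \<phi> x\<bar> \<le> (C + D) * B"
    by (simp add: distrib_right)
qed

lemma has_real_derivative_integral_translate:
  fixes v :: "'a::euclidean_space \<Rightarrow> real"
  assumes v: "integrable lborel v" and \<phi>: "\<phi> \<in> test_functions UNIV" and b: "b \<in> Basis"
  shows "((\<lambda>t. LINT x|lborel. v x * \<phi> (x + t *\<^sub>R b)) has_real_derivative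
    (LINT x|lborel. v x * partial_deriv b \<phi> (x + t *\<^sub>R b))) (at t)"
proof -
  let ?F = "\<lambda>t. LINT x|lborel. v x * \<phi> (x + t *\<^sub>R b)"
  have sm: "smooth \<phi>" by (rule test_functions_smooth[OF \<phi>])
  obtain L where L: "L > 0" "\<And>x. \<bar>partial_deriv b \<phi> x\<bar> \<le> L"
    using test_functions_bounded[OF test_functions_partial_deriv[OF \<phi> b]] by blast
  have i: "integrable lborel (\<lambda>x. v x * \<phi> (x + s *\<^sub>R b))" for s
    by (rule integrable_mult_test_function[OF v test_functions_translate[OF \<phi>]])
  note [measurable] = test_functions_borel[OF \<phi>] test_functions_borel[OF test_functions_partial_deriv[OF \<phi> b]]
    borel_measurable_integrable[OF v]
  have "((\<lambda>h. (?F (t + h) - ?F t) / h) \<longlongrightarrow> (LINT x|lborel. v x * partial_deriv b \<phi> (x + t *\<^sub>R b))) (at 0)"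
    unfolding tendsto_at_iff_sequentially
  proof (intro allI impI)
    fix X :: "nat \<Rightarrow> real" assume X: "\<forall>i. X i \<in> UNIV - {0}" "X \<longlonglongrightarrow> 0"
    let ?q = "\<lambda>i x. v x * ((\<phi> (x + (t + X i) *\<^sub>R b) - \<phi> (x + t *\<^sub>R b)) / X i)"
    have lim: "(\<lambda>i. LINT x|lborel. ?q i x) \<longlonglongrightarrow> (LINT x|lborel. v x * partial_deriv b \<phi> (x + t *\<^sub>R b))"
    proof (rule integral_dominated_convergence[where w = "\<lambda>x. L * \<bar>v x\<bar>"])
      show "AE x in lborel. (\<lambda>i. ?q i x) \<longlonglongrightarrow> v x * partial_deriv b \<phi> (x + t *\<^sub>R b)"
      proof (rule AE_I2)
        fix x
        have "((\<lambda>h. (\<phi> (x + (t + h) *\<^sub>R b) - \<phi> (x + t *\<^sub>R b)) / h) \<longlongrightarrow> partial_deriv b \<phi> (x + t *\<^sub>R b)) (at 0)"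
          using has_real_derivative_along[OF sm, of x b t] by (simp add: DERIV_def)
        then have "((\<lambda>h. (\<phi> (x + (t + h) *\<^sub>R b) - \<phi> (x + t *\<^sub>R b)) / h) \<circ> X) \<longlonglongrightarrow> partial_deriv b \<phi> (x + t *\<^sub>R b)"
          using X unfolding tendsto_at_iff_sequentially by blast
        then show "(\<lambda>i. ?q i x) \<longlonglongrightarrow> v x * partial_deriv b \<phi> (x + t *\<^sub>R b)"
          unfolding comp_def by (rule tendsto_mult_left)
      qed
      show "AE x in lborel. norm (?q i x) \<le> L * \<bar>v x\<bar>" for i
      proof (rule AE_I2)
        fix x
        have "X i \<noteq> 0" using X(1) by auto
        moreover have "\<bar>\<phi> (x + (t + X i) *\<^sub>R b) - \<phi> (x + t *\<^sub>R b)\<bar> \<le> L * \<bar>X i\<bar>"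
          using smooth_increment_le[OF sm L(2), of "x + t *\<^sub>R b" "X i"] by (simp add: scaleR_add_left add.assoc)
        ultimately have "\<bar>(\<phi> (x + (t + X i) *\<^sub>R b) - \<phi> (x + t *\<^sub>R b)) / X i\<bar> \<le> L"
          by (simp add: divide_le_eq)
        then have "\<bar>v x\<bar> * \<bar>(\<phi> (x + (t + X i) *\<^sub>R b) - \<phi> (x + t *\<^sub>R b)) / X i\<bar> \<le> \<bar>v x\<bar> * L"
          by (intro mult_left_mono) auto
        then show "norm (?q i x) \<le> L * \<bar>v x\<bar>" by (simp only: real_norm_def abs_mult mult.commute)
      qed
      show "?q i \<in> borel_measurable lborel" for i by measurable
      show "(\<lambda>x. v x * partial_deriv b \<phi> (x + t *\<^sub>R b)) \<in> borel_measurable lborel" by measurable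
    qed (use v in simp)
    have eq: "(LINT x|lborel. ?q k x) = (?F (t + X k) - ?F t) / X k" for k
    proof -
      have "(LINT x|lborel. ?q k x) = (LINT x|lborel. (v x * \<phi> (x + (t + X k) *\<^sub>R b) - v x * \<phi> (x + t *\<^sub>R b)) / X k)"
        by (simp add: right_diff_distrib)
      also have "\<dots> = (LINT x|lborel. v x * \<phi> (x + (t + X k) *\<^sub>R b) - v x * \<phi> (x + t *\<^sub>R b)) / X k"
        by (rule integral_divide_zero)
      also have "\<dots> = (?F (t + X k) - ?F t) / X k"
        by (subst Bochner_Integration.integral_diff[OF i i]) (rule refl)
      finally show ?thesis .
    qed
    show "((\<lambda>h. (?F (t + h) - ?F t) / h) \<circ> X) \<longlonglongrightarrow> (LINT x|lborel. v x * partial_deriv b \<phi> (x + t *\<^sub>R b))"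
      unfolding comp_def using lim unfolding eq .
  qed
  then show ?thesis by (simp add: DERIV_def)
qed

text \<open>With the shift placed on the test function, the derivative in t is a pairing covered by
  \<open>deriv_bound\<close>, and the mean value inequality asks for no regularity of v.\<close>

lemma translation_estimate_Basis:
  fixes v :: "'a::euclidean_space \<Rightarrow> real"
  assumes v: "integrable lborel v" "deriv_bound v C" and \<phi>: "\<phi> \<in> test_functions UNIV" "\<And>x. \<bar>\<phi> x\<bar> \<le> 1" and b: "b \<in> Basis"
  shows "\<bar>(LINT x|lborel. v x * \<phi> (x + t *\<^sub>R b)) - (LINT x|lborel. v x * \<phi> x)\<bar> \<le> C * \<bar>t\<bar>"
proof -
  let ?F = "\<lambda>t. LINT x|lborel. v x * \<phi> (x + t *\<^sub>R b)"
  have "norm (?F t - ?F 0) \<le> C * norm (t - 0)"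
  proof (rule field_differentiable_bound[of UNIV ?F "\<lambda>t. LINT x|lborel. v x * partial_deriv b \<phi> (x + t *\<^sub>R b)"])
    show "(?F has_field_derivative (LINT x|lborel. v x * partial_deriv b \<phi> (x + s *\<^sub>R b))) (at s within UNIV)" for s
      using has_real_derivative_integral_translate[OF v(1) \<phi>(1) b] by simp
    fix s :: real
    let ?\<psi> = "\<lambda>x. \<phi> (x + s *\<^sub>R b)"
    have "?\<psi> \<in> test_functions UNIV" by (rule test_functions_translate[OF \<phi>(1)])
    from deriv_boundD[OF v(2) this b \<phi>(2)]
    have "\<bar>LINT x|lborel. v x * partial_deriv b ?\<psi> x\<bar> \<le> C * 1" .
    then show "norm (LINT x|lborel. v x * partial_deriv b \<phi> (x + s *\<^sub>R b)) \<le> C"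
      by (simp add: partial_deriv_translate[OF test_functions_smooth[OF \<phi>(1)]])
  qed simp_all
  then show ?thesis by simp
qed

text \<open>Dual form of the L^1 translation estimate. A general shift is reached by moving along
  one basis direction after another, which costs at most the factor \<open>DIM('a)\<close>.\<close>

lemma translation_estimate:
  fixes v :: "'a::euclidean_space \<Rightarrow> real"
  assumes v: "integrable lborel v" "deriv_bound v C" and C: "C \<ge> 0"
    and \<phi>: "\<phi> \<in> test_functions UNIV" "\<And>x. \<bar>\<phi> x\<bar> \<le> 1"
  shows "\<bar>(LINT x|lborel. v x * \<phi> (x + h)) - (LINT x|lborel. v x * \<phi> x)\<bar> \<le> C * (real DIM('a) * norm h)"
proof -
  have "\<bar>(LINT x|lborel. v x * \<phi> (x + (\<Sum>b\<in>S. (h \<bullet> b) *\<^sub>R b))) - (LINT x|lborel. v x * \<phi> x)\<bar> \<le> C * (\<Sum>b\<in>S. \<bar>h \<bullet> b\<bar>)"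
    if "finite S" "S \<subseteq> Basis" for S
    using that
  proof (induction S rule: finite_induct)
    case (insert b S)
    let ?s = "\<Sum>b\<in>S. (h \<bullet> b) *\<^sub>R b"
    let ?\<psi> = "\<lambda>x. \<phi> (x + ?s)"
    have "\<bar>(LINT x|lborel. v x * ?\<psi> (x + (h \<bullet> b) *\<^sub>R b)) - (LINT x|lborel. v x * ?\<psi> x)\<bar> \<le> C * \<bar>h \<bullet> b\<bar>"
      by (rule translation_estimate_Basis[OF v test_functions_translate[OF \<phi>(1)] \<phi>(2)]) (use insert in auto)
    moreover have "x + (h \<bullet> b) *\<^sub>R b + ?s = x + (\<Sum>b\<in>insert b S. (h \<bullet> b) *\<^sub>R b)" for x
      using insert by (simp add: add.assoc)
    ultimately have "\<bar>(LINT x|lborel. v x * \<phi> (x + (\<Sum>b\<in>insert b S. (h \<bullet> b) *\<^sub>R b))) - (LINT x|lborel. v x * ?\<psi> x)\<bar> \<le> C * \<bar>h \<bullet> b\<bar>"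
      by simp
    then show ?case using insert by (simp add: distrib_left)
  qed simp
  from this[of Basis] have "\<bar>(LINT x|lborel. v x * \<phi> (x + h)) - (LINT x|lborel. v x * \<phi> x)\<bar> \<le> C * (\<Sum>b\<in>Basis. \<bar>h \<bullet> b\<bar>)"
    by (simp add: euclidean_representation)
  also have "(\<Sum>b\<in>Basis. \<bar>h \<bullet> b\<bar>) \<le> real DIM('a) * norm h"
    using sum_bounded_above[of Basis "\<lambda>b. \<bar>h \<bullet> b\<bar>" "norm h"] Basis_le_norm by auto
  finally show ?thesis using C by (simp add: mult_left_mono)
qed

section \<open>Mollification\<close>

definition mollify :: "('a::euclidean_space \<Rightarrow> real) \<Rightarrow> ('a \<Rightarrow> real) \<Rightarrow> 'a \<Rightarrow> real" where
  "mollify \<eta> v x = (LINT h|lborel. \<eta> h * v (x + h))"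

lemma mollify_eq:
  fixes v \<eta> :: "'a::euclidean_space \<Rightarrow> real"
  assumes [measurable]: "v \<in> borel_measurable borel" "\<eta> \<in> borel_measurable borel"
  shows "mollify \<eta> v x = (LINT y|lborel. v y * \<eta> (y - x))"
proof -
  have "(\<lambda>y. v y * \<eta> (y - x)) \<in> borel_measurable borel" by measurable
  from integral_translate[OF this, of x]
  have "(LINT h|lborel. v (h + x) * \<eta> h) = (LINT y|lborel. v y * \<eta> (y - x))" by simp
  then show ?thesis by (simp add: mollify_def mult.commute add.commute)
qed

text \<open>Under the integral, averaging v over shifts amounts to averaging the test function over
  the opposite shifts; this is what brings the translation estimate into play.\<close>

lemma mollify_Fubini:
  fixes v \<eta> \<phi> :: "'a::euclidean_space \<Rightarrow> real"
  assumes v: "integrable lborel v" and \<eta>: "integrable lborel \<eta>" and \<phi>[measurable]: "\<phi> \<in> borel_measurable borel" "\<And>x. \<bar>\<phi> x\<bar> \<le> B"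
  shows "(LINT h|lborel. \<eta> h * (LINT x|lborel. v x * \<phi> (x + - h))) = (LINT x|lborel. \<phi> x * mollify \<eta> v x)"
    and "integrable lborel (\<lambda>h. \<eta> h * (LINT x|lborel. v x * \<phi> (x + - h)))"
proof -
  have [measurable]: "v \<in> borel_measurable borel" "\<eta> \<in> borel_measurable borel" using v \<eta> by auto
  let ?f = "\<lambda>h x. \<eta> h * (\<phi> x * v (x + h))"
  have B: "0 \<le> B" using \<phi>(2)[of 0] by linarith
  have iv: "integrable lborel (\<lambda>x. \<phi> x * v (x + h))" for h
    by (rule integrable_bounded_mult[OF integrable_translate[OF v] _ \<phi>(2)]) simp
  have shift: "(LINT x|lborel. v x * \<phi> (x + - h)) = (LINT x|lborel. \<phi> x * v (x + h))" for h
  proof -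
    have "(\<lambda>x. v x * \<phi> (x + - h)) \<in> borel_measurable borel" by measurable
    from integral_translate[OF this, of h] show ?thesis by (simp add: mult.commute)
  qed
  have int: "integrable (lborel \<Otimes>\<^sub>M lborel) (\<lambda>(h, x). ?f h x)"
  proof (rule lborel_pair.Fubini_integrable)
    show "(\<lambda>(h, x). ?f h x) \<in> borel_measurable (lborel \<Otimes>\<^sub>M lborel)" by measurable
    show "AE h in lborel. integrable lborel (\<lambda>x. case (h, x) of (h, x) \<Rightarrow> ?f h x)"
      using iv by simp
    show "integrable lborel (\<lambda>h. LINT x|lborel. norm (case (h, x) of (h, x) \<Rightarrow> ?f h x))"
    proof (rule Bochner_Integration.integrable_bound[of lborel "\<lambda>h. (B * (LINT x|lborel. \<bar>v x\<bar>)) * \<eta> h"])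
      show "integrable lborel (\<lambda>h. (B * (LINT x|lborel. \<bar>v x\<bar>)) * \<eta> h)" using \<eta> by simp
      show "(\<lambda>h. LINT x|lborel. norm (case (h, x) of (h, x) \<Rightarrow> ?f h x)) \<in> borel_measurable lborel"
        by measurable
      have "(LINT x|lborel. \<bar>\<phi> x * v (x + h)\<bar>) \<le> B * (LINT x|lborel. \<bar>v x\<bar>)" for h
      proof -
        have "(LINT x|lborel. \<bar>\<phi> x * v (x + h)\<bar>) \<le> (LINT x|lborel. B * \<bar>v (x + h)\<bar>)"
        proof (rule integral_mono)
          show "integrable lborel (\<lambda>x. \<bar>\<phi> x * v (x + h)\<bar>)" by (rule integrable_abs[OF iv])
          show "integrable lborel (\<lambda>x. B * \<bar>v (x + h)\<bar>)" using integrable_translate[OF v] by simp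
          show "\<bar>\<phi> x * v (x + h)\<bar> \<le> B * \<bar>v (x + h)\<bar>" for x
            unfolding abs_mult by (rule mult_right_mono[OF \<phi>(2) abs_ge_zero])
        qed
        also have "\<dots> = B * (LINT x|lborel. \<bar>v x\<bar>)"
          using integral_translate[of "\<lambda>x. \<bar>v x\<bar>" h] by simp
        finally show ?thesis .
      qed
      then have "\<bar>\<eta> h\<bar> * (LINT x|lborel. \<bar>\<phi> x * v (x + h)\<bar>) \<le> \<bar>\<eta> h\<bar> * (B * (LINT x|lborel. \<bar>v x\<bar>))" for h
        by (intro mult_left_mono) auto
      moreover have "0 \<le> (LINT x|lborel. \<bar>\<phi> x * v (x + h)\<bar>)" "0 \<le> B * (LINT x|lborel. \<bar>v x\<bar>)" for h
        using B by (auto intro!: Bochner_Integration.integral_nonneg mult_nonneg_nonneg)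
      ultimately show "AE h in lborel. norm (LINT x|lborel. norm (case (h, x) of (h, x) \<Rightarrow> ?f h x))
          \<le> norm ((B * (LINT x|lborel. \<bar>v x\<bar>)) * \<eta> h)"
        by (intro AE_I2) (simp add: abs_mult abs_of_nonneg[OF B] mult.commute mult.left_commute)
    qed
  qed
  have "(LINT h|lborel. \<eta> h * (LINT x|lborel. v x * \<phi> (x + - h))) = (LINT h|lborel. LINT x|lborel. ?f h x)"
    unfolding shift by simp
  also have "\<dots> = (LINT x|lborel. LINT h|lborel. ?f h x)"
    by (rule lborel_pair.Fubini_integral[OF int, symmetric])
  also have "\<dots> = (LINT x|lborel. \<phi> x * mollify \<eta> v x)"
    unfolding mollify_def integral_mult_right_zero[symmetric]
    by (intro Bochner_Integration.integral_cong refl) (simp add: mult.left_commute)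
  finally show "(LINT h|lborel. \<eta> h * (LINT x|lborel. v x * \<phi> (x + - h))) = (LINT x|lborel. \<phi> x * mollify \<eta> v x)" .
  show "integrable lborel (\<lambda>h. \<eta> h * (LINT x|lborel. v x * \<phi> (x + - h)))"
    unfolding shift using lborel_pair.integrable_fst'[OF int] by simp
qed

text \<open>Tested with |\<phi>| \<le> 1, the difference of v and its mollification is an
  \<eta>-average of translation errors with shifts of length at most \<rho>. For differences of a
  sequence with a common derivative bound, this reduces L^1 Cauchyness to that of the mollified
  functions.\<close>

lemma integral_abs_le_mollify:
  fixes v \<eta> :: "'a::euclidean_space \<Rightarrow> real"
  assumes v: "integrable lborel v" "deriv_bound v C" and C: "C \<ge> 0"
    and \<eta>: "integrable lborel \<eta>" "\<And>h. 0 \<le> \<eta> h" "\<And>h. norm h > \<rho> \<Longrightarrow> \<eta> h = 0" "(LINT h|lborel. \<eta> h) = 1"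
    and mol: "integrable lborel (mollify \<eta> v)"
  shows "(LINT x|lborel. \<bar>v x\<bar>) \<le> C * (real DIM('a) * \<rho>) + (LINT x|lborel. \<bar>mollify \<eta> v x\<bar>)"
proof (rule integral_abs_le_dual[OF open_UNIV v(1)])
  fix \<phi> assume \<phi>: "\<phi> \<in> test_functions UNIV" "\<And>x::'a. \<bar>\<phi> x\<bar> \<le> 1"
  let ?a = "LINT x|lborel. v x * \<phi> x"
  let ?g = "\<lambda>h. LINT x|lborel. v x * \<phi> (x + - h)"
  note F = mollify_Fubini[OF v(1) \<eta>(1) test_functions_borel[OF \<phi>(1)] \<phi>(2)]
  have "?a = (LINT h|lborel. \<eta> h * ?a)" using \<eta>(4) by simp
  also have "\<dots> = (LINT h|lborel. \<eta> h * ?a - \<eta> h * ?g h) + (LINT h|lborel. \<eta> h * ?g h)"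
    using F(2) \<eta>(1) by simp
  also have "(LINT h|lborel. \<eta> h * ?a - \<eta> h * ?g h) \<le> (LINT h|lborel. \<eta> h * (C * (real DIM('a) * \<rho>)))"
  proof (rule integral_mono)
    show "integrable lborel (\<lambda>h. \<eta> h * ?a - \<eta> h * ?g h)" using F(2) \<eta>(1) by simp
    show "integrable lborel (\<lambda>h. \<eta> h * (C * (real DIM('a) * \<rho>)))" using \<eta>(1) by simp
    fix h
    show "\<eta> h * ?a - \<eta> h * ?g h \<le> \<eta> h * (C * (real DIM('a) * \<rho>))"
    proof (cases "norm h > \<rho>")
      case False
      have "?a - ?g h \<le> C * (real DIM('a) * norm h)"
        using translation_estimate[OF v C \<phi>, of "- h"] by simp
      also have "\<dots> \<le> C * (real DIM('a) * \<rho>)" using False C by (intro mult_left_mono) auto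
      finally show ?thesis using \<eta>(2)[of h] by (simp add: right_diff_distrib[symmetric] mult_left_mono)
    qed (simp add: \<eta>(3))
  qed
  also have "(LINT h|lborel. \<eta> h * (C * (real DIM('a) * \<rho>))) = C * (real DIM('a) * \<rho>)" using \<eta>(4) by simp
  also have "(LINT h|lborel. \<eta> h * ?g h) = (LINT x|lborel. \<phi> x * mollify \<eta> v x)" by (rule F(1))
  also have "\<dots> \<le> (LINT x|lborel. \<bar>mollify \<eta> v x\<bar>)"
  proof (rule integral_mono)
    show "integrable lborel (\<lambda>x. \<phi> x * mollify \<eta> v x)"
      by (rule integrable_bounded_mult[OF mol _ \<phi>(2)]) (use test_functions_borel[OF \<phi>(1)] in simp)
    show "integrable lborel (\<lambda>x. \<bar>mollify \<eta> v x\<bar>)" using mol by simp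
    fix x
    have "\<bar>\<phi> x\<bar> * \<bar>mollify \<eta> v x\<bar> \<le> 1 * \<bar>mollify \<eta> v x\<bar>" using \<phi>(2) by (intro mult_right_mono) auto
    then show "\<phi> x * mollify \<eta> v x \<le> \<bar>mollify \<eta> v x\<bar>"
      unfolding abs_mult[symmetric] by linarith
  qed
  finally show "?a \<le> C * (real DIM('a) * \<rho>) + (LINT x|lborel. \<bar>mollify \<eta> v x\<bar>)" by simp
qed auto

lemma mollifier_exists:
  assumes "\<rho> > 0"
  obtains \<eta> :: "'a::euclidean_space \<Rightarrow> real" and E where "integrable lborel \<eta>" "continuous_on UNIV \<eta>" "\<And>h. 0 \<le> \<eta> h" "\<And>h. \<eta> h \<le> E"
    "\<And>h. norm h > \<rho> \<Longrightarrow> \<eta> h = 0" "(LINT h|lborel. \<eta> h) = 1"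
proof -
  let ?b = "ball_bump (0::'a) \<rho> 1"
  have b: "?b \<in> test_functions (cball 0 \<rho>)" using assms by (intro ball_bump_test_function) auto
  have i: "integrable lborel ?b" by (rule test_functions_integrable[OF b])
  have pos: "?b x > 0" if "x \<in> ball 0 \<rho>" for x
  proof -
    have "norm x < \<rho>" using that by simp
    then have "(norm x)\<^sup>2 < \<rho>\<^sup>2" by (intro power_strict_mono) auto
    then show ?thesis by (simp add: ball_bump_def flat_exp_def)
  qed
  define \<kappa> where "\<kappa> = (LINT h|lborel. ?b h)"
  have "\<kappa> \<noteq> 0"
  proof
    assume "\<kappa> = 0"
    then have "AE x in lborel. ?b x = 0"
      using integral_nonneg_eq_0_iff_AE[OF i AE_I2[OF ball_bump_range(1)]] by (simp add: \<kappa>_def)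
    then have "AE x in lborel. x \<notin> ball (0::'a) \<rho>"
    proof eventually_elim
      case (elim x)
      show ?case using pos[of x] elim by (intro notI) simp
    qed
    then have "emeasure lborel (ball (0::'a) \<rho>) = 0"
      by (subst (asm) AE_iff_measurable[of "ball 0 \<rho>"]) auto
    then show False using content_ball_pos[OF assms, of "0::'a"] by (simp add: measure_def)
  qed
  moreover have "0 \<le> \<kappa>" unfolding \<kappa>_def by (intro Bochner_Integration.integral_nonneg) (rule ball_bump_range(1))
  ultimately have \<kappa>: "\<kappa> > 0" by simp
  show ?thesis
  proof (rule that[of "\<lambda>h. ?b h / \<kappa>" "1 / \<kappa>"])
    show "integrable lborel (\<lambda>h. ?b h / \<kappa>)" using i by simp
    show "continuous_on UNIV (\<lambda>h. ?b h / \<kappa>)"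
      using smooth_continuous[OF test_functions_smooth[OF b]] \<kappa> by (intro continuous_on_divide continuous_on_const) auto
    show "0 \<le> ?b h / \<kappa>" "?b h / \<kappa> \<le> 1 / \<kappa>" for h
      using ball_bump_range[of 0 \<rho> 1 h] \<kappa> by (auto intro: divide_right_mono)
    show "?b h / \<kappa> = 0" if "norm h > \<rho>" for h
      using test_functions_outside[OF b, of h] that by simp
    show "(LINT h|lborel. ?b h / \<kappa>) = 1" using \<kappa> by (simp add: \<kappa>_def)
  qed
qed

text \<open>Takes the place of dominated convergence where no majorant is at hand: Fatou's lemma in
  the second index upgrades the Cauchy property to L^1 convergence to g.\<close>

lemma L1_Cauchy_AE_limit:
  fixes s :: "nat \<Rightarrow> 'a \<Rightarrow> real"
  assumes s: "\<And>n. integrable M (s n)" and g: "g \<in> borel_measurable M"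
    and cau: "\<And>e. e > 0 \<Longrightarrow> \<exists>N. \<forall>i\<ge>N. \<forall>j\<ge>N. (LINT x|M. \<bar>s i x - s j x\<bar>) < e"
    and lim: "AE x in M. (\<lambda>n. s n x) \<longlonglongrightarrow> g x"
  shows "(\<lambda>n. LINT x|M. s n x) \<longlonglongrightarrow> (LINT x|M. g x)"
proof (rule LIMSEQ_I)
  fix e :: real assume "e > 0"
  then obtain N where N: "\<And>i j. i \<ge> N \<Longrightarrow> j \<ge> N \<Longrightarrow> (LINT x|M. \<bar>s i x - s j x\<bar>) < e / 2"
    using cau[of "e / 2"] by (meson half_gt_zero)
  have est: "integrable M (\<lambda>x. \<bar>s n x - g x\<bar>)" "(LINT x|M. \<bar>s n x - g x\<bar>) \<le> e / 2" if n: "n \<ge> N" for n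
  proof -
    have i: "integrable M (\<lambda>x. \<bar>s n x - s (m + N) x\<bar>)" for m using s by simp
    have l: "AE x in M. (\<lambda>m. \<bar>s n x - s (m + N) x\<bar>) \<longlonglongrightarrow> \<bar>s n x - g x\<bar>"
      using lim
    proof eventually_elim
      case (elim x)
      then show ?case by (intro tendsto_intros LIMSEQ_ignore_initial_segment)
    qed
    have b: "(LINT x|M. \<bar>s n x - s (m + N) x\<bar>) \<le> e / 2" for m
      using N[OF n, of "m + N"] by simp
    have m: "(\<lambda>x. \<bar>s n x - g x\<bar>) \<in> borel_measurable M" using s[of n] g by simp
    show "integrable M (\<lambda>x. \<bar>s n x - g x\<bar>)" "(LINT x|M. \<bar>s n x - g x\<bar>) \<le> e / 2"
      by (rule Fatou_AE_limit[OF i abs_ge_zero m l b tendsto_const])+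
  qed
  have sg: "integrable M (\<lambda>x. s n x - g x)" if "n \<ge> N" for n
    using est(1)[OF that] s[of n] g by (subst (asm) integrable_abs_iff) auto
  have ig: "integrable M g"
  proof -
    have "integrable M (\<lambda>x. s N x - (s N x - g x))" by (rule Bochner_Integration.integrable_diff[OF s sg]) simp
    then show ?thesis by simp
  qed
  show "\<exists>N. \<forall>n\<ge>N. norm ((LINT x|M. s n x) - (LINT x|M. g x)) < e"
  proof (intro exI[of _ N] allI impI)
    fix n assume n: "n \<ge> N"
    have "norm ((LINT x|M. s n x) - (LINT x|M. g x)) = norm (LINT x|M. s n x - g x)"
      using s ig by simp
    also have "\<dots> \<le> (LINT x|M. \<bar>s n x - g x\<bar>)"
      using integral_norm_bound[of M "\<lambda>x. s n x - g x"] by simp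
    also have "\<dots> < e" using est(2)[OF n] \<open>e > 0\<close> by simp
    finally show "norm ((LINT x|M. s n x) - (LINT x|M. g x)) < e" .
  qed
qed

section \<open>Local strong compactness\<close>

context bounded_open_set
begin

text \<open>The functions are read as densities of measures. Their weak limit may be singular or
  charge the boundary, so only the existence of the limits of pairings is retained.\<close>

lemma weakly_convergent_subsequence_nonneg:
  fixes g :: "nat \<Rightarrow> 'a \<Rightarrow> real"
  assumes g: "\<And>n. integrable lborel (g n)" "\<And>n x. 0 \<le> g n x" "\<And>n x. x \<notin> \<Omega> \<Longrightarrow> g n x = 0"
    and A: "\<And>n. (LINT x|lborel. g n x) \<le> A"
  shows "\<exists>r. strict_mono (r :: nat \<Rightarrow> nat) \<and>
    (\<forall>\<phi>. continuous_on UNIV \<phi> \<longrightarrow> (\<exists>l. (\<lambda>n. LINT x|lborel. \<phi> x * g (r n) x) \<longlonglongrightarrow> l))"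
proof -
  obtain R where R: "R > 0" "\<And>x. x \<in> \<Omega> \<Longrightarrow> norm x \<le> R" using bounded_\<Omega> bounded_pos by blast
  define \<mu> where "\<mu> n = density lborel (\<lambda>x. ennreal (g n x))" for n
  have R0: "0 \<le> R" using R by simp
  have fin: "finite_measure (\<mu> n)" for n unfolding \<mu>_def by (rule density_real_facts(1)[OF g(1,2)])
  have sets: "sets (\<mu> n) = sets borel" for n by (simp add: \<mu>_def)
  have ae: "AE x in \<mu> n. norm x \<le> R" for n
    unfolding \<mu>_def
  proof (subst AE_density)
    show "(\<lambda>x. ennreal (g n x)) \<in> borel_measurable lborel" using g(1)[of n] by simp
    show "AE x in lborel. 0 < ennreal (g n x) \<longrightarrow> norm x \<le> R"
    proof (intro AE_I2 impI)
      fix x assume "0 < ennreal (g n x)"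
      then have "x \<in> \<Omega>" using g(3)[of x n] by force
      then show "norm x \<le> R" by (rule R(2))
    qed
  qed
  have mass: "measure (\<mu> n) UNIV \<le> A" for n
    using A[of n] density_real_facts(2)[OF g(1,2), of UNIV n] g(2)[of n]
    by (simp add: \<mu>_def measure_def)
  show ?thesis
  proof (rule bounded_measures_weakly_compact[OF R0 fin sets ae mass])
    fix r :: "nat \<Rightarrow> nat" and \<nu> :: "'a measure"
    assume r: "strict_mono r" and conv: "\<And>\<phi> :: 'a \<Rightarrow> real. continuous_on UNIV \<phi> \<Longrightarrow> (\<lambda>n. LINT x|\<mu> (r n). \<phi> x) \<longlonglongrightarrow> (LINT x|\<nu>. \<phi> x)"
    have "\<exists>l. (\<lambda>n. LINT x|lborel. \<phi> x * g (r n) x) \<longlonglongrightarrow> l" if \<phi>: "continuous_on UNIV \<phi>" for \<phi>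
    proof -
      have "\<phi> \<in> borel_measurable lborel" using borel_measurable_continuous_onI[OF \<phi>] by simp
      then have "(LINT x|\<mu> n. \<phi> x) = (LINT x|lborel. \<phi> x * g n x)" for n
        unfolding \<mu>_def by (rule density_real_facts(3)[OF g(1,2)])
      then show ?thesis using conv[OF \<phi>] by auto
    qed
    with r show ?thesis by blast
  qed
qed

lemma integrable_mult_continuous:
  fixes g \<phi> :: "'a \<Rightarrow> real"
  assumes g: "integrable lborel g" "\<And>x. x \<notin> \<Omega> \<Longrightarrow> g x = 0" and \<phi>: "continuous_on UNIV \<phi>"
  shows "integrable lborel (\<lambda>x. \<phi> x * g x)"
proof -
  have c: "compact (closure \<Omega>)" using bounded_\<Omega> by (simp add: compact_closure)
  have "bounded (\<phi> ` closure \<Omega>)"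
    by (intro compact_imp_bounded compact_continuous_image c continuous_on_subset[OF \<phi>]) simp
  then obtain B where B: "\<forall>y\<in>\<phi> ` closure \<Omega>. norm y \<le> B" using bounded_iff by blast
  have m: "\<phi> \<in> borel_measurable borel" by (rule borel_measurable_continuous_onI[OF \<phi>])
  have "integrable lborel (\<lambda>x. (indicator \<Omega> x * \<phi> x) * g x)"
  proof (rule integrable_bounded_mult[OF g(1)])
    show "(\<lambda>x. indicator \<Omega> x * \<phi> x) \<in> borel_measurable lborel" using m open_\<Omega> by simp
    show "\<bar>indicator \<Omega> x * \<phi> x\<bar> \<le> \<bar>B\<bar>" for x
    proof (cases "x \<in> \<Omega>")
      case True
      then have "norm (\<phi> x) \<le> B" using B closure_subset[of \<Omega>] by blast
      then show ?thesis using True by simp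
    qed simp
  qed
  moreover have "(\<lambda>x. (indicator \<Omega> x * \<phi> x) * g x) = (\<lambda>x. \<phi> x * g x)"
    using g(2) by (auto simp: indicator_def fun_eq_iff)
  ultimately show ?thesis by simp
qed

lemma weakly_convergent_subsequence:
  fixes w :: "nat \<Rightarrow> 'a \<Rightarrow> real"
  assumes w: "\<And>n. integrable lborel (w n)" "\<And>n x. x \<notin> \<Omega> \<Longrightarrow> w n x = 0"
    and A: "\<And>n. (LINT x|lborel. \<bar>w n x\<bar>) \<le> A"
  shows "\<exists>r. strict_mono (r :: nat \<Rightarrow> nat) \<and>
    (\<forall>\<phi>. continuous_on UNIV \<phi> \<longrightarrow> (\<exists>l. (\<lambda>n. LINT x|lborel. \<phi> x * w (r n) x) \<longlonglongrightarrow> l))"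
proof -
  define p q where "p n x = max 0 (w n x)" and "q n x = max 0 (- w n x)" for n x
  have pi: "integrable lborel (p n)" "integrable lborel (q n)" for n
    unfolding p_def[abs_def] q_def[abs_def] using w(1)[of n] by auto
  have p0: "0 \<le> p n x" "0 \<le> q n x" "x \<notin> \<Omega> \<Longrightarrow> p n x = 0" "x \<notin> \<Omega> \<Longrightarrow> q n x = 0" "w n x = p n x - q n x"
    "p n x \<le> \<bar>w n x\<bar>" "q n x \<le> \<bar>w n x\<bar>" for n x
    using w(2)[of x n] by (auto simp: p_def q_def)
  have mass: "(LINT x|lborel. p n x) \<le> A" "(LINT x|lborel. q n x) \<le> A" for n
    by (rule order_trans[OF integral_mono[OF pi(1) integrable_abs[OF w(1)] p0(6)] A])
      (rule order_trans[OF integral_mono[OF pi(2) integrable_abs[OF w(1)] p0(7)] A])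
  obtain r1 where r1: "strict_mono r1"
    "\<And>\<phi>. continuous_on UNIV \<phi> \<Longrightarrow> \<exists>l. (\<lambda>n. LINT x|lborel. \<phi> x * p (r1 n) x) \<longlonglongrightarrow> l"
    using weakly_convergent_subsequence_nonneg[of p, OF pi(1) p0(1,3) mass(1)] by blast
  obtain r2 where r2: "strict_mono r2"
    "\<And>\<phi>. continuous_on UNIV \<phi> \<Longrightarrow> \<exists>l. (\<lambda>n. LINT x|lborel. \<phi> x * q (r1 (r2 n)) x) \<longlonglongrightarrow> l"
    using weakly_convergent_subsequence_nonneg[of "\<lambda>n. q (r1 n)", OF pi(2) p0(2,4) mass(2)] by blast
  have "\<exists>l. (\<lambda>n. LINT x|lborel. \<phi> x * w ((r1 \<circ> r2) n) x) \<longlonglongrightarrow> l" if \<phi>: "continuous_on UNIV \<phi>" for \<phi>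
  proof -
    obtain l where l: "(\<lambda>n. LINT x|lborel. \<phi> x * p (r1 n) x) \<longlonglongrightarrow> l" using r1(2)[OF \<phi>] by blast
    obtain k where k: "(\<lambda>n. LINT x|lborel. \<phi> x * q (r1 (r2 n)) x) \<longlonglongrightarrow> k" using r2(2)[OF \<phi>] by blast
    have "(LINT x|lborel. \<phi> x * w n x) = (LINT x|lborel. \<phi> x * p n x) - (LINT x|lborel. \<phi> x * q n x)" for n
      using integrable_mult_continuous[OF pi(1) p0(3) \<phi>, of n] integrable_mult_continuous[OF pi(2) p0(4) \<phi>, of n]
      by (simp add: p0(5) right_diff_distrib)
    then show ?thesis
      using tendsto_diff[OF LIMSEQ_subseq_LIMSEQ[OF l r2(1)] k] by (auto simp: comp_def)
  qed
  then show ?thesis using strict_mono_o[OF r1(1) r2(1)] by blast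
qed

text \<open>Multiplication by \<psi> cuts w off before the boundary: with d for a partial
  derivative, \<psi> d\<phi> = d(\<psi> \<phi>) - \<phi> d\<psi> turns the derivative bound inside
  \<Omega> into \<open>deriv_bound\<close> on the whole space.\<close>

lemma test_function_mult_Cauchy:
  fixes w :: "nat \<Rightarrow> 'a \<Rightarrow> real"
  assumes w: "\<And>n. integrable lborel (w n)" "\<And>n x. x \<notin> \<Omega> \<Longrightarrow> w n x = 0"
    and A: "\<And>n. (LINT x|lborel. \<bar>w n x\<bar>) \<le> A"
    and T: "\<And>n \<phi> b B. \<phi> \<in> test_functions \<Omega> \<Longrightarrow> b \<in> Basis \<Longrightarrow> (\<And>x. \<bar>\<phi> x\<bar> \<le> B) \<Longrightarrow>
      \<bar>LINT x|lborel. w n x * partial_deriv b \<phi> x\<bar> \<le> B * T"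
    and weak: "\<And>\<phi>. continuous_on UNIV \<phi> \<Longrightarrow> \<exists>l. (\<lambda>n. LINT x|lborel. \<phi> x * w n x) \<longlonglongrightarrow> l"
    and \<psi>: "\<psi> \<in> test_functions \<Omega>" and e: "e > 0"
  shows "\<exists>N. \<forall>i\<ge>N. \<forall>j\<ge>N. (LINT x|lborel. \<bar>w i x * \<psi> x - w j x * \<psi> x\<bar>) < e"
proof -
  obtain R where R: "R > 0" "\<And>x. x \<in> \<Omega> \<Longrightarrow> norm x \<le> R" using bounded_\<Omega> bounded_pos by blast
  obtain P where P: "P > 0" "\<And>x. \<bar>\<psi> x\<bar> \<le> P" using test_functions_bounded[OF \<psi>] by blast
  have "\<exists>D. \<forall>x. \<bar>partial_deriv b \<psi> x\<bar> \<le> D" if "b \<in> Basis" for b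
    using test_functions_bounded[OF test_functions_partial_deriv[OF \<psi> that]] by meson
  then obtain Db where Db: "\<And>b x. b \<in> Basis \<Longrightarrow> \<bar>partial_deriv b \<psi> x\<bar> \<le> Db b" by metis
  define D where "D = (\<Sum>b\<in>Basis. Db b)"
  have Db0: "0 \<le> Db b" if "b \<in> Basis" for b using Db[OF that, of 0] by linarith
  have D: "\<bar>partial_deriv b \<psi> x\<bar> \<le> D" if "b \<in> Basis" for b x
    using Db[OF that, of x] member_le_sum[of b Basis Db] Db0 that unfolding D_def by fastforce
  have D0: "0 \<le> D" unfolding D_def by (intro sum_nonneg Db0)
  have A0: "0 \<le> A"
    using A[of 0] order_trans[OF Bochner_Integration.integral_nonneg] by (metis abs_ge_zero)
  \<comment> \<open>The two terms of the Leibniz rule: P goes with the derivative bound T for w, and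
    the bound D for the derivatives of \<psi> goes with the L^1 bound A. The sign of T is unknown,
    hence the absolute value.\<close>
  define C where "C = \<bar>P * T\<bar> + A * D"
  have C0: "0 \<le> C" using A0 D0 by (simp add: C_def)
  define v where "v n x = w n x * \<psi> x" for n x
  have v: "integrable lborel (v n)" for n
    unfolding v_def[abs_def] by (rule integrable_mult_test_function[OF w(1) \<psi>])
  have sm: "smooth \<psi>" by (rule test_functions_smooth[OF \<psi>])
  have vC: "deriv_bound (v n) C" for n
    unfolding deriv_bound_def
  proof (intro ballI allI impI)
    fix \<phi> :: "'a \<Rightarrow> real" and b :: 'a and B :: real
    assume \<phi>: "\<phi> \<in> test_functions UNIV" and b: "b \<in> Basis" and B: "\<forall>x. \<bar>\<phi> x\<bar> \<le> B"
    have s\<phi>: "smooth \<phi>" by (rule test_functions_smooth[OF \<phi>])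
    have B0: "0 \<le> B" using B[rule_format, of 0] by linarith
    have t1: "(\<lambda>x. \<psi> x * \<phi> x) \<in> test_functions \<Omega>" by (rule test_functions_mult_smooth[OF s\<phi> \<psi>])
    have t2: "(\<lambda>x. partial_deriv b \<psi> x * \<phi> x) \<in> test_functions \<Omega>"
      by (rule test_functions_mult_smooth[OF s\<phi> test_functions_partial_deriv[OF \<psi> b]])
    have b1: "\<bar>\<psi> x * \<phi> x\<bar> \<le> P * B" for x
      unfolding abs_mult using P B B0 by (intro mult_mono) auto
    have b2: "\<bar>partial_deriv b \<psi> x * \<phi> x\<bar> \<le> D * B" for x
      unfolding abs_mult using D[OF b] D0 B B0 by (intro mult_mono) auto
    note i1 = integrable_mult_test_function[OF w(1) test_functions_partial_deriv[OF t1 b], of n]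
    note i2 = integrable_mult_test_function[OF w(1) t2, of n]
    have "v n x * partial_deriv b \<phi> x = w n x * partial_deriv b (\<lambda>x. \<psi> x * \<phi> x) x - w n x * (partial_deriv b \<psi> x * \<phi> x)" for x
      unfolding v_def partial_deriv_mult[OF sm s\<phi>] by (simp add: algebra_simps)
    then have "(LINT x|lborel. v n x * partial_deriv b \<phi> x)
        = (LINT x|lborel. w n x * partial_deriv b (\<lambda>x. \<psi> x * \<phi> x) x) - (LINT x|lborel. w n x * (partial_deriv b \<psi> x * \<phi> x))"
      using i1 i2 by simp
    moreover have "\<bar>LINT x|lborel. w n x * partial_deriv b (\<lambda>x. \<psi> x * \<phi> x) x\<bar> \<le> (P * B) * T"
      by (rule T[OF t1 b b1])
    moreover have "(P * B) * T \<le> \<bar>P * T\<bar> * B"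
      using B0 mult_right_mono[OF abs_ge_self[of "P * T"] B0] by (simp add: mult_ac)
    moreover have "\<bar>LINT x|lborel. w n x * (partial_deriv b \<psi> x * \<phi> x)\<bar> \<le> A * (D * B)"
    proof -
      have "\<bar>LINT x|lborel. w n x * (partial_deriv b \<psi> x * \<phi> x)\<bar> \<le> (LINT x|lborel. \<bar>w n x * (partial_deriv b \<psi> x * \<phi> x)\<bar>)"
        using integral_norm_bound[of lborel "\<lambda>x. w n x * (partial_deriv b \<psi> x * \<phi> x)"] by simp
      also have "\<dots> \<le> (LINT x|lborel. \<bar>w n x\<bar> * (D * B))"
      proof (rule integral_mono)
        show "integrable lborel (\<lambda>x. \<bar>w n x * (partial_deriv b \<psi> x * \<phi> x)\<bar>)" using i2 by (rule integrable_abs)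
        show "integrable lborel (\<lambda>x. \<bar>w n x\<bar> * (D * B))" using w(1)[of n] by simp
        show "\<bar>w n x * (partial_deriv b \<psi> x * \<phi> x)\<bar> \<le> \<bar>w n x\<bar> * (D * B)" for x
          unfolding abs_mult[of "w n x"] by (rule mult_left_mono[OF b2 abs_ge_zero])
      qed
      also have "\<dots> = (LINT x|lborel. \<bar>w n x\<bar>) * (D * B)" by simp
      also have "\<dots> \<le> A * (D * B)" using A[of n] D0 B0 by (intro mult_right_mono mult_nonneg_nonneg) auto
      finally show ?thesis .
    qed
    ultimately show "\<bar>LINT x|lborel. v n x * partial_deriv b \<phi> x\<bar> \<le> C * B"
      unfolding C_def distrib_right mult.assoc[of A D B] by linarith
  qed
  define d where "d = real DIM('a)"
  have d0: "d > 0" by (simp add: d_def)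
  \<comment> \<open>Makes (C + C) d \<rho> at most e / 4, where C + C is the derivative bound for a
    difference; the added 1 covers C = 0.\<close>
  define \<rho> where "\<rho> = e / (4 * (C + C + 1) * d)"
  have \<rho>: "\<rho> > 0" unfolding \<rho>_def using e C0 d0 by simp
  obtain \<eta> :: "'a \<Rightarrow> real" and E where \<eta>: "integrable lborel \<eta>" "continuous_on UNIV \<eta>" "\<And>h. 0 \<le> \<eta> h" "\<And>h. \<eta> h \<le> E"
    "\<And>h. norm h > \<rho> \<Longrightarrow> \<eta> h = 0" "(LINT h|lborel. \<eta> h) = 1"
    using mollifier_exists[OF \<rho>] by blast
  note [measurable] = borel_measurable_integrable[OF v] borel_measurable_integrable[OF \<eta>(1)]
  have vb: "v n \<in> borel_measurable borel" "\<eta> \<in> borel_measurable borel" for n by measurable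
  let ?m = "\<lambda>n. mollify \<eta> (v n)"
  have m: "?m n z = (LINT y|lborel. v n y * \<eta> (y - z))" for n z by (rule mollify_eq[OF vb])
  have mi: "integrable lborel (\<lambda>y. v n y * \<eta> (y - z))" for n z
  proof -
    have "integrable lborel (\<lambda>y. \<eta> (y - z) * v n y)"
      by (rule integrable_bounded_mult[OF v, where B = E]) (use \<eta>(3,4) in \<open>auto simp: abs_of_nonneg\<close>)
    then show ?thesis by (simp add: mult.commute)
  qed
  have "\<exists>l. (\<lambda>n. ?m n z) \<longlonglongrightarrow> l" for z
  proof -
    \<comment> \<open>At a fixed z the mollified value is a pairing of w with a continuous function,
      so mollification turns weak convergence into pointwise convergence.\<close>
    have "continuous_on UNIV (\<lambda>y. \<psi> y * \<eta> (y - z))"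
      by (intro continuous_on_mult smooth_continuous[OF sm] continuous_on_compose2[OF \<eta>(2)] continuous_on_diff
          continuous_on_id continuous_on_const subset_UNIV)
    from weak[OF this] show ?thesis unfolding m v_def by (simp add: mult_ac)
  qed
  then obtain G where G: "\<And>z. (\<lambda>n. ?m n z) \<longlonglongrightarrow> G z" by metis
  have mm[measurable]: "?m n \<in> borel_measurable borel" for n
    unfolding mollify_def[abs_def] by measurable
  have Gm[measurable]: "G \<in> borel_measurable borel"
    by (rule borel_measurable_LIMSEQ_real[OF G]) measurable
  define K where "K = E * (P * A)"
  have E0: "0 \<le> E" using \<eta>(3,4)[of 0] by linarith
  have K0: "0 \<le> K" using E0 P A0 by (simp add: K_def)
  \<comment> \<open>The bounded kernel gives a bound uniform in n and z, the bounded domain a common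
    support; together they form an integrable majorant.\<close>
  have mK: "\<bar>?m n z\<bar> \<le> K * indicator (cball 0 (R + \<rho>)) z" for n z
  proof (cases "z \<in> cball 0 (R + \<rho>)")
    case True
    have "\<bar>?m n z\<bar> \<le> (LINT y|lborel. \<bar>v n y * \<eta> (y - z)\<bar>)"
      unfolding m using integral_norm_bound[of lborel "\<lambda>y. v n y * \<eta> (y - z)"] by simp
    also have "\<dots> \<le> (LINT y|lborel. (E * P) * \<bar>w n y\<bar>)"
    proof (rule integral_mono)
      show "integrable lborel (\<lambda>y. \<bar>v n y * \<eta> (y - z)\<bar>)" by (rule integrable_abs[OF mi])
      show "integrable lborel (\<lambda>y. (E * P) * \<bar>w n y\<bar>)" using w(1)[of n] by simp
      fix y
      have "\<bar>w n y\<bar> * \<bar>\<psi> y\<bar> * \<bar>\<eta> (y - z)\<bar> \<le> \<bar>w n y\<bar> * P * E"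
        using P \<eta>(3,4) by (intro mult_mono) auto
      then show "\<bar>v n y * \<eta> (y - z)\<bar> \<le> (E * P) * \<bar>w n y\<bar>" by (simp add: v_def abs_mult mult_ac)
    qed
    also have "\<dots> = (E * P) * (LINT y|lborel. \<bar>w n y\<bar>)" by simp
    also have "\<dots> \<le> (E * P) * A" using A[of n] E0 P by (intro mult_left_mono) auto
    finally show ?thesis using True by (simp add: K_def mult.assoc)
  next
    case False
    have "v n y * \<eta> (y - z) = 0" for y
    proof (cases "y \<in> \<Omega>")
      case True
      have "norm z > R + \<rho>" using False by simp
      moreover have "norm z \<le> norm y + norm (y - z)"
        using norm_triangle_ineq4[of y "y - z"] by simp
      ultimately have "norm (y - z) > \<rho>" using R(2)[OF True] by linarith
      then show ?thesis by (simp add: \<eta>(5))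
    qed (simp add: v_def w(2))
    then have "?m n z = 0" unfolding m by (simp only: Bochner_Integration.integral_zero)
    then show ?thesis using False by simp
  qed
  have Ki: "integrable lborel (\<lambda>z. K * indicator (cball (0::'a) (R + \<rho>)) z)"
    using emeasure_compact_finite[OF compact_cball, of "0::'a" "R + \<rho>"]
    by (intro integrable_mult_right integrable_real_indicator) (auto simp: top.not_eq_extremum)
  have mI: "integrable lborel (?m n)" for n
    by (rule Bochner_Integration.integrable_bound[OF Ki]) (use mK K0 in \<open>auto intro!: AE_I2\<close>)
  have GK: "\<bar>G z\<bar> \<le> K * indicator (cball 0 (R + \<rho>)) z" for z
    by (rule LIMSEQ_le_const2[OF tendsto_rabs[OF G]]) (use mK in blast)
  have GI: "integrable lborel G"
    by (rule Bochner_Integration.integrable_bound[OF Ki]) (use GK K0 in \<open>auto intro!: AE_I2\<close>)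
  have "(\<lambda>n. LINT z|lborel. \<bar>?m n z - G z\<bar>) \<longlonglongrightarrow> (LINT z|(lborel :: 'a measure). 0 :: real)"
  proof (rule integral_dominated_convergence[where w = "\<lambda>z. 2 * (K * indicator (cball (0::'a) (R + \<rho>)) z)"])
    show "AE z in lborel. (\<lambda>n. \<bar>?m n z - G z\<bar>) \<longlonglongrightarrow> 0"
    proof (rule AE_I2)
      fix z
      have "(\<lambda>n. \<bar>?m n z - G z\<bar>) \<longlonglongrightarrow> \<bar>G z - G z\<bar>" by (intro tendsto_intros G)
      then show "(\<lambda>n. \<bar>?m n z - G z\<bar>) \<longlonglongrightarrow> 0" by simp
    qed
    show "AE z in lborel. norm \<bar>?m n z - G z\<bar> \<le> 2 * (K * indicator (cball 0 (R + \<rho>)) z)" for n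
    proof (rule AE_I2)
      fix z
      show "norm \<bar>?m n z - G z\<bar> \<le> 2 * (K * indicator (cball 0 (R + \<rho>)) z)"
        using mK[of n z] GK[of z] by simp
    qed
    show "integrable lborel (\<lambda>z. 2 * (K * indicator (cball (0::'a) (R + \<rho>)) z))" using Ki by (rule integrable_mult_right)
  qed measurable
  then have "\<forall>\<^sub>F n in sequentially. (LINT z|lborel. \<bar>?m n z - G z\<bar>) < e / 4"
    using e by (intro order_tendstoD(2)) auto
  then obtain N where N: "\<And>n. n \<ge> N \<Longrightarrow> (LINT z|lborel. \<bar>?m n z - G z\<bar>) < e / 4"
    unfolding eventually_sequentially by blast
  have "(LINT x|lborel. \<bar>v i x - v j x\<bar>) < e" if ij: "i \<ge> N" "j \<ge> N" for i j
  proof -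
    have mdiff: "mollify \<eta> (\<lambda>x. v i x - v j x) z = ?m i z - ?m j z" for z
    proof -
      have "(\<lambda>x. v i x - v j x) \<in> borel_measurable borel" by measurable
      from mollify_eq[OF this vb(2)] show ?thesis using mi unfolding m by (simp add: left_diff_distrib)
    qed
    have I: "integrable lborel (mollify \<eta> (\<lambda>x. v i x - v j x))"
      unfolding mdiff[abs_def] by (rule Bochner_Integration.integrable_diff[OF mI mI])
    have "(LINT x|lborel. \<bar>v i x - v j x\<bar>) \<le> (C + C) * (real DIM('a) * \<rho>) + (LINT z|lborel. \<bar>?m i z - ?m j z\<bar>)"
      unfolding mdiff[symmetric]
      by (rule integral_abs_le_mollify[OF Bochner_Integration.integrable_diff[OF v v] deriv_bound_diff[OF v v vC vC] _ \<eta>(1,3,5,6) I])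
        (use C0 in auto)
    also have "(C + C) * (real DIM('a) * \<rho>) \<le> e / 4"
    proof -
      have "(C + C) * (d * \<rho>) = (C + C) / (C + C + 1) * (e / 4)"
        using d0 C0 by (simp add: \<rho>_def)
      also have "\<dots> \<le> 1 * (e / 4)" using C0 e by (intro mult_right_mono) (auto simp: divide_le_eq)
      finally show ?thesis by (simp add: d_def)
    qed
    also have "(LINT z|lborel. \<bar>?m i z - ?m j z\<bar>) \<le> (LINT z|lborel. \<bar>?m i z - G z\<bar> + \<bar>?m j z - G z\<bar>)"
      using mI GI by (intro integral_mono integrable_abs Bochner_Integration.integrable_diff Bochner_Integration.integrable_add) auto
    also have "\<dots> = (LINT z|lborel. \<bar>?m i z - G z\<bar>) + (LINT z|lborel. \<bar>?m j z - G z\<bar>)"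
      using mI GI by (intro Bochner_Integration.integral_add integrable_abs Bochner_Integration.integrable_diff)
    also have "\<dots> < e / 4 + e / 4" by (intro add_strict_mono N ij)
    finally show ?thesis using e by simp
  qed
  then show ?thesis unfolding v_def by blast
qed

lemma AE_lborel_imp_AE_M:
  assumes "AE x in lborel. Q x"
  shows "AE x in M. Q x"
proof -
  have "AE x in lebesgue. Q x" using assms by (rule AE_completion)
  then show ?thesis using open_\<Omega> by (subst AE_restrict_space_iff) auto
qed

theorem BV_compact:
  fixes u :: "nat \<Rightarrow> 'a \<Rightarrow> real"
  assumes u: "\<And>n. u n \<in> BV \<Omega>" and A: "\<And>n. (LINT x|M. \<bar>u n x\<bar>) \<le> A" and T: "\<And>n. TV \<Omega> (u n) \<le> T"
  shows "\<exists>r v. strict_mono (r :: nat \<Rightarrow> nat) \<and> integrable M v \<and> (AE x in M. (\<lambda>n. u (r n) x) \<longlonglongrightarrow> v x) \<and>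
    (\<forall>\<phi>\<in>test_functions \<Omega>. \<forall>b\<in>Basis.
      (\<lambda>n. LINT x|M. u (r n) x * partial_deriv b \<phi> x) \<longlonglongrightarrow> (LINT x|M. v x * partial_deriv b \<phi> x))"
proof -
  have ui: "integrable M (u n)" for n using u[of n] by (simp add: BV_def)
  define Q where "Q n w \<longleftrightarrow> integrable lborel w \<and> (\<forall>x. x \<notin> \<Omega> \<longrightarrow> w x = 0) \<and> (AE x in M. u n x = w x) \<and>
      (\<forall>g. g \<in> borel_measurable borel \<longrightarrow> (LINT x|M. u n x * g x) = (LINT x|lborel. w x * g x))"
    for n and w :: "'a \<Rightarrow> real"
  have "\<exists>w. Q n w" for n
  proof (rule borel_representative[OF open_\<Omega> ui[of n]])
    fix w assume "integrable lborel w" "\<And>x. x \<notin> \<Omega> \<Longrightarrow> w x = 0" "AE x in M. u n x = w x"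
      "\<And>g. g \<in> borel_measurable borel \<Longrightarrow> (LINT x|M. u n x * g x) = (LINT x|lborel. w x * g x)"
    then have "Q n w" unfolding Q_def by (intro conjI allI impI)
    then show ?thesis by blast
  qed
  then obtain w where "\<And>n. Q n (w n)" by metis
  then have wi: "\<And>n. integrable lborel (w n)" and w0: "\<And>n x. x \<notin> \<Omega> \<Longrightarrow> w n x = 0"
    and uw: "\<And>n. AE x in M. u n x = w n x"
    and rep: "\<And>n g. g \<in> borel_measurable borel \<Longrightarrow> (LINT x|M. u n x * g x) = (LINT x|lborel. w n x * g x)"
    unfolding Q_def by blast+
  note [measurable] = borel_measurable_integrable[OF wi]
  have wA: "(LINT x|lborel. \<bar>w n x\<bar>) \<le> A" for n
  proof -
    have "(LINT x|lborel. \<bar>w n x\<bar>) = (LINT x|M. \<bar>w n x\<bar>)"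
      by (rule integral_lebesgue_on_eq_lborel(1)[OF open_\<Omega>, symmetric]) (simp_all add: w0)
    also have "\<dots> = (LINT x|M. \<bar>u n x\<bar>)"
    proof (rule integral_cong_AE)
      show "(\<lambda>x. \<bar>w n x\<bar>) \<in> borel_measurable M" by (rule borel_measurable_lebesgue_on) simp
      show "(\<lambda>x. \<bar>u n x\<bar>) \<in> borel_measurable M" using ui[of n] by simp
      show "AE x in M. \<bar>w n x\<bar> = \<bar>u n x\<bar>" using uw[of n] by eventually_elim simp
    qed
    finally show ?thesis using A[of n] by simp
  qed
  have A0: "0 \<le> A"
  proof -
    have "0 \<le> (LINT x|M. \<bar>u 0 x\<bar>)" by (intro Bochner_Integration.integral_nonneg) simp
    then show ?thesis using A[of 0] by linarith
  qed
  have wT: "\<bar>LINT x|lborel. w n x * partial_deriv b \<phi> x\<bar> \<le> B * T"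
    if \<phi>: "\<phi> \<in> test_functions \<Omega>" and b: "b \<in> Basis" and B: "\<And>x. \<bar>\<phi> x\<bar> \<le> B" for n \<phi> b B
  proof -
    have B0: "0 \<le> B" using B[of 0] by linarith
    have "\<bar>LINT x|lborel. w n x * partial_deriv b \<phi> x\<bar> = \<bar>LINT x|M. u n x * partial_deriv b \<phi> x\<bar>"
      using rep[OF test_functions_borel[OF test_functions_partial_deriv[OF \<phi> b]]] by simp
    also have "\<dots> \<le> B * TV \<Omega> (u n)" by (rule BV_integral_partial_deriv_le[OF u \<phi> B b])
    also have "\<dots> \<le> B * T" using T B0 by (rule mult_left_mono)
    finally show ?thesis .
  qed
  obtain r0 where r0: "strict_mono r0"
    and weak: "\<And>\<phi>. continuous_on UNIV \<phi> \<Longrightarrow> \<exists>l. (\<lambda>n. LINT x|lborel. \<phi> x * w (r0 n) x) \<longlonglongrightarrow> l"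
    using weakly_convergent_subsequence[of w, OF wi w0 wA] by blast
  have cauchy: "\<exists>N. \<forall>i\<ge>N. \<forall>j\<ge>N. (LINT x|lborel. \<bar>w (r0 i) x * \<psi> x - w (r0 j) x * \<psi> x\<bar>) < e"
    if "\<psi> \<in> test_functions \<Omega>" "e > 0" for \<psi> e
    by (rule test_function_mult_Cauchy[of "\<lambda>n. w (r0 n)", OF wi w0 wA wT weak that])
  obtain \<phi> where \<phi>: "\<And>k. \<phi> k \<in> test_functions \<Omega>" "\<And>k x. 0 \<le> \<phi> k x" "\<And>k x. \<phi> k x \<le> 1"
    "\<And>x. (\<lambda>k. \<phi> k x) \<longlonglongrightarrow> indicator \<Omega> x"
    using open_indicator_approx[OF open_\<Omega>] by blast
  note [measurable] = test_functions_borel[OF \<phi>(1)]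
  have geo: "(\<lambda>k. (1 / 2) ^ k :: real) sums 2"
    using geometric_sums[of "1 / 2 :: real"] by simp
  have t: "0 \<le> (1 / 2) ^ k * \<phi> k x" "(1 / 2) ^ k * \<phi> k x \<le> (1 / 2) ^ k" "(1 / 2) ^ k * \<phi> k x \<le> \<phi> k x" for k x
    using \<phi>(2,3)[of k x] by (auto intro!: mult_left_le mult_left_le_one_le power_le_one)
  have sm: "summable (\<lambda>k. (1 / 2) ^ k * \<phi> k x)" for x
    by (rule summable_comparison_test'[OF sums_summable[OF geo]]) (use t in auto)
  text \<open>The weight \<open>\<theta>\<close> is positive on all of \<open>\<Omega>\<close>, so that a single subsequence converges almost
    everywhere although \<open>L\<^sup>1\<close> convergence is only local.\<close>
  define \<theta> where "\<theta> x = (\<Sum>k. (1 / 2) ^ k * \<phi> k x)" for x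
  have \<theta>m[measurable]: "\<theta> \<in> borel_measurable borel" unfolding \<theta>_def[abs_def] by measurable
  have \<theta>0: "0 \<le> \<theta> x" for x unfolding \<theta>_def by (rule suminf_nonneg[OF sm t(1)])
  \<comment> \<open>A finite part of the series involves finitely many test functions, for which
    Cauchyness is known; the rest is uniformly small and meets the L^1 bound.\<close>
  have tail: "\<theta> x \<le> (\<Sum>k<n. \<phi> k x) + 2 * (1 / 2) ^ n" for n x
  proof -
    have "\<theta> x = (\<Sum>k. (1 / 2) ^ (k + n) * \<phi> (k + n) x) + (\<Sum>k<n. (1 / 2) ^ k * \<phi> k x)"
      unfolding \<theta>_def by (rule suminf_split_initial_segment[OF sm])
    moreover have "(\<Sum>k<n. (1 / 2) ^ k * \<phi> k x) \<le> (\<Sum>k<n. \<phi> k x)" by (intro sum_mono t(3))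
    moreover have "(\<Sum>k. (1 / 2) ^ (k + n) * \<phi> (k + n) x) \<le> 2 * (1 / 2) ^ n"
    proof -
      have s: "(\<lambda>k. (1 / 2) ^ k * (1 / 2) ^ n :: real) sums (2 * (1 / 2) ^ n)" by (rule sums_mult2[OF geo])
      have "(\<Sum>k. (1 / 2) ^ (k + n) * \<phi> (k + n) x) \<le> (\<Sum>k. (1 / 2) ^ k * (1 / 2) ^ n)"
        by (rule suminf_le[OF _ _ sums_summable[OF s]])
          (use t(2) summable_ignore_initial_segment[OF sm] in \<open>auto simp: power_add[symmetric]\<close>)
      then show ?thesis using s by (simp add: sums_iff)
    qed
    ultimately show ?thesis by linarith
  qed
  have \<theta>2: "\<theta> x \<le> 2" for x using tail[of x 0] by simp
  have \<theta>pos: "\<theta> x > 0" if "x \<in> \<Omega>" for x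
  proof -
    have "(\<lambda>k. \<phi> k x) \<longlonglongrightarrow> 1" using \<phi>(4)[of x] that by simp
    from order_tendstoD(1)[OF this, of 0] obtain k where "\<phi> k x > 0"
      unfolding eventually_sequentially by auto
    then show ?thesis unfolding \<theta>_def by (intro suminf_pos2[OF sm t(1), of k]) simp
  qed
  define s where "s n x = w (r0 n) x * \<theta> x" for n x
  have si: "integrable lborel (s n)" for n
  proof -
    have "integrable lborel (\<lambda>x. \<theta> x * w (r0 n) x)"
      by (rule integrable_bounded_mult[OF wi, where B = 2]) (use \<theta>0 \<theta>2 in auto)
    then show ?thesis by (simp add: s_def[abs_def] mult.commute)
  qed
  have sC: "\<exists>N. \<forall>i\<ge>N. \<forall>j\<ge>N. (LINT x|lborel. norm (s i x - s j x)) < e" if e: "e > 0" for e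
  proof -
    \<comment> \<open>The tail contributes at most 2 (1/2)^n (A + A), which this choice of n keeps
      below e / 2; the added 1 covers A = 0. The other half of e is shared by the first n test
      functions.\<close>
    have "0 < e / (2 * (4 * A + 1))" using e A0 by simp
    then obtain n where n: "(1 / 2) ^ n < e / (2 * (4 * A + 1))" using real_arch_pow_inv[of _ "1 / 2"] by auto
    have "0 < e / (2 * (real n + 1))" using e by simp
    then obtain Nk where Nk: "\<And>k i j. i \<ge> Nk k \<Longrightarrow> j \<ge> Nk k \<Longrightarrow>
        (LINT x|lborel. \<bar>w (r0 i) x * \<phi> k x - w (r0 j) x * \<phi> k x\<bar>) < e / (2 * (real n + 1))"
      using cauchy[OF \<phi>(1)] by metis
    \<comment> \<open>The sum of the thresholds is a common upper bound that also makes sense for n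
      = 0.\<close>
    define N where "N = (\<Sum>k<n. Nk k)"
    have N: "Nk k \<le> N" if "k < n" for k unfolding N_def using that by (intro member_le_sum) auto
    have "(LINT x|lborel. norm (s i x - s j x)) < e" if ij: "i \<ge> N" "j \<ge> N" for i j
    proof -
      let ?p = "\<lambda>k x. \<bar>w (r0 i) x * \<phi> k x - w (r0 j) x * \<phi> k x\<bar>"
      have pi: "integrable lborel (?p k)" for k
        by (intro integrable_abs Bochner_Integration.integrable_diff integrable_mult_test_function[OF wi \<phi>(1)])
      have wi': "integrable lborel (\<lambda>x. \<bar>w (r0 i) x\<bar> + \<bar>w (r0 j) x\<bar>)" using wi by simp
      have "(LINT x|lborel. norm (s i x - s j x)) \<le> (LINT x|lborel. (\<Sum>k<n. ?p k x) + (2 * (1 / 2) ^ n) * (\<bar>w (r0 i) x\<bar> + \<bar>w (r0 j) x\<bar>))"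
      proof (rule integral_mono)
        show "integrable lborel (\<lambda>x. norm (s i x - s j x))" using si by simp
        show "integrable lborel (\<lambda>x. (\<Sum>k<n. ?p k x) + (2 * (1 / 2) ^ n) * (\<bar>w (r0 i) x\<bar> + \<bar>w (r0 j) x\<bar>))"
          by (intro Bochner_Integration.integrable_add Bochner_Integration.integrable_sum pi integrable_mult_right wi')
        fix x
        let ?d = "\<bar>w (r0 i) x - w (r0 j) x\<bar>"
        have "norm (s i x - s j x) = ?d * \<theta> x"
          using \<theta>0[of x] by (simp add: s_def left_diff_distrib[symmetric] abs_mult)
        also have "\<dots> \<le> ?d * ((\<Sum>k<n. \<phi> k x) + 2 * (1 / 2) ^ n)" by (intro mult_left_mono tail) simp
        also have "\<dots> = (\<Sum>k<n. ?d * \<phi> k x) + (2 * (1 / 2) ^ n) * ?d"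
          by (simp only: distrib_left sum_distrib_left mult.commute[of ?d "2 * (1 / 2) ^ n"])
        also have "(\<Sum>k<n. ?d * \<phi> k x) = (\<Sum>k<n. ?p k x)"
        proof (rule sum.cong[OF refl])
          fix k
          show "?d * \<phi> k x = ?p k x"
            using \<phi>(2)[of k x] by (simp add: left_diff_distrib[symmetric] abs_mult)
        qed
        also have "(2 * (1 / 2) ^ n) * ?d \<le> (2 * (1 / 2) ^ n) * (\<bar>w (r0 i) x\<bar> + \<bar>w (r0 j) x\<bar>)"
          by (intro mult_left_mono abs_triangle_ineq4) simp
        finally show "norm (s i x - s j x) \<le> (\<Sum>k<n. ?p k x) + (2 * (1 / 2) ^ n) * (\<bar>w (r0 i) x\<bar> + \<bar>w (r0 j) x\<bar>)" by simp
      qed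
      also have "\<dots> = (\<Sum>k<n. LINT x|lborel. ?p k x) + (2 * (1 / 2) ^ n) * ((LINT x|lborel. \<bar>w (r0 i) x\<bar>) + (LINT x|lborel. \<bar>w (r0 j) x\<bar>))"
        using pi wi wi' by (simp add: Bochner_Integration.integral_sum)
      also have "\<dots> \<le> (\<Sum>k<n. e / (2 * (real n + 1))) + (2 * (1 / 2) ^ n) * (A + A)"
      proof (intro add_mono sum_mono mult_left_mono wA)
        fix k assume "k \<in> {..<n}"
        then show "(LINT x|lborel. ?p k x) \<le> e / (2 * (real n + 1))"
          using Nk[of k i j] N[of k] ij by fastforce
      qed simp
      also have "(\<Sum>k<n. e / (2 * (real n + 1))) \<le> e / 2" using e by (simp add: field_simps)
      also have "(2 * (1 / 2) ^ n) * (A + A) < e / 2"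
      proof -
        have "(2 * (1 / 2) ^ n) * (A + A) \<le> (1 / 2) ^ n * (4 * A + 1)" by (simp add: algebra_simps)
        also have "\<dots> < e / (2 * (4 * A + 1)) * (4 * A + 1)" using n A0 by (intro mult_strict_right_mono) auto
        also have "\<dots> = e / 2" using A0 by (simp add: divide_eq_eq)
        finally show ?thesis .
      qed
      finally show ?thesis by simp
    qed
    then show ?thesis by blast
  qed
  obtain r1 where r1: "strict_mono r1" "AE x in lborel. Cauchy (\<lambda>i. s (r1 i) x)"
    using cauchy_L1_AE_cauchy_subseq[of lborel s, OF si sC] by blast
  define r where "r n = r0 (r1 n)" for n
  have r: "strict_mono r" using strict_mono_o[OF r0 r1(1)] by (simp add: r_def[abs_def] comp_def)
  define v where "v x = lim (\<lambda>n. w (r n) x)" for x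
  have vm[measurable]: "v \<in> borel_measurable borel"
    unfolding v_def[abs_def] by (rule borel_measurable_lim_metric) measurable
  have v0: "v x = 0" if "x \<notin> \<Omega>" for x using w0[OF that] by (simp add: v_def limI)
  have lim: "AE x in lborel. (\<lambda>n. w (r n) x) \<longlonglongrightarrow> v x"
    using r1(2)
  proof eventually_elim
    case (elim x)
    have "convergent (\<lambda>n. w (r n) x)"
    proof (cases "x \<in> \<Omega>")
      case True
      obtain l where "(\<lambda>i. s (r1 i) x) \<longlonglongrightarrow> l" using Cauchy_convergent[OF elim] convergent_def by blast
      then have "(\<lambda>i. s (r1 i) x / \<theta> x) \<longlonglongrightarrow> l / \<theta> x" using \<theta>pos[OF True] by (intro tendsto_intros) auto
      moreover have "s (r1 i) x / \<theta> x = w (r i) x" for i using \<theta>pos[OF True] by (simp add: s_def r_def)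
      ultimately show ?thesis by (auto simp: convergent_def)
    next
      case False
      then show ?thesis using w0 by (simp add: convergent_const)
    qed
    then show ?case by (simp add: v_def convergent_LIMSEQ_iff)
  qed
  \<comment> \<open>Integrability of v up to the boundary comes from Fatou's lemma and the global
    L^1 bound, as L^1 convergence is known only locally.\<close>
  have "AE x in lborel. (\<lambda>n. \<bar>w (r n) x\<bar>) \<longlonglongrightarrow> \<bar>v x\<bar>"
    using lim by eventually_elim (rule tendsto_rabs)
  then have "integrable lborel (\<lambda>x. \<bar>v x\<bar>)"
    by (rule Fatou_AE_limit(1)[OF integrable_abs[OF wi] abs_ge_zero _ _ wA tendsto_const, rotated]) measurable
  then have vi: "integrable lborel v" by (subst (asm) integrable_abs_iff) auto
  have vM: "integrable M v" using integral_lebesgue_on_eq_lborel(2)[OF open_\<Omega> vm v0] vi by simp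
  have "AE x in M. \<forall>n. u n x = w n x" using uw by (simp add: AE_all_countable)
  then have aeM: "AE x in M. (\<lambda>n. u (r n) x) \<longlonglongrightarrow> v x"
    using AE_lborel_imp_AE_M[OF lim] by eventually_elim simp
  have conv: "(\<lambda>n. LINT x|M. u (r n) x * partial_deriv b \<phi> x) \<longlonglongrightarrow> (LINT x|M. v x * partial_deriv b \<phi> x)"
    if \<phi>: "\<phi> \<in> test_functions \<Omega>" and b: "b \<in> Basis" for \<phi> b
  proof -
    let ?\<psi> = "partial_deriv b \<phi>"
    have \<psi>: "?\<psi> \<in> test_functions \<Omega>" by (rule test_functions_partial_deriv[OF \<phi> b])
    note [measurable] = test_functions_borel[OF \<psi>]
    have "(\<lambda>n. LINT x|lborel. w (r n) x * ?\<psi> x) \<longlonglongrightarrow> (LINT x|lborel. v x * ?\<psi> x)"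
    proof (rule L1_Cauchy_AE_limit)
      show "integrable lborel (\<lambda>x. w (r n) x * ?\<psi> x)" for n
        by (rule integrable_mult_test_function[OF wi \<psi>])
      show "(\<lambda>x. v x * ?\<psi> x) \<in> borel_measurable lborel" by measurable
      show "AE x in lborel. (\<lambda>n. w (r n) x * ?\<psi> x) \<longlonglongrightarrow> v x * ?\<psi> x"
        using lim by eventually_elim (rule tendsto_mult_right)
      fix e :: real assume "e > 0"
      from cauchy[OF \<psi> this] obtain N where
        N: "\<And>i j. i \<ge> N \<Longrightarrow> j \<ge> N \<Longrightarrow> (LINT x|lborel. \<bar>w (r0 i) x * ?\<psi> x - w (r0 j) x * ?\<psi> x\<bar>) < e"
        by blast
      have "r1 i \<ge> N" if "i \<ge> N" for i using seq_suble[OF r1(1), of i] that by linarith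
      then show "\<exists>N. \<forall>i\<ge>N. \<forall>j\<ge>N. (LINT x|lborel. \<bar>w (r i) x * ?\<psi> x - w (r j) x * ?\<psi> x\<bar>) < e"
        unfolding r_def using N by blast
    qed
    moreover have "(LINT x|M. u n x * ?\<psi> x) = (LINT x|lborel. w n x * ?\<psi> x)" for n
      by (rule rep[OF test_functions_borel[OF \<psi>]])
    moreover have "(LINT x|M. v x * ?\<psi> x) = (LINT x|lborel. v x * ?\<psi> x)"
      by (rule integral_lebesgue_on_eq_lborel(1)[OF open_\<Omega>]) (simp_all add: v0)
    ultimately show ?thesis by simp
  qed
  show ?thesis using r vM aeM conv by blast
qed

end

section \<open>The penalty and the superposition operator\<close>

text \<open>The integral of the slopes of the penalty from 0 to t: each interval contributes its
  slope times the length that is traversed. In contrast to the definite description in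
  \<open>multibang\<close>, it lets continuity, sign and growth be read off.\<close>

definition ramp_sum :: "nat \<Rightarrow> (nat \<Rightarrow> real) \<Rightarrow> real \<Rightarrow> real" where
  "ramp_sum m us t = us m * max 0 (- t)
     + (\<Sum>i\<in>{1..<m}. (us i + us (Suc i)) / 2 * (max (us i) (min t (us (Suc i))) - us i))
     + us m * max 0 (t - us m)"

text \<open>Each summand is half a difference of squares, so the sum telescopes. With us 1 = 0 it
  shows that the penalty takes the value u_n^2 / 2 at the n-th breakpoint.\<close>

lemma sum_trapezoids:
  fixes us :: "nat \<Rightarrow> real"
  assumes "1 \<le> n"
  shows "(\<Sum>i\<in>{1..<n}. (us i + us (Suc i)) / 2 * (us (Suc i) - us i)) = ((us n)\<^sup>2 - (us 1)\<^sup>2) / 2"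
  using assms
proof (induction n rule: dec_induct)
  case (step n)
  then have "{1..<Suc n} = insert n {1..<n}" by auto
  then show ?case using step by (simp add: power2_eq_square field_simps)
qed simp

locale breakpoints =
  fixes m :: nat and us :: "nat \<Rightarrow> real"
  assumes m: "2 \<le> m" and us1: "us 1 = 0" and mono: "strict_mono_on {1..m} us"
begin

lemma us_le: "1 \<le> i \<Longrightarrow> i \<le> j \<Longrightarrow> j \<le> m \<Longrightarrow> us i \<le> us j"
  using strict_mono_on_leD[OF mono, of i j] by simp

lemma us_nonneg: "1 \<le> i \<Longrightarrow> i \<le> m \<Longrightarrow> 0 \<le> us i"
  using us_le[of 1 i] us1 by simp

lemma us_m_pos: "0 < us m"
  using strict_mono_onD[OF mono, of 1 m] m us1 by simp

lemma multibang_eq_ramp_sum: "multibang m us t = ramp_sum m us t"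
proof -
  consider "t \<le> us 1" | "us m \<le> t" "\<not> t \<le> us 1" | "\<not> t \<le> us 1" "\<not> us m \<le> t" by blast
  then show ?thesis
  proof cases
    case 1
    then have t: "t \<le> 0" using us1 by simp
    have "max (us i) (min t (us (Suc i))) - us i = 0" if "i \<in> {1..<m}" for i
      using us_nonneg[of i] that t by (simp add: max_def min_def)
    then have "(\<Sum>i\<in>{1..<m}. (us i + us (Suc i)) / 2 * (max (us i) (min t (us (Suc i))) - us i)) = 0"
      by (intro sum.neutral) simp
    then show ?thesis using 1 t us_m_pos by (simp add: multibang_def ramp_sum_def max_def)
  next
    case 2
    have "max (us i) (min t (us (Suc i))) = us (Suc i)" if "i \<in> {1..<m}" for i
      using us_le[of i "Suc i"] us_le[of "Suc i" m] that 2 by (simp add: max_def min_def)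
    then have "(\<Sum>i\<in>{1..<m}. (us i + us (Suc i)) / 2 * (max (us i) (min t (us (Suc i))) - us i))
        = (\<Sum>i\<in>{1..<m}. (us i + us (Suc i)) / 2 * (us (Suc i) - us i))"
      by (intro sum.cong) simp_all
    also have "\<dots> = (us m)\<^sup>2 / 2" using sum_trapezoids[of m us] m us1 by simp
    finally show ?thesis
      using 2 us1 by (simp add: multibang_def ramp_sum_def max_def power2_eq_square algebra_simps)
  next
    case 3
    then have t: "0 < t" "t < us m" using us1 by auto
    \<comment> \<open>The largest admissible index whose breakpoint does not exceed t; monotonicity
      makes it the one that the definite description singles out.\<close>
    define i where "i = Max {j \<in> {1..<m}. us j \<le> t}"
    have "1 \<in> {j \<in> {1..<m}. us j \<le> t}" using m us1 t by simp
    then have ne: "{j \<in> {1..<m}. us j \<le> t} \<noteq> {}" by blast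
    have fin: "finite {j \<in> {1..<m}. us j \<le> t}" by simp
    from Max_in[OF fin ne] have "i \<in> {j \<in> {1..<m}. us j \<le> t}" unfolding i_def .
    then have i: "1 \<le> i" "i < m" "us i \<le> t" by simp_all
    have i2: "t < us (Suc i)"
    proof (cases "Suc i = m")
      case False
      show ?thesis
      proof (rule ccontr)
        assume "\<not> t < us (Suc i)"
        then have "Suc i \<in> {j \<in> {1..<m}. us j \<le> t}" using i False by simp
        then have "Suc i \<le> i" unfolding i_def by (rule Max_ge[OF fin])
        then show False by simp
      qed
    qed (use t in simp)
    have unique: "j = i" if j: "j \<in> {1..<m} \<and> us j \<le> t \<and> t < us (Suc j)" for j
    proof (rule ccontr)
      assume "j \<noteq> i"
      then consider "Suc j \<le> i" | "Suc i \<le> j" by linarith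
      then show False
      proof cases
        case 1
        then have "us (Suc j) \<le> us i" using i by (intro us_le) auto
        then show False using i(3) j by linarith
      next
        case 2
        then have "us (Suc i) \<le> us j" using i j by (intro us_le) auto
        then show False using i2 j by linarith
      qed
    qed
    have the: "(THE i. i \<in> {1..<m} \<and> us i \<le> t \<and> t < us (Suc i)) = i"
    proof (rule the_equality)
      show "i \<in> {1..<m} \<and> us i \<le> t \<and> t < us (Suc i)" using i i2 by simp
    qed (rule unique)
    let ?f = "\<lambda>i. (us i + us (Suc i)) / 2 * (max (us i) (min t (us (Suc i))) - us i)"
    \<comment> \<open>Intervals before the i-th are traversed completely, those after it not at
      all.\<close>
    have split: "{1..<m} = {1..<i} \<union> insert i {Suc i..<m}" using i by auto
    have "sum ?f {1..<m} = sum ?f {1..<i} + sum ?f (insert i {Suc i..<m})"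
      unfolding split by (rule sum.union_disjoint) auto
    also have "sum ?f (insert i {Suc i..<m}) = ?f i + sum ?f {Suc i..<m}" by simp
    also have "sum ?f {1..<i} = (\<Sum>i\<in>{1..<i}. (us i + us (Suc i)) / 2 * (us (Suc i) - us i))"
    proof (rule sum.cong[OF refl])
      fix j assume j: "j \<in> {1..<i}"
      then have "us (Suc j) \<le> t" "us j \<le> us (Suc j)" using us_le[of "Suc j" i] us_le[of j "Suc j"] i by auto
      then show "?f j = (us j + us (Suc j)) / 2 * (us (Suc j) - us j)" by (simp add: max_def min_def)
    qed
    also have "\<dots> = (us i)\<^sup>2 / 2" using sum_trapezoids[of i us] i us1 by simp
    also have "sum ?f {Suc i..<m} = 0"
    proof (rule sum.neutral, rule ballI)
      fix j assume j: "j \<in> {Suc i..<m}"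
      then have "t \<le> us j" using us_le[of "Suc i" j] i2 by auto
      then show "?f j = 0" by (simp add: max_def min_def)
    qed
    also have "?f i = (us i + us (Suc i)) / 2 * (t - us i)" using i i2 by (simp add: max_def min_def)
    finally have "sum ?f {1..<m} = (us i)\<^sup>2 / 2 + ((us i + us (Suc i)) / 2 * (t - us i) + 0)" .
    then have "ramp_sum m us t = ((us i + us (Suc i)) * t - us i * us (Suc i)) / 2"
      using t by (simp add: ramp_sum_def power2_eq_square field_simps)
    then show ?thesis using 3 the by (simp add: multibang_def Let_def)
  qed
qed

lemma continuous_multibang: "continuous_on UNIV (multibang m us)"
proof -
  have "continuous_on UNIV (ramp_sum m us)"
    unfolding ramp_sum_def[abs_def] by (intro continuous_intros)
  then show ?thesis using multibang_eq_ramp_sum by (simp add: fun_eq_iff[symmetric])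
qed

lemma multibang_nonneg: "0 \<le> multibang m us t"
  unfolding multibang_eq_ramp_sum ramp_sum_def
  using us_m_pos by (intro add_nonneg_nonneg mult_nonneg_nonneg sum_nonneg) (auto simp: us_nonneg)

text \<open>The two outer ramps account for the linear growth; between them the left-hand side is
  nonpositive.\<close>

lemma multibang_coercive: "us m * (\<bar>t\<bar> - us m) \<le> multibang m us t"
proof -
  have "0 \<le> (\<Sum>i\<in>{1..<m}. (us i + us (Suc i)) / 2 * (max (us i) (min t (us (Suc i))) - us i))"
    by (intro sum_nonneg mult_nonneg_nonneg) (auto simp: us_nonneg)
  moreover have "us m * (\<bar>t\<bar> - us m) \<le> us m * max 0 (- t) + us m * max 0 (t - us m)"
    unfolding distrib_left[symmetric] using us_m_pos by (intro mult_left_mono) auto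
  ultimately show ?thesis unfolding multibang_eq_ramp_sum ramp_sum_def by linarith
qed

text \<open>Makes the penalty of an integrable function integrable. All ramps vanish at t = 0, so no
  additive constant arises.\<close>

lemma multibang_le: "\<exists>L. \<forall>t. multibang m us t \<le> L * \<bar>t\<bar>"
proof (intro exI allI)
  fix t
  have "us m * max 0 (- t) \<le> us m * \<bar>t\<bar>" "us m * max 0 (t - us m) \<le> us m * \<bar>t\<bar>"
    using us_m_pos by (intro mult_left_mono; simp)+
  moreover have "(\<Sum>i\<in>{1..<m}. (us i + us (Suc i)) / 2 * (max (us i) (min t (us (Suc i))) - us i))
      \<le> (\<Sum>i\<in>{1..<m}. (us i + us (Suc i)) / 2 * \<bar>t\<bar>)"
  proof (rule sum_mono)
    fix i assume "i \<in> {1..<m}"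
    then have i: "0 \<le> us i" "0 \<le> us (Suc i)" by (auto intro: us_nonneg)
    then show "(us i + us (Suc i)) / 2 * (max (us i) (min t (us (Suc i))) - us i) \<le> (us i + us (Suc i)) / 2 * \<bar>t\<bar>"
      by (intro mult_left_mono) auto
  qed
  ultimately show "multibang m us t \<le> (us m + (\<Sum>i\<in>{1..<m}. (us i + us (Suc i)) / 2) + us m) * \<bar>t\<bar>"
    unfolding multibang_eq_ramp_sum ramp_sum_def by (simp add: distrib_right sum_distrib_right)
qed

end

text \<open>Both cubic pieces are evaluated at truncated arguments, which makes continuity evident.\<close>

lemma smooth_trunc_eq:
  assumes \<epsilon>: "\<epsilon> > 0" and um: "um > 0"
  shows "smooth_trunc \<epsilon> um t =
    (let s = max (- \<epsilon>) (min t 0); r = max 0 (min (t - um) \<epsilon>) in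
      (- (1 / \<epsilon>\<^sup>2) * s ^ 3 - (1 / \<epsilon>) * s\<^sup>2 + s) + max 0 (min t um) + (r + r\<^sup>2 / \<epsilon> - r ^ 3 / \<epsilon>\<^sup>2))"
proof -
  \<comment> \<open>Recentred at um, the right cubic is the left one under a point reflection, which
    explains its coefficients.\<close>
  have cubic: "- (1 / \<epsilon>\<^sup>2) * t ^ 3 + ((3 * um + \<epsilon>) / \<epsilon>\<^sup>2) * t\<^sup>2
        + ((\<epsilon>\<^sup>2 - 2 * um * \<epsilon> - 3 * um\<^sup>2) / \<epsilon>\<^sup>2) * t + (um ^ 3 + um\<^sup>2 * \<epsilon>) / \<epsilon>\<^sup>2
      = um + ((t - um) + (t - um)\<^sup>2 / \<epsilon> - (t - um) ^ 3 / \<epsilon>\<^sup>2)"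
    using \<epsilon> by (simp add: field_simps power2_eq_square power3_eq_cube)
  \<comment> \<open>At their outer ends the cubics reach -\<epsilon> and \<epsilon>, where they meet
    the constant pieces.\<close>
  have e1: "- (1 / \<epsilon>\<^sup>2) * (- \<epsilon>) ^ 3 - (1 / \<epsilon>) * (- \<epsilon>)\<^sup>2 + - \<epsilon> = - \<epsilon>"
    "\<epsilon> + \<epsilon>\<^sup>2 / \<epsilon> - \<epsilon> ^ 3 / \<epsilon>\<^sup>2 = \<epsilon>"
    using \<epsilon> by (simp_all add: field_simps power2_eq_square power3_eq_cube)
  consider "t \<le> - \<epsilon>" | "- \<epsilon> < t" "t \<le> 0" | "0 < t" "t \<le> um" | "um < t" "t \<le> um + \<epsilon>" | "um + \<epsilon> < t"
    by linarith
  then show ?thesis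
  proof cases
    case 1
    then have "max (- \<epsilon>) (min t 0) = - \<epsilon>" "max 0 (min (t - um) \<epsilon>) = 0" "max 0 (min t um) = 0"
      using \<epsilon> um by auto
    then show ?thesis using 1 e1 by (simp add: smooth_trunc_def Let_def)
  next
    case 2
    then have "max (- \<epsilon>) (min t 0) = t" "max 0 (min (t - um) \<epsilon>) = 0" "max 0 (min t um) = 0"
      using \<epsilon> um by auto
    then show ?thesis using 2 by (simp add: smooth_trunc_def Let_def)
  next
    case 3
    then have "max (- \<epsilon>) (min t 0) = 0" "max 0 (min (t - um) \<epsilon>) = 0" "max 0 (min t um) = t"
      using \<epsilon> um by auto
    then show ?thesis using 3 \<epsilon> by (simp add: smooth_trunc_def Let_def)
  next
    case 4
    then have "max (- \<epsilon>) (min t 0) = 0" "max 0 (min (t - um) \<epsilon>) = t - um" "max 0 (min t um) = um"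
      using \<epsilon> um by auto
    then show ?thesis using 4 \<epsilon> um cubic by (simp add: smooth_trunc_def Let_def)
  next
    case 5
    then have "max (- \<epsilon>) (min t 0) = 0" "max 0 (min (t - um) \<epsilon>) = \<epsilon>" "max 0 (min t um) = um"
      using \<epsilon> um by auto
    then show ?thesis using 5 \<epsilon> um e1 by (simp add: smooth_trunc_def Let_def)
  qed
qed

lemma continuous_smooth_trunc:
  assumes "\<epsilon> > 0" "um > 0"
  shows "continuous_on UNIV (smooth_trunc \<epsilon> um)"
  unfolding smooth_trunc_eq[OF assms, abs_def] Let_def
  using assms by (intro continuous_intros) auto

text \<open>The lower bound is attained and decides whether the coefficient of the state equation
  stays positive. Above, boundedness is all that matters, so the crude 2 \<epsilon> spares a second
  exact polynomial estimate.\<close>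

lemma smooth_trunc_bounds:
  assumes \<epsilon>: "\<epsilon> > 0" and um: "um > 0"
  shows "- \<epsilon> \<le> smooth_trunc \<epsilon> um t" "smooth_trunc \<epsilon> um t \<le> um + 2 * \<epsilon>"
proof -
  define s where "s = max (- \<epsilon>) (min t 0)"
  define r where "r = max 0 (min (t - um) \<epsilon>)"
  define a where "a = - s / \<epsilon>"
  define b where "b = r / \<epsilon>"
  have a: "0 \<le> a" "a \<le> 1" "s = - (\<epsilon> * a)" using \<epsilon> by (auto simp: a_def s_def field_simps)
  have b: "0 \<le> b" "b \<le> 1" "r = \<epsilon> * b" using \<epsilon> by (auto simp: b_def r_def field_simps)
  have eq: "smooth_trunc \<epsilon> um t = \<epsilon> * (a ^ 3 - a\<^sup>2 - a) + max 0 (min t um) + \<epsilon> * (b + b\<^sup>2 - b ^ 3)"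
  proof -
    have "- (1 / \<epsilon>\<^sup>2) * s ^ 3 - (1 / \<epsilon>) * s\<^sup>2 + s = \<epsilon> * (a ^ 3 - a\<^sup>2 - a)"
      using \<epsilon> unfolding a(3) by (simp add: field_simps power2_eq_square power3_eq_cube)
    moreover have "r + r\<^sup>2 / \<epsilon> - r ^ 3 / \<epsilon>\<^sup>2 = \<epsilon> * (b + b\<^sup>2 - b ^ 3)"
      using \<epsilon> unfolding b(3) by (simp add: field_simps power2_eq_square power3_eq_cube)
    ultimately show ?thesis
      unfolding smooth_trunc_eq[OF \<epsilon> um] Let_def s_def[symmetric] r_def[symmetric] by simp
  qed
  have a1: "- 1 \<le> a ^ 3 - a\<^sup>2 - a" "a ^ 3 - a\<^sup>2 - a \<le> 0"
  proof -
    \<comment> \<open>The product expands to 1 + (a^3 - a^2 - a).\<close>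
    have "0 \<le> (1 - a)\<^sup>2 * (1 + a)" using a by simp
    then show "- 1 \<le> a ^ 3 - a\<^sup>2 - a" by (simp add: power2_eq_square power3_eq_cube algebra_simps)
    have "a ^ 3 \<le> a\<^sup>2" using a by (intro power_decreasing) auto
    then show "a ^ 3 - a\<^sup>2 - a \<le> 0" using a by simp
  qed
  have b1: "0 \<le> b + b\<^sup>2 - b ^ 3" "b + b\<^sup>2 - b ^ 3 \<le> 2"
  proof -
    have "b ^ 3 \<le> b\<^sup>2" using b by (intro power_decreasing) auto
    then show "0 \<le> b + b\<^sup>2 - b ^ 3" using b by simp
    have "b\<^sup>2 \<le> 1" using b by (intro power_le_one) auto
    moreover have "0 \<le> b ^ 3" using b(1) by (rule zero_le_power)
    ultimately show "b + b\<^sup>2 - b ^ 3 \<le> 2" using b(2) by linarith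
  qed
  have "\<epsilon> * - 1 \<le> \<epsilon> * (a ^ 3 - a\<^sup>2 - a)" "\<epsilon> * (a ^ 3 - a\<^sup>2 - a) \<le> \<epsilon> * 0"
    "\<epsilon> * 0 \<le> \<epsilon> * (b + b\<^sup>2 - b ^ 3)" "\<epsilon> * (b + b\<^sup>2 - b ^ 3) \<le> \<epsilon> * 2"
    using \<epsilon> a1 b1 by (intro mult_left_mono; simp)+
  moreover have "0 \<le> max 0 (min t um)" "max 0 (min t um) \<le> um" using um by auto
  ultimately show "- \<epsilon> \<le> smooth_trunc \<epsilon> um t" "smooth_trunc \<epsilon> um t \<le> um + 2 * \<epsilon>" unfolding eq by linarith+
qed

text \<open>The operator acts pointwise; applying it to \<open>id\<close> on the reals recovers the
  underlying scalar function, whose continuity and bounds are then those of a real function.\<close>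

lemma superposition_eq_id: "superposition \<epsilon> umin um v x = superposition \<epsilon> umin um id (v x)"
  by (simp add: superposition_def)

lemma continuous_superposition_id:
  assumes "0 \<le> \<epsilon>" "0 < um"
  shows "continuous_on UNIV (superposition \<epsilon> umin um id)"
proof (cases "\<epsilon> = 0")
  case True
  then show ?thesis unfolding superposition_def[abs_def] by (auto intro!: continuous_intros)
next
  case False
  then have "continuous_on UNIV (\<lambda>t. umin + smooth_trunc \<epsilon> um t)"
    using assms by (intro continuous_on_add continuous_on_const continuous_smooth_trunc) auto
  then show ?thesis unfolding superposition_def[abs_def] using False by simp
qed

lemma superposition_id_bounds:
  assumes "0 \<le> \<epsilon>" "0 < um"
  shows "umin - \<epsilon> \<le> superposition \<epsilon> umin um id t" "superposition \<epsilon> umin um id t \<le> umin + um + 2 * \<epsilon>"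
  using smooth_trunc_bounds[of \<epsilon> um t] assms by (auto simp: superposition_def)


section \<open>Existence of a minimizer\<close>

context bounded_open_set
begin

text \<open>Guarantees that the infimum of the functional is taken over a nonempty set.\<close>

lemma zero_in_BV: "(\<lambda>x. 0) \<in> BV \<Omega>"
proof -
  have "has_measure_derivative \<Omega> (\<lambda>x. 0) (\<lambda>A. 0)"
    unfolding has_measure_derivative_def vector_measure_def has_signed_integral_def
    by (auto intro!: exI[of _ "null_measure BO"] finite_measureI measurable_restrict_space1
        test_functions_borel simp: measure_def)
  then show ?thesis by (auto simp: BV_def)
qed

lemma objective_has_minimizer:
  fixes f z :: "'a \<Rightarrow> real"
  assumes bp: "breakpoints m us" and \<alpha>: "\<alpha> > 0" and \<beta>: "\<beta> > 0"
    and f: "sq_integrable M f" and z: "sq_integrable M z"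
    and \<epsilon>: "0 \<le> \<epsilon>" "\<epsilon> < umin"
  shows "\<exists>ubar\<in>BV \<Omega>. \<forall>u\<in>BV \<Omega>. objective \<Omega> f z \<alpha> \<beta> umin m us \<epsilon> ubar \<le> objective \<Omega> f z \<alpha> \<beta> umin m us \<epsilon> u"
proof -
  interpret breakpoints m us by fact
  let ?um = "us m"
  define \<Phi> where "\<Phi> = superposition \<epsilon> umin ?um (id :: real \<Rightarrow> real)"
  have \<Phi>: "continuous_on UNIV \<Phi>" "superposition \<epsilon> umin ?um v = (\<lambda>x. \<Phi> (v x))"
    "umin - \<epsilon> \<le> \<Phi> t" "\<Phi> t \<le> umin + ?um + 2 * \<epsilon>" for v :: "'a \<Rightarrow> real" and t
    unfolding \<Phi>_def
    by (intro continuous_superposition_id superposition_id_bounds superposition_eq_id \<epsilon> us_m_pos ext)+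
  \<comment> \<open>Ellipticity bounds shared by the coefficients of all controls.\<close>
  define c where "c = umin - \<epsilon>"
  define C where "C = umin + ?um + 2 * \<epsilon>"
  have c: "c > 0" using \<epsilon> by (simp add: c_def)
  have \<Phi>b: "\<bar>\<Phi> t\<bar> \<le> C" "c \<le> \<Phi> t" for t using \<Phi>(3,4)[of t] c by (auto simp: c_def C_def)
  have \<Phi>m: "\<Phi> \<in> borel_measurable borel" by (rule borel_measurable_continuous_onI[OF \<Phi>(1)])
  define y where "y u = state \<Omega> f (superposition \<epsilon> umin ?um u)" for u
  define tr where "tr u = (LINT x|M. (norm (y u x - z x))\<^sup>2)" for u
  define G where "G u = (LINT x|M. multibang m us (u x))" for u :: "'a \<Rightarrow> real"
  define J where "J u = 1 / 2 * tr u + \<alpha> * G u + \<beta> * TV \<Omega> u" for u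
  have obj: "objective \<Omega> f z \<alpha> \<beta> umin m us \<epsilon> u = J u" for u
    by (simp add: objective_def J_def tr_def G_def y_def L2_norm_sq multibang_penalty_def)
  have ui: "integrable M u" if "u \<in> BV \<Omega>" for u using that by (simp add: BV_def)
  have wm: "(\<lambda>x. \<Phi> (u x)) \<in> borel_measurable M" if "integrable M u" for u
    using measurable_compose[OF borel_measurable_integrable[OF that] \<Phi>m] .
  have y: "weak_solution \<Omega> f (\<lambda>x. \<Phi> (u x)) (y u)" if "integrable M u" for u
  proof -
    show ?thesis
      unfolding y_def state_def \<Phi>(2) by (rule someI_ex[OF weak_solution_exists[OF wm[OF that] \<Phi>b c f]])
  qed
  have ysq: "sq_integrable M (y u)" if "integrable M u" for u
    using y[OF that] H10_imp_H10_with_gradient unfolding weak_solution_def H10_with_gradient_def by blast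
  have tr0: "0 \<le> tr u" for u unfolding tr_def by (intro Bochner_Integration.integral_nonneg) simp
  have G0: "0 \<le> G u" for u unfolding G_def by (intro Bochner_Integration.integral_nonneg multibang_nonneg)
  have J0: "0 \<le> J u" for u
    unfolding J_def using tr0[of u] G0[of u] TV_nonneg[of u] \<alpha> \<beta> by simp
  have Gm: "multibang m us \<in> borel_measurable borel"
    by (rule borel_measurable_continuous_onI[OF continuous_multibang])
  obtain L where L: "\<And>t. multibang m us t \<le> L * \<bar>t\<bar>" using multibang_le by blast
  have Gmu: "(\<lambda>x. multibang m us (u x)) \<in> borel_measurable M" if "integrable M u" for u
    using measurable_compose[OF borel_measurable_integrable[OF that] Gm] .
  have Gi: "integrable M (\<lambda>x. multibang m us (u x))" if u: "integrable M u" for u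
  proof (rule Bochner_Integration.integrable_bound)
    show "integrable M (\<lambda>x. L * \<bar>u x\<bar>)" using u by simp
    show "AE x in M. norm (multibang m us (u x)) \<le> norm (L * \<bar>u x\<bar>)"
    proof (rule AE_I2)
      fix x
      show "norm (multibang m us (u x)) \<le> norm (L * \<bar>u x\<bar>)"
        using multibang_nonneg[of "u x"] L[of "u x"] by simp
    qed
  qed (rule Gmu[OF u])
  have coerc: "(LINT x|M. \<bar>u x\<bar>) \<le> G u / ?um + ?um * measure M (space M)" if u: "integrable M u" for u
  proof -
    have "(LINT x|M. \<bar>u x\<bar>) \<le> (LINT x|M. multibang m us (u x) / ?um + ?um)"
    proof (rule integral_mono)
      show "\<bar>u x\<bar> \<le> multibang m us (u x) / ?um + ?um" for x
        using multibang_coercive[of "u x"] us_m_pos by (simp add: field_simps)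
    qed (use u Gi[OF u] in auto)
    also have "\<dots> = G u / ?um + ?um * measure M (space M)"
      using Gi[OF u] by (simp add: G_def mult.commute)
    finally show ?thesis .
  qed
  define I where "I = Inf (J ` BV \<Omega>)"
  have bdd: "bdd_below (J ` BV \<Omega>)" using J0 by (intro bdd_belowI[of _ 0]) auto
  have ne: "J ` BV \<Omega> \<noteq> {}" using zero_in_BV by blast
  have I_le: "I \<le> J u" if "u \<in> BV \<Omega>" for u unfolding I_def using that bdd by (intro cInf_lower) auto
  have "\<exists>u. u \<in> BV \<Omega> \<and> J u < I + inverse (real (Suc n))" for n
    using cInf_lessD[OF ne, of "I + inverse (real (Suc n))"] by (auto simp: I_def)
  then obtain u where u: "\<And>n. u n \<in> BV \<Omega>" and Ju: "\<And>n. J (u n) < I + inverse (real (Suc n))" by metis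
  have Ju1: "J (u n) \<le> I + 1" for n
  proof -
    have "inverse (real (Suc n)) \<le> 1" by (simp add: inverse_le_1_iff)
    then show ?thesis using Ju[of n] by linarith
  qed
  have Gb: "G (u n) \<le> (I + 1) / \<alpha>" for n
  proof -
    have "\<alpha> * G (u n) \<le> J (u n)" unfolding J_def using tr0 TV_nonneg[of "u n"] \<beta> by simp
    then show ?thesis using Ju1[of n] \<alpha> by (simp add: field_simps)
  qed
  have Tb: "TV \<Omega> (u n) \<le> (I + 1) / \<beta>" for n
  proof -
    have "\<beta> * TV \<Omega> (u n) \<le> J (u n)" unfolding J_def using tr0 G0[of "u n"] \<alpha> by simp
    then show ?thesis using Ju1[of n] \<beta> by (simp add: field_simps)
  qed
  have Ab: "(LINT x|M. \<bar>u n x\<bar>) \<le> (I + 1) / \<alpha> / ?um + ?um * measure M (space M)" for n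
    using coerc[OF ui[OF u[of n]]] divide_right_mono[OF Gb[of n], of ?um] us_m_pos by simp
  obtain r0 v where r0: "strict_mono r0" and v: "integrable M v" and ae0: "AE x in M. (\<lambda>n. u (r0 n) x) \<longlonglongrightarrow> v x"
    and d0: "\<And>\<phi> b. \<phi> \<in> test_functions \<Omega> \<Longrightarrow> b \<in> Basis \<Longrightarrow>
      (\<lambda>n. LINT x|M. u (r0 n) x * partial_deriv b \<phi> x) \<longlonglongrightarrow> (LINT x|M. v x * partial_deriv b \<phi> x)"
    using BV_compact[of u, OF u Ab Tb] by blast
  \<comment> \<open>The penalty values need not converge along with the functions, so a further
    subsequence is chosen on which they do. Fatou's lemma and the total variation bound below can
    then refer to the same limit \<Gamma>.\<close>
  have "\<forall>n. G (u (r0 n)) \<in> {0..(I + 1) / \<alpha>}" using G0 Gb by simp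
  then obtain \<Gamma> r1 where r1: "strict_mono r1" "((\<lambda>n. G (u (r0 n))) \<circ> r1) \<longlonglongrightarrow> \<Gamma>"
    using seq_compactE[OF compact_imp_seq_compact[OF compact_Icc[of 0 "(I + 1) / \<alpha>"]], of "\<lambda>n. G (u (r0 n))"] by metis
  define r where "r n = r0 (r1 n)" for n
  have r: "strict_mono r" using strict_mono_o[OF r0 r1(1)] by (simp add: r_def[abs_def] comp_def)
  have Glim: "(\<lambda>n. G (u (r n))) \<longlonglongrightarrow> \<Gamma>" using r1(2) by (simp add: comp_def r_def)
  have ae: "AE x in M. (\<lambda>n. u (r n) x) \<longlonglongrightarrow> v x"
    using ae0
  proof eventually_elim
    case (elim x)
    show ?case using LIMSEQ_subseq_LIMSEQ[OF elim r1(1)] by (simp add: comp_def r_def)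
  qed
  have d: "(\<lambda>n. LINT x|M. u (r n) x * partial_deriv b \<phi> x) \<longlonglongrightarrow> (LINT x|M. v x * partial_deriv b \<phi> x)"
    if "\<phi> \<in> test_functions \<Omega>" "b \<in> Basis" for \<phi> b
    using LIMSEQ_subseq_LIMSEQ[OF d0[OF that] r1(1)] by (simp add: comp_def r_def)
  have Gv: "G v \<le> \<Gamma>"
  proof -
    have l: "AE x in M. (\<lambda>n. multibang m us (u (r n) x)) \<longlonglongrightarrow> multibang m us (v x)"
      using ae
    proof eventually_elim
      case (elim x)
      show ?case
        using isCont_tendsto_compose[OF _ elim] continuous_multibang continuous_on_eq_continuous_at[OF open_UNIV]
        by blast
    qed
    show ?thesis
      unfolding G_def
      by (rule Fatou_AE_limit(2)[OF Gi[OF ui[OF u]] multibang_nonneg Gmu[OF v] l _ Glim]) (simp add: G_def)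
  qed
  have trlim: "(\<lambda>n. tr (u (r n))) \<longlonglongrightarrow> tr v"
  proof -
    have l: "AE x in M. (\<lambda>n. \<Phi> (u (r n) x)) \<longlonglongrightarrow> \<Phi> (v x)"
      using ae
    proof eventually_elim
      case (elim x)
      show ?case
        using isCont_tendsto_compose[OF _ elim] \<Phi>(1) continuous_on_eq_continuous_at[OF open_UNIV] by blast
    qed
    have "(\<lambda>n. LINT x|M. (norm (y (u (r n)) x - y v x))\<^sup>2) \<longlonglongrightarrow> 0"
      by (rule weak_solution_continuous[OF wm[OF ui[OF u]] \<Phi>b wm[OF v] \<Phi>b(1) c l y[OF ui[OF u]] y[OF v]])
    then have "(\<lambda>n. LINT x|M. (norm ((y (u (r n)) x - z x) - (y v x - z x)))\<^sup>2) \<longlonglongrightarrow> 0" by simp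
    then show ?thesis
      unfolding tr_def by (rule tendsto_integral_norm_sq[OF sq_integrable_diff[OF ysq[OF ui[OF u]] z] sq_integrable_diff[OF ysq[OF v] z]])
  qed
  \<comment> \<open>Near-minimality of u n solved for the total variation. The tracking and penalty
    terms converge, so these bounds converge too; semicontinuity and G v \<le> \<Gamma> then add up
    to J v \<le> I.\<close>
  let ?c = "\<lambda>n. (I + inverse (real (Suc (r n))) - 1 / 2 * tr (u (r n)) - \<alpha> * G (u (r n))) / \<beta>"
  have TVc: "TV \<Omega> (u (r n)) \<le> ?c n" for n
  proof -
    have "\<beta> * TV \<Omega> (u (r n)) \<le> I + inverse (real (Suc (r n))) - 1 / 2 * tr (u (r n)) - \<alpha> * G (u (r n))"
      using Ju[of "r n"] unfolding J_def by linarith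
    then show ?thesis using \<beta> by (simp add: pos_le_divide_eq mult.commute)
  qed
  have "?c \<longlonglongrightarrow> (I + 0 - 1 / 2 * tr v - \<alpha> * \<Gamma>) / \<beta>"
    using \<beta> LIMSEQ_subseq_LIMSEQ[OF LIMSEQ_inverse_real_of_nat r]
    by (intro tendsto_divide tendsto_diff tendsto_add tendsto_mult tendsto_const trlim Glim) (auto simp: comp_def)
  note lsc = BV_lower_semicontinuous[of "\<lambda>n. u (r n)", OF u v d TVc this]
  have "J v \<le> I"
  proof -
    have "\<beta> * TV \<Omega> v \<le> I - 1 / 2 * tr v - \<alpha> * \<Gamma>"
      using lsc(2) \<beta> by (simp add: pos_le_divide_eq mult.commute)
    moreover have "\<alpha> * G v \<le> \<alpha> * \<Gamma>" using Gv \<alpha> by (intro mult_left_mono) auto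
    ultimately show ?thesis unfolding J_def by linarith
  qed
  then have "\<forall>u\<in>BV \<Omega>. J v \<le> J u" using I_le by (auto intro: order_trans)
  then show ?thesis unfolding obj using lsc(1) by blast
qed

end

theorem proposition3p1:
  fixes \<Omega> :: "(real ^ 'd) set"
    and f z :: "real ^ 'd \<Rightarrow> real"
    and \<alpha> \<beta> umin umax \<epsilon> :: real
    and m :: nat
    and us :: "nat \<Rightarrow> real"
  assumes "bounded_strongly_lipschitz_domain \<Omega>"
    and "\<alpha> > 0" and "\<beta> > 0"
    and "f \<in> L2 \<Omega>" and "z \<in> L2 \<Omega>"
    and "0 < umin" and "umin < umax"
    and "2 \<le> m"
    and "us 1 = 0" and "strict_mono_on {1..m} us" and "us m = umax - umin"
    and "0 \<le> \<epsilon>" and "\<epsilon> < umin / 4"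
  shows "\<exists>ubar\<in>BV \<Omega>. \<forall>u\<in>BV \<Omega>.
           objective \<Omega> f z \<alpha> \<beta> umin m us \<epsilon> ubar \<le> objective \<Omega> f z \<alpha> \<beta> umin m us \<epsilon> u"
proof -
  interpret bounded_open_set \<Omega>
    using assms(1) by unfold_locales (auto simp: bounded_strongly_lipschitz_domain_def)
  show ?thesis
  proof (rule objective_has_minimizer)
    show "breakpoints m us" using assms(8-10) by (rule breakpoints.intro)
    show "\<epsilon> < umin" using assms(6,13) by simp
  qed (use assms in \<open>simp_all add: L2_iff_sq_integrable\<close>)
qed

end
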